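(* Let $k\in\mathbb{N}$ and $z\in\mathbb{C}$ with $-1<\operatorname{Re}(z)<k$ and $z\ne k-1$, let $\operatorname{Re}(w)>0$, and for $n\in\mathbb{N}$ put $a=a_n=2\pi\big(\frac{2\pi n}{w}\big)^{1/k}$. Let $\zeta_{4k}=e^{i\pi/(2k)}$, $A_j=\zeta_{4k}^{(2-k)(2j-1)}$, $B_j=\zeta_{4k}^{(1-k)(2j)}$. If $k\ge2$ is even, \[ \sum_{n=1}^\infty\sigma_z^{(k)}(n)e^{-nw}=-\frac{\zeta(-z)}{2}+\frac{\zeta(k-z)}{w}+\frac1k\frac{\Gamma(\frac{1+z}{k})\zeta(\frac{1+z}{k})}{w^{(1+z)/k}}+\frac{(-1)^{\frac k2-1}(2\pi)^{2+\frac2k-z}}{\pi^2k\,w^{2/k}}\sum_{n=1}^\infty S_z^{(k)}(n)n^{\frac{1-z}{k}}\sum_{j=1}^{k/2}\Big[A_jB(z,a\zeta_{4k}^{2j-1})+\overline{A_j}B(z,a\zeta_{4k}^{-(2j-1)})\Big], \] and if $k\ge1$ is odd, \[ \sum_{n=1}^\infty\sigma_z^{(k)}(n)e^{-nw}=-\frac{\zeta(-z)}{2}+\frac{\zeta(k-z)}{w}+\frac1k\frac{\Gamma(\frac{1+z}{k})\zeta(\frac{1+z}{k})}{w^{(1+z)/k}}+\frac{(-1)^{\frac{k-1}{2}}(2\pi)^{1+\frac1k-z}}{\pi^2k\,w^{1/k}}\sum_{n=1}^\infty S_z^{(k)}(n)n^{-z/k}\Big[B(z+1,a)+\sum_{j=1}^{\frac{k-1}{2}}\Big(B_jB(z+1,a\zeta_{4k}^{2j})+\overline{B_j}B(z+1,a\zeta_{4k}^{-2j})\Big)\Big].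 \]
   Context: $\sigma_z^{(k)}(n):=\sum_{d^k\mid n}d^{z}$ and $S_z^{(k)}(n):=\sum_{d_1^kd_2=n}d_2^{\frac{1+z}{k}-1}$. Powers use principal branches. For $\operatorname{Re} b>0$ and $-1<\operatorname{Re}(z)<2$, $B(z,b):=\int_0^\infty\frac{t^z\cos t}{t^2+b^2}\,dt$, which equals $\frac{\pi b^{z-1}\cosh b}{2\cos(\pi z/2)}-\frac{\pi}{2\cos(\pi z/2)}\sum_{n=0}^\infty\frac{b^{2n}}{\Gamma(2n-z+2)}$; this last expression is taken as the definition of $B(z,b)$ for all $z$ (its meromorphic continuation in $z$, with removable singularities at positive odd integers, where $B$ is defined by the limit). $\overline{A_j}$, $\overline{B_j}$ denote complex conjugates. *)

theory Defs
  imports "HOL-Complex_Analysis.Complex_Analysis"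
begin

text \<open>
  Complex powers with a complex exponent are \<open>powr\<close>, i.e. the principal branch
  \<open>w powr s = exp (s * Ln w)\<close> for \<open>w \<noteq> 0\<close>.
\<close>

text \<open>
  The Riemann zeta function: the analytic continuation of the Dirichlet series to the
  punctured plane, which is unique by the identity theorem. The value at the pole is an
  arbitrary normalisation, needed only to make the description of a total function unique.
\<close>

definition zeta :: "complex \<Rightarrow> complex" where
  "zeta = (THE f. f holomorphic_on (- {1}) \<and>
                  (\<forall>s. Re s > 1 \<longrightarrow> (\<lambda>n. 1 / of_nat (Suc n) powr s) sums f s) \<and>
                  f 1 = 0)"

text \<open>For \<open>k \<ge> 1\<close> and \<open>n \<ge> 1\<close> the index sets below are finite and contain positive numbers only.\<close>

definition sigma_fun :: "nat \<Rightarrow> complex \<Rightarrow> nat \<Rightarrow> complex" where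
  "sigma_fun k z n = (\<Sum>d | d ^ k dvd n. of_nat d powr z)"

definition S_fun :: "nat \<Rightarrow> complex \<Rightarrow> nat \<Rightarrow> complex" where
  "S_fun k z n =
     (\<Sum>(d1, d2) \<in> {(d1, d2). d1 ^ k * d2 = n}. of_nat d2 powr ((1 + z) / of_nat k - 1))"

text \<open>
  For \<open>Re b > 0\<close> and \<open>-1 < Re z < 2\<close> the next expression is the value of the integral of
  \<open>t powr z * cos t / (t\<^sup>2 + b\<^sup>2)\<close> over \<open>{0..}\<close>. The reciprocal of the Gamma function is
  the entire function \<open>rGamma\<close>.
\<close>

definition B_formula :: "complex \<Rightarrow> complex \<Rightarrow> complex" where
  "B_formula z b =
     of_real pi * b powr (z - 1) * cosh b / (2 * cos (of_real pi * z / 2))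
     - of_real pi / (2 * cos (of_real pi * z / 2))
         * (\<Sum>n. b ^ (2 * n) * rGamma (of_nat (2 * n) - z + 2))"

text \<open>
  At the positive odd integers \<open>B_formula\<close> has removable singularities in \<open>z\<close>, and the
  value is the limit. The negative odd integers are genuine poles; the value there is junk.
\<close>

definition B_fun :: "complex \<Rightarrow> complex \<Rightarrow> complex" where
  "B_fun z b =
     (if \<exists>m::nat. z = of_nat (2 * m + 1) then Lim (at z) (\<lambda>s. B_formula s b)
      else B_formula z b)"

definition zeta4 :: "nat \<Rightarrow> complex" where
  "zeta4 k = exp (\<i> * of_real pi / (2 * of_nat k))"

text \<open>The exponents of the root of unity can be negative, hence integer powers.\<close>

definition A_coeff :: "nat \<Rightarrow> nat \<Rightarrow> complex" where
  "A_coeff k j = zeta4 k powi ((2 - int k) * (2 * int j - 1))"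

definition B_coeff :: "nat \<Rightarrow> nat \<Rightarrow> complex" where
  "B_coeff k j = zeta4 k powi ((1 - int k) * (2 * int j))"

definition a_arg :: "nat \<Rightarrow> complex \<Rightarrow> nat \<Rightarrow> complex" where
  "a_arg k w n = 2 * of_real pi * (2 * of_real pi * of_nat n / w) powr (1 / of_nat k)"

definition main_terms :: "nat \<Rightarrow> complex \<Rightarrow> complex \<Rightarrow> complex" where
  "main_terms k z w =
     - zeta (- z) / 2 + zeta (of_nat k - z) / w
     + 1 / of_nat k * (Gamma ((1 + z) / of_nat k) * zeta ((1 + z) / of_nat k)
                        / w powr ((1 + z) / of_nat k))"

definition even_term :: "nat \<Rightarrow> complex \<Rightarrow> complex \<Rightarrow> nat \<Rightarrow> complex" where
  "even_term k z w n =
     S_fun k z n * of_nat n powr ((1 - z) / of_nat k) *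
     (\<Sum>j = 1..k div 2.
        A_coeff k j * B_fun z (a_arg k w n * zeta4 k powi (2 * int j - 1))
        + cnj (A_coeff k j) * B_fun z (a_arg k w n * zeta4 k powi (- (2 * int j - 1))))"

definition odd_term :: "nat \<Rightarrow> complex \<Rightarrow> complex \<Rightarrow> nat \<Rightarrow> complex" where
  "odd_term k z w n =
     S_fun k z n * of_nat n powr (- z / of_nat k) *
     (B_fun (z + 1) (a_arg k w n)
      + (\<Sum>j = 1..(k - 1) div 2.
          B_coeff k j * B_fun (z + 1) (a_arg k w n * zeta4 k powi (2 * int j))
          + cnj (B_coeff k j) * B_fun (z + 1) (a_arg k w n * zeta4 k powi (- (2 * int j)))))"

end

theory Submission
  imports Defs
begin

text \<open>
  Summing the geometric series over the cofactor turns the left-hand side into the Lambert series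
  \<open>\<Sum>d. d powr z / (exp (w * d ^ k) - 1)\<close>. Abel--Plana summation, with both contours rotated into
  a narrow wedge around the positive axis, evaluates it as the three main terms plus the integrals
  of \<open>t powr z * (1 / (exp (w t^k) - 1) - 1 / (w t^k) + 1 / 2)\<close> against
  \<open>1 / (exp (\<mp>2 \<pi> \<i> t) - 1)\<close> along the rays of slope \<open>\<plusminus>\<tau>\<close>. It is first obtained for
  \<open>Re z < 0\<close> and then continued analytically to \<open>Re z < k\<close>.

  On the rays the second kernel is a geometric series in \<open>exp (\<plusminus>2 \<pi> \<i> t)\<close> and the first is
  Euler's partial fraction series in \<open>w t^k\<close>; the resulting double series converges absolutely,
  because the rotation makes the exponentials decay. Each of its terms splits, over the \<open>k\<close>-th roots of
  \<open>-1\<close>, into integrals with a quadratic denominator \<open>t\<^sup>2 + b\<^sup>2\<close>, which the same rotation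
  identifies with values of \<open>B\<close>. Sorting the terms \<open>(L, M)\<close> by \<open>n = L^k M\<close> produces
  \<open>S_fun\<close>.
\<close>

section \<open>Integrals over the half-line\<close>

text \<open>The Planck kernel has poles wherever \<open>w * t^k\<close> is a multiple of 2 pi i.
  Contours turned all the way to the imaginary axis, as in the classical formula, would meet or
  cross them; a narrow wedge does not, and on its sides the summation kernels still decay
  exponentially. The apex of the wedge is the second obstacle: it should be 0, which is a pole of
  the summation kernel. So the rays start at c > 0 and c tends to 0. Without its pole the Planck
  kernel can be summed; only with the additional 1/2 can its rays start at 0. The difference t^z / 2
  has ray integrals that diverge as c tends to 0, but for the same c they are those in the formula
  for zeta(-z), which absorbs them. Third, \<open>B\<close> is given by a series, while its cosine
  integral needs Re z < 2. Splitting the cosine and rotating the halves gives integrals for all Re z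
  > -1; for real b they are matched with the series by a differential equation in b, then continued
  in b and in z. Even and odd k are treated together by writing k = 2 h + p with p = 0 or 1 and
  taking partial fractions in t^2.\<close>

abbreviation halfline :: "real measure" where "halfline \<equiv> lebesgue_on {0<..}"

text \<open>Exponential decay along the rays dominates every power, and \<open>e\<close> is the
  share of it that is spent. The tangent-line bound for \<open>ln\<close> is applied to
  \<open>d * (1 + x)\<close>, with \<open>d\<close> so small that \<open>\<bar>p\<bar> * d\<close>
  stays below \<open>e\<close>.\<close>

lemma powr_le_exp_bound:
  fixes p e :: real
  assumes "e > 0"
  shows "\<exists>K>0. \<forall>x\<ge>0. (1 + x) powr p \<le> K * exp (e * x)"
proof -
  define d where "d = e / (\<bar>p\<bar> + 1)"
  have d: "d > 0" using assms by (simp add: d_def)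
  define K where "K = exp (\<bar>p\<bar> * (d - ln d))"
  have "(1 + x) powr p \<le> K * exp (e * x)" if "x \<ge> 0" for x
  proof -
    have l0: "ln (1 + x) \<ge> 0" using that by simp
    have "ln (d * (1 + x)) \<le> d * (1 + x)" using d that by (intro order.trans[OF ln_le_minus_one]) auto
    moreover have "ln (d * (1 + x)) = ln d + ln (1 + x)" using d that by (simp add: ln_mult del: distrib_left)
    ultimately have l: "ln (1 + x) \<le> (d - ln d) + d * x" by (simp add: algebra_simps)
    have "p * ln (1 + x) \<le> \<bar>p\<bar> * ln (1 + x)" using l0 by (intro mult_right_mono) auto
    also have "\<dots> \<le> \<bar>p\<bar> * ((d - ln d) + d * x)" by (intro mult_left_mono l) auto
    finally have "p * ln (1 + x) \<le> \<bar>p\<bar> * ((d - ln d) + d * x)" .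
    moreover have "\<bar>p\<bar> * (d * x) \<le> e * x"
    proof -
      have "\<bar>p\<bar> * d \<le> e" using assms by (simp add: d_def field_simps)
      thus ?thesis using that by (metis mult.assoc mult_right_mono)
    qed
    ultimately have "p * ln (1 + x) \<le> \<bar>p\<bar> * (d - ln d) + e * x" by (simp add: algebra_simps)
    thus ?thesis using that by (simp add: powr_def K_def flip: exp_add)
  qed
  thus ?thesis by (intro exI[of _ K]) (auto simp: K_def)
qed

text \<open>The exponents that occur are real parts of unknown sign, so both ends of the range enter
  the bound.\<close>

lemma powr_between_le:
  fixes p x y z :: real
  assumes "0 < x" "x \<le> y" "y \<le> z"
  shows "y powr p \<le> x powr p + z powr p"
proof (cases "p \<ge> 0")
  case True
  have "y powr p \<le> z powr p" using assms True by (intro powr_mono2) auto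
  thus ?thesis by (simp add: add_increasing)
next
  case False
  have "y powr p \<le> x powr p" using assms False by (intro powr_mono2') auto
  thus ?thesis by (simp add: add_increasing2)
qed

lemma norm_powr_complex_bounds:
  fixes t z :: complex
  assumes "t \<noteq> 0"
  shows "norm (t powr z) \<le> norm t powr Re z * exp (pi * \<bar>Im z\<bar>)"
proof -
  have "norm (t powr z) = exp (Re z * ln (norm t) - Im z * Im (Ln t))"
    using assms by (simp add: powr_def)
  also have "\<dots> \<le> exp (Re z * ln (norm t) + pi * \<bar>Im z\<bar>)"
  proof -
    have "\<bar>Im z * Im (Ln t)\<bar> \<le> \<bar>Im z\<bar> * pi"
      using mpi_less_Im_Ln[OF assms] Im_Ln_le_pi[OF assms] unfolding abs_mult
      by (intro mult_left_mono) auto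
    thus ?thesis by (auto simp: algebra_simps)
  qed
  also have "\<dots> = norm t powr Re z * exp (pi * \<bar>Im z\<bar>)"
    using assms by (simp add: powr_def exp_add)
  finally show ?thesis .
qed

lemma integrable_halfline_bound:
  fixes f :: "real \<Rightarrow> 'a :: euclidean_space"
  assumes "continuous_on {0<..} f" "integrable halfline g" "\<And>x. x > 0 \<Longrightarrow> norm (f x) \<le> g x"
  shows "integrable halfline f"
proof (rule Bochner_Integration.integrable_bound[OF assms(2)])
  show "f \<in> borel_measurable halfline"
    by (intro continuous_imp_measurable_on_sets_lebesgue assms) auto
  show "AE x in halfline. norm (f x) \<le> norm (g x)"
    by (rule AE_I2) (use assms(3) in \<open>force\<close>)
qed

lemma integrable_powr_exp_halfline:
  fixes a b :: real
  assumes "a > -1" "b > 0"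
  shows "integrable halfline (\<lambda>x. x powr a * exp (- b * x))"
proof -
  have "(\<lambda>t. complex_of_real t powr (of_real (a+1) - 1) / of_real (exp (b * t))) absolutely_integrable_on {0<..}"
    by (rule absolutely_integrable_Gamma_integral) (use assms in auto)
  hence "integrable halfline (\<lambda>t. complex_of_real t powr (of_real (a+1) - 1) / of_real (exp (b * t)))"
    by (simp add: set_integrable_def integrable_restrict_space)
  from integrable_norm[OF this]
  have "integrable halfline (\<lambda>t. norm (complex_of_real t powr (of_real (a+1) - 1) / of_real (exp (b * t))))" .
  moreover have "norm (complex_of_real t powr (of_real (a+1) - 1) / of_real (exp (b * t))) = t powr a * exp (- b * t)"
    if "t > 0" for t
    using that by (auto simp: norm_divide norm_powr_real_powr exp_minus field_simps)
  ultimately show ?thesis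
    by (subst (asm) Bochner_Integration.integrable_cong[OF refl, where g = "\<lambda>t. t powr a * exp (- b * t)"]) auto
qed

lemma integrable_exp_halfline:
  assumes "(b::real) > 0"
  shows "integrable halfline (\<lambda>x. exp (- b * x))"
  using integrable_powr_exp_halfline[of 0 b] assms
  by (subst (asm) Bochner_Integration.integrable_cong[OF refl, where g = "\<lambda>x. exp (- b * x)"]) auto

text \<open>Domination is asked only of \<open>F\<close> itself and only near one point. Cauchy's
  inequality on circles of radius \<open>r / 2\<close> turns it into a bound for the derivative,
  which then dominates the difference quotients. The measure is arbitrary, so that counting measure
  gives the same for series.\<close>

lemma has_field_derivative_integral:
  fixes F :: "complex \<Rightarrow> 'a \<Rightarrow> complex"
  assumes S: "open S" and s0: "s0 \<in> S"
    and meas: "\<And>s. s \<in> S \<Longrightarrow> F s \<in> borel_measurable M"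
    and holo: "\<And>x. x \<in> space M \<Longrightarrow> (\<lambda>s. F s x) holomorphic_on S"
    and bound: "\<exists>r>0. \<exists>g. integrable M g \<and>
                  (\<forall>s\<in>S \<inter> ball s0 r. \<forall>x\<in>space M. norm (F s x) \<le> g x)"
  shows "((\<lambda>s. \<integral>x. F s x \<partial>M) has_field_derivative (\<integral>x. deriv (\<lambda>s. F s x) s0 \<partial>M)) (at s0)"
proof -
  obtain r1 g where r1: "r1 > 0" and g: "integrable M g"
    and bd: "\<And>s x. s \<in> S \<Longrightarrow> s \<in> ball s0 r1 \<Longrightarrow> x \<in> space M \<Longrightarrow> norm (F s x) \<le> g x"
    using bound by (metis IntI)
  obtain r2 where r2: "r2 > 0" "ball s0 r2 \<subseteq> S" using S s0 openE by blast
  define r where "r = min r1 r2 / 2"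
  have r: "r > 0" "r < r1" "r < r2" using r1 r2 by (auto simp: r_def)
  have sub: "ball s0 (2*r) \<subseteq> S" "ball s0 (2*r) \<subseteq> ball s0 r1" using r1 r2 by (auto simp: r_def)
  have int: "integrable M (F s)" if "s \<in> ball s0 (2*r)" for s
    by (rule Bochner_Integration.integrable_bound[OF g])
       (use that sub meas bd in \<open>auto intro!: AE_I2 order.trans[OF bd abs_ge_self]\<close>)
  have dbd: "norm (deriv (\<lambda>s. F s x) s) \<le> g x / (r / 2)" if "s \<in> ball s0 r" "x \<in> space M" for s x
  proof -
    have sub': "cball s (r/2) \<subseteq> ball s0 (2*r)"
    proof
      fix y assume "y \<in> cball s (r/2)"
      hence "dist s0 y < r + r/2" using that dist_triangle[of s0 y s] by auto
      thus "y \<in> ball s0 (2*r)" using r by auto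
    qed
    have "norm ((deriv ^^ 1) (\<lambda>s. F s x) s) \<le> fact 1 * g x / (r/2) ^ 1"
    proof (rule Cauchy_inequality)
      show "(\<lambda>s. F s x) holomorphic_on ball s (r / 2)"
        using holo[OF that(2)] by (rule holomorphic_on_subset) (use sub sub' ball_subset_cball in blast)
      show "continuous_on (cball s (r / 2)) (\<lambda>s. F s x)"
        by (intro holomorphic_on_imp_continuous_on holomorphic_on_subset[OF holo[OF that(2)]])
           (use sub sub' in blast)
      fix y assume "norm (s - y) = r / 2"
      hence "y \<in> cball s (r/2)" by (auto simp: dist_norm)
      hence "y \<in> S" "y \<in> ball s0 r1" using sub sub' by blast+
      thus "norm (F y x) \<le> g x" using that by (intro bd)
    qed (use r in auto)
    thus ?thesis by simp
  qed
  have diff: "norm (F s x - F s0 x) \<le> g x / (r / 2) * norm (s - s0)"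
    if "s \<in> ball s0 r" "x \<in> space M" for s x
  proof (rule field_differentiable_bound)
    show "convex (ball s0 r)" by simp
    fix y assume y: "y \<in> ball s0 r"
    show "((\<lambda>s. F s x) has_field_derivative deriv (\<lambda>s. F s x) y) (at y within ball s0 r)"
    proof -
      have "y \<in> S" using y sub r by (auto simp: subset_iff)
      thus ?thesis using holomorphic_derivI[OF holo[OF that(2)] S, of y] by auto
    qed
    show "norm (deriv (\<lambda>s. F s x) y) \<le> g x / (r/2)" using dbd[OF y that(2)] .
  qed (use that r in auto)
  have "((\<lambda>s. ((\<integral>x. F s x \<partial>M) - (\<integral>x. F s0 x \<partial>M)) / (s - s0)) \<longlongrightarrow> (\<integral>x. deriv (\<lambda>s. F s x) s0 \<partial>M)) (at s0)"
    unfolding tendsto_at_iff_sequentially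
  proof safe
    fix X assume X: "\<forall>i. X i \<in> UNIV - {s0}" "X \<longlonglongrightarrow> s0"
    have "eventually (\<lambda>n. X n \<in> ball s0 r) sequentially"
      using X(2) r by (auto simp: tendsto_iff dist_commute)
    then obtain N where N: "\<And>n. n \<ge> N \<Longrightarrow> X n \<in> ball s0 r" by (auto simp: eventually_sequentially)
    define Y where "Y n = X (n + N)" for n
    have Y: "Y \<longlonglongrightarrow> s0" "\<And>n. Y n \<noteq> s0" "\<And>n. Y n \<in> ball s0 r"
      using LIMSEQ_ignore_initial_segment[OF X(2), of N] X(1) N by (simp_all add: Y_def[abs_def])
    have Yint: "integrable M (F (Y n))" "integrable M (F s0)" for n
      using int[of "Y n"] int[of s0] Y(3)[of n] r by auto
    have lim: "(\<lambda>n. (F (Y n) x - F s0 x) / (Y n - s0)) \<longlonglongrightarrow> deriv (\<lambda>s. F s x) s0" if "x \<in> space M" for x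
    proof -
      have "((\<lambda>s. F s x) has_field_derivative deriv (\<lambda>s. F s x) s0) (at s0)"
        using holomorphic_derivI[OF holo[OF that] S s0] by auto
      hence "((\<lambda>y. (F y x - F s0 x) / (y - s0)) \<longlongrightarrow> deriv (\<lambda>s. F s x) s0) (at s0)"
        by (simp add: has_field_derivative_iff)
      thus ?thesis using Y unfolding tendsto_at_iff_sequentially by (auto simp: o_def)
    qed
    have ms: "(\<lambda>x. (F (Y n) x - F s0 x) / (Y n - s0)) \<in> borel_measurable M" for n
      using Yint by (intro borel_measurable_divide borel_measurable_diff borel_measurable_integrable) auto
    have "(\<lambda>n. \<integral>x. (F (Y n) x - F s0 x) / (Y n - s0) \<partial>M) \<longlonglongrightarrow> (\<integral>x. deriv (\<lambda>s. F s x) s0 \<partial>M)"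
    proof (rule integral_dominated_convergence[where w = "\<lambda>x. g x / (r/2)"])
      show "(\<lambda>x. deriv (\<lambda>s. F s x) s0) \<in> borel_measurable M"
        by (rule borel_measurable_LIMSEQ_metric[OF ms lim])
      show "AE x in M. norm ((F (Y n) x - F s0 x) / (Y n - s0)) \<le> g x / (r / 2)" for n
        using diff[OF Y(3)[of n]] Y(2)[of n]
        by (intro AE_I2) (auto simp: norm_divide divide_simps)
    qed (use ms g lim in auto)
    also have "(\<lambda>n. \<integral>x. (F (Y n) x - F s0 x) / (Y n - s0) \<partial>M) =
               (\<lambda>n. ((\<integral>x. F (Y n) x \<partial>M) - (\<integral>x. F s0 x \<partial>M)) / (Y n - s0))"
      using Yint by (auto simp: Bochner_Integration.integral_diff)
    finally have "(\<lambda>n. ((\<integral>x. F (X (n+N)) x \<partial>M) - (\<integral>x. F s0 x \<partial>M)) / (X (n+N) - s0)) \<longlonglongrightarrow> (\<integral>x. deriv (\<lambda>s. F s x) s0 \<partial>M)"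
      by (simp add: Y_def)
    thus "((\<lambda>s. ((\<integral>x. F s x \<partial>M) - (\<integral>x. F s0 x \<partial>M)) / (s - s0)) \<circ> X) \<longlonglongrightarrow> (\<integral>x. deriv (\<lambda>s. F s x) s0 \<partial>M)"
      unfolding o_def by (rule LIMSEQ_offset)
  qed
  thus ?thesis unfolding has_field_derivative_iff .
qed

lemma holomorphic_on_integral:
  fixes F :: "complex \<Rightarrow> 'a \<Rightarrow> complex"
  assumes S: "open S"
    and meas: "\<And>s. s \<in> S \<Longrightarrow> F s \<in> borel_measurable M"
    and holo: "\<And>x. x \<in> space M \<Longrightarrow> (\<lambda>s. F s x) holomorphic_on S"
    and bound: "\<And>s0. s0 \<in> S \<Longrightarrow> \<exists>r>0. \<exists>g. integrable M g \<and>
                  (\<forall>s\<in>S \<inter> ball s0 r. \<forall>x\<in>space M. norm (F s x) \<le> g x)"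
  shows "(\<lambda>s. \<integral>x. F s x \<partial>M) holomorphic_on S"
  using has_field_derivative_integral[OF S _ meas holo bound] unfolding holomorphic_on_open[OF S] by blast

lemma holomorphic_on_integral_halfline:
  fixes F :: "complex \<Rightarrow> real \<Rightarrow> complex"
  assumes S: "open S"
    and cont: "\<And>s. s \<in> S \<Longrightarrow> continuous_on {0<..} (F s)"
    and holo: "\<And>x. x > 0 \<Longrightarrow> (\<lambda>s. F s x) holomorphic_on S"
    and bound: "\<And>s0. s0 \<in> S \<Longrightarrow> \<exists>r>0. \<exists>g. integrable halfline g \<and>
                  (\<forall>s\<in>S \<inter> ball s0 r. \<forall>x>0. norm (F s x) \<le> g x)"
  shows "(\<lambda>s. \<integral>x. F s x \<partial>halfline) holomorphic_on S"
proof (rule holomorphic_on_integral[OF S])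
  show "F s \<in> borel_measurable halfline" if "s \<in> S" for s
    by (intro continuous_imp_measurable_on_sets_lebesgue cont that) auto
qed (use holo bound in \<open>force+\<close>)

section \<open>Abel--Plana summation along rays\<close>

text \<open>For \<open>e = 1\<close> this is the sum over l \<ge> 1 of exp (2 pi i l t) in the upper
  half-plane, for \<open>e = -1\<close> that of exp (-2 pi i l t) in the lower one: the sign names
  the half-plane in which the kernel decays. Its poles are the integers.\<close>

definition pkern :: "real \<Rightarrow> complex \<Rightarrow> complex" where
  "pkern e t = 1 / (exp (- (2 * of_real pi * \<i> * of_real e * t)) - 1)"

abbreviation unit_sign :: "real \<Rightarrow> bool" where
  "unit_sign e \<equiv> e = 1 \<or> e = -1"

lemma pkern_pole_iff:
  assumes "unit_sign e"
  shows "exp (- (2 * of_real pi * \<i> * of_real e * t)) = (1::complex) \<longleftrightarrow> t \<in> \<int>"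
proof -
  have "exp (2 * of_real pi * \<i> * t) = (1::complex) \<longleftrightarrow> t \<in> \<int>"
  proof
    assume "exp (2 * of_real pi * \<i> * t) = 1"
    then obtain n :: int where "Im t = 0" "2 * (pi * Re t) = real_of_int (2 * n) * pi"
      by (auto simp: exp_eq_1)
    hence "t = of_int n" by (simp add: complex_eq_iff)
    thus "t \<in> \<int>" by simp
  next
    assume "t \<in> \<int>"
    thus "exp (2 * of_real pi * \<i> * t) = 1" by (elim Ints_cases) (auto simp: exp_eq_1)
  qed
  thus ?thesis using assms by (auto simp: exp_minus)
qed

text \<open>Exchanging one kernel for the other costs the constant -1. This is the source of the
  integral of \<open>f\<close> itself in the summation formula.\<close>

lemma pkern_add:
  assumes "t \<notin> \<int>"
  shows "pkern 1 t + pkern (-1) t = -1"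
proof -
  have aux: "1 / (inverse q - 1) + 1 / (q - 1) = -1" if "q \<noteq> 0" "q \<noteq> 1" for q :: complex
  proof -
    have "inverse q - 1 = (1 - q) / q" using that by (simp add: field_simps)
    hence "1 / (inverse q - 1) + 1 / (q - 1) = (1 - q) / (q - 1)"
      using that by (simp add: divide_simps) (simp add: algebra_simps)
    thus ?thesis using that by (simp add: divide_simps)
  qed
  have "exp (2 * of_real pi * \<i> * t) \<noteq> 1" using pkern_pole_iff[of "-1" t] assms by auto
  from aux[OF _ this] show ?thesis by (simp add: pkern_def exp_minus)
qed

lemma holomorphic_pkern:
  assumes "unit_sign e" "S \<inter> \<int> = {}"
  shows "pkern e holomorphic_on S"
proof -
  have "exp (- (2 * of_real pi * \<i> * of_real e * t)) - 1 \<noteq> (0::complex)" if "t \<in> S" for t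
  proof -
    have "t \<notin> \<int>" using that assms(2) by auto
    thus ?thesis unfolding right_minus_eq pkern_pole_iff[OF assms(1)] .
  qed
  thus ?thesis unfolding pkern_def by (intro holomorphic_intros)
qed

lemma continuous_on_pkern:
  assumes "unit_sign e" "S \<inter> \<int> = {}"
  shows "continuous_on S (pkern e)"
  using holomorphic_on_imp_continuous_on[OF holomorphic_pkern[OF assms]] .

lemma norm_pkern_le:
  assumes "unit_sign e" "e * Im t > 0"
  shows "norm (pkern e t) \<le> 1 / (exp (2 * pi * (e * Im t)) - 1)"
proof -
  have "norm (exp (- (2 * of_real pi * \<i> * of_real e * t))) = exp (2 * pi * (e * Im t))"
    by (simp add: mult_ac)
  hence "exp (2 * pi * (e * Im t)) - 1 \<le> norm (exp (- (2 * of_real pi * \<i> * of_real e * t)) - 1)"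
    by (metis norm_one norm_triangle_ineq2)
  moreover have "exp (2 * pi * (e * Im t)) > 1" using assms(2) by simp
  ultimately show ?thesis by (auto simp: pkern_def norm_divide intro!: divide_left_mono mult_pos_pos)
qed

definition rayv :: "real \<Rightarrow> real \<Rightarrow> complex" where "rayv e \<tau> = Complex 1 (e * \<tau>)"

lemma rayv_simps [simp]: "Re (rayv e \<tau>) = 1" "Im (rayv e \<tau>) = e * \<tau>"
  by (simp_all add: rayv_def)

lemma rayv_nz [simp]: "rayv e \<tau> \<noteq> 0" by (simp add: complex_eq_iff)

definition wedge :: "real \<Rightarrow> complex set" where
  "wedge \<tau> = {t. \<bar>Im t\<bar> < \<tau> * Re t}"

lemma open_wedge: "open (wedge \<tau>)"
  unfolding wedge_def by (intro open_Collect_less continuous_intros)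

lemma convex_wedge: "convex (wedge \<tau>)"
proof -
  have "wedge \<tau> = {t. Im t < \<tau> * Re t} \<inter> {t. - Im t < \<tau> * Re t}"
    by (auto simp: wedge_def)
  also have "\<dots> = {t. inner (Complex (-\<tau>) 1) t < 0} \<inter> {t. inner (Complex (-\<tau>) (-1)) t < 0}"
    by (auto simp: inner_complex_def)
  finally show ?thesis by (simp add: convex_Int convex_halfspace_lt)
qed

lemma contour_integral_linepath_ray:
  fixes h :: "complex \<Rightarrow> complex"
  assumes "R > 0"
  shows "contour_integral (linepath a (a + of_real R * v)) h = integral {0..R} (\<lambda>x. h (a + of_real x * v) * v)"
proof -
  let ?g = "\<lambda>x. h (a + of_real x * v) * v"
  \<comment> \<open>Proved as an equivalence for every value \<open>i\<close>, so that the two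
    integrals agree even if neither function is integrable.\<close>
  have *: "((\<lambda>x. h (linepath a (a + of_real R * v) x) * (of_real R * v)) has_integral i) {0..1} \<longleftrightarrow> (?g has_integral i) {0..R}" for i
  proof -
    have im: "(\<lambda>x. x / R) ` {0..R} = {0..1}"
      using assms image_divide_atLeastAtMost[of R 0 R] by simp
    have "(?g has_integral i) {0..R} \<longleftrightarrow> (?g has_integral \<bar>R\<bar> *\<^sub>R ((1 / R) *\<^sub>R i)) {0..R}"
      using assms by simp
    also have "\<dots> \<longleftrightarrow> ((\<lambda>x. ?g (R * x)) has_integral (1 / R) *\<^sub>R i) {0..1}"
      using assms has_integral_stretch_real_iff[of R ?g "(1 / R) *\<^sub>R i" 0 R] unfolding im by (simp only: simp_thms)
    also have "\<dots> \<longleftrightarrow> ((\<lambda>x. of_real R * ?g (R * x)) has_integral of_real R * ((1 / R) *\<^sub>R i)) {0..1}"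
      using assms by (subst has_integral_mult_right_iff) (simp_all add: scaleR_conv_of_real)
    also have "of_real R * ((1 / R) *\<^sub>R i) = i" using assms by (simp add: scaleR_conv_of_real)
    also have "(\<lambda>x. of_real R * ?g (R * x)) = (\<lambda>x. h (linepath a (a + of_real R * v) x) * (of_real R * v))"
      by (auto simp: linepath_def algebra_simps scaleR_conv_of_real)
    finally show ?thesis by simp
  qed
  have "contour_integral (linepath a (a + of_real R * v)) h =
        integral {0..1} (\<lambda>x. h (linepath a (a + of_real R * v) x) * (of_real R * v))"
    by (simp add: contour_integral_integral)
  also have "\<dots> = integral {0..R} ?g"
    unfolding integral_def integrable_on_def * ..
  finally show ?thesis .
qed

lemma integral_halfline_LIMSEQ:
  fixes g :: "real \<Rightarrow> complex"
  assumes "integrable halfline g" "filterlim R at_top sequentially"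
  shows "(\<lambda>n. integral {0..R n} g) \<longlonglongrightarrow> (\<integral>x. g x \<partial>halfline)"
proof -
  let ?M = "halfline"
  have "(\<lambda>n. \<integral>x. indicator {..R n} x *\<^sub>R g x \<partial>?M) \<longlonglongrightarrow> (\<integral>x. g x \<partial>?M)"
  proof (rule integral_dominated_convergence[where w = "\<lambda>x. norm (g x)"])
    show "g \<in> borel_measurable ?M" using assms(1) by auto
    show "(\<lambda>x. indicat_real {..R i} x *\<^sub>R g x) \<in> borel_measurable ?M" for i
      by (intro borel_measurable_scaleR borel_measurable_integrable[OF assms(1)] borel_measurable_indicator'
           measurable_restrict_space1) auto
    have "(\<lambda>i. indicat_real {..R i} x *\<^sub>R g x) \<longlonglongrightarrow> g x" for x
    proof (rule tendsto_eventually)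
      have "eventually (\<lambda>i. R i \<ge> x) sequentially" using assms(2) by (auto simp: filterlim_at_top)
      thus "eventually (\<lambda>i. indicat_real {..R i} x *\<^sub>R g x = g x) sequentially"
        by eventually_elim auto
    qed
    thus "AE x in ?M. (\<lambda>i. indicat_real {..R i} x *\<^sub>R g x) \<longlonglongrightarrow> g x" by simp
  qed (use assms in \<open>auto simp: indicator_def\<close>)
  also have "(\<lambda>n. \<integral>x. indicator {..R n} x *\<^sub>R g x \<partial>?M) = (\<lambda>n. integral {0..R n} g)"
  proof
    fix n
    have "(\<integral>x. indicator {..R n} x *\<^sub>R g x \<partial>?M) = (\<integral>x. indicator {0<..} x *\<^sub>R (indicator {..R n} x *\<^sub>R g x) \<partial>lebesgue)"
      by (subst integral_restrict_space) auto
    also have "\<dots> = (\<integral>x. indicator {0<..R n} x *\<^sub>R g x \<partial>lebesgue)"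
      by (intro Bochner_Integration.integral_cong) (auto simp: indicator_def)
    also have "\<dots> = integral\<^sup>L (lebesgue_on {0<..R n}) g"
      by (subst integral_restrict_space) auto
    also have "\<dots> = integral {0<..R n} g"
    proof (rule lebesgue_integral_eq_integral)
      have "integrable lebesgue (\<lambda>x. indicator {0<..} x *\<^sub>R g x)"
        using assms(1) by (subst (asm) integrable_restrict_space) auto
      from integrable_mult_indicator[OF _ this, of "{..R n}"]
      have "integrable lebesgue (\<lambda>x. indicator {..R n} x *\<^sub>R (indicator {0<..} x *\<^sub>R g x))" by simp
      also have "(\<lambda>x. indicat_real {..R n} x *\<^sub>R (indicator {0<..} x *\<^sub>R g x)) = (\<lambda>x. indicator {0<..R n} x *\<^sub>R g x)"
        by (auto simp: indicator_def)
      finally show "integrable (lebesgue_on {0<..R n}) g"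
        by (subst integrable_restrict_space) auto
    qed auto
    also have "\<dots> = integral {0..R n} g"
      by (rule integral_spike_set; rule negligible_subset[of "{0}"]; force)
    finally show "(\<integral>x. indicator {..R n} x *\<^sub>R g x \<partial>?M) = integral {0..R n} g" .
  qed
  finally show ?thesis .
qed

text \<open>The triangle is the contour of the residue theorem below. Winding number 1 about an
  integer requires it to be an interior point, not merely a point of the hull.\<close>

lemma wedge_triangle_interior:
  assumes "c < X" "\<tau> > 0" "c < Re t" "Re t < X" "\<bar>Im t\<bar> < \<tau> * (Re t - c)"
  shows "t \<in> interior (convex hull {of_real c, Complex X (- (\<tau> * (X - c))), Complex X (\<tau> * (X - c))})"
proof -
  let ?U = "{t. \<bar>Im t\<bar> < \<tau> * (Re t - c) \<and> Re t < X}"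
  have "?U = {t. \<bar>Im t\<bar> < \<tau> * (Re t - c)} \<inter> {t. Re t < X}" by auto
  moreover have "open \<dots>" by (intro open_Int open_Collect_less continuous_intros)
  ultimately have "open ?U" by simp
  moreover have "?U \<subseteq> convex hull {of_real c, Complex X (- (\<tau> * (X - c))), Complex X (\<tau> * (X - c))}"
  proof
    fix t assume t: "t \<in> ?U"
    hence *: "0 < \<tau> * (Re t - c)" by (smt (verit) mem_Collect_eq)
    hence "Re t > c" using assms(2) by (simp add: zero_less_mult_iff)
    \<comment> \<open>\<open>l\<close> is the relative distance from the apex and \<open>m\<close>
      the relative height at that distance; the barycentric coordinates are read off from these
      two.\<close>
    define l where "l = (Re t - c) / (X - c)"
    define m where "m = Im t / (\<tau> * (Re t - c))"
    have l: "0 < l" "l < 1" using \<open>Re t > c\<close> t assms(1) by (auto simp: l_def field_simps)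
    have m: "\<bar>m\<bar> \<le> 1" using t * by (auto simp: m_def abs_divide divide_simps abs_mult)
    have eq: "t = (1 - l) *\<^sub>R of_real c + (l * (1 - m) / 2) *\<^sub>R Complex X (- (\<tau> * (X - c))) + (l * (1 + m) / 2) *\<^sub>R Complex X (\<tau> * (X - c))"
    proof (rule complex_eqI)
      have "Re t = c + l * (X - c)" using assms(1) by (simp add: l_def)
      thus "Re t = Re ((1 - l) *\<^sub>R of_real c + (l * (1 - m) / 2) *\<^sub>R Complex X (- (\<tau> * (X - c))) + (l * (1 + m) / 2) *\<^sub>R Complex X (\<tau> * (X - c)))"
        by (simp add: field_simps)
      have "Im t = m * (\<tau> * (Re t - c))" using * unfolding m_def by (metis less_irrefl nonzero_eq_divide_eq)
      also have "Re t - c = l * (X - c)" using assms(1) by (simp add: l_def)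
      finally show "Im t = Im ((1 - l) *\<^sub>R of_real c + (l * (1 - m) / 2) *\<^sub>R Complex X (- (\<tau> * (X - c))) + (l * (1 + m) / 2) *\<^sub>R Complex X (\<tau> * (X - c)))"
        by (simp add: field_simps)
    qed
    show "t \<in> convex hull {of_real c, Complex X (- (\<tau> * (X - c))), Complex X (\<tau> * (X - c))}"
      unfolding convex_hull_3
    proof (rule CollectI, rule exI[of _ "1 - l"], rule exI[of _ "l * (1 - m) / 2"], rule exI[of _ "l * (1 + m) / 2"], intro conjI)
      show "0 \<le> l * (1 - m) / 2" using l m by simp
      show "0 \<le> l * (1 + m) / 2" using l m by simp
      show "1 - l + l * (1 - m) / 2 + l * (1 + m) / 2 = 1" by (simp add: field_simps)
    qed (use l eq in auto)
  qed
  ultimately have "?U \<subseteq> interior (convex hull {of_real c, Complex X (- (\<tau> * (X - c))), Complex X (\<tau> * (X - c))})"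
    by (intro interior_maximal)
  thus ?thesis using assms by auto
qed

lemma residue_pkern:
  assumes "open S" "connected S" "of_nat d \<in> S" "f holomorphic_on S"
  shows "residue (\<lambda>t. f t * pkern 1 t) (of_nat d) = - f (of_nat d) / (2 * of_real pi * \<i>)"
proof -
  let ?g = "\<lambda>t. exp (- (2 * of_real pi * \<i> * of_real 1 * t)) - 1"
  have e1: "exp (- (2 * of_real pi * \<i> * of_real 1 * of_nat d)) = (1::complex)"
    using pkern_pole_iff[of 1 "of_nat d"] by simp
  have der: "(?g has_field_derivative (- (2 * of_real pi * \<i>))) (at (of_nat d))"
    using e1 by (auto intro!: derivative_eq_intros)
  have lim: "((\<lambda>w. (f w * pkern 1 w) * (w - of_nat d)) \<longlongrightarrow> f (of_nat d) * (1 / (- (2 * of_real pi * \<i>)))) (at (of_nat d))"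
  proof -
    have "((\<lambda>w. ?g w / (w - of_nat d)) \<longlongrightarrow> - (2 * of_real pi * \<i>)) (at (of_nat d))"
      using der e1 by (simp add: has_field_derivative_iff)
    hence "((\<lambda>w. f w * (1 / (?g w / (w - of_nat d)))) \<longlongrightarrow> f (of_nat d) * (1 / (- (2 * of_real pi * \<i>)))) (at (of_nat d))"
      using assms holomorphic_on_imp_continuous_on[OF assms(4)]
      by (intro tendsto_intros) (auto simp: continuous_on_eq_continuous_at isCont_def)
    thus ?thesis by (simp add: pkern_def)
  qed
  \<comment> \<open>Within distance 1 of \<open>d\<close> there is no other integer, so
    \<open>d\<close> is the only singularity left.\<close>
  define T where "T = S \<inter> ball (of_nat d) 1"
  have "T \<inter> \<int> \<subseteq> {of_nat d}"
  proof
    fix x assume "x \<in> T \<inter> \<int>"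
    then obtain n where n: "x = of_int n" "dist (of_nat d) x < 1" by (auto simp: T_def elim!: Ints_cases)
    hence "\<bar>int d - n\<bar> < 1"
      by (metis dist_norm norm_of_int of_int_less_1_iff of_int_of_nat_eq of_int_diff of_int_abs)
    hence "n = int d" by linarith
    thus "x \<in> {of_nat d}" using n(1) by simp
  qed
  hence hol: "(\<lambda>t. f t * pkern 1 t) holomorphic_on (T - {of_nat d})"
    by (intro holomorphic_intros holomorphic_on_subset[OF assms(4)] holomorphic_pkern) (auto simp: T_def)
  have "residue (\<lambda>t. f t * pkern 1 t) (of_nat d) = f (of_nat d) * (1 / (- (2 * of_real pi * \<i>)))"
    by (rule residue_simple'[OF _ _ hol lim]) (use assms in \<open>auto simp: T_def\<close>)
  thus ?thesis by simp
qed

text \<open>The residue theorem is applied to \<open>f * pkern 1\<close> on the triangle with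
  vertices \<open>c\<close>, \<open>P (-1)\<close> and \<open>P 1\<close>. Below the real axis this
  kernel does not decay, so there it is replaced by \<open>-1 - pkern (-1)\<close>; the
  contributions of \<open>- f\<close> telescope, through a primitive, to the integral from
  \<open>c\<close> to \<open>X\<close>. A half-integral \<open>X\<close> keeps the vertical side
  away from the poles.\<close>

lemma abel_plana_finite:
  fixes f :: "complex \<Rightarrow> complex"
  assumes hol: "f holomorphic_on wedge \<tau>'" and tau: "0 < \<tau>" "\<tau> < \<tau>'" and c: "0 < c" "c < 1"
    and X: "X = real N + 1 / 2" and N: "N \<ge> 1"
  defines "P \<equiv> (\<lambda>e. Complex X (e * (\<tau> * (X - c))))"
  shows "(\<Sum>d=1..N. f (of_nat d)) = contour_integral (linepath (of_real c) (of_real X)) f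
     + (\<Sum>e\<in>{1,-1}. contour_integral (linepath (of_real c) (P e)) (\<lambda>t. f t * pkern e t)
                  - contour_integral (linepath (of_real X) (P e)) (\<lambda>t. f t * pkern e t))"
proof -
  have cX: "c < X" using c X N by simp
  have P1: "P 1 = Complex X (\<tau> * (X - c))" "P (-1) = Complex X (-(\<tau> * (X - c)))" by (auto simp: P_def)
  have tX: "\<tau> * (X - c) > 0" using tau cX by simp
  define W where "W = wedge \<tau>'"
  have inW: "Complex x y \<in> W" if "x \<ge> c" "\<bar>y\<bar> \<le> \<tau> * (x - c)" for x y
  proof -
    have "\<tau> * (x - c) < \<tau>' * x"
    proof -
      have "\<tau> * (x - c) < \<tau> * x" using tau c by (intro mult_strict_left_mono) auto
      also have "\<dots> < \<tau>' * x" using tau c that by (intro mult_strict_right_mono) auto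
      finally show ?thesis .
    qed
    thus ?thesis using that by (simp add: W_def wedge_def)
  qed
  have cW: "of_real c \<in> W" "of_real X \<in> W" "P 1 \<in> W" "P (-1) \<in> W"
    using inW[of c 0] inW[of X 0] inW[of X "\<tau> * (X - c)"] inW[of X "-(\<tau> * (X - c))"] cX tau tX
    by (simp_all add: P1 flip: complex_of_real_def)
  have convW: "convex W" and openW: "open W" by (auto simp: W_def convex_wedge open_wedge)
  have segW: "closed_segment a b \<subseteq> W" if "a \<in> W" "b \<in> W" for a b
    using that convW by (simp add: closed_segment_subset)
  have hol: "f holomorphic_on W" using hol by (simp add: W_def)
  have contf: "continuous_on W f" using hol holomorphic_on_imp_continuous_on by blast
  obtain F where F: "\<And>x. x \<in> W \<Longrightarrow> (F has_field_derivative f x) (at x within W)"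
    using holomorphic_convex_primitive'[OF convW openW hol] by blast
  have prim: "contour_integral (linepath a b) f = F b - F a" if "a \<in> W" "b \<in> W" for a b
    using contour_integral_primitive[OF F, of "linepath a b"] segW[OF that]
    by (auto intro!: contour_integral_unique)
  have noint1: "closed_segment (of_real c) (P e) \<inter> \<int> = {}" if e: "unit_sign e" for e
  proof -
    have "t \<notin> \<int>" if "t \<in> closed_segment (of_real c) (P e)" for t
    proof
      assume "t \<in> \<int>"
      then obtain n where n: "t = of_int n" by (elim Ints_cases)
      from \<open>t \<in> closed_segment (of_real c) (P e)\<close> obtain u where u: "t = (1 - u) *\<^sub>R of_real c + u *\<^sub>R P e"
        by (auto simp: closed_segment_def)
      have "Im t = u * (e * (\<tau> * (X - c)))" using u by (simp add: P_def)
      hence "u = 0" using n e tX by auto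
      hence "t = of_real c" using u by simp
      hence "real_of_int n = c" using n by (metis Re_complex_of_real of_real_of_int_eq)
      thus False using c by (metis not_less of_int_0_less_iff of_int_less_1_iff zless_imp_add1_zle add_0)
    qed
    thus ?thesis by auto
  qed
  have noint2: "closed_segment a b \<inter> \<int> = {}" if "Re a = X" "Re b = X" for a b
  proof -
    have "t \<notin> \<int>" if "t \<in> closed_segment a b" for t
    proof
      assume "t \<in> \<int>"
      then obtain n where n: "t = of_int n" by (elim Ints_cases)
      have "Re t = X"
      proof -
        from that obtain u where "t = (1 - u) *\<^sub>R a + u *\<^sub>R b" by (auto simp: closed_segment_def)
        hence "Re t = (1 - u) * X + u * X" using \<open>Re a = X\<close> \<open>Re b = X\<close> by simp
        thus ?thesis by (simp add: algebra_simps)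
      qed
      hence "real_of_int n = real N + 1 / 2" using n X by simp
      hence "real_of_int (2 * n) = real_of_int (2 * int N + 1)" by simp
      hence "2 * n = 2 * int N + 1" by (subst (asm) of_int_eq_iff)
      thus False by presburger
    qed
    thus ?thesis by auto
  qed
  have contK: "continuous_on (closed_segment a b) (\<lambda>t. f t * pkern e t)"
    if "unit_sign e" "a \<in> W" "b \<in> W" "closed_segment a b \<inter> \<int> = {}" for a b e
    using that by (intro continuous_intros continuous_on_subset[OF contf] continuous_on_pkern segW) auto
  have flip: "contour_integral (linepath a b) (\<lambda>t. f t * pkern 1 t) =
      - (F b - F a) - contour_integral (linepath a b) (\<lambda>t. f t * pkern (-1) t)"
    if "a \<in> W" "b \<in> W" "closed_segment a b \<inter> \<int> = {}" for a b
  proof -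
    have "contour_integral (linepath a b) (\<lambda>t. f t * pkern 1 t) =
          contour_integral (linepath a b) (\<lambda>t. - f t - f t * pkern (-1) t)"
    proof (rule contour_integral_cong[OF refl])
      fix t assume "t \<in> path_image (linepath a b)"
      hence "t \<notin> \<int>" using that(3) by auto
      from pkern_add[OF this] have "pkern 1 t = - 1 - pkern (-1) t" by (simp add: algebra_simps)
      thus "f t * pkern 1 t = - f t - f t * pkern (-1) t" by (simp only: right_diff_distrib) simp
    qed
    also have "\<dots> = contour_integral (linepath a b) (\<lambda>t. - f t) - contour_integral (linepath a b) (\<lambda>t. f t * pkern (-1) t)"
    proof (rule contour_integral_diff)
      have "continuous_on (closed_segment a b) f" by (rule continuous_on_subset[OF contf segW[OF that(1,2)]])
      thus "(\<lambda>t. - f t) contour_integrable_on linepath a b"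
        by (intro contour_integrable_continuous_linepath continuous_on_minus)
      show "(\<lambda>t. f t * pkern (-1) t) contour_integrable_on linepath a b"
        using that by (intro contour_integrable_continuous_linepath contK) auto
    qed
    also have "contour_integral (linepath a b) (\<lambda>t. - f t) = - (F b - F a)"
      using prim[OF that(1,2)] by (simp add: contour_integral_neg)
    finally show ?thesis .
  qed
  have ReP: "Re (P e) = X" for e by (simp add: P_def)
  define g where "g = linepath (of_real c) (P (-1)) +++ linepath (P (-1)) (P 1) +++ linepath (P 1) (of_real c)"
  \<comment> \<open>Cutting the wedge off before \<open>N + 1\<close> leaves \<open>1..N\<close> as
    the only integers in the domain, so that the set of poles is finite.\<close>
  define S where "S = W \<inter> {t. Re t < real N + 1}"
  define pts where "pts = (of_nat :: nat \<Rightarrow> complex) ` {1..N}"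
  have convS: "convex S" unfolding S_def using convW
    by (intro convex_Int convex_halfspace_Re_lt)
  have openS: "open S" unfolding S_def using openW by (intro open_Int open_halfspace_Re_lt)
  have SW: "S \<subseteq> W" by (auto simp: S_def)
  have SZ: "t \<in> pts" if "t \<in> S" "t \<in> \<int>" for t
  proof -
    obtain n where n: "t = of_int n" using \<open>t \<in> \<int>\<close> by (elim Ints_cases)
    have "0 < \<tau>' * Re t" using \<open>t \<in> S\<close> by (auto simp: S_def W_def wedge_def)
    hence "real_of_int n > 0" using tau n by (simp add: zero_less_mult_iff)
    moreover have "real_of_int n < real_of_int (int N + 1)" using \<open>t \<in> S\<close> n by (simp add: S_def)
    hence "n < int N + 1" by (subst (asm) of_int_less_iff)
    ultimately have "t = of_nat (nat n)" "nat n \<in> {1..N}" using n by auto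
    thus ?thesis unfolding pts_def by blast
  qed
  have cS: "of_real c \<in> S" "of_real X \<in> S" "P 1 \<in> S" "P (-1) \<in> S"
    using cW cX X c N by (auto simp: S_def ReP)
  have segS: "closed_segment a b \<subseteq> S" if "a \<in> S" "b \<in> S" for a b
    using that convS by (simp add: closed_segment_subset)
  have pi_g: "path_image g \<subseteq> S - pts"
  proof -
    have Z: "pts \<subseteq> \<int>" by (auto simp: pts_def)
    have "closed_segment (of_real c) (P (-1)) \<subseteq> S - pts"
      using segS[OF cS(1) cS(4)] noint1[of "-1"] Z by blast
    moreover have "closed_segment (P (-1)) (P 1) \<subseteq> S - pts"
      using segS[OF cS(4) cS(3)] noint2[OF ReP ReP, of "-1" 1] Z by blast
    moreover have "closed_segment (P 1) (of_real c) \<subseteq> S - pts"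
      using segS[OF cS(3) cS(1)] noint1[of 1] Z by (simp add: closed_segment_commute) blast
    ultimately show ?thesis
      unfolding g_def by (simp add: path_image_join)
  qed
  have wn: "winding_number g (of_nat d) = 1" if d: "d \<in> {1..N}" for d
  proof -
    have "of_nat d \<in> interior (convex hull {of_real c, P (-1), P 1})"
      unfolding P1 using cX tau d c X by (intro wedge_triangle_interior) auto
    moreover have "0 < Im ((P (-1) - of_real c) * cnj (P (-1) - of_nat d))"
    proof -
      have "Im ((P (-1) - of_real c) * cnj (P (-1) - of_nat d)) = (\<tau> * (X - c)) * (real d - c)"
        by (simp add: P_def algebra_simps)
      also have "\<dots> > 0" using tX d c by (intro mult_pos_pos[OF tX]) auto
      finally show ?thesis .
    qed
    ultimately show ?thesis unfolding g_def by (subst winding_number_triangle) auto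
  qed
  have "contour_integral g (\<lambda>t. f t * pkern 1 t) = 2 * pi * \<i> * (\<Sum>p\<in>pts. winding_number g p * residue (\<lambda>t. f t * pkern 1 t) p)"
  proof (rule Residue_theorem[OF openS _ _ _ _ _ pi_g])
    show "(\<lambda>t. f t * pkern 1 t) holomorphic_on S - pts"
      using SZ SW by (intro holomorphic_intros holomorphic_on_subset[OF hol] holomorphic_pkern) auto
    show "valid_path g" by (auto simp: g_def intro!: valid_path_join)
    show "pathfinish g = pathstart g" by (simp add: g_def)
    show "\<forall>z. z \<notin> S \<longrightarrow> winding_number g z = 0"
      using pi_g by (intro allI impI winding_number_zero_outside[OF _ convS])
        (auto simp: g_def intro!: path_join_imp valid_path_imp_path valid_path_join)
  qed (use convS convex_connected in \<open>auto simp: pts_def\<close>)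
  also have "(\<Sum>p\<in>pts. winding_number g p * residue (\<lambda>t. f t * pkern 1 t) p) =
             (\<Sum>d=1..N. - f (of_nat d) / (2 * of_real pi * \<i>))"
  proof -
    have "of_nat d \<in> W" if "d \<in> {1..N}" for d
      using that tau by (auto simp: W_def wedge_def)
    hence "residue (\<lambda>t. f t * pkern 1 t) (of_nat d) = - f (of_nat d) / (2 * of_real pi * \<i>)" if "d \<in> {1..N}" for d
      using residue_pkern[OF openW convex_connected[OF convW] _ hol, of d] that by blast
    thus ?thesis unfolding pts_def
      by (subst sum.reindex) (auto simp: inj_on_def wn intro!: sum.cong)
  qed
  also have "2 * pi * \<i> * \<dots> = - (\<Sum>d=1..N. f (of_nat d))"
    by (simp add: sum_divide_distrib[symmetric] sum_negf)
  finally have main: "contour_integral g (\<lambda>t. f t * pkern 1 t) = - (\<Sum>d=1..N. f (of_nat d))" .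
  have ci: "(\<lambda>t. f t * pkern 1 t) contour_integrable_on linepath a b"
    if "a \<in> W" "b \<in> W" "closed_segment a b \<inter> \<int> = {}" for a b
    using that by (intro contour_integrable_continuous_linepath contK) auto
  have seg3: "closed_segment (P 1) (of_real c) \<inter> \<int> = {}"
    using noint1[of 1] by (simp add: closed_segment_commute)
  have "contour_integral g (\<lambda>t. f t * pkern 1 t) = contour_integral (linepath (of_real c) (P (-1))) (\<lambda>t. f t * pkern 1 t)
     + (contour_integral (linepath (P (-1)) (P 1)) (\<lambda>t. f t * pkern 1 t)
        + contour_integral (linepath (P 1) (of_real c)) (\<lambda>t. f t * pkern 1 t))"
    unfolding g_def
    by (subst contour_integral_join; (subst contour_integral_join)?)
       (auto intro!: ci cW noint1 noint2 seg3 contour_integrable_joinI simp: ReP)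
  also have "contour_integral (linepath (P (-1)) (P 1)) (\<lambda>t. f t * pkern 1 t) =
      contour_integral (linepath (P (-1)) (of_real X)) (\<lambda>t. f t * pkern 1 t) +
      contour_integral (linepath (of_real X) (P 1)) (\<lambda>t. f t * pkern 1 t)"
  proof (rule contour_integral_split_linepath)
    show "continuous_on (closed_segment (P (-1)) (P 1)) (\<lambda>t. f t * pkern 1 t)"
      by (intro contK cW noint2 ReP) auto
    show "of_real X \<in> closed_segment (P (-1)) (P 1)"
      unfolding closed_segment_def by (auto intro!: exI[of _ "1/2"] simp: P1 complex_eq_iff field_simps)
  qed
  also have "contour_integral (linepath (P (-1)) (of_real X)) (\<lambda>t. f t * pkern 1 t) =
     - (F (of_real X) - F (P (-1))) - contour_integral (linepath (P (-1)) (of_real X)) (\<lambda>t. f t * pkern (-1) t)"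
    by (intro flip cW noint2 ReP) auto
  also have "contour_integral (linepath (of_real c) (P (-1))) (\<lambda>t. f t * pkern 1 t) =
     - (F (P (-1)) - F (of_real c)) - contour_integral (linepath (of_real c) (P (-1))) (\<lambda>t. f t * pkern (-1) t)"
    by (intro flip cW noint1) auto
  also have "contour_integral (linepath (P (-1)) (of_real X)) (\<lambda>t. f t * pkern (-1) t) =
     - contour_integral (linepath (of_real X) (P (-1))) (\<lambda>t. f t * pkern (-1) t)"
    using contour_integral_reversepath[of "linepath (of_real X) (P (-1))" "\<lambda>t. f t * pkern (-1) t"] by simp
  also have "contour_integral (linepath (P 1) (of_real c)) (\<lambda>t. f t * pkern 1 t) =
     - contour_integral (linepath (of_real c) (P 1)) (\<lambda>t. f t * pkern 1 t)"
    using contour_integral_reversepath[of "linepath (of_real c) (P 1)" "\<lambda>t. f t * pkern 1 t"] by simp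
  finally show ?thesis unfolding main prim[OF cW(1,2)] by (simp add: algebra_simps minus_equation_iff[of "sum _ _"])
qed

section \<open>Estimates along the rays and the infinite summation formula\<close>

lemma integrable_one_plus_powr:
  fixes b :: real
  assumes "b > 1"
  shows "integrable halfline (\<lambda>x. (1 + x) powr (-b))"
proof -
  have lim: "((\<lambda>x. (1 + x) powr (1 - b) / (1 - b)) \<longlongrightarrow> 0 / (1 - b)) at_top"
    using assms by (intro tendsto_divide tendsto_neg_powr filterlim_tendsto_add_at_top[OF tendsto_const] filterlim_ident) auto
  have "((\<lambda>x. (1 + x) powr (-b)) has_integral (0 / (1 - b) - (1 + 0) powr (1 - b) / (1 - b))) {0..}"
  proof (rule has_integral_to_inf)
    show "(\<lambda>x. (1 + x) powr (-b)) integrable_on {0..y}" for y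
      by (intro integrable_continuous_interval continuous_intros) auto
    have "integral {0..y} (\<lambda>x. (1 + x) powr (-b)) = (1 + y) powr (1 - b) / (1 - b) - (1 + 0) powr (1 - b) / (1 - b)" if "y \<ge> 0" for y
    proof (intro integral_unique fundamental_theorem_of_calculus)
      fix x assume x: "x \<in> {0..y}"
      have "((\<lambda>x. (1 + x) powr (1 - b) / (1 - b)) has_real_derivative (1 + x) powr (1 - b - 1)) (at x within {0..y})"
      proof -
        have "((\<lambda>x. 1 + x) has_real_derivative 1) (at x)" by (auto intro!: derivative_eq_intros)
        from DERIV_cdivide[OF DERIV_fun_powr[OF this, of "1 - b"], of "1 - b"] x assms show ?thesis
          by (simp add: has_field_derivative_at_within)
      qed
      thus "((\<lambda>x. (1 + x) powr (1 - b) / (1 - b)) has_vector_derivative (1 + x) powr (-b)) (at x within {0..y})"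
        by (simp add: has_real_derivative_iff_has_vector_derivative)
    qed (use that in auto)
    hence ev: "eventually (\<lambda>y. integral {0..y} (\<lambda>x. (1 + x) powr (-b)) = (1 + y) powr (1 - b) / (1 - b) - (1 + 0) powr (1 - b) / (1 - b)) at_top"
      by (intro eventually_mono[OF eventually_ge_at_top[of 0]]) auto
    show "((\<lambda>y. integral {0..y} (\<lambda>x. (1 + x) powr (-b))) \<longlongrightarrow> (0 / (1 - b) - (1 + 0) powr (1 - b) / (1 - b))) at_top"
      by (subst filterlim_cong[OF refl refl ev]) (intro tendsto_diff lim tendsto_const)
  qed auto
  hence "(\<lambda>x. (1 + x) powr (-b)) integrable_on {0..}" by blast
  hence "(\<lambda>x. (1 + x) powr (-b)) integrable_on {0<..}"
    by (rule integrable_spike_set) ((rule negligible_subset[of "{0}"]; force)+)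
  hence "(\<lambda>x. (1 + x) powr (-b)) absolutely_integrable_on {0<..}"
    by (intro nonnegative_absolutely_integrable_1) auto
  thus ?thesis by (simp add: set_integrable_def integrable_restrict_space)
qed

lemma integral_halfline_scale:
  fixes f :: "real \<Rightarrow> complex"
  assumes "a > 0"
  shows "(\<integral>x. f (a * x) \<partial>halfline) = (\<integral>x. f x \<partial>halfline) / of_real a"
proof -
  have "(\<integral>x. f x \<partial>halfline) = (\<integral>x. indicator {0<..} x *\<^sub>R f x \<partial>lebesgue)"
    by (subst integral_restrict_space) auto
  also have "\<dots> = \<bar>a\<bar> *\<^sub>R (\<integral>x. indicator {0<..} (0 + a * x) *\<^sub>R f (0 + a * x) \<partial>lebesgue)"
    using assms by (intro lebesgue_integral_real_affine) auto
  also have "(\<lambda>x. indicat_real {0<..} (0 + a * x) *\<^sub>R f (0 + a * x)) = (\<lambda>x. indicator {0<..} x *\<^sub>R f (a * x))"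
    using assms by (auto simp: indicator_def fun_eq_iff zero_less_mult_iff)
  also have "(\<integral>x. indicator {0<..} x *\<^sub>R f (a * x) \<partial>lebesgue) = (\<integral>x. f (a * x) \<partial>halfline)"
    by (subst integral_restrict_space) auto
  finally show ?thesis using assms by (simp add: scaleR_conv_of_real field_simps)
qed

text \<open>The boundary terms of the summation formula: each kernel is integrated along the ray
  from \<open>c\<close> into the half-plane where it decays. For \<open>c = 0\<close> the same
  expression becomes the correction to the main terms.\<close>

definition ray_int :: "real \<Rightarrow> real \<Rightarrow> (complex \<Rightarrow> complex) \<Rightarrow> complex" where
  "ray_int \<tau> c f = (\<Sum>e\<in>{1,-1}. \<integral>x. f (of_real c + of_real x * rayv e \<tau>) * pkern e (of_real c + of_real x * rayv e \<tau>) * rayv e \<tau> \<partial>halfline)"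

lemma ray_not_int:
  assumes "0 < c" "c < 1" "\<tau> > 0" "unit_sign e" "x \<ge> 0"
  shows "of_real c + of_real x * rayv e \<tau> \<notin> \<int>"
proof
  assume "of_real c + of_real x * rayv e \<tau> \<in> \<int>"
  then obtain n where n: "of_real c + of_real x * rayv e \<tau> = of_int n" by (elim Ints_cases)
  from arg_cong[OF n, of Im] have "x = 0" using assms by auto
  with arg_cong[OF n, of Re] have "c = real_of_int n" by simp
  thus False using assms by simp
qed

lemma ray_in_wedge:
  assumes "c \<ge> 0" "0 < \<tau>" "\<tau> < \<tau>'" "unit_sign e" "x \<ge> 0" "c > 0 \<or> x > 0"
  shows "of_real c + of_real x * rayv e \<tau> \<in> wedge \<tau>'"
proof -
  have "x * \<tau> \<le> (c + x) * \<tau>" using assms by (simp add: mult_right_mono)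
  also have "\<dots> < \<tau>' * (c + x)" unfolding mult.commute[of \<tau>'] using assms by (intro mult_strict_left_mono) auto
  finally show ?thesis using assms by (auto simp: wedge_def abs_mult)
qed

text \<open>Near the start compactness suffices because the ray avoids the integers, and further out
  the exponential takes over. The constant depends on \<open>c\<close> and has to blow up as
  \<open>c\<close> approaches the pole at 0, which is why a uniform version follows later.\<close>

lemma pkern_ray_bound:
  assumes "0 < c" "c < 1" "\<tau> > 0" "unit_sign e"
  shows "\<exists>M>0. \<forall>x\<ge>0. norm (pkern e (of_real c + of_real x * rayv e \<tau>)) \<le> M * exp (- (2 * pi * \<tau>) * x)"
proof -
  define y where "y = 2 * pi * \<tau>"
  have y: "y > 0" using assms by (simp add: y_def)
  have "continuous_on {0..1} (\<lambda>x. pkern e (of_real c + of_real x * rayv e \<tau>))"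
    by (rule continuous_on_compose2[OF continuous_on_pkern[OF assms(4), of "- \<int>"]])
       (use ray_not_int[OF assms] in \<open>auto intro!: continuous_intros\<close>)
  from compact_imp_bounded[OF compact_continuous_image[OF this compact_Icc]]
  obtain M1 where M1: "\<And>x. x \<in> {0..1} \<Longrightarrow> norm (pkern e (of_real c + of_real x * rayv e \<tau>)) \<le> M1"
    unfolding bounded_iff by (metis imageI)
  define M where "M = max (M1 * exp y) (1 / (1 - exp (-y)))"
  have 1: "1 / (1 - exp (-y)) > 0" using y by simp
  have "norm (pkern e (of_real c + of_real x * rayv e \<tau>)) \<le> M * exp (- y * x)" if "x \<ge> 0" for x
  proof (cases "x \<le> 1")
    case True
    have M10: "0 \<le> M1" using M1[of 0] by (meson atLeastAtMost_iff norm_ge_zero order.trans order_refl zero_le_one)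
    have "norm (pkern e (of_real c + of_real x * rayv e \<tau>)) \<le> M1 * exp (y + - y * x)"
    proof -
      have "M1 * 1 \<le> M1 * exp (y + - y * x)" using True y M10 by (intro mult_left_mono) (auto simp: algebra_simps)
      thus ?thesis using M1[of x] True that by simp
    qed
    also have "\<dots> = (M1 * exp y) * exp (- y * x)" by (simp only: exp_add mult.assoc)
    also have "\<dots> \<le> M * exp (- y * x)" by (intro mult_right_mono) (auto simp: M_def)
    finally show ?thesis .
  next
    case False
    have "norm (pkern e (of_real c + of_real x * rayv e \<tau>)) \<le> 1 / (exp (y * x) - 1)"
      using norm_pkern_le[OF assms(4), of "of_real c + of_real x * rayv e \<tau>"] assms False that
      by (auto simp: y_def mult_ac)
    also have "\<dots> = exp (- y * x) / (1 - exp (- y * x))"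
      using y False by (simp add: exp_minus field_simps)
    also have "\<dots> \<le> exp (- y * x) / (1 - exp (-y))"
    proof (rule divide_left_mono)
      have "exp (- y * x) \<le> exp (- y)" using y False by simp
      thus "1 - exp (- y) \<le> 1 - exp (- y * x)" by simp
      thus "0 < (1 - exp (- y * x)) * (1 - exp (-y))" using y False by (intro mult_pos_pos) auto
    qed auto
    also have "\<dots> = (1 / (1 - exp (-y))) * exp (- y * x)" by simp
    also have "\<dots> \<le> M * exp (- y * x)" by (intro mult_right_mono) (auto simp: M_def)
    finally show ?thesis .
  qed
  moreover have "M > 0" unfolding M_def using 1 by (rule order.strict_trans2) simp
  ultimately show ?thesis unfolding y_def by blast
qed

lemma continuous_on_ray_integrand:
  assumes "0 < c" "c < 1" "0 < \<tau>" "\<tau> < \<tau>'" "unit_sign e" "continuous_on (wedge \<tau>') f"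
  shows "continuous_on {0..} (\<lambda>x. f (of_real c + of_real x * rayv e \<tau>) * pkern e (of_real c + of_real x * rayv e \<tau>) * rayv e \<tau>)"
proof (intro continuous_intros)
  show "continuous_on {0..} (\<lambda>x. f (of_real c + of_real x * rayv e \<tau>))"
    by (rule continuous_on_compose2[OF assms(6)]) (use ray_in_wedge assms in \<open>auto intro!: continuous_intros\<close>)
  show "continuous_on {0..} (\<lambda>x. pkern e (of_real c + of_real x * rayv e \<tau>))"
    by (rule continuous_on_compose2[OF continuous_on_pkern[OF assms(5), of "- \<int>"]])
       (use ray_not_int assms in \<open>auto intro!: continuous_intros\<close>)
qed

lemma integrable_ray_integrand:
  assumes c: "0 < c" "c < 1" and tau: "0 < \<tau>" "\<tau> < \<tau>'" and e: "unit_sign e" and f: "continuous_on (wedge \<tau>') f"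
    and bd: "\<And>x. x \<ge> 0 \<Longrightarrow> norm (f (of_real c + of_real x * rayv e \<tau>)) \<le> K * (1 + x) powr p"
  shows "integrable halfline (\<lambda>x. f (of_real c + of_real x * rayv e \<tau>) * pkern e (of_real c + of_real x * rayv e \<tau>) * rayv e \<tau>)"
proof -
  obtain M where M: "M > 0" "\<And>x. x \<ge> 0 \<Longrightarrow> norm (pkern e (of_real c + of_real x * rayv e \<tau>)) \<le> M * exp (- (2 * pi * \<tau>) * x)"
    using pkern_ray_bound[OF c tau(1) e] by blast
  obtain K' where K': "K' > 0" "\<And>x. x \<ge> 0 \<Longrightarrow> (1 + x) powr p \<le> K' * exp (pi * \<tau> * x)"
    using powr_le_exp_bound[of "pi * \<tau>" p] tau by auto
  have K: "K \<ge> 0" using order.trans[OF norm_ge_zero bd[of 0]] by simp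
  show ?thesis
  proof (rule integrable_halfline_bound)
    show "continuous_on {0<..} (\<lambda>x. f (of_real c + of_real x * rayv e \<tau>) * pkern e (of_real c + of_real x * rayv e \<tau>) * rayv e \<tau>)"
      by (rule continuous_on_subset[OF continuous_on_ray_integrand]) (use assms in auto)
    show "integrable halfline (\<lambda>x. (K * K' * M * norm (rayv e \<tau>)) * exp (- (pi * \<tau>) * x))"
      by (intro integrable_mult_right integrable_exp_halfline) (use tau in auto)
    fix x :: real assume x: "x > 0"
    have "norm (f (of_real c + of_real x * rayv e \<tau>)) * norm (pkern e (of_real c + of_real x * rayv e \<tau>)) \<le>
      (K * (K' * exp (pi * \<tau> * x))) * (M * exp (- (2 * pi * \<tau>) * x))"
      using x K M K' by (intro mult_mono order.trans[OF bd] mult_left_mono mult_nonneg_nonneg) auto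
    also have "\<dots> = K * K' * M * (exp (pi * \<tau> * x + - (2 * pi * \<tau>) * x))" by (simp only: exp_add mult_ac)
    also have "pi * \<tau> * x + - (2 * pi * \<tau>) * x = - (pi * \<tau>) * x" by (simp add: algebra_simps)
    finally show "norm (f (of_real c + of_real x * rayv e \<tau>) * pkern e (of_real c + of_real x * rayv e \<tau>) * rayv e \<tau>)
       \<le> (K * K' * M * norm (rayv e \<tau>)) * exp (- (pi * \<tau>) * x)"
      unfolding norm_mult by (simp add: mult_right_mono mult_ac)
  qed
qed

lemma exp_half_int:
  assumes "unit_sign e"
  shows "exp (- (2 * of_real pi * \<i> * of_real e * of_real (real N + 1 / 2))) = (-1 :: complex)"
proof -
  have 1: "exp (of_real pi * \<i> * (2 * of_nat N + 1)) = (-1::complex)"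
    using cis_pi by (simp add: cis_conv_exp distrib_left exp_add) (simp add: exp_eq_1 mult_ac exp_of_nat_mult[symmetric] flip: exp_add)
  hence 2: "exp (- (of_real pi * \<i> * (2 * of_nat N + 1))) = (-1::complex)" by (simp add: exp_minus)
  have 3: "2 * of_real pi * \<i> * of_real (real N + 1 / 2) = (of_real pi * \<i> * (2 * of_nat N + 1) :: complex)"
    by (simp add: algebra_simps)
  from assms show ?thesis
  proof
    assume "e = 1"
    have "- (2 * of_real pi * \<i> * of_real e * of_real (real N + 1 / 2)) = (- (of_real pi * \<i> * (2 * of_nat N + 1)) :: complex)"
      unfolding 3[symmetric] \<open>e = 1\<close> by simp
    thus ?thesis using 2 by (simp only:)
  next
    assume "e = -1"
    have "- (2 * of_real pi * \<i> * of_real e * of_real (real N + 1 / 2)) = (of_real pi * \<i> * (2 * of_nat N + 1) :: complex)"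
      unfolding 3[symmetric] \<open>e = -1\<close> by simp
    thus ?thesis using 1 by (simp only:)
  qed
qed

text \<open>On a vertical line through a half-integer the exponential is real and negative, so it
  adds to the -1 in the denominator instead of cancelling it.\<close>

lemma norm_pkern_half_int_le:
  assumes "unit_sign e" "Re t = real N + 1 / 2" "e * Im t \<ge> 0"
  shows "norm (pkern e t) \<le> 1"
proof -
  have t: "t = of_real (real N + 1 / 2) + \<i> * of_real (Im t)" using assms by (simp add: complex_eq_iff)
  have "- (2 * of_real pi * \<i> * of_real e * t) = - (2 * of_real pi * \<i> * of_real e * of_real (real N + 1 / 2)) + of_real (2 * pi * (e * Im t))"
    by (subst t) (simp add: algebra_simps)
  hence "exp (- (2 * of_real pi * \<i> * of_real e * t)) = - of_real (exp (2 * pi * (e * Im t)))"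
    by (simp only: exp_add exp_half_int[OF assms(1)] exp_of_real) simp
  hence "norm (exp (- (2 * of_real pi * \<i> * of_real e * t)) - 1) = norm (complex_of_real (- (exp (2 * pi * (e * Im t)) + 1)))"
    by simp
  also have "\<dots> = exp (2 * pi * (e * Im t)) + 1"
    unfolding norm_of_real by (simp only: abs_minus_cancel) (simp add: add_pos_pos)
  finally show ?thesis
    by (simp add: pkern_def norm_divide) (simp add: divide_simps add_pos_pos add_increasing2)
qed

text \<open>On the far vertical side the kernel is at most 1 and \<open>f\<close> is O(X^(-b)),
  while the side has length O(X); with b > 1 its contribution vanishes. The remaining integrals
  converge by domination.\<close>

theorem abel_plana:
  fixes f :: "complex \<Rightarrow> complex"
  assumes hol: "f holomorphic_on wedge \<tau>'" and tau: "0 < \<tau>" "\<tau> < \<tau>'" and c: "0 < c" "c < 1"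
    and b: "b > 1" and bd: "\<And>t. t \<in> wedge \<tau>' \<Longrightarrow> Re t \<ge> c \<Longrightarrow> norm (f t) \<le> C * Re t powr (-b)"
  shows "(\<lambda>d. f (of_nat (Suc d))) sums ((\<integral>x. f (of_real (c + x)) \<partial>halfline) + ray_int \<tau> c f)"
proof -
  have cont: "continuous_on (wedge \<tau>') f" using hol holomorphic_on_imp_continuous_on by blast
  have inw: "of_real x \<in> wedge \<tau>'" if "x > 0" for x using that tau by (simp add: wedge_def)
  have "norm (f (of_real c)) \<le> C * c powr (-b)" using bd[OF inw, of c] c by simp
  hence C: "C \<ge> 0" using c by (metis norm_ge_zero order.trans powr_gt_zero zero_le_mult_iff not_le less_irrefl)
  have powr_bd: "C * (c + x) powr (-b) \<le> (C * c powr (-b)) * (1 + x) powr (-b)" if "x \<ge> 0" for x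
  proof -
    have "c * (1 + x) \<le> c + x" using that c by (simp add: algebra_simps mult_left_le_one_le)
    hence "(c + x) powr (-b) \<le> (c * (1 + x)) powr (-b)" using c that b by (intro powr_mono2') auto
    also have "\<dots> = c powr (-b) * (1 + x) powr (-b)" using c that by (simp add: powr_mult)
    finally show ?thesis using C by (simp add: mult_left_mono mult.assoc)
  qed
  \<comment> \<open>Counting from \<open>Suc N\<close> makes the finite formula, which needs at
    least one integer inside, available for every index.\<close>
  define X where "X N = real (Suc N) + 1 / 2" for N
  define P where "P N e = Complex (X N) (e * (\<tau> * (X N - c)))" for N and e :: real
  define g where "g e x = f (of_real c + of_real x * rayv e \<tau>) * pkern e (of_real c + of_real x * rayv e \<tau>) * rayv e \<tau>" for e x
  have X: "X N > c" for N using c by (simp add: X_def)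
  have P: "P N e = of_real c + of_real (X N - c) * rayv e \<tau>" for N e
    by (simp add: P_def complex_eq_iff)
  have Xlim: "filterlim (\<lambda>N. X N - c) at_top sequentially"
    unfolding X_def by real_asymp
  have A: "contour_integral (linepath (of_real c) (P N e)) (\<lambda>t. f t * pkern e t) = integral {0..X N - c} (g e)" for N e
    unfolding P using contour_integral_linepath_ray[of "X N - c" "of_real c" "rayv e \<tau>" "\<lambda>t. f t * pkern e t"] X[of N]
    by (simp add: g_def[abs_def])
  have Alim: "(\<lambda>N. contour_integral (linepath (of_real c) (P N e)) (\<lambda>t. f t * pkern e t)) \<longlonglongrightarrow> (\<integral>x. g e x \<partial>halfline)"
    if e: "unit_sign e" for e
  proof -
    have "integrable halfline (g e)"
      unfolding g_def
    proof (rule integrable_ray_integrand[OF c tau e cont])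
      fix x :: real assume x: "x \<ge> 0"
      have "norm (f (of_real c + of_real x * rayv e \<tau>)) \<le> C * (c + x) powr (-b)"
        using bd[OF ray_in_wedge[of c \<tau> \<tau>' e x]] x c tau e by auto
      thus "norm (f (of_real c + of_real x * rayv e \<tau>)) \<le> (C * c powr (-b)) * (1 + x) powr (-b)"
        using powr_bd[OF x] by linarith
    qed
    from integral_halfline_LIMSEQ[OF this Xlim] show ?thesis unfolding A .
  qed
  have B: "contour_integral (linepath (of_real c) (of_real (X N))) f = integral {0..X N - c} (\<lambda>x. f (of_real (c + x)))" for N
    using contour_integral_linepath_ray[of "X N - c" "of_real c" 1 f] X[of N] by simp
  have Blim: "(\<lambda>N. contour_integral (linepath (of_real c) (of_real (X N))) f) \<longlonglongrightarrow> (\<integral>x. f (of_real (c + x)) \<partial>halfline)"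
  proof -
    have "integrable halfline (\<lambda>x. f (of_real (c + x)))"
    proof (rule integrable_halfline_bound)
      show "continuous_on {0<..} (\<lambda>x. f (of_real (c + x)))"
        by (rule continuous_on_compose2[OF cont]) (use inw c in \<open>auto intro!: continuous_intros simp del: of_real_add\<close>)
      show "integrable halfline (\<lambda>x. (C * c powr (-b)) * (1 + x) powr (-b))"
        by (intro integrable_mult_right integrable_one_plus_powr b)
      fix x :: real assume x: "x > 0"
      have "norm (f (of_real (c + x))) \<le> C * (c + x) powr (-b)"
        using bd[OF inw, of "c + x"] x c by simp
      thus "norm (f (of_real (c + x))) \<le> (C * c powr (-b)) * (1 + x) powr (-b)"
        using powr_bd[of x] x by linarith
    qed
    from integral_halfline_LIMSEQ[OF this Xlim] show ?thesis unfolding B .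
  qed
  have Rlim: "(\<lambda>N. contour_integral (linepath (of_real (X N)) (P N e)) (\<lambda>t. f t * pkern e t)) \<longlonglongrightarrow> 0"
    if e: "unit_sign e" for e
  proof (rule Lim_null_comparison)
    show "eventually (\<lambda>N. norm (contour_integral (linepath (of_real (X N)) (P N e)) (\<lambda>t. f t * pkern e t)) \<le> C * \<tau> * X N powr (1 - b)) sequentially"
    proof (rule always_eventually, rule allI)
      fix N
      have seg: "Re t = X N \<and> e * Im t \<ge> 0 \<and> e * Im t \<le> \<tau> * (X N - c)"
        if t: "t \<in> closed_segment (of_real (X N)) (P N e)" for t
      proof -
        from t obtain u where u: "0 \<le> u" "u \<le> 1" "t = (1 - u) *\<^sub>R of_real (X N) + u *\<^sub>R P N e"
          by (auto simp: closed_segment_def)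
        have "e * Im t = u * (\<tau> * (X N - c))" using u e by (auto simp: P_def)
        moreover have "\<tau> * (X N - c) \<ge> 0" using tau X[of N] by simp
        moreover have "Re t = (1 - u) * X N + u * X N" using u(3) by (simp add: P_def)
        hence "Re t = X N" by (simp add: algebra_simps)
        ultimately show ?thesis using u(1,2) by (simp add: mult_left_le_one_le)
      qed
      have inW: "t \<in> wedge \<tau>'" if "t \<in> closed_segment (of_real (X N)) (P N e)" for t
      proof -
        have "\<bar>Im t\<bar> \<le> \<tau> * (X N - c)" using seg[OF that] e by auto
        also have "\<dots> < \<tau> * X N" using tau c by simp
        also have "\<dots> < \<tau>' * X N" using tau c X[of N] by simp
        finally show ?thesis using seg[OF that] by (simp add: wedge_def)
      qed
      have noZ: "t \<notin> \<int>" if "t \<in> closed_segment (of_real (X N)) (P N e)" for t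
      proof
        assume "t \<in> \<int>"
        then obtain n where n: "t = of_int n" by (elim Ints_cases)
        hence "real_of_int n = real (Suc N) + 1 / 2" using seg[OF that] by (simp add: X_def)
        hence "real_of_int (2 * n) = real_of_int (2 * int (Suc N) + 1)" by simp
        hence "2 * n = 2 * int (Suc N) + 1" by (subst (asm) of_int_eq_iff)
        thus False by presburger
      qed
      have "norm (contour_integral (linepath (of_real (X N)) (P N e)) (\<lambda>t. f t * pkern e t)) \<le> (C * X N powr (-b)) * norm (P N e - of_real (X N))"
      proof (rule contour_integral_bound_linepath)
        show "(\<lambda>t. f t * pkern e t) contour_integrable_on linepath (of_real (X N)) (P N e)"
          by (intro contour_integrable_continuous_linepath continuous_intros continuous_on_subset[OF cont] continuous_on_pkern[OF e])
             (use inW noZ in auto)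
        fix t assume t: "t \<in> closed_segment (of_real (X N)) (P N e)"
        have "norm (f t) \<le> C * X N powr (-b)" using bd[OF inW[OF t]] seg[OF t] X[of N] by simp
        moreover have "norm (pkern e t) \<le> 1" using seg[OF t] by (intro norm_pkern_half_int_le[OF e, of _ "Suc N"]) (auto simp: X_def)
        ultimately have "norm (f t) * norm (pkern e t) \<le> (C * X N powr (-b)) * 1" using C by (intro mult_mono) auto
        thus "norm (f t * pkern e t) \<le> C * X N powr (-b)" by (simp add: norm_mult)
      qed (use C in auto)
      also have "norm (P N e - of_real (X N)) = \<tau> * (X N - c)"
      proof -
        have "P N e - of_real (X N) = \<i> * of_real (e * (\<tau> * (X N - c)))" by (simp add: P_def complex_eq_iff)
        moreover have "\<tau> * (X N - c) \<ge> 0" using tau X[of N] by simp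
        ultimately show ?thesis using e by (auto simp: norm_mult simp del: of_real_mult of_real_diff)
      qed
      also have "(C * X N powr (-b)) * (\<tau> * (X N - c)) \<le> (C * X N powr (-b)) * (\<tau> * X N)"
        using C tau c by (intro mult_left_mono) auto
      also have "\<dots> = C * \<tau> * X N powr (1 - b)"
        using X[of N] c by (simp add: powr_diff powr_minus divide_simps)
      finally show "norm (contour_integral (linepath (of_real (X N)) (P N e)) (\<lambda>t. f t * pkern e t)) \<le> C * \<tau> * X N powr (1 - b)" .
    qed
    have "(\<lambda>N. X N powr (1 - b)) \<longlonglongrightarrow> 0"
      unfolding X_def using b by (intro tendsto_neg_powr) (simp, real_asymp)
    from tendsto_mult_right_zero[OF this, of "C * \<tau>"]
    show "(\<lambda>N. C * \<tau> * X N powr (1 - b)) \<longlonglongrightarrow> 0" .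
  qed
  have fin: "(\<Sum>d<Suc N. f (of_nat (Suc d))) = contour_integral (linepath (of_real c) (of_real (X N))) f
     + (\<Sum>e\<in>{1,-1}. contour_integral (linepath (of_real c) (P N e)) (\<lambda>t. f t * pkern e t)
                  - contour_integral (linepath (of_real (X N)) (P N e)) (\<lambda>t. f t * pkern e t))" for N
  proof -
    have "(\<Sum>d<Suc N. f (of_nat (Suc d))) = (\<Sum>d=1..Suc N. f (of_nat d))"
      by (rule sum.reindex_bij_witness[of _ "\<lambda>d. d - 1" Suc]) auto
    thus ?thesis
      using abel_plana_finite[OF hol tau c, of "X N" "Suc N"] by (simp add: X_def P_def del: sum.lessThan_Suc)
  qed
  have "(\<lambda>N. \<Sum>d<Suc N. f (of_nat (Suc d))) \<longlonglongrightarrow> (\<integral>x. f (of_real (c + x)) \<partial>halfline) + (\<Sum>e\<in>{1,-1}. (\<integral>x. g e x \<partial>halfline) - 0)"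
    unfolding fin by (intro tendsto_add tendsto_sum tendsto_diff Alim Blim Rlim) auto
  hence "(\<lambda>N. \<Sum>d<N. f (of_nat (Suc d))) \<longlonglongrightarrow> (\<integral>x. f (of_real (c + x)) \<partial>halfline) + ray_int \<tau> c f"
    by (subst (asm) filterlim_sequentially_Suc) (simp add: ray_int_def g_def[abs_def])
  thus ?thesis by (simp add: sums_def)
qed

section \<open>Continuation of the zeta function\<close>

lemma zeta_eqI:
  assumes "f holomorphic_on (- {1})"
    and "\<And>s. Re s > 1 \<Longrightarrow> (\<lambda>n. 1 / of_nat (Suc n) powr s) sums f s"
    and "f 1 = 0"
  shows "zeta = f"
  unfolding zeta_def
proof (rule the_equality)
  fix g :: "complex \<Rightarrow> complex"
  assume g: "g holomorphic_on (- {1}) \<and> (\<forall>s. Re s > 1 \<longrightarrow> (\<lambda>n. 1 / of_nat (Suc n) powr s) sums g s) \<and> g 1 = 0"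
  show "g = f"
  proof
    fix s
    show "g s = f s"
    proof (cases "s = 1")
      case False
      show ?thesis
      proof (rule analytic_continuation_open[of "{s. Re s > 1}" "- {1}" g f])
        show "open {s. Re s > 1}" by (rule open_halfspace_Re_gt)
        show "open (- {1::complex})" by (simp add: open_Compl)
        show "{s. Re s > 1} \<noteq> {}" by (auto intro!: exI[of _ 2])
        show "connected (- {1::complex})" by (rule connected_punctured_universe) simp
        show "g z = f z" if "z \<in> {s. Re s > 1}" for z
          using that g assms(2) by (auto intro: sums_unique2)
      qed (use g assms False in auto)
    qed (use g assms in auto)
  qed
qed (use assms in auto)

lemma powr_le_powr_abs:
  fixes y p P :: real
  assumes "y > 0" "\<bar>p\<bar> \<le> P"
  shows "y powr p \<le> y powr P + y powr (-P)"
proof (cases "y \<ge> 1")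
  case True
  have "y powr p \<le> y powr P" using True assms by (intro powr_mono) auto
  thus ?thesis by (simp add: add_increasing2)
next
  case False
  have "y powr p \<le> y powr (-P)" using False assms by (intro powr_mono') auto
  thus ?thesis by (simp add: add_increasing)
qed

lemma norm_ray_le: "x \<ge> 0 \<Longrightarrow> c \<ge> 0 \<Longrightarrow> c \<le> 1 \<Longrightarrow> norm (of_real c + of_real x * rayv e \<tau>) \<le> (1 + norm (rayv e \<tau>)) * (1 + x)"
proof -
  assume "x \<ge> 0" "c \<ge> 0" "c \<le> 1"
  have "norm (of_real c + of_real x * rayv e \<tau>) \<le> c + x * norm (rayv e \<tau>)"
    using \<open>x \<ge> 0\<close> \<open>c \<ge> 0\<close> by (intro order.trans[OF norm_triangle_ineq]) (simp add: norm_mult)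
  also have "\<dots> \<le> 1 + x * norm (rayv e \<tau>) + (norm (rayv e \<tau>) + x)" using \<open>x \<ge> 0\<close> \<open>c \<le> 1\<close> norm_ge_zero[of "rayv e \<tau>"] by linarith
  finally show ?thesis by (simp add: algebra_simps)
qed

lemma Re_ray_le_norm: "c + x \<le> norm (of_real c + of_real x * rayv e \<tau>)"
  using complex_Re_le_cmod[of "of_real c + of_real x * rayv e \<tau>"] by simp

lemma ray_nonzero: "c \<ge> 0 \<Longrightarrow> x \<ge> 0 \<Longrightarrow> c + x > 0 \<Longrightarrow> of_real c + of_real x * rayv e \<tau> \<noteq> 0"
  using Re_ray_le_norm[of c x e \<tau>] by auto

lemma holomorphic_on_powr_wedge: "0 < \<tau> \<Longrightarrow> (\<lambda>t. t powr s) holomorphic_on (wedge \<tau>)"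
proof -
  assume tau: "0 < \<tau>"
  have "t \<notin> \<real>\<^sub>\<le>\<^sub>0" if "t \<in> wedge \<tau>" for t
  proof -
    have "0 < \<tau> * Re t" using that by (auto simp: wedge_def)
    hence "Re t > 0" using tau by (simp add: zero_less_mult_iff)
    thus ?thesis by (auto simp: complex_nonpos_Reals_iff)
  qed
  thus ?thesis by (intro holomorphic_intros) auto
qed

lemma continuous_on_powr_wedge: "0 < \<tau> \<Longrightarrow> continuous_on (wedge \<tau>) (\<lambda>t. t powr s)"
  by (intro holomorphic_on_imp_continuous_on holomorphic_on_powr_wedge)

lemma holomorphic_powr_exponent: "(\<lambda>s. a powr g s) holomorphic_on S" if "g holomorphic_on S" for a :: complex
  using that by (cases "a = 0") (auto simp: powr_def intro!: holomorphic_intros)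

text \<open>The decay of \<open>pkern\<close> absorbs every power of t at infinity, and
  \<open>c > 0\<close> keeps t away from 0, so the exponent is unrestricted.\<close>

lemma holomorphic_ray_int_powr:
  assumes c: "0 < c" "c < 1" and tau: "0 < \<tau>"
  shows "(\<lambda>s. ray_int \<tau> c (\<lambda>t. t powr (-s))) holomorphic_on UNIV"
  unfolding ray_int_def
proof (rule holomorphic_on_sum, rule holomorphic_on_integral_halfline)
  fix e :: real assume "e \<in> {1, -1}"
  hence e: "unit_sign e" by auto
  have cont: "continuous_on {0..} (\<lambda>x. (of_real c + of_real x * rayv e \<tau>) powr (-s) * pkern e (of_real c + of_real x * rayv e \<tau>) * rayv e \<tau>)" for s
    using tau by (intro continuous_on_ray_integrand[OF c tau _ e, of "2 * \<tau>"] continuous_on_powr_wedge) auto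
  show "continuous_on {0<..} (\<lambda>x. (of_real c + of_real x * rayv e \<tau>) powr (-s) * pkern e (of_real c + of_real x * rayv e \<tau>) * rayv e \<tau>)" for s
    by (rule continuous_on_subset[OF cont]) auto
  show "(\<lambda>s. (of_real c + of_real x * rayv e \<tau>) powr (-s) * pkern e (of_real c + of_real x * rayv e \<tau>) * rayv e \<tau>) holomorphic_on UNIV" for x
    by (intro holomorphic_intros holomorphic_powr_exponent)
  fix s0 :: complex
  define P where "P = \<bar>Re s0\<bar> + 1"
  define Q where "Q = exp (pi * (\<bar>Im s0\<bar> + 1))"
  define V where "V = 1 + norm (rayv e \<tau>)"
  obtain M where M: "M > 0" "\<And>x. x \<ge> 0 \<Longrightarrow> norm (pkern e (of_real c + of_real x * rayv e \<tau>)) \<le> M * exp (- (2 * pi * \<tau>) * x)"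
    using pkern_ray_bound[OF c tau e] by blast
  obtain K where K: "K > 0" "\<And>x. x \<ge> 0 \<Longrightarrow> (1 + x) powr P \<le> K * exp (pi * \<tau> * x)"
    using powr_le_exp_bound[of "pi * \<tau>" P] tau by auto
  define L where "L = (V powr P + c powr (-P)) * K * Q * M * norm (rayv e \<tau>)"
  have V: "V > 0" by (simp add: V_def add_pos_nonneg)
  have bd: "norm ((of_real c + of_real x * rayv e \<tau>) powr (-s) * pkern e (of_real c + of_real x * rayv e \<tau>) * rayv e \<tau>) \<le> L * exp (- (pi * \<tau>) * x)"
    if s: "s \<in> ball s0 1" and x: "x > 0" for s x
  proof -
    let ?t = "of_real c + of_real x * rayv e \<tau>"
    have nz: "?t \<noteq> 0" using ray_nonzero[of c x] c x by auto
    have "\<bar>Re (s - s0)\<bar> \<le> norm (s - s0)" "\<bar>Im (s - s0)\<bar> \<le> norm (s - s0)" "norm (s - s0) < 1"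
      using s abs_Re_le_cmod[of "s - s0"] abs_Im_le_cmod[of "s - s0"] by (auto simp: dist_norm norm_minus_commute)
    hence sP: "\<bar>Re (-s)\<bar> \<le> P" "\<bar>Im (-s)\<bar> \<le> \<bar>Im s0\<bar> + 1" by (auto simp: P_def)
    have "norm (?t powr (-s)) \<le> norm ?t powr Re (-s) * exp (pi * \<bar>Im (-s)\<bar>)"
      by (rule norm_powr_complex_bounds[OF nz])
    also have "\<dots> \<le> ((V powr P + c powr (-P)) * (K * exp (pi * \<tau> * x))) * Q"
    proof (intro mult_mono)
      have "norm ?t powr Re (-s) \<le> norm ?t powr P + norm ?t powr (-P)"
        using nz sP by (intro powr_le_powr_abs) auto
      also have "norm ?t powr P \<le> (V * (1 + x)) powr P"
        unfolding V_def using c x P_def by (intro powr_mono2 norm_ray_le) auto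
      also have "\<dots> = V powr P * (1 + x) powr P" using V x by (simp add: powr_mult)
      also have "norm ?t powr (-P) \<le> c powr (-P) * (1 + x) powr P"
      proof -
        have "norm ?t powr (-P) \<le> c powr (-P)"
          using c x Re_ray_le_norm[of c x e \<tau>] by (intro powr_mono2') (auto simp: P_def)
        also have "\<dots> \<le> c powr (-P) * (1 + x) powr P"
        proof -
          have "1 \<le> (1 + x) powr P" using x by (intro ge_one_powr_ge_zero) (auto simp: P_def)
          from mult_left_mono[OF this, of "c powr (-P)"] show ?thesis by simp
        qed
        finally show ?thesis .
      qed
      finally have "norm ?t powr Re (-s) \<le> (V powr P + c powr (-P)) * (1 + x) powr P"
        by (simp add: algebra_simps)
      also have "\<dots> \<le> (V powr P + c powr (-P)) * (K * exp (pi * \<tau> * x))"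
        using x by (intro mult_left_mono K) auto
      finally show "norm ?t powr Re (-s) \<le> (V powr P + c powr (-P)) * (K * exp (pi * \<tau> * x))" .
      show "exp (pi * \<bar>Im (-s)\<bar>) \<le> Q" using sP by (simp add: Q_def)
    qed (use K in \<open>auto intro!: mult_nonneg_nonneg add_nonneg_nonneg\<close>)
    finally have 1: "norm (?t powr (-s)) \<le> ((V powr P + c powr (-P)) * (K * exp (pi * \<tau> * x))) * Q" .
    have "norm (?t powr (-s)) * norm (pkern e ?t) \<le> (((V powr P + c powr (-P)) * (K * exp (pi * \<tau> * x))) * Q) * (M * exp (- (2 * pi * \<tau>) * x))"
      using K x by (intro mult_mono 1 M) (auto intro!: mult_nonneg_nonneg add_nonneg_nonneg simp: Q_def)
    also have "\<dots> = (V powr P + c powr (-P)) * K * Q * M * exp (pi * \<tau> * x + - (2 * pi * \<tau>) * x)"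
      by (simp only: exp_add mult_ac)
    also have "pi * \<tau> * x + - (2 * pi * \<tau>) * x = - (pi * \<tau>) * x" by (simp add: algebra_simps)
    finally show ?thesis unfolding L_def norm_mult by (simp add: mult_right_mono mult_ac)
  qed
  have "integrable halfline (\<lambda>x. L * exp (- (pi * \<tau>) * x))"
    by (intro integrable_mult_right integrable_exp_halfline) (use tau in auto)
  thus "\<exists>r>0. \<exists>g. integrable halfline g \<and> (\<forall>s\<in>UNIV \<inter> ball s0 r. \<forall>x>0.
      norm ((of_real c + of_real x * rayv e \<tau>) powr (-s) * pkern e (of_real c + of_real x * rayv e \<tau>) * rayv e \<tau>) \<le> g x)"
    using bd by (intro exI[of _ 1] conjI exI[of _ "\<lambda>x. L * exp (- (pi * \<tau>) * x)"]) auto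
qed auto

lemma integral_tail_powr:
  assumes "Re s > 1" "c > 0"
  shows "(\<integral>x. of_real (c + x) powr (-s) \<partial>halfline) = of_real c powr (1 - s) / (s - 1)"
    and "integrable halfline (\<lambda>x. of_real (c + x) powr (-s))"
proof -
  \<comment> \<open>Chosen so that \<open>d * (1 + x) \<le> c + x\<close>, which compares the tail
    with a power of \<open>1 + x\<close>.\<close>
  define d where "d = min c 1"
  have d: "0 < d" "d \<le> c" "d \<le> 1" using assms by (auto simp: d_def)
  show int: "integrable halfline (\<lambda>x. of_real (c + x) powr (-s))"
  proof (rule integrable_halfline_bound)
    show "continuous_on {0<..} (\<lambda>x. complex_of_real (c + x) powr (-s))"
      using assms by (intro continuous_intros) (auto simp: complex_nonpos_Reals_iff simp del: of_real_add)
    show "integrable halfline (\<lambda>x. d powr (- Re s) * (1 + x) powr (- Re s))"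
      by (intro integrable_mult_right integrable_one_plus_powr assms)
    fix x :: real assume x: "x > 0"
    have "norm (complex_of_real (c + x) powr (-s)) = (c + x) powr (- Re s)"
      using assms x by (subst norm_powr_real_powr) auto
    also have "\<dots> \<le> (d * (1 + x)) powr (- Re s)"
    proof (intro powr_mono2')
      have "d * x \<le> 1 * x" using d x by (intro mult_right_mono) auto
      thus "d * (1 + x) \<le> c + x" using d by (simp add: algebra_simps)
    qed (use assms d x in auto)
    also have "\<dots> = d powr (- Re s) * (1 + x) powr (- Re s)" using d x by (simp add: powr_mult)
    finally show "norm (complex_of_real (c + x) powr (-s)) \<le> d powr (- Re s) * (1 + x) powr (- Re s)" .
  qed
  have s1: "1 - s \<noteq> 0" using assms by (metis eq_iff_diff_eq_0 less_irrefl one_complex.sel(1))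
  have eq: "integral {0..real n} (\<lambda>x. complex_of_real (c + x) powr (-s)) =
        of_real (c + real n) powr (1 - s) / (1 - s) - of_real (c + 0) powr (1 - s) / (1 - s)" for n
  proof (intro integral_unique fundamental_theorem_of_calculus)
    fix x assume x: "x \<in> {0..real n}"
    have nn: "complex_of_real c + complex_of_real x \<notin> \<real>\<^sub>\<le>\<^sub>0"
      using x assms by (auto simp: complex_nonpos_Reals_iff)
    have "((\<lambda>t. (of_real c + t) powr (1 - s) / (1 - s)) has_field_derivative (of_real (c + x) powr (-s))) (at (of_real x))"
      using nn s1 by (auto intro!: derivative_eq_intros simp: divide_simps)
    hence "((\<lambda>x. (of_real c + of_real x) powr (1 - s) / (1 - s)) has_vector_derivative (of_real (c + x) powr (-s))) (at x within {0..real n})"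
      by (rule has_vector_derivative_real_field)
    thus "((\<lambda>x. of_real (c + x) powr (1 - s) / (1 - s)) has_vector_derivative (of_real (c + x) powr (-s))) (at x within {0..real n})"
      by simp
  qed auto
  have lim: "(\<lambda>n. complex_of_real (c + real n) powr (1 - s)) \<longlonglongrightarrow> 0"
  proof (rule Lim_null_comparison)
    show "eventually (\<lambda>n. norm (complex_of_real (c + real n) powr (1 - s)) \<le> (c + real n) powr (1 - Re s)) sequentially"
      using assms by (intro always_eventually allI) (subst norm_powr_real_powr, auto)
    show "(\<lambda>n. (c + real n) powr (1 - Re s)) \<longlonglongrightarrow> 0"
      using assms by (intro tendsto_neg_powr) (simp, real_asymp)
  qed
  have "(\<lambda>n. integral {0..real n} (\<lambda>x. complex_of_real (c + x) powr (-s))) \<longlonglongrightarrow>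
          0 / (1 - s) - of_real (c + 0) powr (1 - s) / (1 - s)"
    unfolding eq using s1 by (intro tendsto_diff tendsto_divide lim tendsto_const) auto
  moreover have "(\<lambda>n. integral {0..real n} (\<lambda>x. complex_of_real (c + x) powr (-s))) \<longlonglongrightarrow> (\<integral>x. of_real (c + x) powr (-s) \<partial>halfline)"
    by (rule integral_halfline_LIMSEQ[OF int filterlim_real_sequentially])
  ultimately have "(\<integral>x. of_real (c + x) powr (-s) \<partial>halfline) = - (of_real c powr (1 - s) / (1 - s))"
    using LIMSEQ_unique by force
  also have "\<dots> = of_real c powr (1 - s) / (s - 1)" using s1 by (simp add: divide_simps) (simp add: algebra_simps)
  finally show "(\<integral>x. of_real (c + x) powr (-s) \<partial>halfline) = of_real c powr (1 - s) / (s - 1)" .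
qed

lemma sums_powr_ray:
  assumes c: "0 < c" "c < 1" and tau: "0 < \<tau>" and s: "Re s > 1"
  shows "(\<lambda>n. of_nat (Suc n) powr (-s)) sums (of_real c powr (1 - s) / (s - 1) + ray_int \<tau> c (\<lambda>t. t powr (-s)))"
proof -
  have "(\<lambda>d. of_nat (Suc d) powr (-s)) sums ((\<integral>x. of_real (c + x) powr (-s) \<partial>halfline) + ray_int \<tau> c (\<lambda>t. t powr (-s)))"
  proof (rule abel_plana[where \<tau>' = "2 * \<tau>" and b = "Re s" and C = "exp (pi * \<bar>Im s\<bar>)"])
    show "(\<lambda>t. t powr (-s)) holomorphic_on wedge (2 * \<tau>)" using tau by (intro holomorphic_on_powr_wedge) auto
    fix t assume t: "t \<in> wedge (2 * \<tau>)" "Re t \<ge> c"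
    hence "t \<noteq> 0" using c by auto
    hence "norm (t powr (-s)) \<le> norm t powr (- Re s) * exp (pi * \<bar>Im s\<bar>)"
      using norm_powr_complex_bounds[of t "-s"] by simp
    also have "\<dots> \<le> Re t powr (- Re s) * exp (pi * \<bar>Im s\<bar>)"
      using t c s complex_Re_le_cmod[of t] by (intro mult_right_mono powr_mono2') auto
    finally show "norm (t powr (-s)) \<le> exp (pi * \<bar>Im s\<bar>) * Re t powr (- Re s)" by (simp add: mult.commute)
  qed (use s c tau in auto)
  thus ?thesis using integral_tail_powr(1)[OF s c(1)] by simp
qed

text \<open>This is the summation formula for t^(-s): the pole sits in the elementary first term and
  the ray integrals are entire, so the right-hand side is the continuation. It is available for
  every \<open>c\<close> and \<open>\<tau>\<close>, and can therefore be inserted later on exactly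
  the rays that occur there.\<close>

theorem zeta_ray_formula:
  assumes c: "0 < c" "c < 1" and tau: "0 < \<tau>"
  shows "zeta = (\<lambda>s. if s = 1 then 0 else of_real c powr (1 - s) / (s - 1) + ray_int \<tau> c (\<lambda>t. t powr (-s)))"
proof (rule zeta_eqI)
  have "(\<lambda>s. of_real c powr (1 - s) / (s - 1) + ray_int \<tau> c (\<lambda>t. t powr (-s))) holomorphic_on (- {1})"
    by (intro holomorphic_intros holomorphic_powr_exponent holomorphic_on_subset[OF holomorphic_ray_int_powr[OF assms]]) auto
  thus "(\<lambda>s. if s = 1 then 0 else of_real c powr (1 - s) / (s - 1) + ray_int \<tau> c (\<lambda>t. t powr (-s))) holomorphic_on (- {1})"
    by (rule holomorphic_transform) auto
  fix s :: complex assume s: "Re s > 1"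
  show "(\<lambda>n. 1 / of_nat (Suc n) powr s) sums (if s = 1 then 0 else of_real c powr (1 - s) / (s - 1) + ray_int \<tau> c (\<lambda>t. t powr (-s)))"
    using s sums_powr_ray[OF c tau s] by (auto simp: powr_minus_divide)
qed auto

lemma holomorphic_zeta: "zeta holomorphic_on (- {1})"
proof -
  have "(\<lambda>s. of_real (1/2) powr (1 - s) / (s - 1) + ray_int 1 (1/2) (\<lambda>t. t powr (-s))) holomorphic_on (- {1})"
    by (intro holomorphic_intros holomorphic_powr_exponent holomorphic_on_subset[OF holomorphic_ray_int_powr]) auto
  thus ?thesis
    by (rule holomorphic_transform) (subst zeta_ray_formula[of "1/2" 1]; simp)
qed

lemma sums_zeta:
  assumes "Re s > 1"
  shows "(\<lambda>n. of_nat (Suc n) powr (-s)) sums zeta s"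
  using sums_powr_ray[of "1/2" 1 s] assms by (subst zeta_ray_formula[of "1/2" 1]) auto

section \<open>Gamma integrals and the expansion of the Planck kernel\<close>

text \<open>Several integrals below are evaluated by scaling when a parameter is real and positive.
  An interval has a limit point, so this settles complex parameters without moving a path of
  integration.\<close>

lemma analytic_continuation_reals:
  assumes "f holomorphic_on S" "g holomorphic_on S" "open S" "connected S"
    and "a < b" "\<And>x. a < x \<Longrightarrow> x < b \<Longrightarrow> of_real x \<in> S \<and> f (of_real x) = g (of_real x)" "w \<in> S"
  shows "f w = g w"
proof -
  define c where "c = (a + b) / 2"
  have c: "a < c" "c < b" using assms(5) by (auto simp: c_def)
  have "complex_of_real c islimpt (of_real ` {a<..<b})"
    unfolding islimpt_approachable
  proof (intro allI impI)
    fix e :: real assume "e > 0"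
    define d where "d = min (e / 2) ((b - c) / 2)"
    have "d > 0" "d < e" "d < b - c" using \<open>e > 0\<close> c by (auto simp: d_def min_def)
    thus "\<exists>x'\<in>of_real ` {a<..<b}. x' \<noteq> complex_of_real c \<and> dist x' (of_real c) < e"
      using c by (intro bexI[of _ "of_real (c + d)"] imageI) (auto simp: dist_norm simp flip: of_real_diff)
  qed
  moreover have "(\<lambda>z. f z - g z) holomorphic_on S" by (intro holomorphic_intros assms)
  moreover have "of_real ` {a<..<b} \<subseteq> S" "of_real c \<in> S" using assms(6) c by auto
  moreover have "f z - g z = 0" if "z \<in> of_real ` {a<..<b}" for z using assms(6) that by auto
  ultimately have "f w - g w = 0"
    using assms(3,4,7) analytic_continuation[of "\<lambda>z. f z - g z" S "of_real ` {a<..<b}" "of_real c" w] by blast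
  thus ?thesis by simp
qed

lemma integral_halfline_cong:
  fixes f g :: "real \<Rightarrow> 'a :: euclidean_space"
  shows "(\<And>x. x > 0 \<Longrightarrow> f x = g x) \<Longrightarrow> (\<integral>x. f x \<partial>halfline) = (\<integral>x. g x \<partial>halfline)"
  by (intro Bochner_Integration.integral_cong refl) auto

lemma integrable_halfline_cong:
  fixes f g :: "real \<Rightarrow> 'a :: euclidean_space"
  shows "(\<And>x. x > 0 \<Longrightarrow> f x = g x) \<Longrightarrow> integrable halfline f \<longleftrightarrow> integrable halfline g"
  by (intro Bochner_Integration.integrable_cong refl) auto

lemma norm_Gamma_integrand:
  assumes "x > 0"
  shows "norm (of_real x powr z * exp (- u * of_real x)) = x powr Re z * exp (- Re u * x)"
  using assms by (simp add: norm_mult norm_powr_real_powr)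

lemma continuous_on_Gamma_integrand:
  "continuous_on {0<..} (\<lambda>x. of_real x powr z * exp (- u * of_real x) :: complex)"
  by (intro continuous_intros) (auto simp: complex_nonpos_Reals_iff)

lemma integrable_Gamma_integrand:
  assumes "Re z > -1" "Re u > 0"
  shows "integrable halfline (\<lambda>x. of_real x powr z * exp (- u * of_real x))"
  by (rule integrable_halfline_bound[OF continuous_on_Gamma_integrand integrable_powr_exp_halfline[of "Re z" "Re u"]])
     (use assms norm_Gamma_integrand in auto)

text \<open>For real \<open>u\<close> this is a rescaling of Euler's integral. Both sides are
  holomorphic in \<open>u\<close> on the right half-plane, which replaces a rotation of the
  path.\<close>

lemma integral_Gamma_cmult:
  assumes z: "Re z > -1" and u: "Re u > 0"
  shows "(\<integral>x. of_real x powr z * exp (- u * of_real x) \<partial>halfline) = Gamma (z + 1) * u powr (- (z + 1))"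
proof -
  let ?S = "{u. Re u > 0}"
  show ?thesis
  proof (rule analytic_continuation_reals[where S = ?S and a = 0 and b = 1 and w = u
        and f = "\<lambda>u. \<integral>x. of_real x powr z * exp (- u * of_real x) \<partial>halfline"
        and g = "\<lambda>u. Gamma (z + 1) * u powr (- (z + 1))"])
    show "open ?S" by (rule open_halfspace_Re_gt)
    show "connected ?S" by (intro convex_connected convex_halfspace_Re_gt)
    show "(\<lambda>u. Gamma (z + 1) * u powr (- (z + 1))) holomorphic_on ?S"
      by (intro holomorphic_intros) (auto simp: complex_nonpos_Reals_iff)
    show "(\<lambda>u. \<integral>x. of_real x powr z * exp (- u * of_real x) \<partial>halfline) holomorphic_on ?S"
    proof (rule holomorphic_on_integral_halfline)
      fix s0 assume s0: "s0 \<in> ?S"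
      define d where "d = Re s0 / 2"
      have d: "d > 0" using s0 by (simp add: d_def)
      have "norm (of_real x powr z * exp (- s * of_real x)) \<le> x powr Re z * exp (- d * x)"
        if "s \<in> ball s0 d" "x > 0" for s x
      proof -
        have "\<bar>Re (s0 - s)\<bar> < d" using that(1) abs_Re_le_cmod[of "s0 - s"] by (auto simp: dist_norm)
        hence "d \<le> Re s" by (auto simp: d_def abs_if split: if_splits)
        hence "exp (- Re s * x) \<le> exp (- d * x)" using that by simp
        thus ?thesis using that by (subst norm_Gamma_integrand) (auto intro: mult_left_mono)
      qed
      thus "\<exists>r>0. \<exists>g. integrable halfline g \<and> (\<forall>s\<in>?S \<inter> ball s0 r. \<forall>x>0. norm (of_real x powr z * exp (- s * of_real x)) \<le> g x)"
        using d integrable_powr_exp_halfline[OF z d] by (intro exI[of _ d] conjI exI[of _ "\<lambda>x. x powr Re z * exp (- d * x)"]) auto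
    qed (rule open_halfspace_Re_gt continuous_on_Gamma_integrand | intro holomorphic_intros)+
    fix a :: real assume a: "0 < a" "a < 1"
    let ?f = "\<lambda>x. complex_of_real x powr z * exp (- of_real x)"
    have int: "integrable halfline ?f" using integrable_Gamma_integrand[OF z, of 1] by simp
    have "(\<integral>x. ?f x \<partial>halfline) = integral {0<..} ?f"
      by (rule lebesgue_integral_eq_integral[OF int]) auto
    also have "\<dots> = Gamma (z + 1)"
    proof (rule integral_unique)
      have "((\<lambda>t. of_real t powr (z + 1 - 1) / of_real (exp t)) has_integral Gamma (z + 1)) {0<..}"
        using z by (intro Gamma_integral_complex') simp
      thus "(?f has_integral Gamma (z + 1)) {0<..}"
        by (rule has_integral_cong[THEN iffD1, rotated]) (auto simp: exp_minus field_simps exp_of_real)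
    qed
    finally have *: "(\<integral>x. ?f x \<partial>halfline) = Gamma (z + 1)" .
    have "(\<integral>x. ?f (a * x) \<partial>halfline) = Gamma (z + 1) / of_real a"
      using integral_halfline_scale[OF a(1), of ?f] * by simp
    moreover have "(\<integral>x. ?f (a * x) \<partial>halfline) = (\<integral>x. of_real a powr z * (of_real x powr z * exp (- of_real a * of_real x)) \<partial>halfline)"
      using a by (intro Bochner_Integration.integral_cong refl) (auto simp: powr_times_real mult_ac)
    ultimately have "of_real a powr z * (\<integral>x. of_real x powr z * exp (- of_real a * of_real x) \<partial>halfline) = Gamma (z + 1) / of_real a"
      by simp
    hence "(\<integral>x. of_real x powr z * exp (- of_real a * of_real x) \<partial>halfline) = Gamma (z + 1) / of_real a / of_real a powr z"
      using a by (simp add: field_simps)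
    also have "\<dots> = Gamma (z + 1) * of_real a powr (- (z + 1))"
      using a by (simp add: powr_minus powr_add powr_diff field_simps)
    finally show "of_real a \<in> ?S \<and> (\<integral>x. of_real x powr z * exp (- of_real a * of_real x) \<partial>halfline) = Gamma (z + 1) * of_real a powr (- (z + 1))"
      using a by simp
  qed (use u in auto)
qed

lemma integral_halfline_power_subst:
  fixes f :: "real \<Rightarrow> complex"
  assumes k: "k \<ge> 1" and f: "integrable halfline f"
  shows "(\<integral>x. of_real (real k * x ^ (k - 1)) * f (x ^ k) \<partial>halfline) = (\<integral>x. f x \<partial>halfline)"
    and "integrable halfline (\<lambda>x. of_real (real k * x ^ (k - 1)) * f (x ^ k))"
proof -
  let ?h = "\<lambda>x::real. real k * x ^ (k - 1)"
  have im: "(\<lambda>x. x ^ k) ` {0<..} = {0::real<..}"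
  proof safe
    fix x :: real assume "x > 0"
    thus "x \<in> (\<lambda>x. x ^ k) ` {0<..}" using k by (intro image_eqI[of _ _ "root k x"]) auto
  qed auto
  have inj: "inj_on (\<lambda>x::real. x ^ k) {0<..}"
    using k by (auto simp: inj_on_def intro: power_eq_imp_eq_base)
  have fa: "f absolutely_integrable_on {0<..}"
    using f by (simp add: set_integrable_def integrable_restrict_space)
  have "(\<lambda>x. \<bar>?h x\<bar> *\<^sub>R f (x ^ k)) absolutely_integrable_on {0<..} \<and> integral {0<..} (\<lambda>x. \<bar>?h x\<bar> *\<^sub>R f (x ^ k)) = integral {0<..} f"
    using has_absolute_integral_change_of_variables_real[of "{0<..}" "\<lambda>x. x ^ k" ?h f "integral {0<..} f"] inj fa unfolding im
    by (auto intro!: derivative_eq_intros)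
  hence 1: "integrable halfline (\<lambda>x. \<bar>?h x\<bar> *\<^sub>R f (x ^ k))" "integral {0<..} (\<lambda>x. \<bar>?h x\<bar> *\<^sub>R f (x ^ k)) = integral {0<..} f"
    by (simp_all add: set_integrable_def integrable_restrict_space)
  have 2: "\<bar>?h x\<bar> *\<^sub>R f (x ^ k) = of_real (?h x) * f (x ^ k)" if "x > 0" for x
    using that by (simp add: scaleR_conv_of_real)
  show "integrable halfline (\<lambda>x. of_real (?h x) * f (x ^ k))"
    using 1(1) by (subst integrable_halfline_cong[OF 2[symmetric]])
  have "(\<integral>x. of_real (?h x) * f (x ^ k) \<partial>halfline) = (\<integral>x. \<bar>?h x\<bar> *\<^sub>R f (x ^ k) \<partial>halfline)"
    by (rule integral_halfline_cong) (rule 2[symmetric])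
  also have "\<dots> = integral {0<..} (\<lambda>x. \<bar>?h x\<bar> *\<^sub>R f (x ^ k))"
    by (rule lebesgue_integral_eq_integral[OF 1(1)]) auto
  also have "\<dots> = (\<integral>x. f x \<partial>halfline)"
    unfolding 1(2) by (rule lebesgue_integral_eq_integral[OF f, symmetric]) auto
  finally show "(\<integral>x. of_real (?h x) * f (x ^ k) \<partial>halfline) = (\<integral>x. f x \<partial>halfline)" .
qed

lemma integral_Gamma_power:
  assumes k: "k \<ge> 1" and z: "Re z > -1" and u: "Re u > 0"
  shows "(\<integral>x. of_real x powr z * exp (- u * of_real x ^ k) \<partial>halfline) =
           Gamma ((1 + z) / of_nat k) * u powr (- ((1 + z) / of_nat k)) / of_nat k" (is ?th1)
    and "integrable halfline (\<lambda>x. of_real x powr z * exp (- u * of_real x ^ k))" (is ?th2)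
proof -
  define s where "s = (1 + z) / of_nat k - 1"
  have s: "Re s > -1" using z k by (simp add: s_def field_simps)
  let ?f = "\<lambda>x. of_real x powr s * exp (- u * of_real x)"
  note sub = integral_halfline_power_subst[OF k integrable_Gamma_integrand[OF s u]]
  have eq: "of_real (real k * x ^ (k - 1)) * ?f (x ^ k) = of_nat k * (of_real x powr z * exp (- u * of_real x ^ k))" if "x > 0" for x
  proof -
    have "complex_of_real (x ^ k) powr s = of_real x powr (of_nat k * s)"
      using that by (simp add: powr_def Ln_of_real ln_realpow mult_ac flip: of_real_power)
    also have "of_nat k * s = z - of_nat (k - 1)" using k by (simp add: s_def field_simps of_nat_diff)
    also have "complex_of_real x powr \<dots> = of_real x powr z / of_real x ^ (k - 1)"
      using that by (simp add: powr_diff powr_nat')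
    finally show ?thesis using that by (simp add: field_simps)
  qed
  have "(\<integral>x. of_nat k * (of_real x powr z * exp (- u * of_real x ^ k)) \<partial>halfline) = Gamma (s + 1) * u powr (- (s + 1))"
    unfolding integral_Gamma_cmult[OF s u, symmetric] sub(1)[symmetric]
    by (rule integral_halfline_cong) (rule eq[symmetric])
  thus ?th1 using k by (simp add: s_def field_simps)
  have "integrable halfline (\<lambda>x. of_nat k * (of_real x powr z * exp (- u * of_real x ^ k)))"
    using sub(2) by (subst integrable_halfline_cong[OF eq[symmetric]])
  from integrable_mult_right[OF this, of "1 / of_nat k"] show ?th2 using k by simp
qed

text \<open>The Planck kernel in the variable x without the first two terms of its Laurent series at
  0. It vanishes at 0 and is the sum of Euler's partial fractions over the nonzero poles 2 pi i m,
  paired with their negatives.\<close>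

definition bexp :: "complex \<Rightarrow> complex" where
  "bexp x = 1 / (exp x - 1) - 1 / x + 1 / 2"

lemma exp_ne_one: "Re x > 0 \<Longrightarrow> exp x \<noteq> (1::complex)"
  by (metis exp_eq_1 less_irrefl)

text \<open>Logarithmic derivative of the reflection formula for \<open>Gamma\<close>. Together with
  the limit formula for \<open>Digamma\<close> it yields the partial fractions of the
  cotangent.\<close>

lemma Digamma_reflection:
  fixes s :: complex
  assumes "s \<notin> \<int>"
  shows "Digamma (1 - s) - Digamma s = of_real pi * cos (of_real pi * s) / sin (of_real pi * s)"
proof -
  have s1: "1 - s \<notin> \<int>"
  proof
    assume "1 - s \<in> \<int>"
    hence "1 - (1 - s) \<in> \<int>" by (intro Ints_diff) auto
    thus False using assms by simp
  qed
  have nz: "s \<notin> \<int>\<^sub>\<le>\<^sub>0" "1 - s \<notin> \<int>\<^sub>\<le>\<^sub>0" using assms s1 nonpos_Ints_subset_Ints by auto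
  have sn: "sin (of_real pi * s) \<noteq> 0"
    using assms sin_eq_0[of "of_real pi * s"] by (auto simp: mult.commute)
  have "((\<lambda>s. Gamma s * Gamma (1 - s)) has_field_derivative
          (Gamma s * Digamma s * Gamma (1 - s) - Gamma s * (Gamma (1 - s) * Digamma (1 - s)))) (at s)"
    using nz by (auto intro!: derivative_eq_intros)
  moreover have "((\<lambda>s. Gamma s * Gamma (1 - s)) has_field_derivative
          (- (of_real pi * (cos (of_real pi * s) * of_real pi)) / (sin (of_real pi * s))\<^sup>2)) (at s)"
    unfolding Gamma_reflection_complex using sn
    by (auto intro!: derivative_eq_intros simp: power2_eq_square)
  ultimately have "Gamma s * Digamma s * Gamma (1 - s) - Gamma s * (Gamma (1 - s) * Digamma (1 - s)) =
       - (of_real pi * (cos (of_real pi * s) * of_real pi)) / (sin (of_real pi * s))\<^sup>2"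
    by (rule DERIV_unique)
  hence "(Gamma s * Gamma (1 - s)) * (Digamma (1 - s) - Digamma s) =
       (of_real pi * (cos (of_real pi * s) * of_real pi)) / (sin (of_real pi * s))\<^sup>2"
    by (simp add: algebra_simps minus_equation_iff eq_neg_iff_add_eq_0 add_eq_0_iff)
  moreover define C S p D where "C = cos (of_real pi * s)" and "S = sin (of_real pi * s)" and "p = complex_of_real pi" and "D = Digamma (1 - s) - Digamma s"
  ultimately have "p / S * D = p * (C * p) / S\<^sup>2" by (simp add: Gamma_reflection_complex)
  moreover have "S \<noteq> 0" "p \<noteq> 0" using sn by (simp_all add: S_def p_def)
  ultimately have "D = p * C / S" by (simp add: divide_simps power2_eq_square)
  thus ?thesis by (simp add: C_def S_def p_def D_def)
qed

lemma sums_bexp: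
  assumes x: "Re x > 0"
  shows "(\<lambda>m. 2 * x / (x ^ 2 + (2 * of_real pi * of_nat (Suc m)) ^ 2)) sums bexp x"
proof -
  \<comment> \<open>This carries the poles 2 pi i m of \<open>bexp\<close> to the integers, so that
    the claim becomes the cotangent series at \<open>pi * s\<close>.\<close>
  define s where "s = \<i> * x / (2 * of_real pi)"
  have xs: "x = - (2 * \<i> * of_real pi * s)" by (simp add: s_def)
  have Ims: "Im s > 0" using x by (simp add: s_def)
  have sZ: "s + of_int n \<notin> \<int>" "of_int n - s \<notin> \<int>" "s + of_int n \<noteq> 0" "of_int n - s \<noteq> 0" for n
    using Ims by (auto simp: complex_eq_iff elim!: Ints_cases)
  have sZ': "s \<notin> \<int>" "s \<noteq> 0" using sZ(1)[of 0] sZ(3)[of 0] by auto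
  have nz: "1 - s \<noteq> 0" "1 + s \<noteq> 0" using sZ(4)[of 1] sZ(3)[of 1] by (auto simp: add.commute)
  \<comment> \<open>The \<open>ln\<close> terms of the two limits cancel, and what remains are the
    partial sums of a convergent series.\<close>
  have "(\<lambda>m. (of_real (ln (real m)) - (\<Sum>n<m. inverse (1 - s + of_nat n))) - (of_real (ln (real m)) - (\<Sum>n<m. inverse (1 + s + of_nat n))))
          \<longlonglongrightarrow> Digamma (1 - s) - Digamma (1 + s)"
    by (intro tendsto_diff Digamma_LIMSEQ nz)
  hence "(\<lambda>n. inverse (1 + s + of_nat n) - inverse (1 - s + of_nat n)) sums (Digamma (1 - s) - Digamma (1 + s))"
    by (simp add: sums_def sum_subtractf)
  also have "Digamma (1 + s) = Digamma s + 1 / s" using Digamma_plus1[OF sZ'(2)] by (simp add: add.commute)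
  also have "Digamma (1 - s) - (Digamma s + 1 / s) = of_real pi * cos (of_real pi * s) / sin (of_real pi * s) - 1 / s"
    using Digamma_reflection[OF sZ'(1)] by (simp add: algebra_simps)
  finally have S: "(\<lambda>n. inverse (1 + s + of_nat n) - inverse (1 - s + of_nat n)) sums (of_real pi * cos (of_real pi * s) / sin (of_real pi * s) - 1 / s)" .
  define q where "q = exp (\<i> * of_real pi * s)"
  have q0: "q \<noteq> 0" by (simp add: q_def)
  have q2: "q ^ 2 = exp (- x)" by (simp add: q_def xs exp_double[symmetric] mult_ac)
  have q1: "q ^ 2 \<noteq> 1" using exp_ne_one[OF x] unfolding q2 by (simp add: exp_minus)
  have ex: "exp x = 1 / q ^ 2" unfolding q2 by (simp add: exp_minus field_simps)
  have c: "cos (of_real pi * s) = (q + 1 / q) / 2"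
    by (simp add: cos_exp_eq q_def exp_minus field_simps)
  have sn: "sin (of_real pi * s) = (q - 1 / q) / (2 * \<i>)"
    by (simp add: sin_exp_eq q_def exp_minus field_simps)
  have cot: "of_real pi * cos (of_real pi * s) / sin (of_real pi * s) = of_real pi * \<i> * (q ^ 2 + 1) / (q ^ 2 - 1)"
    unfolding c sn using q0 q1 by (simp add: divide_simps power2_eq_square; simp add: algebra_simps)
  have i2: "\<i> / (2 * of_real pi) * (of_real pi * cos (of_real pi * s) / sin (of_real pi * s) - 1 / s) = bexp x"
  proof -
    have "\<i> / (2 * of_real pi) * (of_real pi * \<i> * (q ^ 2 + 1) / (q ^ 2 - 1)) = (q ^ 2 + 1) / (2 * (1 - q ^ 2))"
      using q1 by (simp add: divide_simps; simp add: algebra_simps)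
    moreover have "\<i> / (2 * of_real pi) * (1 / s) = 1 / x"
      using sZ'(2) by (simp add: xs field_simps)
    moreover have "(q ^ 2 + 1) / (2 * (1 - q ^ 2)) = 1 / (exp x - 1) + 1 / 2"
    proof -
      have "1 / (exp x - 1) = q ^ 2 / (1 - q ^ 2)" unfolding ex using q0 q1 by (simp add: divide_simps)
      moreover have "q ^ 2 / (1 - q ^ 2) + 1 / 2 = (q ^ 2 + 1) / (2 * (1 - q ^ 2))"
        using q1 by (simp add: divide_simps)
      ultimately show ?thesis by simp
    qed
    ultimately show ?thesis unfolding cot bexp_def by (simp add: right_diff_distrib)
  qed
  have "\<i> / (2 * of_real pi) * (inverse (1 + s + of_nat n) - inverse (1 - s + of_nat n)) = 2 * x / (x ^ 2 + (2 * of_real pi * of_nat (Suc n)) ^ 2)" for n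
  proof -
    have a: "1 + s + of_nat n \<noteq> 0" "1 - s + of_nat n \<noteq> 0"
      using sZ(3)[of "int (Suc n)"] sZ(4)[of "int (Suc n)"] by (auto simp: algebra_simps)
    have "inverse (1 + s + of_nat n) - inverse (1 - s + of_nat n) = - (2 * s) / ((1 + s + of_nat n) * (1 - s + of_nat n))"
      using a by (simp add: field_simps)
    moreover have "x ^ 2 + (2 * of_real pi * of_nat (Suc n)) ^ 2 = (2 * of_real pi)\<^sup>2 * ((1 + s + of_nat n) * (1 - s + of_nat n))"
      by (simp add: xs power2_eq_square algebra_simps)
    ultimately show ?thesis using a
      by (simp add: xs power2_eq_square divide_simps)
  qed
  thus ?thesis using sums_mult[OF S, of "\<i> / (2 * of_real pi)"] unfolding i2 by simp
qed

text \<open>The imaginary part of \<open>(x + \<i> * of_real y) * cnj x\<close> is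
  \<open>y * Re x\<close>. The lemma makes quantitative that a sector around the positive axis stays
  away from poles on the imaginary axis.\<close>

lemma norm_add_imaginary_ge:
  assumes "Re x \<ge> \<kappa> * norm x" "x \<noteq> 0"
  shows "norm (x + \<i> * of_real y) \<ge> \<kappa> * \<bar>y\<bar>"
proof -
  have "Im ((x + \<i> * of_real y) * cnj x) = y * Re x" by (simp add: algebra_simps)
  hence "\<bar>y * Re x\<bar> \<le> norm ((x + \<i> * of_real y) * cnj x)" by (metis abs_Im_le_cmod)
  hence "\<bar>y\<bar> * \<bar>Re x\<bar> \<le> norm (x + \<i> * of_real y) * norm x" by (simp add: norm_mult abs_mult)
  moreover have "\<bar>y\<bar> * (\<kappa> * norm x) \<le> \<bar>y\<bar> * \<bar>Re x\<bar>" using assms by (intro mult_left_mono) auto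
  ultimately have "(\<kappa> * \<bar>y\<bar>) * norm x \<le> norm (x + \<i> * of_real y) * norm x" by (simp add: mult_ac)
  thus ?thesis using assms by simp
qed

lemma norm_square_add_square_ge:
  assumes "Re x \<ge> \<kappa> * norm x" "x \<noteq> 0" "\<kappa> \<ge> 0"
  shows "norm (x ^ 2 + of_real y ^ 2) \<ge> \<kappa>\<^sup>2 * y\<^sup>2"
proof -
  have "x ^ 2 + of_real y ^ 2 = (x + \<i> * of_real y) * (x + \<i> * of_real (- y))"
    by (simp add: algebra_simps power2_eq_square)
  moreover have "(\<kappa> * \<bar>y\<bar>) * (\<kappa> * \<bar>- y\<bar>) \<le> norm (x + \<i> * of_real y) * norm (x + \<i> * of_real (- y))"
    using assms by (intro mult_mono norm_add_imaginary_ge) auto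
  ultimately show ?thesis by (simp add: norm_mult power2_eq_square mult_ac)
qed

definition bterm :: "complex \<Rightarrow> nat \<Rightarrow> complex" where
  "bterm x m = 2 * x / (x ^ 2 + (2 * of_real pi * of_nat (Suc m)) ^ 2)"

lemma norm_bterm_le:
  assumes "Re x \<ge> \<kappa> * norm x" "\<kappa> > 0"
  shows "norm (bterm x m) \<le> norm x / \<kappa>\<^sup>2 * (1 / real (Suc m) ^ 2)"
proof (cases "x = 0")
  case False
  let ?y = "2 * pi * real (Suc m)"
  have "\<kappa>\<^sup>2 * ?y\<^sup>2 \<le> norm (x ^ 2 + (2 * of_real pi * of_nat (Suc m)) ^ 2)"
    using norm_square_add_square_ge[OF assms(1) False, of ?y] assms by simp
  moreover have "\<kappa>\<^sup>2 * (2 * real (Suc m) ^ 2) \<le> \<kappa>\<^sup>2 * ?y\<^sup>2"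
  proof (intro mult_left_mono)
    have "2 \<le> pi * pi" using pi_ge_two mult_mono[of 2 pi 1 pi] by simp
    hence "2 * real (Suc m) ^ 2 \<le> (4 * (pi * pi)) * real (Suc m) ^ 2" by (intro mult_right_mono) auto
    thus "2 * real (Suc m) ^ 2 \<le> ?y\<^sup>2" by (simp add: power2_eq_square algebra_simps)
  qed auto
  ultimately have "\<kappa>\<^sup>2 * (2 * real (Suc m) ^ 2) \<le> norm (x ^ 2 + (2 * of_real pi * of_nat (Suc m)) ^ 2)"
    by (rule order.trans[rotated])
  hence "norm (bterm x m) \<le> 2 * norm x / (\<kappa>\<^sup>2 * (2 * real (Suc m) ^ 2))"
    using assms unfolding bterm_def norm_divide norm_mult
    by (intro frac_le) (auto intro!: mult_pos_pos)
  thus ?thesis by simp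
qed (auto simp: bterm_def)

lemma summable_inverse_squares: "summable (\<lambda>m. 1 / real (Suc m) ^ 2)"
  using inverse_squares_sums by (auto simp: summable_def add.commute)

text \<open>Every term of Euler's series carries the factor x, hence the linear bound. This zero at
  0 is what later compensates the pole of \<open>pkern\<close> at the apex of the rays.\<close>

lemma norm_bexp_le:
  assumes "Re x \<ge> \<kappa> * norm x" "\<kappa> > 0" "x \<noteq> 0"
  shows "norm (bexp x) \<le> norm x * ((\<Sum>m. 1 / real (Suc m) ^ 2) / \<kappa>\<^sup>2)"
proof -
  have "Re x > 0" using assms by (smt (verit) mult_pos_pos zero_less_norm_iff)
  hence S: "bterm x sums bexp x" using sums_bexp by (simp add: bterm_def[abs_def])
  have sm: "summable (\<lambda>m. norm x / \<kappa>\<^sup>2 * (1 / real (Suc m) ^ 2))"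
    by (intro summable_mult summable_inverse_squares)
  have "norm (suminf (bterm x)) \<le> (\<Sum>m. norm x / \<kappa>\<^sup>2 * (1 / real (Suc m) ^ 2))"
    by (rule norm_suminf_le[OF norm_bterm_le[OF assms(1,2)] sm])
  also have "\<dots> = norm x / \<kappa>\<^sup>2 * (\<Sum>m. 1 / real (Suc m) ^ 2)"
    by (rule suminf_mult[OF summable_inverse_squares])
  finally show ?thesis using sums_unique[OF S] by simp
qed

section \<open>The Lambert series\<close>

text \<open>A series is an integral over counting measure, so a local majorant of the terms is
  enough and their derivatives need no separate estimate.\<close>

lemma holomorphic_on_suminf_Mtest:
  fixes f :: "nat \<Rightarrow> complex \<Rightarrow> complex"
  assumes S: "open S" and hol: "\<And>n. f n holomorphic_on S"
    and bound: "\<And>s0. s0 \<in> S \<Longrightarrow> \<exists>r>0. \<exists>g. summable g \<and> (\<forall>s\<in>S \<inter> ball s0 r. \<forall>n. norm (f n s) \<le> g n)"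
  shows "(\<lambda>s. \<Sum>n. f n s) holomorphic_on S"
proof -
  have "(\<lambda>s. \<integral>n. f n s \<partial>count_space UNIV) holomorphic_on S"
  proof (rule holomorphic_on_integral[OF S])
    fix s0 assume s0: "s0 \<in> S"
    obtain r g where rg: "r > 0" "summable g" "\<forall>s\<in>S \<inter> ball s0 r. \<forall>n. norm (f n s) \<le> g n"
      using bound[OF s0] by blast
    have "0 \<le> g n" for n using rg(1,3) s0 order.trans[OF norm_ge_zero] by (metis IntI centre_in_ball)
    hence "integrable (count_space UNIV) g"
      unfolding integrable_count_space_nat_iff using rg(2) by simp
    thus "\<exists>r>0. \<exists>g. integrable (count_space UNIV) g \<and> (\<forall>s\<in>S \<inter> ball s0 r. \<forall>x\<in>space (count_space UNIV). norm (f x s) \<le> g x)"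
      using rg by auto
  qed (auto intro: hol)
  thus ?thesis
  proof (rule holomorphic_transform)
    fix s0 assume s0: "s0 \<in> S"
    obtain r g where rg: "r > 0" "summable g" "\<forall>s\<in>S \<inter> ball s0 r. \<forall>n. norm (f n s) \<le> g n"
      using bound[OF s0] by blast
    have "summable (\<lambda>n. norm (f n s0))"
      by (rule summable_comparison_test'[OF rg(2), of 0]) (use rg s0 in auto)
    thus "(\<integral>n. f n s0 \<partial>count_space UNIV) = (\<Sum>n. f n s0)"
      by (intro integral_count_space_nat) (simp add: integrable_count_space_nat_iff)
  qed
qed

lemma powr_of_real_mult:
  fixes w s :: complex
  assumes "r > 0" "w \<noteq> 0"
  shows "(of_real r * w) powr s = of_real r powr s * w powr s"
  using assms by (simp add: powr_def Ln_times_of_real Ln_of_real exp_add distrib_left)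

lemma integral_01_powr:
  assumes "Re p > -1"
  shows "integrable halfline (\<lambda>t. indicat_real {..1} t *\<^sub>R of_real t powr p)"
    and "(\<integral>t. indicat_real {..1} t *\<^sub>R complex_of_real t powr p \<partial>halfline) = 1 / (p + 1)"
proof -
  let ?M = "halfline"
  have p1: "p + 1 \<noteq> 0" using assms by (auto simp: complex_eq_iff)
  have meas: "(\<lambda>t. complex_of_real t powr p) \<in> borel_measurable ?M"
    by (intro continuous_imp_measurable_on_sets_lebesgue continuous_intros) (auto simp: complex_nonpos_Reals_iff)
  show int: "integrable ?M (\<lambda>t. indicat_real {..1} t *\<^sub>R complex_of_real t powr p)"
  proof (rule Bochner_Integration.integrable_bound)
    show "integrable ?M (\<lambda>t. exp 1 * (t powr Re p * exp (-1 * t)))"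
      by (intro integrable_mult_right integrable_powr_exp_halfline assms) auto
    show "(\<lambda>t. indicat_real {..1} t *\<^sub>R complex_of_real t powr p) \<in> borel_measurable ?M"
      by (intro borel_measurable_scaleR borel_measurable_indicator' measurable_restrict_space1 meas) auto
    show "AE t in ?M. norm (indicat_real {..1} t *\<^sub>R complex_of_real t powr p) \<le> norm (exp 1 * (t powr Re p * exp (-1 * t)))"
    proof (rule AE_I2)
      fix t assume "t \<in> space ?M"
      hence t: "t > 0" by simp
      show "norm (indicat_real {..1} t *\<^sub>R complex_of_real t powr p) \<le> norm (exp 1 * (t powr Re p * exp (-1 * t)))"
      proof (cases "t \<le> 1")
        case True
        have "exp 1 * (t powr Re p * exp (-1 * t)) = t powr Re p * exp (1 - t)" by (simp add: exp_diff exp_minus field_simps)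
        moreover have "t powr Re p * 1 \<le> t powr Re p * exp (1 - t)" using True by (intro mult_left_mono) auto
        ultimately show ?thesis using t True by (simp add: norm_powr_real_powr)
      qed auto
    qed
  qed
  have "(\<integral>t. indicat_real {..1} t *\<^sub>R complex_of_real t powr p \<partial>?M) = integral {0<..} (\<lambda>t. indicat_real {..1} t *\<^sub>R complex_of_real t powr p)"
    by (rule lebesgue_integral_eq_integral[OF int]) auto
  also have "\<dots> = integral {0<..} (\<lambda>t. if t \<in> {0<..1} then complex_of_real t powr p else 0)"
    by (rule integral_cong) (auto simp: indicator_def)
  also have "\<dots> = integral {0<..1} (\<lambda>t. complex_of_real t powr p)"
  proof -
    have "{0<..1} \<inter> {0<..} = {0<..1::real}" by auto
    thus ?thesis using integral_restrict_Int[of "{0<..}" "{0<..1}" "\<lambda>t. complex_of_real t powr p"] by simp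
  qed
  also have "\<dots> = integral {0..1} (\<lambda>t. complex_of_real t powr p)"
    by (rule integral_spike_set; rule negligible_subset[of "{0}"]; force)
  also have "\<dots> = of_real 1 powr (p + 1) / (p + 1) - of_real 0 powr (p + 1) / (p + 1)"
  proof (intro integral_unique fundamental_theorem_of_calculus_interior)
    show "continuous_on {0..1} (\<lambda>t. complex_of_real t powr (p + 1) / (p + 1))"
      using assms p1 by (intro continuous_intros) auto
    fix t :: real assume t: "t \<in> {0<..<1}"
    have "((\<lambda>t. t powr (p + 1) / (p + 1)) has_field_derivative (of_real t powr p)) (at (of_real t))"
      using t p1 by (auto intro!: derivative_eq_intros simp: complex_nonpos_Reals_iff)
    thus "((\<lambda>t. of_real t powr (p + 1) / (p + 1)) has_vector_derivative (of_real t powr p)) (at t)"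
      by (rule has_vector_derivative_real_field)
  qed auto
  finally show "(\<integral>t. indicat_real {..1} t *\<^sub>R complex_of_real t powr p \<partial>?M) = 1 / (p + 1)" by simp
qed

lemma integral_1_inf_powr:
  assumes "Re p < -1"
  shows "integrable halfline (\<lambda>t. indicat_real {1<..} t *\<^sub>R of_real t powr p)"
    and "(\<integral>t. indicat_real {1<..} t *\<^sub>R complex_of_real t powr p \<partial>halfline) = - 1 / (p + 1)"
proof -
  let ?M = "halfline"
  let ?f = "\<lambda>t. indicat_real {1<..} t *\<^sub>R complex_of_real t powr p"
  have tail: "integrable ?M (\<lambda>x. of_real (1 + x) powr p)" "(\<integral>x. complex_of_real (1 + x) powr p \<partial>?M) = 1 / (- p - 1)"
    using integral_tail_powr[of "-p" 1] assms by simp_all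
  have f: "(\<lambda>t. indicat_real {0<..} t *\<^sub>R ?f t) = ?f" by (auto simp: indicator_def)
  have g: "(\<lambda>x. ?f (1 + 1 * x)) = (\<lambda>x. indicat_real {0<..} x *\<^sub>R complex_of_real (1 + x) powr p)"
    by (auto simp: indicator_def)
  have "integrable lebesgue (\<lambda>x. ?f (1 + 1 * x))"
    unfolding g using tail(1) by (subst (asm) integrable_restrict_space) auto
  hence "integrable lebesgue ?f" by (subst (asm) lebesgue_integrable_real_affine_iff) auto
  thus "integrable ?M ?f" by (subst integrable_restrict_space) (simp, simp only: f)
  have "(\<integral>t. ?f t \<partial>?M) = (\<integral>t. ?f t \<partial>lebesgue)"
    by (subst integral_restrict_space) (simp, simp only: f)
  also have "\<dots> = \<bar>1\<bar> *\<^sub>R (\<integral>x. ?f (1 + 1 * x) \<partial>lebesgue)" by (rule lebesgue_integral_real_affine) auto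
  also have "\<dots> = (\<integral>x. complex_of_real (1 + x) powr p \<partial>?M)"
    unfolding g by (subst integral_restrict_space) auto
  finally have eq: "(\<integral>t. ?f t \<partial>?M) = (\<integral>x. complex_of_real (1 + x) powr p \<partial>?M)" .
  show "(\<integral>t. ?f t \<partial>?M) = - 1 / (p + 1)"
  proof -
    have "1 / (- p - 1) = 1 / (- (p + 1))" by simp
    also have "\<dots> = - 1 / (p + 1)" by (simp only: minus_divide_right[symmetric] minus_divide_left)
    finally show ?thesis unfolding eq tail(2) .
  qed
qed

section \<open>The Mellin transform of the Planck kernel\<close>

context
  fixes k :: nat and w :: complex
  assumes k: "k \<ge> 1" and w: "Re w > 0"
begin

lemma w_nz: "w \<noteq> 0" using w by auto

definition planck :: "complex \<Rightarrow> complex" where "planck t = 1 / (exp (w * t ^ k) - 1)"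

text \<open>
  Subtracting the pole of the Planck kernel only on \<open>(0, 1]\<close> leaves an integrand that still decays
  at infinity, so that its Mellin transform extends from \<open>Re z > k - 1\<close> to \<open>Re z > -1\<close>.
\<close>

definition mellin_cut :: "complex \<Rightarrow> real \<Rightarrow> complex" where
  "mellin_cut z t = of_real t powr z * (planck (of_real t) - indicat_real {..1} t *\<^sub>R (1 / (w * of_real t ^ k)))"

lemma planck_den_nz: "t > 0 \<Longrightarrow> exp (w * of_real t ^ k) \<noteq> 1"
  using w by (intro exp_ne_one) (simp flip: of_real_power)

lemma planck_small: "\<exists>K\<ge>0. \<forall>t. 0 < t \<and> t \<le> 1 \<longrightarrow> norm (planck (of_real t) - 1 / (w * of_real t ^ k)) \<le> K"
proof -
  \<comment> \<open>For t > 0 the values \<open>w * t^k\<close> all lie on the ray through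
    \<open>w\<close>, and this is the cosine of its argument: the sector condition holds with
    equality.\<close>
  define \<kappa> where "\<kappa> = Re w / norm w"
  have \<kappa>: "\<kappa> > 0" using w w_nz by (simp add: \<kappa>_def)
  define C where "C = (\<Sum>m. 1 / real (Suc m) ^ 2) / \<kappa>\<^sup>2"
  have C: "C \<ge> 0" unfolding C_def by (intro divide_nonneg_nonneg suminf_nonneg summable_inverse_squares) auto
  have "norm (planck (of_real t) - 1 / (w * of_real t ^ k)) \<le> norm w * C + 1 / 2" if t: "0 < t" "t \<le> 1" for t :: real
  proof -
    let ?x = "w * of_real t ^ k"
    have "Re ?x = Re w * t ^ k" by (simp flip: of_real_power)
    moreover have nx: "norm ?x = norm w * t ^ k" using t by (simp add: norm_mult norm_power)
    ultimately have "Re ?x \<ge> \<kappa> * norm ?x" using w_nz by (simp add: \<kappa>_def)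
    from norm_bexp_le[OF this \<kappa>] have 1: "norm (bexp ?x) \<le> norm ?x * C" using t w_nz by (simp add: C_def)
    also have "\<dots> \<le> norm w * C"
    proof -
      have "norm ?x \<le> norm w" unfolding nx using t by (simp add: mult_left_le power_le_one)
      thus ?thesis using C by (rule mult_right_mono)
    qed
    finally have "norm (bexp ?x) \<le> norm w * C" .
    moreover have "planck (of_real t) - 1 / ?x = bexp ?x - 1 / 2" by (simp add: planck_def bexp_def)
    ultimately show ?thesis by (metis add.commute add_left_mono norm_triangle_le_diff norm_divide norm_numeral norm_one add_mono order_refl)
  qed
  thus ?thesis using C by (intro exI[of _ "norm w * C + 1 / 2"]) auto
qed

lemma planck_large: "\<exists>K\<ge>0. \<forall>t\<ge>1. norm (planck (of_real t)) \<le> K * exp (- Re w * t)"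
proof -
  define K where "K = 1 / (1 - exp (- Re w))"
  have K: "K > 0" using w by (simp add: K_def)
  have "norm (planck (of_real t)) \<le> K * exp (- Re w * t)" if t: "t \<ge> 1" for t :: real
  proof -
    have "t ^ 1 \<le> t ^ k" using t k by (intro power_increasing) auto
    hence 1: "Re w * t \<le> Re w * t ^ k" using w by simp
    have "norm (exp (w * of_real t ^ k)) = exp (Re w * t ^ k)" by (simp flip: of_real_power)
    hence "exp (Re w * t ^ k) - 1 \<le> norm (exp (w * of_real t ^ k) - 1)"
      by (metis norm_one norm_triangle_ineq2)
    moreover have "exp (Re w * t) - 1 \<le> exp (Re w * t ^ k) - 1" using 1 by simp
    ultimately have 2: "exp (Re w * t) - 1 \<le> norm (exp (w * of_real t ^ k) - 1)" by linarith
    have 3: "exp (Re w * t) - 1 > 0" using w t by simp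
    have "norm (planck (of_real t)) \<le> 1 / (exp (Re w * t) - 1)"
      unfolding planck_def norm_divide norm_one using 2 3 by (intro divide_left_mono mult_pos_pos) auto
    also have "\<dots> = exp (- Re w * t) / (1 - exp (- Re w * t))"
      using 3 by (simp add: exp_minus field_simps)
    also have "\<dots> \<le> exp (- Re w * t) / (1 - exp (- Re w))"
      using w t by (intro divide_left_mono mult_pos_pos) auto
    finally show ?thesis by (simp add: K_def)
  qed
  thus ?thesis using K by (intro exI[of _ K]) auto
qed

lemma mellin_cut_bound: "\<exists>K\<ge>0. \<forall>z t. t > 0 \<longrightarrow> norm (mellin_cut z t) \<le> K * (t powr Re z * exp (- Re w * t))"
proof -
  obtain K1 where K1: "K1 \<ge> 0" "\<And>t. 0 < t \<Longrightarrow> t \<le> 1 \<Longrightarrow> norm (planck (of_real t) - 1 / (w * of_real t ^ k)) \<le> K1"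
    using planck_small by blast
  obtain K2 where K2: "K2 \<ge> 0" "\<And>t. 1 \<le> t \<Longrightarrow> norm (planck (of_real t)) \<le> K2 * exp (- Re w * t)"
    using planck_large by blast
  define K where "K = max (K1 * exp (Re w)) K2"
  have "norm (mellin_cut z t) \<le> K * (t powr Re z * exp (- Re w * t))" if t: "t > 0" for z t
  proof -
    have "norm (planck (of_real t) - indicat_real {..1} t *\<^sub>R (1 / (w * of_real t ^ k))) \<le> K * exp (- Re w * t)"
    proof (cases "t \<le> 1")
      case True
      have "norm (planck (of_real t) - 1 / (w * of_real t ^ k)) \<le> K1 * 1" using K1(2)[OF t True] by simp
      also have "\<dots> \<le> K1 * exp (Re w + - Re w * t)" using K1 w True by (intro mult_left_mono) (auto simp: mult_left_le)
      also have "\<dots> = (K1 * exp (Re w)) * exp (- Re w * t)" by (simp only: exp_add mult.assoc)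
      also have "\<dots> \<le> K * exp (- Re w * t)" by (intro mult_right_mono) (auto simp: K_def)
      finally show ?thesis using True by simp
    next
      case False
      have "K2 * exp (- Re w * t) \<le> K * exp (- Re w * t)" by (intro mult_right_mono) (auto simp: K_def)
      thus ?thesis using K2(2)[of t] False by (simp only: indicator_simps atMost_iff scaleR_zero_left diff_zero simp_thms) linarith
    qed
    hence "norm (of_real t powr z) * norm (planck (of_real t) - indicat_real {..1} t *\<^sub>R (1 / (w * of_real t ^ k))) \<le> t powr Re z * (K * exp (- Re w * t))"
      using t by (intro mult_mono) (auto simp: norm_powr_real_powr)
    thus ?thesis by (simp add: mellin_cut_def norm_mult mult_ac)
  qed
  moreover have "K \<ge> 0" using K2 by (simp add: K_def)
  ultimately show ?thesis by blast
qed

lemma continuous_on_planck: "continuous_on {0<..} (\<lambda>t. planck (of_real t))"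
  unfolding planck_def using planck_den_nz by (intro continuous_intros) auto

lemma measurable_mellin_cut: "mellin_cut z \<in> borel_measurable halfline"
proof -
  have "(\<lambda>t. complex_of_real t powr z) \<in> borel_measurable halfline"
    by (intro continuous_imp_measurable_on_sets_lebesgue continuous_intros) (auto simp: complex_nonpos_Reals_iff)
  moreover have "(\<lambda>t. planck (of_real t)) \<in> borel_measurable halfline"
    by (intro continuous_imp_measurable_on_sets_lebesgue continuous_on_planck) auto
  moreover have "(\<lambda>t. 1 / (w * complex_of_real t ^ k)) \<in> borel_measurable halfline"
    using w_nz by (intro continuous_imp_measurable_on_sets_lebesgue continuous_intros) auto
  moreover have "indicat_real {..1} \<in> borel_measurable halfline"
    by (intro borel_measurable_indicator' measurable_restrict_space1) auto
  ultimately show ?thesis unfolding mellin_cut_def[abs_def]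
    by (intro borel_measurable_times borel_measurable_diff borel_measurable_scaleR)
qed

lemma integrable_mellin_cut: "Re z > -1 \<Longrightarrow> integrable halfline (mellin_cut z)"
proof -
  assume z: "Re z > -1"
  obtain K where K: "K \<ge> 0" "\<And>z t. t > 0 \<Longrightarrow> norm (mellin_cut z t) \<le> K * (t powr Re z * exp (- Re w * t))"
    using mellin_cut_bound by blast
  show ?thesis
  proof (rule Bochner_Integration.integrable_bound)
    show "integrable halfline (\<lambda>t. K * (t powr Re z * exp (- Re w * t)))"
      by (intro integrable_mult_right integrable_powr_exp_halfline z w)
    show "AE t in halfline. norm (mellin_cut z t) \<le> norm (K * (t powr Re z * exp (- Re w * t)))"
      using K by (intro AE_I2) auto
  qed (rule measurable_mellin_cut)
qed

lemma holomorphic_mellin_cut: "(\<lambda>z. \<integral>t. mellin_cut z t \<partial>halfline) holomorphic_on {z. Re z > -1}"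
proof (rule holomorphic_on_integral)
  show "open {z. Re z > -1}" by (rule open_halfspace_Re_gt)
  show "(\<lambda>z. mellin_cut z t) holomorphic_on {z. Re z > -1}" for t
    unfolding mellin_cut_def by (intro holomorphic_intros holomorphic_powr_exponent)
  fix z0 :: complex assume "z0 \<in> {z. Re z > -1}"
  hence z0: "Re z0 > -1" by simp
  define d where "d = (Re z0 + 1) / 2"
  have d: "d > 0" "Re z0 - d > -1" using z0 by (auto simp: d_def field_simps)
  obtain K where K: "K \<ge> 0" "\<And>z t. t > 0 \<Longrightarrow> norm (mellin_cut z t) \<le> K * (t powr Re z * exp (- Re w * t))"
    using mellin_cut_bound by blast
  define g where "g t = K * (t powr (Re z0 - d) * exp (- Re w * t) + t powr (Re z0 + d) * exp (- Re w * t))" for t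
  have "integrable halfline g" unfolding g_def
    using d by (intro integrable_mult_right Bochner_Integration.integrable_add integrable_powr_exp_halfline w) auto
  moreover have "norm (mellin_cut z t) \<le> g t" if "z \<in> ball z0 d" "t > 0" for z t
  proof -
    have "\<bar>Re (z0 - z)\<bar> < d" using that(1) abs_Re_le_cmod[of "z0 - z"] by (auto simp: dist_norm)
    hence r: "Re z0 - d \<le> Re z" "Re z \<le> Re z0 + d" by auto
    have "t powr Re z \<le> t powr (Re z0 - d) + t powr (Re z0 + d)"
    proof (cases "t \<le> 1")
      case True
      have "t powr Re z \<le> t powr (Re z0 - d)" using r True that by (intro powr_mono') auto
      thus ?thesis by (simp add: add_increasing2)
    next
      case False
      have "t powr Re z \<le> t powr (Re z0 + d)" using r False by (intro powr_mono) auto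
      thus ?thesis by (simp add: add_increasing)
    qed
    hence "K * (t powr Re z * exp (- Re w * t)) \<le> K * ((t powr (Re z0 - d) + t powr (Re z0 + d)) * exp (- Re w * t))"
      using K by (intro mult_left_mono mult_right_mono) auto
    thus ?thesis using K(2)[OF that(2), of z] by (simp add: g_def distrib_right)
  qed
  ultimately show "\<exists>r>0. \<exists>g. integrable halfline g \<and> (\<forall>z\<in>{z. Re z > -1} \<inter> ball z0 r. \<forall>t\<in>space halfline. norm (mellin_cut z t) \<le> g t)"
    using d by (intro exI[of _ d] conjI exI[of _ g]) auto
qed (rule measurable_mellin_cut)

lemma planck_sums: "t > 0 \<Longrightarrow> (\<lambda>n. exp (- (of_nat (Suc n) * w) * of_real t ^ k)) sums planck (of_real t)"
proof -
  assume t: "t > 0"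
  define q where "q = exp (- (w * of_real t ^ k))"
  have "norm q < 1" using t w by (simp add: q_def flip: of_real_power)
  hence "(\<lambda>n. q * q ^ n) sums (q * (1 / (1 - q)))" by (intro sums_mult geometric_sums)
  also have "(\<lambda>n. q * q ^ n) = (\<lambda>n. exp (- (of_nat (Suc n) * w) * of_real t ^ k))"
    by (simp add: fun_eq_iff q_def exp_of_nat_mult[symmetric] exp_add[symmetric] algebra_simps)
  also have "q * (1 / (1 - q)) = planck (of_real t)"
    using planck_den_nz[OF t] by (simp add: planck_def q_def exp_minus field_simps)
  finally show ?thesis .
qed

text \<open>For Re z > k - 1 the pole at 0 is integrable. A geometric series for the Planck kernel
  gives one Gamma integral per term, with Re s > 1 ensuring that these add up to
  \<open>zeta s\<close>. The fraction on the left is the integral over (0, 1] of the pole that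
  \<open>mellin_cut\<close> removes.\<close>

lemma mellin_large:
  assumes z: "Re z > real k - 1"
  defines "s \<equiv> (1 + z) / of_nat k"
  shows "(\<integral>t. mellin_cut z t \<partial>halfline) + 1 / (w * (z + 1 - of_nat k)) = Gamma s * zeta s / (of_nat k * w powr s)"
proof -
  have z1: "Re z > -1" and zk: "Re (z - of_nat k) > -1" using z k by auto
  have s1: "Re s > 1" using z k by (simp add: s_def field_simps)
  let ?f = "\<lambda>n t. of_real t powr z * exp (- (of_nat (Suc n) * w) * of_real t ^ k)"
  have u: "Re (of_nat (Suc n) * w) > 0" for n using w by simp
  have int: "integrable halfline (?f n)" for n by (rule integral_Gamma_power(2)[OF k z1 u])
  have intval: "(\<integral>t. ?f n t \<partial>halfline) = Gamma s * w powr (-s) / of_nat k * of_nat (Suc n) powr (-s)" for n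
    using integral_Gamma_power(1)[OF k z1 u, of n] powr_of_real_mult[of "real (Suc n)" w "-s"] w_nz
    by (simp add: s_def mult_ac)
  \<comment> \<open>The integrals of the norms are again Gamma integrals, with \<open>Re z\<close>
    and \<open>Re w\<close> in place of \<open>z\<close> and \<open>w\<close>. They are evaluated
    over the complex numbers and turned back into reals by taking norms.\<close>
  have norms: "(\<integral>t. norm (?f n t) \<partial>halfline) = norm (Gamma (of_real (Re s)) * of_real (Re w) powr (- of_real (Re s)) / of_nat k :: complex) * real (Suc n) powr (- Re s)" for n
  proof -
    have r: "(1 + of_real (Re z)) / of_nat k = (of_real (Re s) :: complex)" by (simp add: s_def)
    have "complex_of_real (\<integral>t. norm (?f n t) \<partial>halfline) = (\<integral>t. complex_of_real (norm (?f n t)) \<partial>halfline)"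
      by (rule integral_complex_of_real[symmetric])
    also have "\<dots> = (\<integral>t. of_real t powr of_real (Re z) * exp (- (of_nat (Suc n) * of_real (Re w)) * of_real t ^ k) \<partial>halfline)"
    proof (rule integral_halfline_cong)
      fix t :: real assume t: "t > 0"
      have "norm (?f n t) = t powr Re z * exp (- (real (Suc n) * Re w) * t ^ k)"
        using t by (simp add: norm_mult norm_powr_real_powr flip: of_real_power)
      thus "complex_of_real (norm (?f n t)) = of_real t powr of_real (Re z) * exp (- (of_nat (Suc n) * of_real (Re w)) * of_real t ^ k)"
        using t by (simp add: powr_of_real flip: exp_of_real)
    qed
    also have "\<dots> = Gamma (of_real (Re s)) * (of_nat (Suc n) * of_real (Re w)) powr (- of_real (Re s)) / of_nat k"
      using integral_Gamma_power(1)[of k "of_real (Re z)" "of_nat (Suc n) * of_real (Re w)"] k z1 w by (simp add: r)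
    also have "\<dots> = Gamma (of_real (Re s)) * of_real (Re w) powr (- of_real (Re s)) / of_nat k * of_real (real (Suc n) powr (- Re s))"
      using powr_of_real_mult[of "real (Suc n)" "of_real (Re w)" "- of_real (Re s)"] w powr_of_real[of "real (Suc n)" "- Re s"]
      by (simp add: mult_ac)
    finally have "norm (complex_of_real (\<integral>t. norm (?f n t) \<partial>halfline)) = norm (Gamma (of_real (Re s)) * of_real (Re w) powr (- of_real (Re s)) / of_nat k :: complex) * real (Suc n) powr (- Re s)"
      by (simp only: norm_mult norm_of_real abs_of_nonneg powr_ge_zero)
    moreover have "(\<integral>t. norm (?f n t) \<partial>halfline) \<ge> 0" by (rule integral_nonneg_AE) auto
    ultimately show ?thesis by (simp only: norm_of_real abs_of_nonneg)
  qed
  have sumn: "summable (\<lambda>n. \<integral>t. norm (?f n t) \<partial>halfline)"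
    unfolding norms using summable_real_powr_iff[of "- Re s"] s1
    by (intro summable_mult) (subst summable_Suc_iff, simp)
  have ae: "AE t in halfline. summable (\<lambda>n. norm (?f n t))"
  proof (rule AE_I2)
    fix t assume "t \<in> space halfline"
    hence t: "t > 0" by simp
    define q where "q = exp (- (Re w * t ^ k))"
    have "0 \<le> q" "q < 1" using t w by (simp_all add: q_def)
    hence "summable (\<lambda>n. (t powr Re z * q) * q ^ n)" by (intro summable_mult summable_geometric) auto
    also have "(\<lambda>n. (t powr Re z * q) * q ^ n) = (\<lambda>n. norm (?f n t))"
    proof
      fix n
      have "norm (?f n t) = t powr Re z * exp (- (real (Suc n) * Re w) * t ^ k)"
        using t by (simp add: norm_mult norm_powr_real_powr flip: of_real_power)
      also have "exp (- (real (Suc n) * Re w) * t ^ k) = q * q ^ n"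
        by (simp add: q_def exp_of_nat_mult[symmetric] exp_add[symmetric] algebra_simps)
      finally show "(t powr Re z * q) * q ^ n = norm (?f n t)" by (simp add: mult_ac)
    qed
    finally show "summable (\<lambda>n. norm (?f n t))" .
  qed
  have "(\<lambda>n. \<integral>t. ?f n t \<partial>halfline) sums (\<integral>t. (\<Sum>n. ?f n t) \<partial>halfline)" by (rule sums_integral[OF int ae sumn])
  moreover have "(\<integral>t. (\<Sum>n. ?f n t) \<partial>halfline) = (\<integral>t. of_real t powr z * planck (of_real t) \<partial>halfline)"
    by (rule integral_halfline_cong) (use sums_unique[OF sums_mult[OF planck_sums]] in simp)
  ultimately have A: "(\<lambda>n. \<integral>t. ?f n t \<partial>halfline) sums (\<integral>t. of_real t powr z * planck (of_real t) \<partial>halfline)" by simp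
  have "(\<lambda>n. \<integral>t. ?f n t \<partial>halfline) sums (Gamma s * w powr (-s) / of_nat k * zeta s)"
    unfolding intval by (intro sums_mult sums_zeta s1)
  from sums_unique2[OF A this] have B: "(\<integral>t. of_real t powr z * planck (of_real t) \<partial>halfline) = Gamma s * w powr (-s) / of_nat k * zeta s" .
  have "(\<integral>t. of_real t powr z * planck (of_real t) \<partial>halfline) = (\<integral>t. mellin_cut z t + (1 / w) * (indicat_real {..1} t *\<^sub>R complex_of_real t powr (z - of_nat k)) \<partial>halfline)"
  proof (rule integral_halfline_cong)
    fix t :: real assume t: "t > 0"
    have "complex_of_real t powr (z - of_nat k) = of_real t powr z / of_real t ^ k"
      using t by (simp add: powr_diff powr_nat')
    thus "of_real t powr z * planck (of_real t) = mellin_cut z t + (1 / w) * (indicat_real {..1} t *\<^sub>R complex_of_real t powr (z - of_nat k))"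
      using w_nz t by (simp add: mellin_cut_def indicator_def field_simps)
  qed
  also have "\<dots> = (\<integral>t. mellin_cut z t \<partial>halfline) + (\<integral>t. (1 / w) * (indicat_real {..1} t *\<^sub>R complex_of_real t powr (z - of_nat k)) \<partial>halfline)"
    by (intro Bochner_Integration.integral_add integrable_mellin_cut z1 integrable_mult_right integral_01_powr zk)
  also have "(\<integral>t. (1 / w) * (indicat_real {..1} t *\<^sub>R complex_of_real t powr (z - of_nat k)) \<partial>halfline) = (1 / w) * (1 / (z - of_nat k + 1))"
    unfolding integral_mult_right_zero integral_01_powr(2)[OF zk] ..
  finally have "(\<integral>t. mellin_cut z t \<partial>halfline) + (1 / w) * (1 / (z - of_nat k + 1)) = Gamma s * w powr (-s) / of_nat k * zeta s"
    using B by simp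
  thus ?thesis by (simp add: powr_minus field_simps add_ac)
qed

text \<open>Both sides are holomorphic for Re z > -1 except at \<open>k - 1\<close>, where the
  fraction on the left and the zeta factor on the right are singular. Removing a single point leaves
  the half-plane connected.\<close>

lemma mellin_all:
  assumes z: "Re z > -1" "z \<noteq> of_nat k - 1"
  shows "(\<integral>t. mellin_cut z t \<partial>halfline) + 1 / (w * (z + 1 - of_nat k)) =
     Gamma ((1 + z) / of_nat k) * zeta ((1 + z) / of_nat k) / (of_nat k * w powr ((1 + z) / of_nat k))"
proof (rule analytic_continuation_open[of "{z. Re z > real k - 1}" "{z. Re z > -1} - {of_nat k - 1}"
    "\<lambda>z. (\<integral>t. mellin_cut z t \<partial>halfline) + 1 / (w * (z + 1 - of_nat k))"
    "\<lambda>z. Gamma ((1 + z) / of_nat k) * zeta ((1 + z) / of_nat k) / (of_nat k * w powr ((1 + z) / of_nat k))"])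
  have k0: "of_nat k \<noteq> (0::complex)" using k by simp
  show "open {z. Re z > real k - 1}" by (rule open_halfspace_Re_gt)
  show "open ({z. Re z > -1} - {of_nat k - 1})" by (intro open_Diff open_halfspace_Re_gt) auto
  show "{z. Re z > real k - 1} \<noteq> {}" by (auto intro!: exI[of _ "of_nat k"])
  show "connected ({z. Re z > -1} - {of_nat k - 1 :: complex})"
    by (intro connected_open_delete convex_connected convex_halfspace_Re_gt open_halfspace_Re_gt) auto
  show "{z. Re z > real k - 1} \<subseteq> {z. Re z > -1} - {of_nat k - 1}" using k by auto
  show "(\<lambda>z. (\<integral>t. mellin_cut z t \<partial>halfline) + 1 / (w * (z + 1 - of_nat k))) holomorphic_on {z. Re z > -1} - {of_nat k - 1}"
    using w_nz by (intro holomorphic_intros holomorphic_on_subset[OF holomorphic_mellin_cut]) (auto simp: diff_eq_eq eq_diff_eq)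
  have im: "(1 + z) / of_nat k \<noteq> 1 \<and> (1 + z) / of_nat k \<notin> \<int>\<^sub>\<le>\<^sub>0" if "z \<in> {z. Re z > -1} - {of_nat k - 1}" for z
  proof
    show "(1 + z) / of_nat k \<noteq> 1" using that k0 by (auto simp: field_simps)
    have "Re ((1 + z) / of_nat k) > 0" using that k by simp
    thus "(1 + z) / of_nat k \<notin> \<int>\<^sub>\<le>\<^sub>0"
      by (metis nonpos_Ints_cases complex_Re_of_int not_less of_int_le_0_iff)
  qed
  have "(zeta \<circ> (\<lambda>z. (1 + z) / of_nat k)) holomorphic_on {z. Re z > -1} - {of_nat k - 1}"
  proof (rule holomorphic_on_compose_gen[OF _ holomorphic_zeta])
    show "(\<lambda>z. (1 + z) / of_nat k) holomorphic_on {z. Re z > -1} - {of_nat k - 1}"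
      using k0 by (intro holomorphic_intros) auto
    show "(\<lambda>z. (1 + z) / of_nat k) ` ({z. Re z > -1} - {of_nat k - 1}) \<subseteq> - {1}"
    proof (rule image_subsetI)
      fix z assume "z \<in> {z. Re z > -1} - {of_nat k - 1}"
      from im[OF this] show "(1 + z) / of_nat k \<in> - {1}" by auto
    qed
  qed
  thus "(\<lambda>z. Gamma ((1 + z) / of_nat k) * zeta ((1 + z) / of_nat k) / (of_nat k * w powr ((1 + z) / of_nat k))) holomorphic_on {z. Re z > -1} - {of_nat k - 1}"
    using im k0 w_nz by (intro holomorphic_intros holomorphic_powr_exponent) (auto simp: o_def)
  show "(\<integral>t. mellin_cut z t \<partial>halfline) + 1 / (w * (z + 1 - of_nat k)) =
     Gamma ((1 + z) / of_nat k) * zeta ((1 + z) / of_nat k) / (of_nat k * w powr ((1 + z) / of_nat k))"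
    if "z \<in> {z. Re z > real k - 1}" for z using mellin_large[of z] that by simp
qed (use z in auto)

text \<open>Once Re z < 0, the pole can be subtracted on (1, \<infinity>) as well. The additional
  integral contributes exactly the explicit fraction of \<open>mellin_all\<close>, which therefore
  disappears.\<close>

lemma mellin_strip:
  assumes z: "Re z > -1" "Re z < 0"
  shows "(\<integral>t. of_real t powr z * (planck (of_real t) - 1 / (w * of_real t ^ k)) \<partial>halfline) =
     Gamma ((1 + z) / of_nat k) * zeta ((1 + z) / of_nat k) / (of_nat k * w powr ((1 + z) / of_nat k))"
proof -
  have zk: "Re (z - of_nat k) < -1" using z k by simp
  have zk': "z \<noteq> of_nat k - 1" using z k by auto
  have "(\<integral>t. of_real t powr z * (planck (of_real t) - 1 / (w * of_real t ^ k)) \<partial>halfline) =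
        (\<integral>t. mellin_cut z t - (1 / w) * (indicat_real {1<..} t *\<^sub>R complex_of_real t powr (z - of_nat k)) \<partial>halfline)"
  proof (rule integral_halfline_cong)
    fix t :: real assume t: "t > 0"
    have "complex_of_real t powr (z - of_nat k) = of_real t powr z / of_real t ^ k"
      using t by (simp add: powr_diff powr_nat')
    thus "of_real t powr z * (planck (of_real t) - 1 / (w * of_real t ^ k)) = mellin_cut z t - (1 / w) * (indicat_real {1<..} t *\<^sub>R complex_of_real t powr (z - of_nat k))"
      using w_nz t by (auto simp: mellin_cut_def indicator_def field_simps)
  qed
  also have "\<dots> = (\<integral>t. mellin_cut z t \<partial>halfline) - (\<integral>t. (1 / w) * (indicat_real {1<..} t *\<^sub>R complex_of_real t powr (z - of_nat k)) \<partial>halfline)"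
    by (intro Bochner_Integration.integral_diff integrable_mellin_cut z integrable_mult_right integral_1_inf_powr zk)
  also have "(\<integral>t. (1 / w) * (indicat_real {1<..} t *\<^sub>R complex_of_real t powr (z - of_nat k)) \<partial>halfline) = (1 / w) * (- 1 / (z - of_nat k + 1))"
    unfolding integral_mult_right_zero integral_1_inf_powr(2)[OF zk] ..
  also have "(\<integral>t. mellin_cut z t \<partial>halfline) - (1 / w) * (- 1 / (z - of_nat k + 1)) = (\<integral>t. mellin_cut z t \<partial>halfline) + 1 / (w * (z + 1 - of_nat k))"
    by (simp add: add_diff_eq diff_add_eq)
  finally show ?thesis using mellin_all[OF z(1) zk'] by simp
qed

end

section \<open>Estimates on the rays that are uniform near the apex\<close>

lemma exp_minus_one_ge:
  shows "\<exists>d>0. \<forall>z::complex. norm z < d \<longrightarrow> norm (exp z - 1) \<ge> norm z / 2"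
proof -
  have "((\<lambda>z::complex. (exp z - exp 0) / (z - 0)) \<longlongrightarrow> exp 0) (at 0)"
    using DERIV_exp[of "0::complex"] by (simp only: has_field_derivative_iff)
  hence "eventually (\<lambda>z::complex. dist ((exp z - exp 0) / (z - 0)) (exp 0) < 1 / 2) (at 0)"
    by (rule tendstoD) auto
  then obtain d where d: "d > 0" "\<And>z::complex. z \<noteq> 0 \<Longrightarrow> norm z < d \<Longrightarrow> norm ((exp z - 1) / z - 1) < 1 / 2"
    by (auto simp: eventually_at dist_norm)
  have "norm (exp z - 1) \<ge> norm z / 2" if "norm z < d" for z :: complex
  proof (cases "z = 0")
    case False
    have "1 = norm ((exp z - 1) / z - ((exp z - 1) / z - 1))" by simp
    also have "\<dots> \<le> norm ((exp z - 1) / z) + norm ((exp z - 1) / z - 1)" by (rule norm_triangle_ineq4)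
    finally have "norm ((exp z - 1) / z) \<ge> 1 / 2" using d(2)[OF False that] by linarith
    thus ?thesis using False by (simp add: norm_divide field_simps)
  qed auto
  thus ?thesis using d by blast
qed

text \<open>Needed to let the starting point of the rays tend to the pole at 0. Close to 0 the
  estimate exp u - 1 = u + o(u) gives the factor 1 / norm t; elsewhere the exponential bound
  applies. The two regimes are separated by \<open>norm t < r\<close>.\<close>

lemma pkern_ray_bound_uniform:
  assumes tau: "\<tau> > 0" and e: "unit_sign e"
  shows "\<exists>c0>0. \<exists>M>0. \<forall>c x. 0 \<le> c \<and> c \<le> c0 \<and> x > 0 \<longrightarrow>
           norm (pkern e (of_real c + of_real x * rayv e \<tau>)) \<le>
             M * (1 + 1 / norm (of_real c + of_real x * rayv e \<tau>)) * exp (- (2 * pi * \<tau>) * x)"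
proof -
  obtain d where d: "d > 0" "\<And>z::complex. norm z < d \<Longrightarrow> norm (exp z - 1) \<ge> norm z / 2"
    using exp_minus_one_ge by blast
  define r where "r = d / (2 * pi)"
  have r: "r > 0" using d by (simp add: r_def)
  define V where "V = norm (rayv e \<tau>)"
  have V: "V > 0" by (simp add: V_def)
  \<comment> \<open>With \<open>c \<le> c0 = r / 2\<close>, a point at distance at least
    \<open>r\<close> from 0 has \<open>x * V \<ge> r / 2\<close>, that is \<open>x \<ge> x0\<close>.
    So the far regime stays a fixed distance up the ray, uniformly in \<open>c\<close>.\<close>
  define c0 where "c0 = r / 2"
  define x0 where "x0 = r / (2 * V)"
  have x0: "x0 > 0" using r V by (simp add: x0_def)
  define y where "y = 2 * pi * \<tau>"
  have y: "y > 0" using tau by (simp add: y_def)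
  define M where "M = max (exp (y * r) / pi) (1 / (1 - exp (- y * x0)))"
  have Mpos: "M > 0" unfolding M_def by (rule order.strict_trans2[OF _ max.cobounded1]) simp
  have "norm (pkern e (of_real c + of_real x * rayv e \<tau>)) \<le> M * (1 + 1 / norm (of_real c + of_real x * rayv e \<tau>)) * exp (- y * x)"
    if c: "0 \<le> c" "c \<le> c0" and x: "x > 0" for c x
  proof -
    let ?t = "of_real c + of_real x * rayv e \<tau>"
    have tpos: "norm ?t > 0" using Re_ray_le_norm[of c x e \<tau>] c x by linarith
    show ?thesis
    proof (cases "norm ?t < r")
      case True
      let ?z = "- (2 * of_real pi * \<i> * of_real e * ?t)"
      have nz: "norm ?z = 2 * pi * norm ?t" using e by (auto simp: norm_mult)
      have "norm ?z < d" unfolding nz using True by (simp add: r_def field_simps)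
      from d(2)[OF this] have "norm (exp ?z - 1) \<ge> pi * norm ?t" unfolding nz by simp
      hence "norm (pkern e ?t) \<le> 1 / (pi * norm ?t)"
      proof -
        have "0 < pi * norm ?t" using tpos by simp
        from frac_le[OF _ order_refl this \<open>norm (exp ?z - 1) \<ge> pi * norm ?t\<close>, of 1] show ?thesis
          unfolding pkern_def norm_divide norm_one by simp
      qed
      also have "\<dots> = (1 / pi) * 1 * (1 / norm ?t)" by simp
      also have "\<dots> \<le> (1 / pi) * exp (y * r + - y * x) * (1 / norm ?t)"
      proof (intro mult_right_mono mult_left_mono)
        have "x \<le> r" using Re_ray_le_norm[of c x e \<tau>] c True by linarith
        thus "1 \<le> exp (y * r + - y * x)" using y by simp
      qed auto
      also have "\<dots> = (exp (y * r) / pi) * (1 / norm ?t) * exp (- y * x)" by (simp only: exp_add) simp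
      also have "\<dots> \<le> M * (1 / norm ?t) * exp (- y * x)" by (intro mult_right_mono) (auto simp: M_def)
      also have "\<dots> \<le> M * (1 + 1 / norm ?t) * exp (- y * x)" using Mpos by (intro mult_right_mono mult_left_mono) auto
      finally show ?thesis .
    next
      case False
      have "norm ?t \<le> c + x * V" using c x by (intro order.trans[OF norm_triangle_ineq]) (simp add: norm_mult V_def)
      hence "r / 2 \<le> x * V" using False c by (simp add: c0_def)
      hence xx: "x0 \<le> x" using V by (simp add: x0_def field_simps)
      have "norm (pkern e ?t) \<le> 1 / (exp (y * x) - 1)"
        using norm_pkern_le[OF e, of ?t] e tau x by (auto simp: y_def mult_ac)
      also have "\<dots> = exp (- y * x) / (1 - exp (- y * x))"
        using y x by (simp add: exp_minus field_simps)
      also have "\<dots> \<le> exp (- y * x) / (1 - exp (- y * x0))"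
        using xx y x x0 by (intro divide_left_mono mult_pos_pos) auto
      also have "\<dots> = (1 / (1 - exp (- y * x0))) * 1 * exp (- y * x)" by simp
      also have "\<dots> \<le> M * (1 + 1 / norm ?t) * exp (- y * x)"
        using Mpos by (intro mult_right_mono mult_mono) (auto simp: M_def)
      finally show ?thesis .
    qed
  qed
  moreover have "c0 > 0" using r by (simp add: c0_def)
  ultimately show ?thesis using Mpos unfolding y_def by blast
qed

lemma integrable_ray_dominator:
  fixes p b K :: real
  assumes "p > -1" "b > 0"
  shows "integrable halfline (\<lambda>x. (x powr p + K * (1 + x) powr p) * exp (- b * x))"
proof -
  obtain L where L: "L > 0" "\<And>x. x \<ge> 0 \<Longrightarrow> (1 + x) powr p \<le> L * exp (b / 2 * x)"
    using powr_le_exp_bound[of "b / 2" p] assms by auto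
  have "integrable halfline (\<lambda>x. (1 + x) powr p * exp (- b * x))"
  proof (rule integrable_halfline_bound)
    show "continuous_on {0<..} (\<lambda>x. (1 + x) powr p * exp (- b * x))" by (intro continuous_intros) auto
    show "integrable halfline (\<lambda>x. L * exp (- (b / 2) * x))"
      using assms by (intro integrable_mult_right integrable_exp_halfline) auto
    fix x :: real assume x: "x > 0"
    have "(1 + x) powr p * exp (- b * x) \<le> (L * exp (b / 2 * x)) * exp (- b * x)"
      using L x by (intro mult_right_mono) auto
    also have "\<dots> = L * exp (b / 2 * x + - b * x)" by (simp only: exp_add mult.assoc)
    also have "b / 2 * x + - b * x = - (b / 2) * x" by (simp add: field_simps)
    finally show "norm ((1 + x) powr p * exp (- b * x)) \<le> L * exp (- (b / 2) * x)" by simp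
  qed
  from Bochner_Integration.integrable_add[OF integrable_powr_exp_halfline[OF assms] integrable_mult_right[OF this, of K]]
  show ?thesis by (simp add: algebra_simps)
qed

lemma integrable_sum_list:
  fixes f :: "'b \<Rightarrow> 'a \<Rightarrow> real"
  shows "(\<And>p. p \<in> set xs \<Longrightarrow> integrable M (f p)) \<Longrightarrow> integrable M (\<lambda>x. \<Sum>p\<leftarrow>xs. f p x)"
  by (induction xs) auto

lemma norm_ray_powr_le:
  assumes "x > 0" "0 \<le> c" "c \<le> 1"
  shows "norm (of_real c + of_real x * rayv e \<tau>) powr p \<le> x powr p + (1 + norm (rayv e \<tau>)) powr p * (1 + x) powr p"
proof -
  have "norm (of_real c + of_real x * rayv e \<tau>) powr p \<le> x powr p + ((1 + norm (rayv e \<tau>)) * (1 + x)) powr p"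
    using assms Re_ray_le_norm[of c x e \<tau>] by (intro powr_between_le norm_ray_le) auto
  thus ?thesis using assms by (simp add: powr_mult add_nonneg_nonneg)
qed

lemma integrable_powr_one_plus:
  fixes a b :: real
  assumes "a > -1" "a - b < -1"
  shows "integrable halfline (\<lambda>t. t powr a * (1 + t) powr (-b))"
proof (rule integrable_halfline_bound)
  show "continuous_on {0<..} (\<lambda>t. t powr a * (1 + t) powr (-b))" by (intro continuous_intros) auto
  define K1 where "K1 = exp 1 * (1 + 2 powr (-b))"
  define K2 where "K2 = (1 / 2) powr a + 1"
  show "integrable halfline (\<lambda>t. K1 * (t powr a * exp (-1 * t)) + K2 * (1 + t) powr (- (b - a)))"
    using assms by (intro Bochner_Integration.integrable_add integrable_mult_right integrable_powr_exp_halfline integrable_one_plus_powr) auto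
  fix t :: real assume t: "t > 0"
  show "norm (t powr a * (1 + t) powr (-b)) \<le> K1 * (t powr a * exp (-1 * t)) + K2 * (1 + t) powr (- (b - a))"
  proof (cases "t \<le> 1")
    case True
    have "(1 + t) powr (-b) \<le> 1 powr (-b) + 2 powr (-b)" using t True by (intro powr_between_le) auto
    hence "(1 + t) powr (-b) \<le> (1 + 2 powr (-b)) * 1" by simp
    also have "\<dots> \<le> (1 + 2 powr (-b)) * exp (1 + -1 * t)" using True by (intro mult_left_mono) auto
    also have "\<dots> = K1 * exp (-1 * t)" by (simp only: K1_def exp_add mult_ac)
    finally have "t powr a * (1 + t) powr (-b) \<le> t powr a * (K1 * exp (-1 * t))" by (intro mult_left_mono) auto
    moreover have "K2 * (1 + t) powr (- (b - a)) \<ge> 0" by (simp add: K2_def)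
    ultimately show ?thesis by (simp add: mult_ac)
  next
    case False
    have "(t / (1 + t)) powr a \<le> (1 / 2) powr a + 1 powr a" using False by (intro powr_between_le) (auto simp: field_simps)
    hence "t powr a \<le> K2 * (1 + t) powr a" using t by (simp add: powr_divide K2_def field_simps)
    hence "t powr a * (1 + t) powr (-b) \<le> K2 * (1 + t) powr a * (1 + t) powr (-b)" by (intro mult_right_mono) auto
    also have "\<dots> = K2 * (1 + t) powr (- (b - a))" using t by (simp add: powr_add[symmetric])
    finally have "t powr a * (1 + t) powr (-b) \<le> K2 * (1 + t) powr (- (b - a))" .
    moreover have "K1 * (t powr a * exp (-1 * t)) \<ge> 0" by (simp add: K1_def)
    ultimately show ?thesis by simp
  qed
qed

text \<open>The condition is homogeneous of degree k in t, so it depends only on the slope of t, and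
  by continuity it survives near slope 0. Half of the cosine of the argument of \<open>w\<close>
  serves as \<open>\<kappa>\<close>, which makes the inequality strict on the axis.\<close>

lemma ex_wedge:
  fixes w :: complex
  assumes w: "Re w > 0"
  shows "\<exists>\<tau>>0. \<exists>\<kappa>>0. \<forall>t\<in>wedge \<tau>. Re (w * t ^ k) \<ge> \<kappa> * norm (w * t ^ k)"
proof -
  define f where "f s = Re (w * Complex 1 s ^ k) - Re w / (2 * norm w) * norm (w * Complex 1 s ^ k)" for s
  have w0: "w \<noteq> 0" using w by auto
  have "f 0 = Re w / 2" using w0 by (simp add: f_def complex_of_real_def[symmetric] flip: one_complex.code)
  hence f0: "f 0 > 0" using w by simp
  have "continuous_on UNIV f" unfolding f_def[abs_def] Complex_eq using w0 by (intro continuous_intros) auto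
  hence "isCont f 0" by (simp add: continuous_on_eq_continuous_at)
  hence "eventually (\<lambda>s. f s > 0) (at 0)" using f0 by (intro order_tendstoD(1)) (auto simp: isCont_def)
  then obtain d where d: "d > 0" "\<And>s. s \<noteq> 0 \<Longrightarrow> \<bar>s\<bar> < d \<Longrightarrow> f s > 0"
    by (auto simp: eventually_at dist_norm)
  have "Re (w * t ^ k) \<ge> Re w / (2 * norm w) * norm (w * t ^ k)" if t: "t \<in> wedge d" for t
  proof -
    have "0 < d * Re t" using t by (auto simp: wedge_def)
    hence R: "Re t > 0" using d by (simp add: zero_less_mult_iff)
    define s where "s = Im t / Re t"
    have "\<bar>s\<bar> < d" using t R by (simp add: s_def wedge_def abs_divide field_simps)
    hence fs: "f s > 0" using d f0 by (cases "s = 0") auto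
    have "t = of_real (Re t) * Complex 1 s" using R by (simp add: complex_eq_iff s_def)
    hence "w * t ^ k = of_real (Re t ^ k) * (w * Complex 1 s ^ k)" by (metis power_mult_distrib mult.left_commute of_real_power)
    moreover have "Re (of_real r * Z) = r * Re Z" for r Z by simp
    moreover have "norm (of_real (Re t ^ k) * Z) = Re t ^ k * norm Z" for Z :: complex
      using R by (simp add: norm_mult norm_power)
    ultimately have "Re (w * t ^ k) = Re t ^ k * Re (w * Complex 1 s ^ k)" "norm (w * t ^ k) = Re t ^ k * norm (w * Complex 1 s ^ k)"
      by metis+
    moreover have "Re t ^ k * (Re w / (2 * norm w) * norm (w * Complex 1 s ^ k)) \<le> Re t ^ k * Re (w * Complex 1 s ^ k)"
      using fs R by (intro mult_left_mono) (auto simp: f_def)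
    ultimately show ?thesis by (simp add: mult_ac)
  qed
  moreover have "Re w / (2 * norm w) > 0" using w w0 by simp
  ultimately show ?thesis using d by blast
qed

section \<open>The Lambert series as main terms plus ray integrals\<close>

context
  fixes k :: nat and w :: complex and \<tau> \<tau>' \<kappa> :: real
  assumes k: "k \<ge> 1" and w: "Re w > 0" and tau: "0 < \<tau>" "\<tau> < \<tau>'" and kap: "\<kappa> > 0"
    and wedge: "\<And>t. t \<in> wedge \<tau>' \<Longrightarrow> Re (w * t ^ k) \<ge> \<kappa> * norm (w * t ^ k)"
begin

definition hfun :: "complex \<Rightarrow> complex \<Rightarrow> complex" where
  "hfun z t = t powr z * bexp (w * t ^ k)"

text \<open>\<open>hreg\<close> is of order t^(z-k) at infinity, as summation requires, but like -
  t^z / 2 at 0, where the pole of \<open>pkern\<close> makes it non-integrable if Re z \<le> 0.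
  Adding t^z / 2 gives \<open>hfun\<close>, which is O(t^(z+k)) at 0, so that its rays may start at
  0; its growth at infinity is harmless there because the kernel decays exponentially.\<close>

definition hreg :: "complex \<Rightarrow> complex \<Rightarrow> complex" where
  "hreg z t = t powr z * (planck k w t - 1 / (w * t ^ k))"

lemma hreg_eq: "hreg z t = hfun z t - 1 / 2 * t powr z"
  by (simp add: hreg_def hfun_def bexp_def planck_def[OF k w] algebra_simps)

lemma wedge_nz: "t \<in> wedge \<tau>' \<Longrightarrow> t \<noteq> 0" by (auto simp: wedge_def)

lemma wnz: "w \<noteq> 0" using w by auto

lemma wedge_Re_pos: "t \<in> wedge \<tau>' \<Longrightarrow> Re (w * t ^ k) > 0"
  using wedge[of t] wedge_nz[of t] wnz kap by (smt (verit) mult_pos_pos zero_less_norm_iff no_zero_divisors power_not_zero)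

lemma bexp_wedge_bound: "\<exists>C\<ge>0. \<forall>t\<in>wedge \<tau>'. norm (bexp (w * t ^ k)) \<le> C * norm t ^ k"
proof -
  define C where "C = (\<Sum>m. 1 / real (Suc m) ^ 2) / \<kappa>\<^sup>2"
  have C: "C \<ge> 0" unfolding C_def by (intro divide_nonneg_nonneg suminf_nonneg summable_inverse_squares) auto
  have "norm (bexp (w * t ^ k)) \<le> (norm w * C) * norm t ^ k" if "t \<in> wedge \<tau>'" for t
    using norm_bexp_le[OF wedge[OF that] kap] wnz wedge_nz[OF that] by (simp add: C_def norm_mult norm_power mult_ac)
  thus ?thesis using C by (intro exI[of _ "norm w * C"]) auto
qed

lemma bexp_wedge_holomorphic: "(\<lambda>t. bexp (w * t ^ k)) holomorphic_on wedge \<tau>'"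
  unfolding bexp_def using exp_ne_one[OF wedge_Re_pos] wedge_nz wnz
  by (intro holomorphic_intros) auto

lemma hfun_holomorphic: "hfun z holomorphic_on wedge \<tau>'"
  unfolding hfun_def[abs_def] using tau by (intro holomorphic_intros holomorphic_on_powr_wedge bexp_wedge_holomorphic) auto

lemma hreg_holomorphic: "hreg z holomorphic_on wedge \<tau>'"
  unfolding hreg_eq[abs_def] using tau by (intro holomorphic_intros holomorphic_on_powr_wedge hfun_holomorphic) auto

lemma hreg_wedge_bound:
  assumes z: "Re z < real k"
  shows "\<exists>C\<ge>0. \<forall>t\<in>wedge \<tau>'. norm (hreg z t) \<le> C * Re t powr (- (real k - Re z))"
proof -
  define C where "C = exp (pi * \<bar>Im z\<bar>) * ((1 / \<kappa> + 1) / norm w)"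
  have "norm (hreg z t) \<le> C * Re t powr (- (real k - Re z))" if t: "t \<in> wedge \<tau>'" for t
  proof -
    let ?x = "w * t ^ k"
    have nz: "t \<noteq> 0" using wedge_nz[OF t] .
    have "0 < \<tau>' * Re t" using t by (auto simp: wedge_def)
    hence Rt: "Re t > 0" using tau by (simp add: zero_less_mult_iff)
    have x: "?x \<noteq> 0" using nz wnz by simp
    have Rx: "Re ?x > 0" by (rule wedge_Re_pos[OF t])
    have "norm (exp ?x) - 1 \<le> norm (exp ?x - 1)" by (metis norm_one norm_triangle_ineq2)
    moreover have "Re ?x \<le> exp (Re ?x) - 1" using exp_ge_add_one_self[of "Re ?x"] by linarith
    ultimately have "\<kappa> * norm ?x \<le> norm (exp ?x - 1)" using wedge[OF t] by simp
    hence "norm (1 / (exp ?x - 1)) \<le> 1 / (\<kappa> * norm ?x)"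
      unfolding norm_divide norm_one using kap x exp_ne_one[OF Rx] by (intro divide_left_mono mult_pos_pos) auto
    hence "norm (planck k w t - 1 / ?x) \<le> 1 / (\<kappa> * norm ?x) + 1 / norm ?x"
      unfolding planck_def[OF k w] by (intro order.trans[OF norm_triangle_ineq4] add_mono) (auto simp: norm_divide norm_mult)
    also have "\<dots> = (1 / \<kappa> + 1) / norm w * norm t powr (- real k)"
      using nz by (simp add: norm_mult norm_power powr_minus powr_realpow divide_simps)
    finally have "norm (hreg z t) \<le> (norm t powr Re z * exp (pi * \<bar>Im z\<bar>)) * ((1 / \<kappa> + 1) / norm w * norm t powr (- real k))"
      unfolding hreg_def norm_mult by (intro mult_mono norm_powr_complex_bounds nz) auto
    also have "\<dots> = C * norm t powr (- (real k - Re z))"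
      by (simp add: C_def powr_diff powr_minus field_simps)
    also have "\<dots> \<le> C * Re t powr (- (real k - Re z))"
      using Rt z kap complex_Re_le_cmod[of t] by (intro mult_left_mono powr_mono2') (auto simp: C_def)
    finally show ?thesis .
  qed
  moreover have "C \<ge> 0" using kap by (simp add: C_def)
  ultimately show ?thesis by blast
qed

lemma ray_wedge: "0 \<le> c \<Longrightarrow> x > 0 \<Longrightarrow> unit_sign e \<Longrightarrow> of_real c + of_real x * rayv e \<tau> \<in> wedge \<tau>'"
  using ray_in_wedge[of c \<tau> \<tau>' e x] tau by auto

text \<open>The majorant is uniform in \<open>z\<close> near \<open>z0\<close> and in the starting
  point \<open>c\<close>, including 0. The first gives holomorphy in \<open>z\<close>, the second
  the limit of the ray integrals as \<open>c\<close> tends to 0.\<close>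

lemma hfun_ray_dominated:
  assumes z0: "Re z0 > -1" and e: "unit_sign e"
  shows "\<exists>d>0. \<exists>c0>0. \<exists>D. integrable halfline D \<and> (\<forall>z\<in>ball z0 d. \<forall>c x. 0 \<le> c \<and> c \<le> c0 \<and> x > 0 \<longrightarrow>
     norm (hfun z (of_real c + of_real x * rayv e \<tau>) * pkern e (of_real c + of_real x * rayv e \<tau>) * rayv e \<tau>) \<le> D x)"
proof -
  define d where "d = (Re z0 + 1) / 2"
  have d: "d > 0" "Re z0 - d > -1" using z0 by (auto simp: d_def field_simps)
  obtain c1 M where c1: "c1 > 0" "M > 0" "\<And>c x. 0 \<le> c \<Longrightarrow> c \<le> c1 \<Longrightarrow> x > 0 \<Longrightarrow>
     norm (pkern e (of_real c + of_real x * rayv e \<tau>)) \<le> M * (1 + 1 / norm (of_real c + of_real x * rayv e \<tau>)) * exp (- (2 * pi * \<tau>) * x)"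
    using pkern_ray_bound_uniform[OF tau(1) e] by blast
  obtain C where C: "C \<ge> 0" "\<And>t. t \<in> wedge \<tau>' \<Longrightarrow> norm (bexp (w * t ^ k)) \<le> C * norm t ^ k"
    using bexp_wedge_bound by blast
  define c0 where "c0 = min c1 1"
  define V where "V = 1 + norm (rayv e \<tau>)"
  define Q where "Q = exp (pi * (\<bar>Im z0\<bar> + d))"
  \<comment> \<open>The shifts by \<open>d\<close> come from varying \<open>z\<close>, the summand
    \<open>k\<close> from the zero of \<open>bexp\<close> at 0, and -1 from the pole of the kernel.
    All four exponents exceed -1 because \<open>k \<ge> 1\<close>.\<close>
  define P where "P = [Re z0 - d + real k, Re z0 + d + real k, Re z0 - d + real k - 1, Re z0 + d + real k - 1]"
  define D where "D x = (Q * C * M * norm (rayv e \<tau>)) * (\<Sum>p\<leftarrow>P. (x powr p + V powr p * (1 + x) powr p) * exp (- (2 * pi * \<tau>) * x))" for x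
  have P: "p > -1" if "p \<in> set P" for p using that d k by (auto simp: P_def)
  have "integrable halfline D"
    unfolding D_def using P tau by (intro integrable_mult_right integrable_sum_list integrable_ray_dominator) auto
  moreover have "norm (hfun z (of_real c + of_real x * rayv e \<tau>) * pkern e (of_real c + of_real x * rayv e \<tau>) * rayv e \<tau>) \<le> D x"
    if z: "z \<in> ball z0 d" and c: "0 \<le> c" "c \<le> c0" and x: "x > 0" for z c x
  proof -
    define t where "t = of_real c + of_real x * rayv e \<tau>"
    define N where "N = norm t"
    define E where "E = exp (- (2 * pi * \<tau>) * x)"
    have tw: "t \<in> wedge \<tau>'" unfolding t_def by (rule ray_wedge) (use c x e in auto)
    have N: "N > 0" using wedge_nz[OF tw] by (simp add: N_def)
    have "\<bar>Re (z0 - z)\<bar> < d" "\<bar>Im (z0 - z)\<bar> < d"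
      using z abs_Re_le_cmod[of "z0 - z"] abs_Im_le_cmod[of "z0 - z"] by (auto simp: dist_norm)
    hence r: "Re z0 - d \<le> Re z" "Re z \<le> Re z0 + d" "\<bar>Im z\<bar> \<le> \<bar>Im z0\<bar> + d" by auto
    have Npk: "N powr p \<le> x powr p + V powr p * (1 + x) powr p" for p
      using norm_ray_powr_le[of x c e \<tau> p] x c by (simp add: N_def t_def V_def c0_def)
    have pz: "N powr Re z \<le> N powr (Re z0 - d) + N powr (Re z0 + d)"
    proof (cases "N \<le> 1")
      case True
      have "N powr Re z \<le> N powr (Re z0 - d)" using r N True by (intro powr_mono') auto
      thus ?thesis by (simp add: add_increasing2)
    next
      case False
      have "N powr Re z \<le> N powr (Re z0 + d)" using r False by (intro powr_mono) auto
      thus ?thesis by (simp add: add_increasing)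
    qed
    have h: "norm (hfun z t) \<le> ((N powr (Re z0 - d) + N powr (Re z0 + d)) * Q) * (C * N ^ k)"
    proof -
      have "norm (t powr z) \<le> N powr Re z * exp (pi * \<bar>Im z\<bar>)"
        unfolding N_def by (rule norm_powr_complex_bounds[OF wedge_nz[OF tw]])
      also have "\<dots> \<le> (N powr (Re z0 - d) + N powr (Re z0 + d)) * Q"
        using r by (intro mult_mono pz) (auto simp: Q_def)
      finally have "norm (t powr z) \<le> (N powr (Re z0 - d) + N powr (Re z0 + d)) * Q" .
      thus ?thesis unfolding hfun_def norm_mult using C(2)[OF tw] C(1) N
        by (intro mult_mono) (auto simp: N_def Q_def)
    qed
    have pk: "norm (pkern e t) \<le> M * (1 + 1 / N) * E"
      unfolding t_def N_def E_def by (rule c1(3)) (use c x in \<open>auto simp: c0_def\<close>)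
    have "norm (hfun z t) * norm (pkern e t) \<le> (((N powr (Re z0 - d) + N powr (Re z0 + d)) * Q) * (C * N ^ k)) * (M * (1 + 1 / N) * E)"
      using h pk C(1) N by (intro mult_mono) (auto simp: Q_def)
    also have "\<dots> = (Q * C * M) * (\<Sum>p\<leftarrow>P. N powr p * E)"
      using N by (simp add: P_def powr_add powr_diff powr_realpow[symmetric] field_simps)
    also have "\<dots> \<le> (Q * C * M) * (\<Sum>p\<leftarrow>P. (x powr p + V powr p * (1 + x) powr p) * E)"
      using C c1 by (intro mult_left_mono sum_list_mono mult_right_mono Npk) (auto simp: Q_def E_def)
    finally have "norm (hfun z t) * norm (pkern e t) * norm (rayv e \<tau>) \<le> (Q * C * M) * (\<Sum>p\<leftarrow>P. (x powr p + V powr p * (1 + x) powr p) * E) * norm (rayv e \<tau>)"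
      by (rule mult_right_mono) simp
    thus ?thesis by (simp only: t_def[symmetric] norm_mult D_def E_def mult_ac)
  qed
  moreover have "c0 > 0" using c1 by (simp add: c0_def)
  ultimately show ?thesis using d(1) by blast
qed

lemma hfun_ray_continuous:
  assumes "0 \<le> c" "c < 1" "unit_sign e"
  shows "continuous_on {0<..} (\<lambda>x. hfun z (of_real c + of_real x * rayv e \<tau>) * pkern e (of_real c + of_real x * rayv e \<tau>) * rayv e \<tau>)"
proof (intro continuous_intros)
  show "continuous_on {0<..} (\<lambda>x. hfun z (of_real c + of_real x * rayv e \<tau>))"
    by (rule continuous_on_compose2[OF holomorphic_on_imp_continuous_on[OF hfun_holomorphic[of z]]])
       (use ray_wedge assms in \<open>auto intro!: continuous_intros\<close>)
  have "of_real c + of_real x * rayv e \<tau> \<notin> \<int>" if "x > 0" for x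
  proof
    assume "of_real c + of_real x * rayv e \<tau> \<in> \<int>"
    then obtain n where "of_real c + of_real x * rayv e \<tau> = of_int n" by (elim Ints_cases)
    from arg_cong[OF this, of Im] show False using that assms tau by auto
  qed
  thus "continuous_on {0<..} (\<lambda>x. pkern e (of_real c + of_real x * rayv e \<tau>))"
    by (intro continuous_on_compose2[OF continuous_on_pkern[OF assms(3), of "- \<int>"]])
       (auto intro!: continuous_intros)
qed

lemma holomorphic_ray_int_hfun: "(\<lambda>z. ray_int \<tau> 0 (hfun z)) holomorphic_on {z. Re z > -1}"
  unfolding ray_int_def
proof (rule holomorphic_on_sum, rule holomorphic_on_integral_halfline)
  fix e :: real assume "e \<in> {1, -1}"
  hence e: "unit_sign e" by auto
  show "open {z. Re z > -1}" by (rule open_halfspace_Re_gt)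
  show "continuous_on {0<..} (\<lambda>x. hfun z (of_real 0 + of_real x * rayv e \<tau>) * pkern e (of_real 0 + of_real x * rayv e \<tau>) * rayv e \<tau>)" for z
    by (rule hfun_ray_continuous) (use e in auto)
  show "(\<lambda>z. hfun z (of_real 0 + of_real x * rayv e \<tau>) * pkern e (of_real 0 + of_real x * rayv e \<tau>) * rayv e \<tau>) holomorphic_on {z. Re z > -1}" for x
    unfolding hfun_def by (intro holomorphic_intros holomorphic_powr_exponent)
  fix z0 :: complex assume "z0 \<in> {z. Re z > -1}"
  hence "Re z0 > -1" by simp
  from hfun_ray_dominated[OF this e] obtain d c0 D where "d > 0" "c0 > 0" "integrable halfline D"
    and D: "\<And>z c x. z \<in> ball z0 d \<Longrightarrow> 0 \<le> c \<Longrightarrow> c \<le> c0 \<Longrightarrow> x > 0 \<Longrightarrow>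
     norm (hfun z (of_real c + of_real x * rayv e \<tau>) * pkern e (of_real c + of_real x * rayv e \<tau>) * rayv e \<tau>) \<le> D x"
    by blast
  show "\<exists>r>0. \<exists>g. integrable halfline g \<and> (\<forall>z\<in>{z. Re z > -1} \<inter> ball z0 r. \<forall>x>0.
     norm (hfun z (of_real 0 + of_real x * rayv e \<tau>) * pkern e (of_real 0 + of_real x * rayv e \<tau>) * rayv e \<tau>) \<le> g x)"
  proof (intro exI[of _ d] conjI exI[of _ D] ballI allI impI)
    fix z x assume "z \<in> {z. Re z > -1} \<inter> ball z0 d" "(x::real) > 0"
    thus "norm (hfun z (of_real 0 + of_real x * rayv e \<tau>) * pkern e (of_real 0 + of_real x * rayv e \<tau>) * rayv e \<tau>) \<le> D x"
      using \<open>c0 > 0\<close> by (intro D) auto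
  qed fact+
qed

lemma ray_int_hfun_limit:
  assumes z: "Re z > -1" and X: "X \<longlonglongrightarrow> 0" "\<And>n. X n > 0" "\<And>n. X n < 1"
  shows "(\<lambda>n. ray_int \<tau> (X n) (hfun z)) \<longlonglongrightarrow> ray_int \<tau> 0 (hfun z)"
  unfolding ray_int_def
proof (rule tendsto_sum)
  fix e :: real assume "e \<in> {1, -1}"
  hence e: "unit_sign e" by auto
  from hfun_ray_dominated[OF z e] obtain d c0 D where d: "d > 0" "c0 > 0" "integrable halfline D"
    and D: "\<And>z' c x. z' \<in> ball z d \<Longrightarrow> 0 \<le> c \<Longrightarrow> c \<le> c0 \<Longrightarrow> x > 0 \<Longrightarrow>
     norm (hfun z' (of_real c + of_real x * rayv e \<tau>) * pkern e (of_real c + of_real x * rayv e \<tau>) * rayv e \<tau>) \<le> D x"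
    by blast
  have "eventually (\<lambda>n. X n < c0) sequentially" using order_tendstoD(2)[OF X(1) d(2)] .
  then obtain N where N: "\<And>n. n \<ge> N \<Longrightarrow> X n < c0" by (auto simp: eventually_sequentially)
  let ?F = "\<lambda>c x. hfun z (of_real c + of_real x * rayv e \<tau>) * pkern e (of_real c + of_real x * rayv e \<tau>) * rayv e \<tau>"
  have "(\<lambda>n. \<integral>x. ?F (X (n + N)) x \<partial>halfline) \<longlonglongrightarrow> (\<integral>x. ?F 0 x \<partial>halfline)"
  proof (rule integral_dominated_convergence[where w = D])
    show "?F 0 \<in> borel_measurable halfline"
      by (intro continuous_imp_measurable_on_sets_lebesgue hfun_ray_continuous e) auto
    show "?F (X (n + N)) \<in> borel_measurable halfline" for n
      using X(2,3)[of "n + N"] by (intro continuous_imp_measurable_on_sets_lebesgue hfun_ray_continuous e) auto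
    show "AE x in halfline. norm (?F (X (n + N)) x) \<le> D x" for n
      using d N[of "n + N"] X(2)[of "n + N"] by (intro AE_I2 D) auto
    show "AE x in halfline. (\<lambda>n. ?F (X (n + N)) x) \<longlonglongrightarrow> ?F 0 x"
    proof (rule AE_I2)
      fix x assume "x \<in> space halfline"
      hence x: "x > 0" by simp
      let ?t = "\<lambda>c. of_real c + of_real x * rayv e \<tau>"
      have t0: "?t 0 \<in> wedge \<tau>'" by (rule ray_wedge) (use x e in auto)
      have tZ: "?t 0 \<notin> \<int>"
      proof
        assume "?t 0 \<in> \<int>"
        then obtain n where "?t 0 = of_int n" by (elim Ints_cases)
        from arg_cong[OF this, of Im] show False using x e tau by auto
      qed
      have 1: "isCont (hfun z) (?t 0)"
        using holomorphic_on_imp_continuous_on[OF hfun_holomorphic[of z]] t0 open_wedge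
        by (simp add: continuous_on_eq_continuous_at)
      have "continuous_on (- \<int>) (pkern e)" by (rule continuous_on_pkern[OF e]) auto
      hence 2: "isCont (pkern e) (?t 0)"
        using tZ by (simp add: continuous_on_eq_continuous_at open_Compl closed_Ints)
      have "(\<lambda>n. X (n + N)) \<longlonglongrightarrow> 0" using X(1) by (rule LIMSEQ_ignore_initial_segment)
      hence "(\<lambda>n. ?t (X (n + N))) \<longlonglongrightarrow> ?t 0" by (intro tendsto_intros)
      thus "(\<lambda>n. ?F (X (n + N)) x) \<longlonglongrightarrow> ?F 0 x"
        by (intro tendsto_mult isCont_tendsto_compose[OF 1] isCont_tendsto_compose[OF 2] tendsto_const)
    qed
  qed (use d in auto)
  thus "(\<lambda>n. \<integral>x. ?F (X n) x \<partial>halfline) \<longlonglongrightarrow> (\<integral>x. ?F 0 x \<partial>halfline)" by (rule LIMSEQ_offset)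
qed

lemma hreg_real_bound:
  shows "\<exists>K\<ge>0. \<forall>t>0. norm (hreg z (of_real t)) \<le> K * (t powr Re z * (1 + t) powr (- real k))"
proof -
  obtain K1 where K1: "K1 \<ge> 0" "\<And>t. 0 < t \<Longrightarrow> t \<le> 1 \<Longrightarrow> norm (planck k w (of_real t) - 1 / (w * of_real t ^ k)) \<le> K1"
    using planck_small[OF k w] by blast
  obtain K2 where K2: "K2 \<ge> 0" "\<And>t. 1 \<le> t \<Longrightarrow> norm (planck k w (of_real t)) \<le> K2 * exp (- Re w * t)"
    using planck_large[OF k w] by blast
  obtain L where L: "L > 0" "\<And>t. t \<ge> 0 \<Longrightarrow> (1 + t) powr real k \<le> L * exp (Re w * t)"
    using powr_le_exp_bound[OF w, of "real k"] by blast
  define K where "K = max (K1 * 2 powr real k) (K2 * L + 2 powr real k / norm w)"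
  have K: "K \<ge> 0" unfolding K_def using K1 by (simp add: le_max_iff_disj)
  have "norm (hreg z (of_real t)) \<le> K * (t powr Re z * (1 + t) powr (- real k))" if t: "t > 0" for t
  proof -
    have "norm (planck k w (of_real t) - 1 / (w * of_real t ^ k)) \<le> K * (1 + t) powr (- real k)"
    proof (cases "t \<le> 1")
      case True
      have "(1 + t) powr real k \<le> 2 powr real k" using t True by (intro powr_mono2) auto
      hence "1 \<le> 2 powr real k * (1 + t) powr (- real k)" using t by (simp add: powr_minus field_simps)
      hence "K1 * 1 \<le> K1 * (2 powr real k * (1 + t) powr (- real k))" using K1(1) by (rule mult_left_mono)
      also have "\<dots> = (K1 * 2 powr real k) * (1 + t) powr (- real k)" by simp
      also have "\<dots> \<le> K * (1 + t) powr (- real k)" by (intro mult_right_mono) (auto simp: K_def)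
      finally show ?thesis using K1(2)[OF t True] by simp
    next
      case False
      have "K2 * exp (- Re w * t) \<le> (K2 * L) * (1 + t) powr (- real k)"
      proof -
        have "exp (- Re w * t) * (1 + t) powr real k \<le> L"
          using L(2)[of t] t by (simp add: exp_minus field_simps)
        hence "exp (- Re w * t) \<le> L * (1 + t) powr (- real k)" using t by (simp add: powr_minus field_simps)
        from mult_left_mono[OF this K2(1)] show ?thesis by simp
      qed
      moreover have "norm (1 / (w * of_real t ^ k)) \<le> 2 powr real k / norm w * (1 + t) powr (- real k)"
      proof -
        have "(1 + t) powr real k \<le> (2 * t) powr real k" using False by (intro powr_mono2) auto
        also have "\<dots> = 2 powr real k * t ^ k" using t by (simp add: powr_mult powr_realpow)
        finally have "1 / t ^ k \<le> 2 powr real k * (1 + t) powr (- real k)" using t by (simp add: powr_minus field_simps)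
        hence "1 / t ^ k / norm w \<le> 2 powr real k * (1 + t) powr (- real k) / norm w" by (rule divide_right_mono) simp
        thus ?thesis using t by (simp add: norm_divide norm_mult norm_power field_simps)
      qed
      moreover have "norm (planck k w (of_real t)) \<le> K2 * exp (- Re w * t)" using K2(2)[of t] False by simp
      ultimately have "norm (planck k w (of_real t) - 1 / (w * of_real t ^ k)) \<le> (K2 * L + 2 powr real k / norm w) * (1 + t) powr (- real k)"
        using norm_triangle_ineq4[of "planck k w (of_real t)" "1 / (w * of_real t ^ k)"] unfolding distrib_right by linarith
      also have "\<dots> \<le> K * (1 + t) powr (- real k)" by (intro mult_right_mono) (auto simp: K_def)
      finally show ?thesis .
    qed
    hence "norm (of_real t powr z) * norm (planck k w (of_real t) - 1 / (w * of_real t ^ k)) \<le> t powr Re z * (K * (1 + t) powr (- real k))"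
      using t by (intro mult_mono) (auto simp: norm_powr_real_powr)
    thus ?thesis by (simp add: hreg_def norm_mult mult_ac)
  qed
  thus ?thesis using K by blast
qed

text \<open>Both exponents in the majorant of \<open>hreg\<close> are negative here, so its value at
  \<open>x\<close> also dominates the shifted argument \<open>X n + x\<close>. It is integrable
  since Re z - k < -1.\<close>

lemma hreg_integral_limit:
  assumes z: "Re z > -1" "Re z < 0" and X: "X \<longlonglongrightarrow> 0" "\<And>n. X n > 0"
  shows "(\<lambda>n. \<integral>x. hreg z (of_real (X n + x)) \<partial>halfline) \<longlonglongrightarrow> (\<integral>x. hreg z (of_real x) \<partial>halfline)"
proof -
  obtain K where K: "K \<ge> 0" "\<And>t. t > 0 \<Longrightarrow> norm (hreg z (of_real t)) \<le> K * (t powr Re z * (1 + t) powr (- real k))"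
    using hreg_real_bound[of z] by blast
  have inw: "complex_of_real x \<in> wedge \<tau>'" if "x > 0" for x using that tau by (simp add: wedge_def)
  have cont: "continuous_on (wedge \<tau>') (hreg z)" by (rule holomorphic_on_imp_continuous_on[OF hreg_holomorphic])
  show ?thesis
  proof (rule integral_dominated_convergence[where w = "\<lambda>x. K * (x powr Re z * (1 + x) powr (- real k))"])
    show "integrable halfline (\<lambda>x. K * (x powr Re z * (1 + x) powr (- real k)))"
      using z k by (intro integrable_mult_right integrable_powr_one_plus) auto
    show "(\<lambda>x. hreg z (of_real x)) \<in> borel_measurable halfline"
      by (intro continuous_imp_measurable_on_sets_lebesgue continuous_on_compose2[OF cont] continuous_intros) (auto intro: inw)
    show "(\<lambda>x. hreg z (of_real (X n + x))) \<in> borel_measurable halfline" for n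
      using X(2)[of n]
      by (intro continuous_imp_measurable_on_sets_lebesgue continuous_on_compose2[OF cont] continuous_intros) (auto intro!: inw simp del: of_real_add)
    show "AE x in halfline. norm (hreg z (of_real (X n + x))) \<le> K * (x powr Re z * (1 + x) powr (- real k))" for n
    proof (rule AE_I2)
      fix x assume "x \<in> space halfline"
      hence x: "x > 0" by simp
      have "norm (hreg z (of_real (X n + x))) \<le> K * ((X n + x) powr Re z * (1 + (X n + x)) powr (- real k))"
        using x X(2)[of n] by (intro K) auto
      also have "\<dots> \<le> K * (x powr Re z * (1 + x) powr (- real k))"
        using x X(2)[of n] K(1) z by (intro mult_left_mono mult_mono powr_mono2') auto
      finally show "norm (hreg z (of_real (X n + x))) \<le> K * (x powr Re z * (1 + x) powr (- real k))" .
    qed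
    show "AE x in halfline. (\<lambda>n. hreg z (of_real (X n + x))) \<longlonglongrightarrow> hreg z (of_real x)"
    proof (rule AE_I2)
      fix x assume "x \<in> space halfline"
      hence "isCont (hreg z) (of_real x)"
        using cont inw[of x] open_wedge by (simp add: continuous_on_eq_continuous_at)
      moreover have "(\<lambda>n. complex_of_real (X n + x)) \<longlonglongrightarrow> of_real (0 + x)" by (intro tendsto_intros X)
      ultimately show "(\<lambda>n. hreg z (of_real (X n + x))) \<longlonglongrightarrow> hreg z (of_real x)"
        by (intro isCont_tendsto_compose[where g = "hreg z"]) auto
    qed
  qed
qed

text \<open>Abel--Plana for \<open>hreg\<close> from \<open>c\<close> splits its ray integrals into
  those of \<open>hfun\<close> and of - t^z / 2. By \<open>zeta_ray_formula\<close> at the same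
  \<open>c\<close> and \<open>\<tau>\<close>, the latter equal - zeta (-z) / 2 up to a multiple of
  c^(1+z), which vanishes in the limit. The subtracted pole is restored by the Dirichlet series of
  zeta (k - z). The strip Re z < 0 gives Re (k - z) > 1 for every \<open>k \<ge> 1\<close>.\<close>

lemma lambert_small_strip:
  assumes z: "Re z > -1" "Re z < 0"
  shows "(\<lambda>d. of_nat (Suc d) powr z * planck k w (of_nat (Suc d))) sums (main_terms k z w + ray_int \<tau> 0 (hfun z))"
proof -
  define c where "c n = 1 / (real n + 2)" for n :: nat
  have c: "c n > 0" "c n < 1" for n by (simp_all add: c_def)
  have clim: "c \<longlonglongrightarrow> 0" unfolding c_def by real_asymp
  obtain C where C: "C \<ge> 0" "\<And>t. t \<in> wedge \<tau>' \<Longrightarrow> norm (hreg z t) \<le> C * Re t powr (- (real k - Re z))"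
    using hreg_wedge_bound[of z] z k by auto
  obtain C' where C': "C' \<ge> 0" "\<And>t. t \<in> wedge \<tau>' \<Longrightarrow> norm (bexp (w * t ^ k)) \<le> C' * norm t ^ k"
    using bexp_wedge_bound by blast
  have mz1: "- z \<noteq> 1"
  proof
    assume "- z = 1"
    from arg_cong[OF this, of Re] show False using z by simp
  qed
  have zz: "zeta (- z) = of_real c powr (1 + z) / (- z - 1) + ray_int \<tau> c (\<lambda>t. t powr z)" if "0 < c" "c < 1" for c
    using zeta_ray_formula[OF that tau(1)] mz1 by (simp add: fun_eq_iff)
  have rays: "ray_int \<tau> c (hreg z) = ray_int \<tau> c (hfun z) - 1 / 2 * ray_int \<tau> c (\<lambda>t. t powr z)" if c: "0 < c" "c < 1" for c
  proof -
    have E: "(\<integral>x. hreg z (of_real c + of_real x * rayv e \<tau>) * pkern e (of_real c + of_real x * rayv e \<tau>) * rayv e \<tau> \<partial>halfline) =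
      (\<integral>x. hfun z (of_real c + of_real x * rayv e \<tau>) * pkern e (of_real c + of_real x * rayv e \<tau>) * rayv e \<tau> \<partial>halfline) -
      1 / 2 * (\<integral>x. (of_real c + of_real x * rayv e \<tau>) powr z * pkern e (of_real c + of_real x * rayv e \<tau>) * rayv e \<tau> \<partial>halfline)"
      if e: "unit_sign e" for e
    proof -
      define V where "V = 1 + norm (rayv e \<tau>)"
      define W where "W = exp (pi * \<bar>Im z\<bar>)"
      have V: "V > 0" by (simp add: V_def add_pos_nonneg)
      have tz: "norm ((of_real c + of_real x * rayv e \<tau>) powr z) \<le> c powr Re z * W" if "x \<ge> 0" for x
      proof -
        have "c + x \<le> norm (of_real c + of_real x * rayv e \<tau>)" by (rule Re_ray_le_norm)
        hence "norm (of_real c + of_real x * rayv e \<tau>) powr Re z \<le> c powr Re z" using c z that by (intro powr_mono2') auto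
        hence "norm (of_real c + of_real x * rayv e \<tau>) powr Re z * W \<le> c powr Re z * W" by (intro mult_right_mono) (auto simp: W_def)
        moreover have "of_real c + of_real x * rayv e \<tau> \<noteq> 0" using ray_nonzero[of c x e \<tau>] c that by simp
        from norm_powr_complex_bounds[OF this, of z]
        have "norm ((of_real c + of_real x * rayv e \<tau>) powr z) \<le> norm (of_real c + of_real x * rayv e \<tau>) powr Re z * W"
          by (simp add: W_def)
        ultimately show ?thesis by (rule order.trans[rotated])
      qed
      have cw: "of_real c + of_real x * rayv e \<tau> \<in> wedge \<tau>'" if "x \<ge> 0" for x
        using ray_in_wedge[of c \<tau> \<tau>' e x] tau e c that by auto
      have i1: "integrable halfline (\<lambda>x. (of_real c + of_real x * rayv e \<tau>) powr z * pkern e (of_real c + of_real x * rayv e \<tau>) * rayv e \<tau>)"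
        using tau by (intro integrable_ray_integrand[OF c tau e, where K = "c powr Re z * W" and p = 0] continuous_on_powr_wedge) (auto intro: tz)
      have i2: "integrable halfline (\<lambda>x. hfun z (of_real c + of_real x * rayv e \<tau>) * pkern e (of_real c + of_real x * rayv e \<tau>) * rayv e \<tau>)"
      proof (rule integrable_ray_integrand[OF c tau e holomorphic_on_imp_continuous_on[OF hfun_holomorphic], where K = "c powr Re z * W * C' * V ^ k" and p = "real k"])
        fix x :: real assume x: "x \<ge> 0"
        let ?t = "of_real c + of_real x * rayv e \<tau>"
        have "norm (bexp (w * ?t ^ k)) \<le> C' * norm ?t ^ k" using C' cw[OF x] by blast
        also have "\<dots> \<le> C' * (V * (1 + x)) ^ k" using C' x c unfolding V_def by (intro mult_left_mono power_mono norm_ray_le) auto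
        finally have "norm (?t powr z) * norm (bexp (w * ?t ^ k)) \<le> (c powr Re z * W) * (C' * (V * (1 + x)) ^ k)"
          using tz[OF x] by (intro mult_mono) (auto simp: W_def)
        thus "norm (hfun z ?t) \<le> c powr Re z * W * C' * V ^ k * (1 + x) powr real k"
          using x by (simp add: hfun_def norm_mult power_mult_distrib powr_realpow mult_ac)
      qed
      have "(\<integral>x. hreg z (of_real c + of_real x * rayv e \<tau>) * pkern e (of_real c + of_real x * rayv e \<tau>) * rayv e \<tau> \<partial>halfline) =
        (\<integral>x. hfun z (of_real c + of_real x * rayv e \<tau>) * pkern e (of_real c + of_real x * rayv e \<tau>) * rayv e \<tau> -
        1 / 2 * ((of_real c + of_real x * rayv e \<tau>) powr z * pkern e (of_real c + of_real x * rayv e \<tau>) * rayv e \<tau>) \<partial>halfline)"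
        unfolding hreg_eq by (simp only: left_diff_distrib mult.assoc)
      also have "\<dots> = (\<integral>x. hfun z (of_real c + of_real x * rayv e \<tau>) * pkern e (of_real c + of_real x * rayv e \<tau>) * rayv e \<tau> \<partial>halfline) -
      (\<integral>x. 1 / 2 * ((of_real c + of_real x * rayv e \<tau>) powr z * pkern e (of_real c + of_real x * rayv e \<tau>) * rayv e \<tau>) \<partial>halfline)"
        by (rule Bochner_Integration.integral_diff[OF i2 integrable_mult_right[OF i1]])
      finally show ?thesis unfolding integral_mult_right_zero .
    qed
    show ?thesis unfolding ray_int_def sum_distrib_left sum_subtractf[symmetric]
      by (intro sum.cong refl, rule E) auto
  qed
  have S: "(\<lambda>d. hreg z (of_nat (Suc d))) sums ((\<integral>x. hreg z (of_real (c n + x)) \<partial>halfline) + ray_int \<tau> (c n) (hfun z)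
       - 1 / 2 * (zeta (- z) - of_real (c n) powr (1 + z) / (- z - 1)))" for n
  proof -
    have "(\<lambda>d. hreg z (of_nat (Suc d))) sums ((\<integral>x. hreg z (of_real (c n + x)) \<partial>halfline) + ray_int \<tau> (c n) (hreg z))"
      by (rule abel_plana[OF hreg_holomorphic tau c, where b = "real k - Re z" and C = C]) (use C z k in auto)
    thus ?thesis unfolding rays[OF c[of n]] zz[OF c[of n]] by (simp add: algebra_simps)
  qed
  have "(\<lambda>n. (\<integral>x. hreg z (of_real (c n + x)) \<partial>halfline) + ray_int \<tau> (c n) (hfun z)
       - 1 / 2 * (zeta (- z) - of_real (c n) powr (1 + z) / (- z - 1)))
     \<longlonglongrightarrow> (\<integral>x. hreg z (of_real x) \<partial>halfline) + ray_int \<tau> 0 (hfun z) - 1 / 2 * (zeta (- z) - 0 / (- z - 1))"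
  proof (intro tendsto_intros hreg_integral_limit ray_int_hfun_limit z clim c)
    show "(\<lambda>n. complex_of_real (c n) powr (1 + z)) \<longlonglongrightarrow> 0"
    proof (rule Lim_null_comparison)
      show "eventually (\<lambda>n. norm (complex_of_real (c n) powr (1 + z)) \<le> c n powr (1 + Re z)) sequentially"
        using c by (intro always_eventually allI) (subst norm_powr_real_powr, auto intro: less_imp_le)
      show "(\<lambda>n. c n powr (1 + Re z)) \<longlonglongrightarrow> 0"
      proof -
        have "eventually (\<lambda>n. 0 \<le> c n) sequentially" using c by (intro always_eventually allI less_imp_le)
        hence "(\<lambda>n. c n powr (1 + Re z)) \<longlonglongrightarrow> 0 powr (1 + Re z)"
          using z by (intro tendsto_powr'[OF clim tendsto_const]) auto
        thus ?thesis by simp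
      qed
    qed
    show "- z - 1 \<noteq> 0" using mz1 by (simp add: diff_eq_eq)
  qed
  \<comment> \<open>For each starting point this is the same sum, so the sequence is constant and
    its limit is its value.\<close>
  moreover have "(\<integral>x. hreg z (of_real (c n + x)) \<partial>halfline) + ray_int \<tau> (c n) (hfun z)
       - 1 / 2 * (zeta (- z) - of_real (c n) powr (1 + z) / (- z - 1)) = (\<Sum>d. hreg z (of_nat (Suc d)))" for n
    using sums_unique[OF S] by simp
  ultimately have "(\<Sum>d. hreg z (of_nat (Suc d))) = (\<integral>x. hreg z (of_real x) \<partial>halfline) + ray_int \<tau> 0 (hfun z) - 1 / 2 * zeta (- z)"
    by (simp add: LIMSEQ_const_iff)
  hence S1: "(\<lambda>d. hreg z (of_nat (Suc d))) sums ((\<integral>x. hreg z (of_real x) \<partial>halfline) + ray_int \<tau> 0 (hfun z) - 1 / 2 * zeta (- z))"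
    using S[of 0] by (simp add: sums_iff)
  have "(\<lambda>d. (1 / w) * of_nat (Suc d) powr (- (of_nat k - z))) sums ((1 / w) * zeta (of_nat k - z))"
    using z k by (intro sums_mult sums_zeta) auto
  from sums_add[OF S1 this]
  have "(\<lambda>d. hreg z (of_nat (Suc d)) + (1 / w) * of_nat (Suc d) powr (- (of_nat k - z))) sums
     ((\<integral>x. hreg z (of_real x) \<partial>halfline) + ray_int \<tau> 0 (hfun z) - 1 / 2 * zeta (- z) + (1 / w) * zeta (of_nat k - z))" .
  also have "(\<lambda>d. hreg z (of_nat (Suc d)) + (1 / w) * of_nat (Suc d) powr (- (of_nat k - z))) = (\<lambda>d. of_nat (Suc d) powr z * planck k w (of_nat (Suc d)))"
  proof
    fix d
    have "(of_nat (Suc d) :: complex) powr (- (of_nat k - z)) = of_nat (Suc d) powr z / of_nat (Suc d) ^ k"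
      by (simp only: minus_diff_eq powr_diff powr_nat' of_nat_eq_0_iff simp_thms nat.distinct)
    thus "hreg z (of_nat (Suc d)) + (1 / w) * of_nat (Suc d) powr (- (of_nat k - z)) = of_nat (Suc d) powr z * planck k w (of_nat (Suc d))"
      by (simp add: hreg_def algebra_simps)
  qed
  also have "(\<integral>x. hreg z (of_real x) \<partial>halfline) = Gamma ((1 + z) / of_nat k) * zeta ((1 + z) / of_nat k) / (of_nat k * w powr ((1 + z) / of_nat k))"
    unfolding hreg_def by (rule mellin_strip[OF k w z])
  finally show ?thesis by (simp add: main_terms_def algebra_simps)
qed

lemma holomorphic_lambert:
  "(\<lambda>z. \<Sum>d. of_nat (Suc d) powr z * planck k w (of_nat (Suc d))) holomorphic_on UNIV"
  and summable_lambert: "summable (\<lambda>d. norm (of_nat (Suc d) powr z * planck k w (of_nat (Suc d))))"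
proof -
  obtain K where K: "K \<ge> 0" "\<And>t. 1 \<le> t \<Longrightarrow> norm (planck k w (of_real t)) \<le> K * exp (- Re w * t)"
    using planck_large[OF k w] by blast
  have *: "\<exists>g. summable g \<and> (\<forall>z d. \<bar>Re z\<bar> \<le> P \<longrightarrow> norm (of_nat (Suc d) powr z * planck k w (of_nat (Suc d))) \<le> g d)" for P
  proof -
    obtain L where L: "L > 0" "\<And>t. t \<ge> 0 \<Longrightarrow> (1 + t) powr P \<le> L * exp (Re w / 2 * t)"
      using powr_le_exp_bound[of "Re w / 2" P] w by auto
    define g where "g d = (L * K) * exp (- Re w / 2) ^ d" for d :: nat
    have "summable g" unfolding g_def using w by (intro summable_mult summable_geometric) auto
    moreover have "norm (of_nat (Suc d) powr z * planck k w (of_nat (Suc d))) \<le> g d" if "\<bar>Re z\<bar> \<le> P" for z d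
    proof -
      have "norm (of_nat (Suc d) powr z) = real (Suc d) powr Re z"
        using norm_powr_real_powr[of "of_nat (Suc d)" z] by simp
      also have "\<dots> \<le> real (Suc d) powr P" using that by (intro powr_mono) auto
      also have "\<dots> \<le> L * exp (Re w / 2 * real d)" using L(2)[of "real d"] by simp
      finally have 1: "norm (of_nat (Suc d) powr z) \<le> L * exp (Re w / 2 * real d)" .
      have "norm (planck k w (of_nat (Suc d))) \<le> K * exp (- Re w * real (Suc d))" using K(2)[of "real (Suc d)"] by simp
      also have "\<dots> \<le> K * exp (- Re w * real d)" using K w by (intro mult_left_mono) auto
      finally have "norm (of_nat (Suc d) powr z) * norm (planck k w (of_nat (Suc d))) \<le> (L * exp (Re w / 2 * real d)) * (K * exp (- Re w * real d))"
        using 1 L by (intro mult_mono) auto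
      also have "\<dots> = (L * K) * exp (Re w / 2 * real d + - Re w * real d)" by (simp only: exp_add mult_ac)
      also have "Re w / 2 * real d + - Re w * real d = real d * (- Re w / 2)" by (simp add: field_simps)
      also have "exp \<dots> = exp (- Re w / 2) ^ d" by (rule exp_of_nat_mult)
      finally show ?thesis by (simp add: norm_mult g_def)
    qed
    ultimately show ?thesis by blast
  qed
  show "summable (\<lambda>d. norm (of_nat (Suc d) powr z * planck k w (of_nat (Suc d))))"
  proof -
    obtain g where g: "summable g" "\<And>z' d. \<bar>Re z'\<bar> \<le> \<bar>Re z\<bar> \<Longrightarrow> norm (of_nat (Suc d) powr z' * planck k w (of_nat (Suc d))) \<le> g d"
      using *[of "\<bar>Re z\<bar>"] by blast
    show ?thesis by (rule summable_comparison_test'[OF g(1), of 0]) (use g(2)[of z] in auto)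
  qed
  show "(\<lambda>z. \<Sum>d. of_nat (Suc d) powr z * planck k w (of_nat (Suc d))) holomorphic_on UNIV"
  proof (rule holomorphic_on_suminf_Mtest)
    show "(\<lambda>z. of_nat (Suc d) powr z * planck k w (of_nat (Suc d))) holomorphic_on UNIV" for d
      by (intro holomorphic_intros holomorphic_powr_exponent)
    fix z0 :: complex
    obtain g where g: "summable g" "\<And>z' d. \<bar>Re z'\<bar> \<le> \<bar>Re z0\<bar> + 1 \<Longrightarrow> norm (of_nat (Suc d) powr z' * planck k w (of_nat (Suc d))) \<le> g d"
      using *[of "\<bar>Re z0\<bar> + 1"] by blast
    have "\<bar>Re z\<bar> \<le> \<bar>Re z0\<bar> + 1" if "z \<in> ball z0 1" for z
      using that abs_Re_le_cmod[of "z0 - z"] by (auto simp: dist_norm)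
    thus "\<exists>r>0. \<exists>g. summable g \<and> (\<forall>z\<in>UNIV \<inter> ball z0 r. \<forall>d. norm (of_nat (Suc d) powr z * planck k w (of_nat (Suc d))) \<le> g d)"
      using g by (intro exI[of _ 1] conjI exI[of _ g]) auto
  qed auto
qed

text \<open>Continuation in \<open>z\<close> from the strip -1 < Re z < 0. The point
  \<open>k - 1\<close> is taken out since there \<open>zeta (k - z)\<close> and
  \<open>zeta ((1 + z) / k)\<close> both reach the pole of \<open>zeta\<close>; the punctured strip
  is still connected.\<close>

theorem lambert_formula:
  assumes z: "Re z > -1" "Re z < real k" "z \<noteq> of_nat k - 1"
  shows "(\<Sum>d. of_nat (Suc d) powr z * planck k w (of_nat (Suc d))) = main_terms k z w + ray_int \<tau> 0 (hfun z)"
proof (rule analytic_continuation_open[of "{z. Re z > -1} \<inter> {z. Re z < 0}" "({z. Re z > -1} \<inter> {z. Re z < real k}) - {of_nat k - 1}"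
    "\<lambda>z. \<Sum>d. of_nat (Suc d) powr z * planck k w (of_nat (Suc d))" "\<lambda>z. main_terms k z w + ray_int \<tau> 0 (hfun z)"])
  let ?S = "({z. Re z > -1} \<inter> {z. Re z < real k}) - {of_nat k - 1}"
  have k0: "of_nat k \<noteq> (0::complex)" using k by simp
  show "open ({z. Re z > -1} \<inter> {z. Re z < 0})" by (intro open_Int open_halfspace_Re_gt open_halfspace_Re_lt)
  show "open ?S" by (intro open_Diff open_Int open_halfspace_Re_gt open_halfspace_Re_lt) auto
  have "(- (1 / 2) :: complex) \<in> {z. Re z > -1} \<inter> {z. Re z < 0}" by simp
  thus "{z. Re z > -1} \<inter> {z. Re z < 0} \<noteq> {}" by (metis empty_iff)
  show "connected ?S"
    by (intro connected_open_delete convex_connected convex_Int convex_halfspace_Re_gt convex_halfspace_Re_lt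
         open_Int open_halfspace_Re_gt open_halfspace_Re_lt) auto
  show "{z. Re z > -1} \<inter> {z. Re z < 0} \<subseteq> ?S" using k by auto
  show "(\<lambda>z. \<Sum>d. of_nat (Suc d) powr z * planck k w (of_nat (Suc d))) holomorphic_on ?S"
    by (rule holomorphic_on_subset[OF holomorphic_lambert]) auto
  show "z \<in> ?S" using z by auto
  show "(\<Sum>d. of_nat (Suc d) powr z * planck k w (of_nat (Suc d))) = main_terms k z w + ray_int \<tau> 0 (hfun z)"
    if "z \<in> {z. Re z > -1} \<inter> {z. Re z < 0}" for z
    using sums_unique[OF lambert_small_strip[of z]] that by auto
  have zcomp: "(\<lambda>z. zeta (f z)) holomorphic_on ?S" if "f holomorphic_on ?S" "\<And>z. z \<in> ?S \<Longrightarrow> f z \<noteq> 1" for f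
  proof -
    have "(zeta \<circ> f) holomorphic_on ?S"
    proof (rule holomorphic_on_compose_gen[OF that(1) holomorphic_zeta], rule image_subsetI)
      fix z assume "z \<in> ?S"
      from that(2)[OF this] show "f z \<in> - {1}" by simp
    qed
    thus ?thesis by (simp add: o_def)
  qed
  have i1: "- z \<noteq> 1" if "z \<in> ?S" for z
  proof
    assume "- z = 1"
    from arg_cong[OF this, of Re] show False using that by simp
  qed
  have i2: "of_nat k - z \<noteq> 1" if "z \<in> ?S" for z using that by (auto simp: algebra_simps)
  have i3: "(1 + z) / of_nat k \<noteq> 1" if "z \<in> ?S" for z using that k0 by (auto simp: field_simps)
  have i4: "(1 + z) / of_nat k \<notin> \<int>\<^sub>\<le>\<^sub>0" if "z \<in> ?S" for z
  proof -
    have "Re ((1 + z) / of_nat k) > 0" using that k by simp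
    thus ?thesis by (metis nonpos_Ints_cases complex_Re_of_int not_less of_int_le_0_iff)
  qed
  have h1: "(\<lambda>z. zeta (- z)) holomorphic_on ?S" by (intro zcomp i1 holomorphic_intros)
  have h2: "(\<lambda>z. zeta (of_nat k - z)) holomorphic_on ?S" by (intro zcomp i2 holomorphic_intros)
  have h3: "(\<lambda>z. zeta ((1 + z) / of_nat k)) holomorphic_on ?S" using k0 by (intro zcomp i3 holomorphic_intros)
  have h4: "(\<lambda>z. Gamma ((1 + z) / of_nat k)) holomorphic_on ?S" using k0 i4 by (intro holomorphic_intros) auto
  have h5: "(\<lambda>z. ray_int \<tau> 0 (hfun z)) holomorphic_on ?S"
    by (rule holomorphic_on_subset[OF holomorphic_ray_int_hfun]) auto
  show "(\<lambda>z. main_terms k z w + ray_int \<tau> 0 (hfun z)) holomorphic_on ?S"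
    unfolding main_terms_def
    by (rule holomorphic_on_add, rule holomorphic_on_add, rule holomorphic_on_add)
       (intro holomorphic_intros holomorphic_powr_exponent h1 h2 h3 h4 h5; use k0 wnz in simp)+
qed

end

section \<open>The function B as an integral along rays\<close>

text \<open>Besides holomorphy, this identifies the derivative as the series of the derivatives,
  which the differential equation below requires. It is again the integral lemma, for counting
  measure.\<close>

lemma has_field_derivative_suminf_Mtest:
  fixes f f' :: "nat \<Rightarrow> complex \<Rightarrow> complex"
  assumes S: "open S" "s0 \<in> S"
    and der: "\<And>n s. s \<in> S \<Longrightarrow> (f n has_field_derivative f' n s) (at s)"
    and r: "r > 0" and g: "summable g" and bound: "\<And>s n. s \<in> S \<Longrightarrow> s \<in> ball s0 r \<Longrightarrow> norm (f n s) \<le> g n"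
    and sf: "summable (\<lambda>n. norm (f' n s0))"
  shows "((\<lambda>s. \<Sum>n. f n s) has_field_derivative (\<Sum>n. f' n s0)) (at s0)"
proof -
  let ?M = "count_space (UNIV :: nat set)"
  have g0: "0 \<le> g n" for n using bound[OF S(2), of n] r order.trans[OF norm_ge_zero] by auto
  have gi: "integrable ?M g" using g g0 by (simp add: integrable_count_space_nat_iff)
  have "((\<lambda>s. \<integral>n. f n s \<partial>?M) has_field_derivative (\<integral>n. deriv (\<lambda>s. f n s) s0 \<partial>?M)) (at s0)"
  proof (rule has_field_derivative_integral[OF S])
    show "(\<lambda>s. f n s) holomorphic_on S" for n
      using der S(1) by (subst holomorphic_on_open) blast+
    show "\<exists>r>0. \<exists>g. integrable ?M g \<and> (\<forall>s\<in>S \<inter> ball s0 r. \<forall>n\<in>space ?M. norm (f n s) \<le> g n)"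
      using r gi bound by (intro exI[of _ r] conjI exI[of _ g]) auto
  qed auto
  also have "(\<lambda>n. deriv (\<lambda>s. f n s) s0) = (\<lambda>n. f' n s0)"
    using DERIV_imp_deriv[OF der[OF S(2)]] by auto
  also have "(\<integral>n. f' n s0 \<partial>?M) = (\<Sum>n. f' n s0)"
    by (intro integral_count_space_nat) (use sf in \<open>simp add: integrable_count_space_nat_iff\<close>)
  finally have 1: "((\<lambda>s. \<integral>n. f n s \<partial>?M) has_field_derivative (\<Sum>n. f' n s0)) (at s0)" .
  have "(\<integral>n. f n s \<partial>?M) = (\<Sum>n. f n s)" if "s \<in> S \<inter> ball s0 r" for s
  proof (intro integral_count_space_nat)
    have "summable (\<lambda>n. norm (f n s))"
      by (rule summable_comparison_test'[OF g, of 0]) (use bound that in auto)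
    thus "integrable ?M (\<lambda>n. f n s)" by (simp add: integrable_count_space_nat_iff)
  qed
  moreover have "open (S \<inter> ball s0 r)" "s0 \<in> S \<inter> ball s0 r" using S r by auto
  ultimately show ?thesis using 1
    by (subst (asm) DERIV_cong_ev[OF refl _ refl]) (auto simp: eventually_nhds)
qed

section \<open>The power series in the formula for \<open>B\<close>\<close>

lemma norm_pochhammer_ge_fact:
  assumes "Re s \<ge> 1"
  shows "norm (pochhammer s n) \<ge> fact n"
proof (induction n)
  case (Suc n)
  have "real (Suc n) \<le> Re (s + of_nat n)" using assms by simp
  also have "\<dots> \<le> norm (s + of_nat n)" by (rule complex_Re_le_cmod)
  finally have "fact n * real (Suc n) \<le> norm (pochhammer s n) * norm (s + of_nat n)"
    using Suc by (intro mult_mono) auto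
  thus ?case by (simp add: pochhammer_Suc norm_mult mult.commute)
qed auto

lemma norm_pochhammer_le:
  fixes s :: complex
  shows "norm (pochhammer s n) \<le> (norm s + real n) ^ n"
proof (induction n)
  case (Suc n)
  have "norm (s + of_nat n) \<le> norm s + real n" by (metis norm_triangle_ineq norm_of_nat)
  also have "\<dots> \<le> norm s + real (Suc n)" by simp
  finally have 1: "norm (s + of_nat n) \<le> norm s + real (Suc n)" .
  have "(norm s + real n) ^ n \<le> (norm s + real (Suc n)) ^ n" by (intro power_mono) auto
  hence "norm (pochhammer s n) \<le> (norm s + real (Suc n)) ^ n" using Suc by linarith
  with 1 have "norm (pochhammer s n) * norm (s + of_nat n) \<le> (norm s + real (Suc n)) ^ n * (norm s + real (Suc n))"
    by (intro mult_mono) auto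
  thus ?case by (simp add: pochhammer_Suc norm_mult mult.commute)
qed auto

lemma power_le_fact_exp: "x \<ge> 0 \<Longrightarrow> x ^ n \<le> fact n * exp (x::real)"
proof -
  assume x: "x \<ge> 0"
  have "(\<Sum>i\<in>{n}. x ^ i /\<^sub>R fact i) \<le> (\<Sum>i. x ^ i /\<^sub>R fact i)"
    using x by (intro sum_le_suminf summable_exp_generic) auto
  thus ?thesis by (simp add: exp_def field_simps)
qed

text \<open>The argument is shifted twice by the functional equation. With \<open>N \<ge> R\<close>
  the point \<open>t = 2 N - z + 2\<close> stays in a compact set with Re t \<ge> 1, where a
  Pochhammer product of length 2 n is at least (2 n)!; hence \<open>rGamma (t + 2 n)\<close> is O(1
  / (2 n)!). Going back by 2 N costs a polynomial in n of fixed degree, and that is absorbed by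
  \<open>exp 2 ^ n\<close>.\<close>

lemma rGamma_bound:
  fixes R :: real
  shows "\<exists>C\<ge>0. \<forall>z n. norm z \<le> R \<longrightarrow> norm (rGamma (of_nat (2 * n) - z + 2 :: complex)) \<le> C * exp 2 ^ n / fact n"
proof (cases "R \<ge> 0")
  case True
  obtain N :: nat where N: "R \<le> real N" using real_arch_simple by blast
  have "continuous_on (cball 0 R) (\<lambda>z::complex. rGamma (of_nat (2 * N) - z + 2))"
    by (intro holomorphic_on_imp_continuous_on holomorphic_rGamma' holomorphic_intros)
  from compact_imp_bounded[OF compact_continuous_image[OF this compact_cball]]
  obtain C1 where C1': "\<forall>y\<in>(\<lambda>z::complex. rGamma (of_nat (2 * N) - z + 2)) ` cball 0 R. norm y \<le> C1"
    unfolding bounded_iff by blast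
  have C1: "norm (rGamma (of_nat (2 * N) - z + 2)) \<le> C1" if "norm z \<le> R" for z :: complex
    using C1' that by simp
  have C10: "C1 \<ge> 0" using order.trans[OF norm_ge_zero C1[of 0]] True by simp
  define K where "K = 2 + R + real (2 * N)"
  define C where "C = fact (2 * N) * exp K * C1"
  have "norm (rGamma (of_nat (2 * n) - z + 2)) \<le> C * exp 2 ^ n / fact n" if z: "norm z \<le> R" for z :: complex and n
  proof -
    let ?s = "of_nat (2 * n) - z + 2" and ?t = "of_nat (2 * N) - z + 2"
    have Rz: "Re z \<le> R" using z complex_Re_le_cmod[of z] by linarith
    have eq1: "rGamma ?s = pochhammer ?s (2 * N) * rGamma (?s + of_nat (2 * N))" by (rule pochhammer_rGamma)
    have eq2: "rGamma ?t = pochhammer ?t (2 * n) * rGamma (?t + of_nat (2 * n))" by (rule pochhammer_rGamma)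
    have st: "?s + of_nat (2 * N) = ?t + of_nat (2 * n)" by simp
    have "Re ?t \<ge> 1" using Rz N by simp
    from norm_pochhammer_ge_fact[OF this] have "fact (2 * n) \<le> norm (pochhammer ?t (2 * n))" .
    hence "fact (2 * n) * norm (rGamma (?t + of_nat (2 * n))) \<le> norm (pochhammer ?t (2 * n)) * norm (rGamma (?t + of_nat (2 * n)))"
      by (intro mult_right_mono) auto
    also have "\<dots> = norm (rGamma ?t)" unfolding eq2 norm_mult ..
    also have "\<dots> \<le> C1" by (rule C1[OF z])
    finally have 1: "norm (rGamma (?t + of_nat (2 * n))) \<le> C1 / fact (2 * n)" by (simp add: field_simps)
    have "norm ?s + real (2 * N) \<le> real (2 * n) + K"
      using norm_triangle_ineq[of "of_nat (2 * n) - z" 2] norm_triangle_ineq4[of "of_nat (2 * n)" z] z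
      by (simp add: K_def)
    hence "(norm ?s + real (2 * N)) ^ (2 * N) \<le> (real (2 * n) + K) ^ (2 * N)" by (intro power_mono) auto
    also have "\<dots> \<le> fact (2 * N) * exp (real (2 * n) + K)" using True by (intro power_le_fact_exp) (simp add: K_def)
    finally have "norm (pochhammer ?s (2 * N)) \<le> fact (2 * N) * exp (real (2 * n) + K)"
      using norm_pochhammer_le[of ?s "2 * N"] by linarith
    hence "norm (rGamma ?s) \<le> (fact (2 * N) * exp (real (2 * n) + K)) * (C1 / fact (2 * n))"
      unfolding eq1 norm_mult st using 1 by (intro mult_mono) auto
    also have "\<dots> = C * exp (real n * 2) / fact (2 * n)" by (simp add: C_def exp_add mult_ac)
    also have "exp (real n * 2) = exp 2 ^ n" by (rule exp_of_nat_mult)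
    also have "C * exp 2 ^ n / fact (2 * n) \<le> C * exp 2 ^ n / fact n"
      using C10 by (intro divide_left_mono fact_mono) (auto simp: C_def)
    finally show ?thesis .
  qed
  thus ?thesis using C10 by (intro exI[of _ C]) (auto simp: C_def)
next
  case False
  hence "\<not> norm z \<le> R" for z :: complex using norm_ge_zero[of z] by linarith
  thus ?thesis by (intro exI[of _ 0]) auto
qed

lemma bseries_term_bound:
  fixes R :: real
  obtains g where "summable g"
    "\<And>(z::complex) b n. norm z \<le> R \<Longrightarrow> norm b \<le> R \<Longrightarrow> norm (b ^ (2 * n) * rGamma (of_nat (2 * n) - z + 2)) \<le> g n"
proof -
  obtain C where C: "C \<ge> 0" "\<And>z n. norm z \<le> R \<Longrightarrow> norm (rGamma (of_nat (2 * n) - z + 2 :: complex)) \<le> C * exp 2 ^ n / fact n"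
    using rGamma_bound by blast
  define g where "g n = C * (inverse (fact n) * (R ^ 2 * exp 2) ^ n)" for n
  have "summable g" unfolding g_def by (intro summable_mult summable_exp)
  moreover have "norm (b ^ (2 * n) * rGamma (of_nat (2 * n) - z + 2)) \<le> g n" if "norm z \<le> R" "norm b \<le> R" for z b :: complex and n
  proof -
    have "norm (b ^ (2 * n)) \<le> (R ^ 2) ^ n" unfolding norm_power power_mult using that by (intro power_mono) auto
    hence "norm (b ^ (2 * n)) * norm (rGamma (of_nat (2 * n) - z + 2)) \<le> (R ^ 2) ^ n * (C * exp 2 ^ n / fact n)"
      using C(2)[OF that(1)] by (intro mult_mono) auto
    thus ?thesis by (simp add: g_def norm_mult power_mult_distrib field_simps)
  qed
  ultimately show ?thesis by (rule that)
qed

definition bseries :: "complex \<Rightarrow> complex \<Rightarrow> complex" where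
  "bseries z b = (\<Sum>n. b ^ (2 * n) * rGamma (of_nat (2 * n) - z + 2))"

lemma summable_bseries:
  fixes z b :: complex
  shows "summable (\<lambda>n. norm (b ^ (2 * n) * rGamma (of_nat (2 * n) - z + 2)))"
proof -
  obtain g where g: "summable g" "\<And>(z'::complex) b' n. norm z' \<le> max (norm z) (norm b) \<Longrightarrow> norm b' \<le> max (norm z) (norm b) \<Longrightarrow> norm (b' ^ (2 * n) * rGamma (of_nat (2 * n) - z' + 2)) \<le> g n"
    using bseries_term_bound[of "max (norm z) (norm b)"] by blast
  show ?thesis by (rule summable_comparison_test'[OF g(1), of 0]) (use g(2)[of z b] in auto)
qed

lemma holomorphic_bseries1: "(\<lambda>z. bseries z b) holomorphic_on UNIV"
  unfolding bseries_def
proof (rule holomorphic_on_suminf_Mtest)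
  show "(\<lambda>z. b ^ (2 * n) * rGamma (of_nat (2 * n) - z + 2)) holomorphic_on UNIV" for n
    by (intro holomorphic_intros holomorphic_rGamma')
  fix z0 :: complex
  define R where "R = max (norm z0 + 1) (norm b)"
  obtain g where g: "summable g" "\<And>(z'::complex) b' n. norm z' \<le> R \<Longrightarrow> norm b' \<le> R \<Longrightarrow> norm (b' ^ (2 * n) * rGamma (of_nat (2 * n) - z' + 2)) \<le> g n"
    using bseries_term_bound[of R] by blast
  have "norm z \<le> R" if "z \<in> ball z0 1" for z
    using that norm_triangle_ineq2[of z z0] by (auto simp: R_def dist_norm norm_minus_commute)
  thus "\<exists>r>0. \<exists>g. summable g \<and> (\<forall>z\<in>UNIV \<inter> ball z0 r. \<forall>n. norm (b ^ (2 * n) * rGamma (of_nat (2 * n) - z + 2)) \<le> g n)"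
    using g by (intro exI[of _ 1] conjI exI[of _ g]) (auto simp: R_def)
qed auto

lemma holomorphic_bseries2: "(\<lambda>b. bseries z b) holomorphic_on UNIV"
  unfolding bseries_def
proof (rule holomorphic_on_suminf_Mtest)
  show "(\<lambda>b. b ^ (2 * n) * rGamma (of_nat (2 * n) - z + 2)) holomorphic_on UNIV" for n
    by (intro holomorphic_intros)
  fix b0 :: complex
  define R where "R = max (norm b0 + 1) (norm z)"
  obtain g where g: "summable g" "\<And>(z'::complex) b' n. norm z' \<le> R \<Longrightarrow> norm b' \<le> R \<Longrightarrow> norm (b' ^ (2 * n) * rGamma (of_nat (2 * n) - z' + 2)) \<le> g n"
    using bseries_term_bound[of R] by blast
  have "norm b \<le> R" if "b \<in> ball b0 1" for b
    using that norm_triangle_ineq2[of b b0] by (auto simp: R_def dist_norm norm_minus_commute)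
  thus "\<exists>r>0. \<exists>g. summable g \<and> (\<forall>b\<in>UNIV \<inter> ball b0 r. \<forall>n. norm (b ^ (2 * n) * rGamma (of_nat (2 * n) - z + 2)) \<le> g n)"
    using g by (intro exI[of _ 1] conjI exI[of _ g]) (auto simp: R_def)
qed auto

text \<open>Splits off the head term. With two applications of
  \<open>has_field_derivative_powr_bseries\<close>, it shows that y = b^(1-z) * bseries z b
  satisfies y'' = y + b^(-(z+1)) * rGamma (-z).\<close>

lemma bseries_shift: "bseries (z + 2) b = rGamma (- z) + b ^ 2 * bseries z b"
proof -
  have s: "summable (\<lambda>n. b ^ (2 * n) * rGamma (of_nat (2 * n) - z + 2))" for z
    by (rule summable_norm_cancel[OF summable_bseries])
  have "bseries (z + 2) b = b ^ (2 * 0) * rGamma (of_nat (2 * 0) - (z + 2) + 2) + (\<Sum>n. b ^ (2 * Suc n) * rGamma (of_nat (2 * Suc n) - (z + 2) + 2))"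
    unfolding bseries_def using suminf_split_head[OF s[of "z + 2"]] by simp
  also have "(\<Sum>n. b ^ (2 * Suc n) * rGamma (of_nat (2 * Suc n) - (z + 2) + 2)) = (\<Sum>n. b ^ 2 * (b ^ (2 * n) * rGamma (of_nat (2 * n) - z + 2)))"
    by (simp add: power2_eq_square algebra_simps)
  also have "\<dots> = b ^ 2 * bseries z b" unfolding bseries_def by (rule suminf_mult[OF s])
  finally show ?thesis by simp
qed

text \<open>Each term b^(2 n + 1 - z) / Gamma (2 n + 2 - z) is a divided power: differentiation
  lowers both the exponent and the Gamma argument by 1, which amounts to replacing \<open>z\<close>
  by \<open>z + 1\<close>.\<close>

lemma has_field_derivative_powr_bseries:
  assumes b: "Re b > 0"
  shows "((\<lambda>b. b powr (1 - z) * bseries z b) has_field_derivative (b powr (- z) * bseries (z + 1) b)) (at b)"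
proof -
  let ?S = "{b. Re b > 0}"
  let ?f = "\<lambda>n b. b powr (1 - z) * (b ^ (2 * n) * rGamma (of_nat (2 * n) - z + 2))"
  let ?f' = "\<lambda>n b. b powr (- z) * (b ^ (2 * n) * rGamma (of_nat (2 * n) - (z + 1) + 2))"
  have "((\<lambda>b. \<Sum>n. ?f n b) has_field_derivative (\<Sum>n. ?f' n b)) (at b)"
  proof -
    define R where "R = max (norm b + 1) (norm z)"
    obtain g where g: "summable g" "\<And>(z'::complex) b' n. norm z' \<le> R \<Longrightarrow> norm b' \<le> R \<Longrightarrow> norm (b' ^ (2 * n) * rGamma (of_nat (2 * n) - z' + 2)) \<le> g n"
      using bseries_term_bound[of R] by blast
    have "continuous_on (cball b (Re b / 2)) (\<lambda>b. b powr (1 - z))"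
    proof (intro continuous_intros)
      have "Re c > 0" if "c \<in> cball b (Re b / 2)" for c
        using that b abs_Re_le_cmod[of "b - c"] by (auto simp: dist_norm abs_if split: if_splits)
      note pos = this
      show "cball b (Re b / 2) \<subseteq> {c. 0 \<le> Re c \<or> Im c \<noteq> 0}"
        by (rule subsetI) (use pos in \<open>auto intro: less_imp_le\<close>)
      fix c :: complex assume "c \<in> cball b (Re b / 2)" "c = 0"
      with pos[of c] show "0 < Re (1 - z)" by simp
    qed
    from compact_imp_bounded[OF compact_continuous_image[OF this compact_cball]]
    obtain C where C': "\<forall>y\<in>(\<lambda>b. b powr (1 - z)) ` cball b (Re b / 2). norm y \<le> C"
      unfolding bounded_iff by blast
    have C: "norm (c powr (1 - z)) \<le> C" if "c \<in> cball b (Re b / 2)" for c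
      using C' that by blast
    define r where "r = min 1 (Re b / 2)"
    show ?thesis
    proof (rule has_field_derivative_suminf_Mtest[where S = ?S and r = r and g = "\<lambda>n. C * g n"])
      show "open ?S" by (rule open_halfspace_Re_gt)
      show "b \<in> ?S" using b by simp
      show "r > 0" using b by (simp add: r_def)
      show "summable (\<lambda>n. C * g n)" by (intro summable_mult g)
      show "norm (?f n c) \<le> C * g n" if "c \<in> ?S" "c \<in> ball b r" for c n
      proof -
        have "norm c \<le> R" using that(2) norm_triangle_ineq2[of c b] by (auto simp: R_def r_def dist_norm norm_minus_commute)
        hence 1: "norm (c ^ (2 * n) * rGamma (of_nat (2 * n) - z + 2)) \<le> g n" by (intro g) (auto simp: R_def)
        have 2: "norm (c powr (1 - z)) \<le> C" using that(2) by (intro C) (auto simp: r_def)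
        have "C \<ge> 0" using order.trans[OF norm_ge_zero 2] .
        thus ?thesis unfolding norm_mult[of "c powr (1 - z)"] using 1 2 by (intro mult_mono) auto
      qed
      show "summable (\<lambda>n. norm (?f' n b))"
        unfolding norm_mult[of "b powr (- z)"] by (intro summable_mult summable_bseries)
      fix n c assume "c \<in> ?S"
      hence c: "Re c > 0" "c \<noteq> 0" "c \<notin> \<real>\<^sub>\<le>\<^sub>0" by (auto simp: complex_nonpos_Reals_iff)
      have eq: "d powr (1 - z) * d ^ (2 * n) = d powr (of_nat (2 * n) - z + 1)" if "Re d > 0" for d
      proof -
        have "d \<noteq> 0" using that by auto
        have "of_nat (2 * n) - z + 1 = (1 - z) + of_nat (2 * n)" by simp
        hence "d powr (of_nat (2 * n) - z + 1) = d powr (1 - z) * d powr of_nat (2 * n)" by (simp only: powr_add)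
        thus ?thesis using \<open>d \<noteq> 0\<close> by (subst (asm) powr_nat') auto
      qed
      have "((\<lambda>d. d powr (of_nat (2 * n) - z + 1) * rGamma (of_nat (2 * n) - z + 2)) has_field_derivative
          (of_nat (2 * n) - z + 1) * c powr (of_nat (2 * n) - z + 1 - 1) * rGamma (of_nat (2 * n) - z + 2)) (at c)"
        using has_field_derivative_powr[OF c(3), of "of_nat (2 * n) - z + 1"] by (intro DERIV_cmult_right)
      moreover have "(of_nat (2 * n) - z + 1) * c powr (of_nat (2 * n) - z + 1 - 1) * rGamma (of_nat (2 * n) - z + 2) = ?f' n c"
      proof -
        have "(of_nat (2 * n) - z + 1) * rGamma (of_nat (2 * n) - z + 1 + 1) = rGamma (of_nat (2 * n) - z + 1)"
          by (rule rGamma_plus1)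
        hence r: "(of_nat (2 * n) - z + 1) * rGamma (of_nat (2 * n) - z + 2) = rGamma (of_nat (2 * n) - (z + 1) + 2)"
          by (simp add: algebra_simps)
        have "of_nat (2 * n) - z + 1 - 1 = - z + of_nat (2 * n)" by simp
        hence "c powr (of_nat (2 * n) - z + 1 - 1) = c powr (- z) * c powr of_nat (2 * n)" by (simp only: powr_add)
        also have "c powr of_nat (2 * n) = c ^ (2 * n)" using c by (subst powr_nat') auto
        finally show ?thesis unfolding r[symmetric] by (simp only: mult_ac)
      qed
      ultimately have "((\<lambda>d. d powr (of_nat (2 * n) - z + 1) * rGamma (of_nat (2 * n) - z + 2)) has_field_derivative ?f' n c) (at c)" by simp
      thus "(?f n has_field_derivative ?f' n c) (at c)"
      proof (rule has_field_derivative_transform_within_open[OF _ open_halfspace_Re_gt[of 0]])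
        fix d :: complex assume "d \<in> {d. 0 < Re d}"
        thus "d powr (of_nat (2 * n) - z + 1) * rGamma (of_nat (2 * n) - z + 2) = ?f n d" using eq[of d] by simp
      qed (use c in auto)
    qed
  qed
  moreover have "(\<Sum>n. ?f n b) = b powr (1 - z) * bseries z b" for b
    unfolding bseries_def by (rule suminf_mult[OF summable_norm_cancel[OF summable_bseries]])
  moreover have "(\<Sum>n. ?f' n b) = b powr (- z) * bseries (z + 1) b"
    unfolding bseries_def by (rule suminf_mult[OF summable_norm_cancel[OF summable_bseries]])
  ultimately show ?thesis by simp
qed

section \<open>The kernel t^s / (1 + t^2) on rays\<close>

lemma quad_lower_bound:
  assumes y: "Re y \<ge> \<rho>" "\<rho> > 0" "norm y \<le> R" and x: "x > 0"
  defines "c \<equiv> min \<rho> (\<rho> / R) / 2"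
  shows "norm (1 + (of_real x * y) ^ 2) \<ge> c\<^sup>2 * (1 + x)\<^sup>2" and "c > 0"
proof -
  have R: "R > 0" using y complex_Re_le_cmod[of y] by linarith
  show c: "c > 0" using y R by (simp add: c_def)
  have y0: "y \<noteq> 0" using y by auto
  \<comment> \<open>1 + t^2 factors as (t + i) (t - i). Each factor is at least
    \<open>x * \<rho>\<close> by its real part and at least \<open>\<rho> / R\<close> by the sector
    bound; \<open>c * (1 + x)\<close> is below the mean of the two, which is the reason for the
    factor 1/2 in \<open>c\<close>.\<close>
  have 1: "norm (of_real x * y + \<i> * of_real s) \<ge> c * (1 + x)" if "s = 1 \<or> s = -1" for s
  proof -
    let ?q = "of_real x * y + \<i> * of_real s"
    have "Re ?q \<le> norm ?q" by (rule complex_Re_le_cmod)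
    moreover have "Re ?q \<ge> x * \<rho>" using x y by (simp add: mult_left_mono)
    ultimately have a: "x * \<rho> \<le> norm ?q" by linarith
    have "\<rho> / R * norm y \<le> \<rho>" using y R by (simp add: field_simps mult_left_mono)
    hence "\<rho> / R * norm (of_real x * y) \<le> Re (of_real x * y)"
    proof -
      have "x * (\<rho> / R * norm y) \<le> x * Re y" using x y \<open>\<rho> / R * norm y \<le> \<rho>\<close> by (intro mult_left_mono) linarith+
      thus ?thesis using x by (simp add: norm_mult mult_ac)
    qed
    from norm_add_imaginary_ge[OF this, of s] have "\<rho> / R * \<bar>s\<bar> \<le> norm ?q" using x y0 by simp
    hence b: "\<rho> / R \<le> norm ?q" using that by auto
    have "x * min \<rho> (\<rho> / R) \<le> x * \<rho>" using x by (intro mult_left_mono) auto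
    moreover have "min \<rho> (\<rho> / R) \<le> \<rho> / R" by simp
    moreover have "c * (1 + x) = (min \<rho> (\<rho> / R) + x * min \<rho> (\<rho> / R)) / 2" unfolding c_def by (simp add: field_simps)
    ultimately have "c * (1 + x) \<le> (\<rho> / R + x * \<rho>) / 2" by (simp only:) (intro divide_right_mono add_mono; simp)
    thus ?thesis using a b by simp
  qed
  have "1 + (of_real x * y) ^ 2 = (of_real x * y + \<i> * of_real 1) * (of_real x * y + \<i> * of_real (-1))"
    by (simp add: power2_eq_square algebra_simps)
  moreover have "(c * (1 + x)) * (c * (1 + x)) \<le> norm (of_real x * y + \<i> * of_real 1) * norm (of_real x * y + \<i> * of_real (-1))"
    using c x 1[of 1] 1[of "-1"] by (intro mult_mono) auto
  ultimately show "norm (1 + (of_real x * y) ^ 2) \<ge> c\<^sup>2 * (1 + x)\<^sup>2"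
    by (simp only: norm_mult power2_eq_square mult_ac)
qed

lemma quad_nonzero: "Re y > 0 \<Longrightarrow> x > 0 \<Longrightarrow> 1 + (of_real x * y) ^ 2 \<noteq> 0"
proof
  assume y: "Re y > 0" and x: "x > 0" and "1 + (of_real x * y) ^ 2 = 0"
  note q = quad_lower_bound[OF order_refl y order_refl x]
  have "0 < (min (Re y) (Re y / norm y) / 2)\<^sup>2 * (1 + x)\<^sup>2"
    using q(2) x by (intro mult_pos_pos zero_less_power) auto
  with q(1) \<open>1 + (of_real x * y) ^ 2 = 0\<close> show False by simp
qed

text \<open>The pull-back of t^s dt / (1 + t^2) to the ray t = x y; the trailing factor
  \<open>y\<close> is the one from dt.\<close>

definition kern0 :: "complex \<Rightarrow> complex \<Rightarrow> real \<Rightarrow> complex" where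
  "kern0 s y x = (of_real x * y) powr s / (1 + (of_real x * y) ^ 2) * y"

lemma continuous_on_kern0:
  assumes "Re y > 0" shows "continuous_on {0<..} (kern0 s y)"
  unfolding kern0_def[abs_def]
proof (intro continuous_intros)
  show "\<forall>x\<in>{0<..}. 1 + (of_real x * y) ^ 2 \<noteq> 0" using quad_nonzero[OF assms] by simp
qed (use assms in auto)

lemma kern0_bound:
  assumes "\<rho> > 0" "R > 0"
  shows "\<exists>K\<ge>0. \<forall>y x. Re y \<ge> \<rho> \<and> norm y \<le> R \<and> x > 0 \<longrightarrow> norm (kern0 s y x) \<le> K * (x powr Re s * (1 + x) powr (- 2))"
proof -
  define c where "c = min \<rho> (\<rho> / R) / 2"
  have c: "c > 0" using assms by (simp add: c_def)
  define K where "K = (\<rho> powr Re s + R powr Re s) * exp (pi * \<bar>Im s\<bar>) / c\<^sup>2 * R"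
  have "norm (kern0 s y x) \<le> K * (x powr Re s * (1 + x) powr (- 2))" if y: "Re y \<ge> \<rho>" "norm y \<le> R" and x: "x > 0" for y x
  proof -
    have ny: "\<rho> \<le> norm y" using y complex_Re_le_cmod[of y] by linarith
    have y0: "y \<noteq> 0" using y assms by auto
    have "norm ((of_real x * y) powr s) \<le> norm (of_real x * y) powr Re s * exp (pi * \<bar>Im s\<bar>)"
      using y0 x by (intro norm_powr_complex_bounds) auto
    also have "norm (of_real x * y) powr Re s = x powr Re s * norm y powr Re s" using x by (simp add: norm_mult powr_mult)
    also have "x powr Re s * norm y powr Re s * exp (pi * \<bar>Im s\<bar>) \<le> x powr Re s * (\<rho> powr Re s + R powr Re s) * exp (pi * \<bar>Im s\<bar>)"
      using ny y assms by (intro mult_right_mono mult_left_mono powr_between_le) auto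
    finally have 1: "norm ((of_real x * y) powr s) \<le> x powr Re s * (\<rho> powr Re s + R powr Re s) * exp (pi * \<bar>Im s\<bar>)" .
    have 2: "c\<^sup>2 * (1 + x)\<^sup>2 \<le> norm (1 + (of_real x * y) ^ 2)"
      using quad_lower_bound(1)[OF y(1) assms(1) y(2) x] by (simp add: c_def)
    have "norm ((of_real x * y) powr s) / norm (1 + (of_real x * y) ^ 2) \<le> (x powr Re s * (\<rho> powr Re s + R powr Re s) * exp (pi * \<bar>Im s\<bar>)) / (c\<^sup>2 * (1 + x)\<^sup>2)"
      using c x by (intro frac_le 1 2) (auto intro!: mult_pos_pos)
    hence "norm ((of_real x * y) powr s) / norm (1 + (of_real x * y) ^ 2) * norm y \<le> (x powr Re s * (\<rho> powr Re s + R powr Re s) * exp (pi * \<bar>Im s\<bar>)) / (c\<^sup>2 * (1 + x)\<^sup>2) * R"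
      using y x by (intro mult_mono) auto
    also have "\<dots> = K * (x powr Re s * (1 + x) powr (- 2))"
      using x by (simp add: K_def powr_minus powr_numeral divide_simps)
    finally show ?thesis by (simp add: kern0_def norm_mult norm_divide)
  qed
  moreover have "K \<ge> 0" using assms by (simp add: K_def)
  ultimately show ?thesis by blast
qed

lemma integrable_kern0:
  assumes "Re y > 0" "Re s > -1" "Re s < 1"
  shows "integrable halfline (kern0 s y)"
proof -
  have "norm y > 0" using assms complex_Re_le_cmod[of y] by linarith
  then obtain K where K: "\<And>x. x > 0 \<Longrightarrow> norm (kern0 s y x) \<le> K * (x powr Re s * (1 + x) powr (- 2))"
    using kern0_bound[OF assms(1), of "norm y" s] by blast
  show ?thesis
    by (rule integrable_halfline_bound[OF continuous_on_kern0[OF assms(1)] _ K])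
       (intro integrable_mult_right integrable_powr_one_plus; use assms in auto)
qed

text \<open>Independence of the direction of the ray: the integral is holomorphic in
  \<open>y\<close> and, by scaling, constant for positive real \<open>y\<close>.\<close>

lemma integral_kern0_rotate:
  assumes y: "Re y > 0" and s: "Re s > -1" "Re s < 1"
  shows "(\<integral>x. kern0 s y x \<partial>halfline) = (\<integral>x. kern0 s 1 x \<partial>halfline)"
proof (rule analytic_continuation_reals[where S = "{y. Re y > 0}" and a = 0 and b = 1 and w = y
      and f = "\<lambda>y. \<integral>x. kern0 s y x \<partial>halfline" and g = "\<lambda>y. \<integral>x. kern0 s 1 x \<partial>halfline"])
  let ?S = "{y. Re y > 0}"
  show "open ?S" by (rule open_halfspace_Re_gt)
  show "connected ?S" by (intro convex_connected convex_halfspace_Re_gt)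
  show "(\<lambda>y. \<integral>x. kern0 s y x \<partial>halfline) holomorphic_on ?S"
  proof (rule holomorphic_on_integral_halfline)
    show "open ?S" by (rule open_halfspace_Re_gt)
    show "(\<lambda>y. kern0 s y x) holomorphic_on ?S" if "x > 0" for x
      unfolding kern0_def using that quad_nonzero
      by (intro holomorphic_intros) (auto simp: complex_nonpos_Reals_iff dest: mult_pos_pos[OF that])
    fix y0 assume "y0 \<in> ?S"
    hence y0: "Re y0 > 0" by simp
    define \<rho> R where "\<rho> = Re y0 / 2" and "R = norm y0 + Re y0 / 2"
    have R: "\<rho> > 0" "R > 0" using y0 by (auto simp: \<rho>_def R_def add_nonneg_pos)
    obtain K where K: "\<And>y x. Re y \<ge> \<rho> \<Longrightarrow> norm y \<le> R \<Longrightarrow> x > 0 \<Longrightarrow> norm (kern0 s y x) \<le> K * (x powr Re s * (1 + x) powr (- 2))"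
      using kern0_bound[OF R] by blast
    have "Re y \<ge> \<rho> \<and> norm y \<le> R" if "y \<in> ball y0 \<rho>" for y
      using that abs_Re_le_cmod[of "y0 - y"] norm_triangle_ineq2[of y y0]
      by (auto simp: dist_norm norm_minus_commute \<rho>_def R_def abs_if split: if_splits)
    thus "\<exists>r>0. \<exists>g. integrable halfline g \<and> (\<forall>y\<in>?S \<inter> ball y0 r. \<forall>x>0. norm (kern0 s y x) \<le> g x)"
      using R K s
      by (intro exI[of _ \<rho>] conjI exI[of _ "\<lambda>x. K * (x powr Re s * (1 + x) powr (- 2))"] integrable_mult_right integrable_powr_one_plus) auto
  qed (auto intro: continuous_on_kern0)
  fix r :: real assume r: "0 < r" "r < 1"
  have "(\<integral>x. kern0 s (of_real r) x \<partial>halfline) = (\<integral>x. of_real r * kern0 s 1 (r * x) \<partial>halfline)"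
    by (rule integral_halfline_cong) (simp add: kern0_def mult_ac)
  also have "\<dots> = (\<integral>x. kern0 s 1 x \<partial>halfline)"
    using integral_halfline_scale[OF r(1), of "kern0 s 1"] r by simp
  finally show "of_real r \<in> ?S \<and> (\<integral>x. kern0 s (of_real r) x \<partial>halfline) = (\<integral>x. kern0 s 1 x \<partial>halfline)"
    using r by simp
qed (use y in auto)

text \<open>The substitution u = x^2 / (1 + x^2) leads to the Beta integral with parameters
  \<open>a\<close> and \<open>1 - a\<close>, where a = (r + 1) / 2, and the reflection formula
  evaluates it.\<close>

lemma integral_kern0_real:
  assumes r: "-1 < r" "r < 1"
  shows "(\<integral>x. kern0 (of_real r) 1 x \<partial>halfline) = of_real pi / (2 * cos (of_real pi * of_real r / 2))"
proof -
  define a where "a = (r + 1) / 2"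
  have a: "0 < a" "a < 1" using r by (auto simp: a_def)
  let ?f = "\<lambda>t. t powr (a - 1) * (1 - t) powr ((1 - a) - 1)"
  let ?g = "\<lambda>x::real. x\<^sup>2 / (1 + x\<^sup>2)"
  let ?h = "\<lambda>x::real. 2 * x / (1 + x\<^sup>2)\<^sup>2"
  have hI: "(?f has_integral Beta a (1 - a)) {0<..<1}"
    using has_integral_Beta_real[of a "1 - a"] a by (simp add: has_integral_Icc_iff_Ioo)
  have fabs: "?f absolutely_integrable_on {0<..<1}"
    using hI by (intro nonnegative_absolutely_integrable_1) (auto simp: has_integral_iff)
  have im: "?g ` {0<..} = {0<..<1}"
  proof safe
    fix t :: real assume t: "t \<in> {0<..<1}"
    have "t = ?g (sqrt (t / (1 - t)))" using t by (simp add: field_simps)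
    thus "t \<in> ?g ` {0<..}" using t by (intro image_eqI[of _ _ "sqrt (t / (1 - t))"]) auto
  next
    fix x :: real assume x: "x > 0"
    have "0 < 1 + x\<^sup>2" "0 < x\<^sup>2" using x by (simp_all add: add_pos_nonneg)
    thus "?g x \<in> {0<..<1}" unfolding greaterThanLessThan_iff by (metis divide_pos_pos divide_less_eq_1_pos less_add_same_cancel2 zero_less_one)
  qed
  have inj: "inj_on ?g {0<..}"
  proof (rule inj_onI)
    fix x y :: real assume xy: "x \<in> {0<..}" "y \<in> {0<..}" "?g x = ?g y"
    have "1 + x\<^sup>2 > 0" "1 + y\<^sup>2 > 0" by (simp_all add: add_pos_nonneg)
    hence "x\<^sup>2 = y\<^sup>2" using xy(3) by (simp add: field_simps)
    thus "x = y" using xy by (simp add: power2_eq_iff_nonneg)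
  qed
  have der: "(?g has_field_derivative ?h x) (at x within {0<..})" if "x \<in> {0<..}" for x
  proof -
    have nz: "1 + x\<^sup>2 \<noteq> 0" by (metis add_pos_nonneg less_irrefl zero_le_power2 zero_less_one)
    show ?thesis using nz by (auto intro!: derivative_eq_intros simp: power2_eq_square field_simps)
  qed
  have fx: "\<bar>?h x\<bar> * ?f (?g x) = 2 * (x powr r / (1 + x\<^sup>2))" if "x > 0" for x
  proof -
    define q where "q = 1 + x\<^sup>2"
    have q: "q > 0" by (simp add: q_def add_pos_nonneg)
    have 1: "1 - x\<^sup>2 / q = 1 / q" using q by (simp add: q_def field_simps)
    have "(x\<^sup>2 / q) powr (a - 1) * (1 / q) powr ((1 - a) - 1) = (x\<^sup>2) powr (a - 1) / (q powr (a - 1) * q powr (- a))"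
      using that q by (simp add: powr_divide)
    also have "q powr (a - 1) * q powr (- a) = 1 / q" using q by (simp add: powr_diff powr_minus_divide)
    also have "(x\<^sup>2) powr (a - 1) = x powr (r - 1)"
    proof -
      have "2 * (a - 1) = r - 1" by (simp add: a_def field_simps)
      thus ?thesis using that by (simp only: powr_numeral[OF less_imp_le, symmetric] powr_powr)
    qed
    finally have "?f (?g x) = x powr (r - 1) * q" unfolding q_def[symmetric] 1 by simp
    moreover have "x powr r = x * x powr (r - 1)" using that by (simp add: powr_diff)
    moreover have "\<bar>?h x\<bar> = 2 * x / q\<^sup>2" using that by (simp add: q_def)
    ultimately have "\<bar>?h x\<bar> * ?f (?g x) = 2 * x / q\<^sup>2 * (x powr (r - 1) * q)" and "x powr r = x * x powr (r - 1)" by (simp_all only:)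
    thus ?thesis unfolding q_def[symmetric] using q by (simp add: power2_eq_square)
  qed
  have cv: "integral {0<..} (\<lambda>x. \<bar>?h x\<bar> * ?f (?g x)) = Beta a (1 - a)"
    using has_absolute_integral_change_of_variables_1'[of "{0<..}" ?g ?h ?f "Beta a (1 - a)"] der inj fabs hI
    unfolding im by (auto simp: has_integral_iff)
  have "kern0 (of_real r) 1 x = of_real (x powr r / (1 + x\<^sup>2))" if "x > 0" for x
    using that by (simp add: kern0_def powr_of_real)
  hence "(\<integral>x. kern0 (of_real r) 1 x \<partial>halfline) = (\<integral>x. complex_of_real (x powr r / (1 + x\<^sup>2)) \<partial>halfline)"
    by (intro integral_halfline_cong)
  also have "\<dots> = of_real (\<integral>x. x powr r / (1 + x\<^sup>2) \<partial>halfline)" by (rule integral_complex_of_real)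
  also have "(\<integral>x. x powr r / (1 + x\<^sup>2) \<partial>halfline) = integral {0<..} (\<lambda>x. x powr r / (1 + x\<^sup>2))"
  proof (rule lebesgue_integral_eq_integral)
    have "integrable halfline (\<lambda>x. norm (kern0 (of_real r) 1 x))"
      using r by (intro integrable_norm integrable_kern0) auto
    thus "integrable halfline (\<lambda>x. x powr r / (1 + x\<^sup>2))"
    proof (subst integrable_halfline_cong)
      fix x :: real assume x: "x > 0"
      show "x powr r / (1 + x\<^sup>2) = norm (kern0 (of_real r) 1 x)"
        unfolding \<open>\<And>x. x > 0 \<Longrightarrow> kern0 (of_real r) 1 x = of_real (x powr r / (1 + x\<^sup>2))\<close>[OF x] norm_of_real by simp
    qed
  qed auto
  also have "integral {0<..} (\<lambda>x. x powr r / (1 + x\<^sup>2)) = 1 / 2 * integral {0<..} (\<lambda>x. \<bar>?h x\<bar> * ?f (?g x))"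
    unfolding integral_mult_right[symmetric] by (rule integral_cong) (use fx in auto)
  also have "\<dots> = 1 / 2 * (Gamma a * Gamma (1 - a))" unfolding cv by (simp add: Beta_def)
  also have "complex_of_real \<dots> = 1 / 2 * (Gamma (of_real a) * Gamma (1 - of_real a))"
    by (simp flip: Gamma_complex_of_real)
  also have "\<dots> = 1 / 2 * (of_real pi / sin (of_real pi * of_real a))" by (simp add: Gamma_reflection_complex)
  also have "sin (complex_of_real pi * of_real a) = cos (of_real pi * of_real r / 2)"
  proof -
    have "complex_of_real pi * of_real a = of_real pi * of_real r / 2 + of_real pi / 2" by (simp add: a_def field_simps)
    thus ?thesis by (simp add: sin_add)
  qed
  finally show ?thesis by simp
qed

section \<open>Rotated oscillatory integrals and their differential equation\<close>

lemma norm_exp_ray: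
  assumes "unit_sign e"
  shows "norm (exp (\<i> * of_real e * b * (of_real x * rayv e \<tau>))) = exp (- (x * (\<tau> * Re b + e * Im b)))"
proof -
  have "Re (\<i> * of_real e * b * (of_real x * rayv e \<tau>)) = - (x * (\<tau> * (e * e) * Re b + e * Im b))"
    by (simp add: algebra_simps)
  moreover have "e * e = 1" using assms by auto
  ultimately show ?thesis by simp
qed

text \<open>One exponential half of the integral of t^z cos (b t) / (1 + t^2), moved to the ray on
  which that half decays. The mean over both signs stands for the cosine integral and exists for all
  Re z > -1.\<close>

definition osc_int :: "real \<Rightarrow> real \<Rightarrow> complex \<Rightarrow> complex \<Rightarrow> complex" where
  "osc_int e \<tau> z b = (\<integral>x. kern0 z (rayv e \<tau>) x * exp (\<i> * of_real e * b * (of_real x * rayv e \<tau>)) \<partial>halfline)"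

lemma continuous_on_osc:
  "continuous_on {0<..} (\<lambda>x. kern0 z (rayv e \<tau>) x * exp (\<i> * of_real e * b * (of_real x * rayv e \<tau>)))"
  by (intro continuous_intros continuous_on_kern0) auto

lemma kern0_ray_bound: "\<exists>K\<ge>0. \<forall>x>0. norm (kern0 z (rayv e \<tau>) x) \<le> K * (x powr Re z * (1 + x) powr (- 2))"
  using kern0_bound[of 1 "norm (rayv e \<tau>)" z] by auto

lemma osc_wedge_pos: "unit_sign e \<Longrightarrow> b \<in> wedge \<tau> \<Longrightarrow> \<tau> * Re b + e * Im b > 0"
  by (auto simp: wedge_def)

text \<open>Differentiation brings down i e t and thus raises \<open>z\<close> by 1. The exponential
  decay at rate \<open>\<tau> * Re b + e * Im b\<close>, locally bounded away from 0, supplies the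
  majorant.\<close>

lemma osc_int_deriv:
  assumes z: "Re z > -1" and e: "unit_sign e" and b: "b \<in> wedge \<tau>"
  shows "(osc_int e \<tau> z has_field_derivative (\<i> * of_real e * osc_int e \<tau> (z + 1) b)) (at b)"
proof -
  let ?v = "rayv e \<tau>"
  let ?M = "halfline"
  let ?F = "\<lambda>b x. kern0 z ?v x * exp (\<i> * of_real e * b * (of_real x * ?v))"
  obtain K where K: "K \<ge> 0" "\<And>x. x > 0 \<Longrightarrow> norm (kern0 z ?v x) \<le> K * (x powr Re z * (1 + x) powr (- 2))"
    using kern0_ray_bound by blast
  define d where "d = \<tau> * Re b + e * Im b"
  have d: "d > 0" unfolding d_def by (rule osc_wedge_pos[OF e b])
  have "((\<lambda>b. \<integral>x. ?F b x \<partial>?M) has_field_derivative (\<integral>x. deriv (\<lambda>b. ?F b x) b \<partial>?M)) (at b)"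
  proof (rule has_field_derivative_integral[OF open_wedge b])
    show "?F b \<in> borel_measurable ?M" for b
      by (intro continuous_imp_measurable_on_sets_lebesgue continuous_on_osc) auto
    show "(\<lambda>b. ?F b x) holomorphic_on wedge \<tau>" for x by (intro holomorphic_intros)
    have "continuous_on UNIV (\<lambda>b. \<tau> * Re b + e * Im b)" by (intro continuous_intros)
    hence "open {c. \<tau> * Re c + e * Im c > d / 2}" by (intro open_Collect_less continuous_intros)
    moreover have "b \<in> {c. \<tau> * Re c + e * Im c > d / 2}" using d by (simp add: d_def)
    ultimately obtain r where r: "r > 0" "ball b r \<subseteq> {c. \<tau> * Re c + e * Im c > d / 2}" by (meson openE)
    define g where "g x = K * (x powr Re z * exp (- (d / 2) * x))" for x
    have "integrable ?M g" unfolding g_def using d z by (intro integrable_mult_right integrable_powr_exp_halfline) auto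
    moreover have "norm (?F c x) \<le> g x" if c: "c \<in> ball b r" and x: "x > 0" for c x
    proof -
      have "\<tau> * Re c + e * Im c > d / 2" using c r by auto
      hence "- (x * (\<tau> * Re c + e * Im c)) \<le> - (d / 2) * x" using x by (simp add: mult.commute)
      hence "norm (exp (\<i> * of_real e * c * (of_real x * ?v))) \<le> exp (- (d / 2) * x)"
        unfolding norm_exp_ray[OF e] exp_le_cancel_iff .
      moreover have "norm (kern0 z ?v x) \<le> K * (x powr Re z * 1)"
      proof -
        have "(1 + x) powr (- 2) \<le> 1" using x by (simp add: powr_minus powr_numeral divide_simps)
        hence "K * (x powr Re z * (1 + x) powr (- 2)) \<le> K * (x powr Re z * 1)" using K(1) by (intro mult_left_mono) auto
        thus ?thesis using K(2)[OF x] by linarith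
      qed
      ultimately have "norm (kern0 z ?v x) * norm (exp (\<i> * of_real e * c * (of_real x * ?v))) \<le> K * (x powr Re z * 1) * exp (- (d / 2) * x)"
        by (intro mult_mono) (use K in auto)
      thus ?thesis by (simp add: norm_mult g_def)
    qed
    ultimately show "\<exists>r>0. \<exists>g. integrable ?M g \<and> (\<forall>c\<in>wedge \<tau> \<inter> ball b r. \<forall>x\<in>space ?M. norm (?F c x) \<le> g x)"
      using r by (intro exI[of _ r] conjI exI[of _ g]) auto
  qed
  also have "(\<integral>x. deriv (\<lambda>b. ?F b x) b \<partial>?M) = (\<integral>x. \<i> * of_real e * (kern0 (z + 1) ?v x * exp (\<i> * of_real e * b * (of_real x * ?v))) \<partial>?M)"
  proof (rule integral_halfline_cong)
    fix x :: real assume x: "x > 0"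
    have "((\<lambda>b. ?F b x) has_field_derivative (kern0 z ?v x * (exp (\<i> * of_real e * b * (of_real x * ?v)) * (\<i> * of_real e * (of_real x * ?v))))) (at b)"
      by (auto intro!: derivative_eq_intros)
    hence "deriv (\<lambda>b. ?F b x) b = kern0 z ?v x * (exp (\<i> * of_real e * b * (of_real x * ?v)) * (\<i> * of_real e * (of_real x * ?v)))"
      by (rule DERIV_imp_deriv)
    moreover have "kern0 (z + 1) ?v x = kern0 z ?v x * (of_real x * ?v)"
      using x by (simp add: kern0_def powr_add)
    ultimately show "deriv (\<lambda>b. ?F b x) b = \<i> * of_real e * (kern0 (z + 1) ?v x * exp (\<i> * of_real e * b * (of_real x * ?v)))"
      by (simp only: mult_ac)
  qed
  also have "\<dots> = \<i> * of_real e * osc_int e \<tau> (z + 1) b" unfolding osc_int_def by (rule integral_mult_right_zero)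
  finally show ?thesis unfolding osc_int_def[abs_def] .
qed

lemma osc_int_integrable:
  assumes z: "Re z > -1" and e: "unit_sign e" and b: "b \<in> wedge \<tau>"
  shows "integrable halfline (\<lambda>x. kern0 z (rayv e \<tau>) x * exp (\<i> * of_real e * b * (of_real x * rayv e \<tau>)))"
proof -
  let ?v = "rayv e \<tau>"
  obtain K where K: "K \<ge> 0" "\<And>x. x > 0 \<Longrightarrow> norm (kern0 z ?v x) \<le> K * (x powr Re z * (1 + x) powr (- 2))"
    using kern0_ray_bound by blast
  define d where "d = \<tau> * Re b + e * Im b"
  have d: "d > 0" unfolding d_def by (rule osc_wedge_pos[OF e b])
  show ?thesis
  proof (rule integrable_halfline_bound[OF continuous_on_osc])
    show "integrable halfline (\<lambda>x. K * (x powr Re z * exp (- d * x)))"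
      using d z by (intro integrable_mult_right integrable_powr_exp_halfline) auto
    fix x :: real assume x: "x > 0"
    have "(1 + x) powr (- 2) \<le> 1" using x by (simp add: powr_minus powr_numeral divide_simps)
    hence "K * (x powr Re z * (1 + x) powr (- 2)) \<le> K * (x powr Re z * 1)" using K(1) by (intro mult_left_mono) auto
    hence "norm (kern0 z ?v x) \<le> K * x powr Re z" using K(2)[OF x] by simp
    hence "norm (kern0 z ?v x) * exp (- (x * d)) \<le> K * x powr Re z * exp (- (x * d))" by (intro mult_right_mono) auto
    thus "norm (kern0 z ?v x * exp (\<i> * of_real e * b * (of_real x * ?v))) \<le> K * (x powr Re z * exp (- d * x))"
      unfolding norm_mult norm_exp_ray[OF e] by (simp add: d_def[symmetric] mult_ac)
  qed
qed

text \<open>In t^z + t^(z+2) the factor 1 + t^2 cancels the denominator, and a plain Gamma integral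
  with parameter u = - i e b v remains. This is the inhomogeneous term of the differential equation
  in b.\<close>

lemma osc_int_add:
  assumes z: "Re z > -1" and e: "unit_sign e" and b: "b > 0" and tau: "\<tau> > 0"
  shows "osc_int e \<tau> z (of_real b) + osc_int e \<tau> (z + 2) (of_real b) =
           Gamma (z + 1) * of_real b powr (- (z + 1)) * exp (\<i> * of_real e * of_real pi * (z + 1) / 2)"
proof -
  let ?v = "rayv e \<tau>"
  let ?M = "halfline"
  define u where "u = - (\<i> * of_real e * of_real b * ?v)"
  have ee: "e * e = 1" using e by auto
  have "Re u = b * \<tau> * (e * e)" by (simp add: u_def mult_ac)
  hence u: "Re u > 0" using b tau ee by simp
  have bw: "of_real b \<in> wedge \<tau>" using b tau by (simp add: wedge_def)
  have z2: "Re (z + 2) > -1" using z by simp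
  have "osc_int e \<tau> z (of_real b) + osc_int e \<tau> (z + 2) (of_real b) =
     (\<integral>x. kern0 z ?v x * exp (\<i> * of_real e * of_real b * (of_real x * ?v)) + kern0 (z + 2) ?v x * exp (\<i> * of_real e * of_real b * (of_real x * ?v)) \<partial>?M)"
    unfolding osc_int_def
    by (rule Bochner_Integration.integral_add[symmetric, OF osc_int_integrable[OF z e bw] osc_int_integrable[OF z2 e bw]])
  also have "\<dots> = (\<integral>x. (?v powr z * ?v) * (of_real x powr z * exp (- u * of_real x)) \<partial>?M)"
  proof (rule integral_halfline_cong)
    fix x :: real assume x: "x > 0"
    have nz: "1 + (of_real x * ?v) ^ 2 \<noteq> 0" using x by (intro quad_nonzero) auto
    have "(of_real x * ?v) powr (z + 2) = (of_real x * ?v) powr z * (of_real x * ?v) ^ 2"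
      using x by (simp add: powr_add powr_numeral power2_eq_square)
    hence "kern0 z ?v x + kern0 (z + 2) ?v x = (of_real x * ?v) powr z * (1 + (of_real x * ?v) ^ 2) / (1 + (of_real x * ?v) ^ 2) * ?v"
      by (simp add: kern0_def add_divide_distrib distrib_left distrib_right)
    also have "\<dots> = (of_real x * ?v) powr z * ?v" using nz by simp
    also have "(of_real x * ?v) powr z = of_real x powr z * ?v powr z" using x by (simp add: powr_of_real_mult)
    finally have "kern0 z ?v x + kern0 (z + 2) ?v x = (?v powr z * ?v) * of_real x powr z" by (simp add: mult_ac)
    moreover have "\<i> * of_real e * of_real b * (of_real x * ?v) = - u * of_real x" by (simp add: u_def)
    ultimately show "kern0 z ?v x * exp (\<i> * of_real e * of_real b * (of_real x * ?v)) + kern0 (z + 2) ?v x * exp (\<i> * of_real e * of_real b * (of_real x * ?v)) =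
        (?v powr z * ?v) * (of_real x powr z * exp (- u * of_real x))"
      by (simp add: distrib_right[symmetric])
  qed
  also have "\<dots> = ?v powr z * ?v * (Gamma (z + 1) * u powr (- (z + 1)))"
    unfolding integral_mult_right_zero integral_Gamma_cmult[OF z u] ..
  also have "u powr (- (z + 1)) = of_real b powr (- (z + 1)) * exp (\<i> * of_real e * of_real pi * (z + 1) / 2) * ?v powr (- (z + 1))"
  proof -
    \<comment> \<open>The candidate for \<open>Ln u\<close>. Since \<open>Ln\<close> of the ray
      direction has imaginary part below pi / 2 in absolute value, the rotation by pi / 2 stays
      inside the principal strip, so no multiple of 2 pi i enters.\<close>
    define L where "L = of_real (ln b) + Ln ?v - \<i> * of_real e * of_real pi / 2"
    have Lv: "\<bar>Im (Ln ?v)\<bar> < pi / 2" using Re_Ln_pos_lt[of ?v] by simp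
    have "exp (\<i> * of_real e * of_real pi / 2) = \<i> * of_real e"
    proof -
      have h: "exp (\<i> * of_real pi / 2) = \<i>" using cis_pi_half by (simp add: cis_conv_exp mult.commute)
      from e show ?thesis
      proof
        assume "e = 1" thus ?thesis using h by simp
      next
        assume "e = -1" thus ?thesis using h by (simp add: exp_minus)
      qed
    qed
    hence "exp (- (\<i> * of_real e * of_real pi / 2)) = - (\<i> * of_real e)"
      using e by (auto simp: exp_minus)
    moreover have "exp L = exp (of_real (ln b)) * exp (Ln ?v) * exp (- (\<i> * of_real e * of_real pi / 2))"
      by (simp only: L_def exp_add[symmetric] diff_conv_add_uminus)
    ultimately have eL: "exp L = u" using b by (simp add: u_def exp_of_real mult_ac)
    have "Ln u = L"
    proof (rule Ln_unique[OF eL])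
      show "- pi < Im L" "Im L \<le> pi" using Lv e by (auto simp: L_def)
    qed
    moreover have "u \<noteq> 0" using u by auto
    ultimately have "u powr (- (z + 1)) = exp (- (z + 1) * L)" by (simp add: powr_def)
    also have "- (z + 1) * L = - (z + 1) * of_real (ln b) + - (z + 1) * Ln ?v + \<i> * of_real e * of_real pi * (z + 1) / 2"
      by (simp add: L_def algebra_simps diff_divide_distrib add_divide_distrib)
    also have "exp \<dots> = exp (- (z + 1) * of_real (ln b)) * exp (- (z + 1) * Ln ?v) * exp (\<i> * of_real e * of_real pi * (z + 1) / 2)"
      by (simp only: exp_add)
    finally show ?thesis using b by (simp add: powr_def Ln_of_real mult_ac)
  qed
  also have "?v powr z * ?v * (Gamma (z + 1) * (of_real b powr (- (z + 1)) * exp (\<i> * of_real e * of_real pi * (z + 1) / 2) * ?v powr (- (z + 1)))) =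
     Gamma (z + 1) * of_real b powr (- (z + 1)) * exp (\<i> * of_real e * of_real pi * (z + 1) / 2)"
  proof -
    have "?v powr z * ?v = ?v powr (z + 1)" by (simp add: powr_add)
    moreover have "?v powr (z + 1) * ?v powr (- (z + 1)) = 1" by (subst powr_minus) simp
    ultimately have one: "?v powr z * ?v * ?v powr (- (z + 1)) = 1" by simp
    have alg: "p * q * (G * (B * E * r)) = G * B * E * (p * q * r)" for p q G B E r :: complex by (simp only: mult_ac)
    show ?thesis by (rule trans[OF alg]) (simp only: one mult_1_right)
  qed
  finally show ?thesis .
qed

text \<open>The exponential has norm at most 1 on its ray, so for Re z < 1 the kernel itself is an
  integrable majorant. The limit no longer depends on the sign or slope of the ray.\<close>

lemma osc_int_limit:
  assumes z: "Re z > -1" "Re z < 1" and e: "unit_sign e" and tau: "\<tau> > 0"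
  shows "(\<lambda>n. osc_int e \<tau> z (of_real (1 / real (Suc n)))) \<longlonglongrightarrow> (\<integral>x. kern0 z 1 x \<partial>halfline)"
proof -
  let ?v = "rayv e \<tau>"
  let ?b = "\<lambda>n. 1 / real (Suc n)"
  have "(\<lambda>n. osc_int e \<tau> z (of_real (?b n))) \<longlonglongrightarrow> (\<integral>x. kern0 z ?v x \<partial>halfline)"
    unfolding osc_int_def
  proof (rule integral_dominated_convergence[where w = "\<lambda>x. norm (kern0 z ?v x)"])
    show "kern0 z ?v \<in> borel_measurable halfline"
      by (intro continuous_imp_measurable_on_sets_lebesgue continuous_on_kern0) auto
    show "(\<lambda>x. kern0 z ?v x * exp (\<i> * of_real e * of_real (?b n) * (of_real x * ?v))) \<in> borel_measurable halfline" for n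
      by (intro continuous_imp_measurable_on_sets_lebesgue continuous_on_osc) auto
    show "integrable halfline (\<lambda>x. norm (kern0 z ?v x))"
      using z by (intro integrable_norm integrable_kern0) auto
    show "AE x in halfline. norm (kern0 z ?v x * exp (\<i> * of_real e * of_real (?b n) * (of_real x * ?v))) \<le> norm (kern0 z ?v x)" for n
    proof (rule AE_I2)
      fix x assume "x \<in> space halfline"
      hence x: "x > 0" by simp
      have "- (x * (\<tau> * ?b n)) \<le> 0" using x tau by simp
      hence "norm (exp (\<i> * of_real e * of_real (?b n) * (of_real x * ?v))) \<le> 1"
        unfolding norm_exp_ray[OF e] by simp
      thus "norm (kern0 z ?v x * exp (\<i> * of_real e * of_real (?b n) * (of_real x * ?v))) \<le> norm (kern0 z ?v x)"
        unfolding norm_mult[of "kern0 z ?v x"] by (intro mult_left_le) auto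
    qed
    show "AE x in halfline. (\<lambda>n. kern0 z ?v x * exp (\<i> * of_real e * of_real (?b n) * (of_real x * ?v))) \<longlonglongrightarrow> kern0 z ?v x"
    proof (rule AE_I2)
      fix x :: real
      have "(\<lambda>n. complex_of_real (?b n)) \<longlonglongrightarrow> of_real 0" by (intro tendsto_of_real LIMSEQ_Suc lim_1_over_n)
      hence "(\<lambda>n. kern0 z ?v x * exp (\<i> * of_real e * of_real (?b n) * (of_real x * ?v))) \<longlonglongrightarrow> kern0 z ?v x * exp (\<i> * of_real e * of_real 0 * (of_real x * ?v))"
        by (intro tendsto_mult tendsto_exp tendsto_const)
      thus "(\<lambda>n. kern0 z ?v x * exp (\<i> * of_real e * of_real (?b n) * (of_real x * ?v))) \<longlonglongrightarrow> kern0 z ?v x" by simp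
    qed
  qed
  also have "(\<integral>x. kern0 z ?v x \<partial>halfline) = (\<integral>x. kern0 z 1 x \<partial>halfline)"
    using z by (intro integral_kern0_rotate) auto
  finally show ?thesis .
qed

text \<open>\<open>D0\<close> adds to the mean of the two integrals the multiple \<open>C\<close> of
  the series, which cancels the inhomogeneous terms: D0'' = D0. Its limits at 0 are D0 = C and D0' =
  0, so D0 = C cosh b. With r between -1 and 0 both z and z + 1 lie in the range where these limits
  at 0 are known.\<close>

lemma osc_sum_formula:
  assumes r: "-1 < r" "r < 0" and b: "b > 0" and tau: "\<tau> > 0"
  defines "z \<equiv> complex_of_real r"
  shows "(osc_int 1 \<tau> z (of_real b) + osc_int (-1) \<tau> z (of_real b)) / 2 =
    of_real pi / (2 * cos (of_real pi * z / 2)) * (cosh (of_real b) - of_real b powr (1 - z) * bseries z (of_real b))"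
proof -
  have z: "Re z > -1" "Re z < 0" using r by (simp_all add: z_def)
  have z1: "Re (z + 1) > -1" using z by simp
  define C where "C = of_real pi / (2 * cos (of_real pi * z / 2))"
  have cosnz: "cos (of_real pi * z / 2) \<noteq> 0"
  proof -
    have "pi * (-1) < pi * r" using r by (intro mult_strict_left_mono) auto
    moreover have "pi * r < pi * 1" using r by (intro mult_strict_left_mono) auto
    ultimately have "cos (pi * r / 2) > 0" by (intro cos_gt_zero_pi) simp_all
    hence "complex_of_real (cos (pi * r / 2)) \<noteq> 0" by simp
    thus ?thesis by (simp add: z_def flip: cos_of_real)
  qed
  have K: "(\<integral>x. kern0 z 1 x \<partial>halfline) = C"
    using integral_kern0_real[of r] r by (simp add: C_def z_def)
  define D0 where "D0 b = (osc_int 1 \<tau> z b + osc_int (-1) \<tau> z b) / 2 + C * (b powr (1 - z) * bseries z b)" for b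
  define D1 where "D1 b = \<i> * (osc_int 1 \<tau> (z + 1) b - osc_int (-1) \<tau> (z + 1) b) / 2 + C * (b powr (- z) * bseries (z + 1) b)" for b
  have d0: "(D0 has_field_derivative D1 (of_real x)) (at (of_real x))" if x: "x > 0" for x
  proof -
    have xw: "of_real x \<in> wedge \<tau>" using x tau by (simp add: wedge_def)
    have "(D0 has_field_derivative ((\<i> * of_real 1 * osc_int 1 \<tau> (z + 1) (of_real x) + \<i> * of_real (-1) * osc_int (-1) \<tau> (z + 1) (of_real x)) / 2
        + C * (of_real x powr (- z) * bseries (z + 1) (of_real x)))) (at (of_real x))"
      unfolding D0_def[abs_def]
      using x by (intro DERIV_add DERIV_cdivide DERIV_cmult osc_int_deriv[OF z(1) _ xw] has_field_derivative_powr_bseries) auto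
    thus ?thesis by (simp add: D1_def algebra_simps)
  qed
  have d1: "(D1 has_field_derivative D0 (of_real x)) (at (of_real x))" if x: "x > 0" for x
  proof -
    have xw: "of_real x \<in> wedge \<tau>" using x tau by (simp add: wedge_def)
    have x0: "complex_of_real x \<noteq> 0" using x by simp
    have "((\<lambda>b. b powr (1 - (z + 1)) * bseries (z + 1) b) has_field_derivative (of_real x powr (- (z + 1)) * bseries (z + 1 + 1) (of_real x))) (at (of_real x))"
      using x by (intro has_field_derivative_powr_bseries) auto
    hence bs: "((\<lambda>b. b powr (- z) * bseries (z + 1) b) has_field_derivative (of_real x powr (- (z + 1)) * bseries (z + 2) (of_real x))) (at (of_real x))"
      by (simp add: add.assoc)
    have "(D1 has_field_derivative (\<i> * (\<i> * of_real 1 * osc_int 1 \<tau> (z + 1 + 1) (of_real x) - \<i> * of_real (-1) * osc_int (-1) \<tau> (z + 1 + 1) (of_real x)) / 2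
        + C * (of_real x powr (- (z + 1)) * bseries (z + 2) (of_real x)))) (at (of_real x))"
      unfolding D1_def[abs_def]
      using x by (intro DERIV_add DERIV_cdivide DERIV_cmult DERIV_diff osc_int_deriv[OF z1 _ xw] bs) auto
    also have "\<i> * (\<i> * of_real 1 * osc_int 1 \<tau> (z + 1 + 1) (of_real x) - \<i> * of_real (-1) * osc_int (-1) \<tau> (z + 1 + 1) (of_real x)) / 2 =
       - (osc_int 1 \<tau> (z + 2) (of_real x) + osc_int (-1) \<tau> (z + 2) (of_real x)) / 2"
      by (simp add: algebra_simps)
    also have "\<dots> = (osc_int 1 \<tau> z (of_real x) + osc_int (-1) \<tau> z (of_real x)) / 2 - C * of_real x powr (- (z + 1)) * rGamma (- z)"
    proof -
      have "osc_int 1 \<tau> z (of_real x) + osc_int 1 \<tau> (z + 2) (of_real x) + (osc_int (-1) \<tau> z (of_real x) + osc_int (-1) \<tau> (z + 2) (of_real x)) =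
         Gamma (z + 1) * of_real x powr (- (z + 1)) * (exp (\<i> * of_real pi * (z + 1) / 2) + exp (- (\<i> * of_real pi * (z + 1) / 2)))"
      proof -
        have us: "unit_sign 1" "unit_sign (-1)" by auto
        have arg: "\<i> * of_real (-1) * of_real pi * (z + 1) / 2 = - (\<i> * of_real pi * (z + 1) / 2)"
          "\<i> * of_real 1 * of_real pi * (z + 1) / 2 = \<i> * of_real pi * (z + 1) / 2" by simp_all
        show ?thesis unfolding osc_int_add[OF z(1) us(1) x tau] osc_int_add[OF z(1) us(2) x tau] arg by (rule distrib_left[symmetric])
      qed
      also have "exp (\<i> * of_real pi * (z + 1) / 2) + exp (- (\<i> * of_real pi * (z + 1) / 2)) = 2 * cos (of_real pi * (z + 1) / 2)"
        by (simp add: cos_exp_eq mult.assoc)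
      also have "cos (of_real pi * (z + 1) / 2) = - sin (of_real pi * z / 2)"
      proof -
        have "of_real pi * (z + 1) / 2 = of_real pi * z / 2 + of_real pi / 2" by (simp add: field_simps)
        thus ?thesis by (simp only: cos_add) simp
      qed
      \<comment> \<open>Here the two inhomogeneous terms are matched: by the reflection and
        double-angle formulas, \<open>C * rGamma (- z)\<close> equals - sin (pi z / 2) * Gamma (z +
        1).\<close>
      also have "Gamma (z + 1) * of_real x powr (- (z + 1)) * (2 * - sin (of_real pi * z / 2)) = 2 * (C * of_real x powr (- (z + 1)) * rGamma (- z))"
      proof -
        have nG: "z + 1 \<notin> \<int>\<^sub>\<le>\<^sub>0"
        proof
          assume "z + 1 \<in> \<int>\<^sub>\<le>\<^sub>0"
          then obtain n where "z + 1 = of_int n" "n \<le> 0" by (elim nonpos_Ints_cases)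
          from arg_cong[OF this(1), of Re] this(2) z show False by simp
        qed
        have "rGamma (- z) * rGamma (1 - (- z)) = sin (of_real pi * (- z)) / of_real pi" by (rule rGamma_reflection_complex)
        hence "rGamma (- z) * rGamma (z + 1) = - sin (of_real pi * z) / of_real pi" by (simp add: add.commute)
        moreover have "rGamma (z + 1) * Gamma (z + 1) = 1" using nG by (simp add: rGamma_inverse_Gamma Gamma_eq_zero_iff)
        ultimately have "rGamma (- z) = - sin (of_real pi * z) / of_real pi * Gamma (z + 1)"
          by (metis mult.assoc mult.right_neutral)
        also have "sin (of_real pi * z) = 2 * sin (of_real pi * z / 2) * cos (of_real pi * z / 2)"
          using sin_double[of "of_real pi * z / 2"] by simp
        finally have R: "rGamma (- z) = - (2 * sin (of_real pi * z / 2) * cos (of_real pi * z / 2)) / of_real pi * Gamma (z + 1)" .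
        have CR: "C * rGamma (- z) = - sin (of_real pi * z / 2) * Gamma (z + 1)"
          unfolding C_def R using cosnz by (simp add: divide_simps)
        have "2 * (C * of_real x powr (- (z + 1)) * rGamma (- z)) = 2 * of_real x powr (- (z + 1)) * (C * rGamma (- z))"
          by (simp only: mult_ac)
        thus ?thesis unfolding CR by (simp only:) (simp only: mult_minus_left mult_minus_right mult_ac)
      qed
      finally have Q: "osc_int 1 \<tau> z (of_real x) + osc_int (-1) \<tau> z (of_real x) - 2 * (C * of_real x powr (- (z + 1)) * rGamma (- z)) =
         - (osc_int 1 \<tau> (z + 2) (of_real x) + osc_int (-1) \<tau> (z + 2) (of_real x))"
        by (simp add: algebra_simps)
      show ?thesis unfolding Q[symmetric] by (simp add: diff_divide_distrib)
    qed
    also have "bseries (z + 2) (of_real x) = rGamma (- z) + (of_real x) ^ 2 * bseries z (of_real x)" by (rule bseries_shift)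
    also have "(osc_int 1 \<tau> z (of_real x) + osc_int (-1) \<tau> z (of_real x)) / 2 - C * of_real x powr (- (z + 1)) * rGamma (- z)
       + C * (of_real x powr (- (z + 1)) * (rGamma (- z) + (of_real x) ^ 2 * bseries z (of_real x))) = D0 (of_real x)"
    proof -
      have "1 - z = - (z + 1) + 2" by simp
      hence "of_real x powr (1 - z) = of_real x powr (- (z + 1)) * (of_real x) ^ 2"
        using x0 by (simp only: powr_add) (simp add: powr_numeral)
      thus ?thesis by (simp add: D0_def algebra_simps)
    qed
    finally show ?thesis .
  qed
  have lim0: "(\<lambda>n. D0 (of_real (1 / real (Suc n)))) \<longlonglongrightarrow> C" and lim1: "(\<lambda>n. D1 (of_real (1 / real (Suc n)))) \<longlonglongrightarrow> 0"
  proof -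
    have s0: "(\<lambda>n. 1 / real (Suc n)) \<longlonglongrightarrow> 0" by (rule LIMSEQ_Suc[OF lim_1_over_n])
    have b0: "(\<lambda>n. bseries z (of_real (1 / real (Suc n)))) \<longlonglongrightarrow> bseries z (of_real 0)" for z
    proof -
      have "isCont (bseries z) (of_real 0)"
        using holomorphic_on_imp_continuous_on[OF holomorphic_bseries2[of z]] by (simp add: continuous_on_eq_continuous_at)
      thus ?thesis by (rule isCont_tendsto_compose) (intro tendsto_of_real s0)
    qed
    have p0: "(\<lambda>n. complex_of_real (1 / real (Suc n)) powr p) \<longlonglongrightarrow> 0" if "Re p > 0" for p
    proof (rule Lim_null_comparison)
      show "eventually (\<lambda>n. norm (complex_of_real (1 / real (Suc n)) powr p) \<le> (1 / real (Suc n)) powr Re p) sequentially"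
        by (intro always_eventually allI) (subst norm_powr_real_powr, auto)
      have "(\<lambda>n. (1 / real (Suc n)) powr Re p) \<longlonglongrightarrow> 0 powr Re p"
        using that by (intro tendsto_powr'[OF s0 tendsto_const]) auto
      thus "(\<lambda>n. (1 / real (Suc n)) powr Re p) \<longlonglongrightarrow> 0" by simp
    qed
    have "(\<lambda>n. D0 (of_real (1 / real (Suc n)))) \<longlonglongrightarrow> (C + C) / 2 + C * (0 * bseries z (of_real 0))"
      unfolding D0_def K[symmetric] using z tau by (intro tendsto_intros osc_int_limit b0 p0) auto
    thus "(\<lambda>n. D0 (of_real (1 / real (Suc n)))) \<longlonglongrightarrow> C" by simp
    \<comment> \<open>Both rotated integrals tend to the same unrotated one, so their difference
      vanishes at 0.\<close>
    have "(\<lambda>n. D1 (of_real (1 / real (Suc n)))) \<longlonglongrightarrow> \<i> * ((\<integral>x. kern0 (z + 1) 1 x \<partial>halfline) - (\<integral>x. kern0 (z + 1) 1 x \<partial>halfline)) / 2 + C * (0 * bseries (z + 1) (of_real 0))"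
      unfolding D1_def using z tau by (intro tendsto_intros osc_int_limit b0 p0) auto
    thus "(\<lambda>n. D1 (of_real (1 / real (Suc n)))) \<longlonglongrightarrow> 0" by simp
  qed
  \<comment> \<open>First integrals of y'' = y: (y + s y') e^(-s b) is constant for s = 1 and s =
    -1, and its value is read off at 0. Adding the two cases gives the hyperbolic cosine.\<close>
  have const: "(D0 (of_real x) + s * D1 (of_real x)) * exp (- s * of_real x) = C" if s: "s = 1 \<or> s = -1" and x: "x > 0" for s x
  proof -
    let ?E = "\<lambda>b. (D0 b + s * D1 b) * exp (- s * b)"
    have "((\<lambda>y. ?E (of_real y)) has_vector_derivative 0) (at y within {0<..})" if "y \<in> {0<..}" for y
    proof (rule has_vector_derivative_real_field)
      have y: "y > 0" using that by simp
      have "(?E has_field_derivative (D1 (of_real y) + s * D0 (of_real y)) * exp (- s * of_real y) + (exp (- s * of_real y) * (- s * 1)) * (D0 (of_real y) + s * D1 (of_real y))) (at (of_real y))"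
        by (intro DERIV_mult DERIV_add DERIV_cmult d0 d1 y DERIV_fun_exp DERIV_ident)
      moreover have "(D1 (of_real y) + s * D0 (of_real y)) * exp (- s * of_real y) + (exp (- s * of_real y) * (- s * 1)) * (D0 (of_real y) + s * D1 (of_real y)) = 0"
        using s by (auto simp: algebra_simps)
      ultimately show "(?E has_field_derivative 0) (at (of_real y))" by simp
    qed
    then obtain c where c: "\<And>y. y \<in> {0<..} \<Longrightarrow> ?E (of_real y) = c"
      using has_vector_derivative_zero_constant[of "{0<..}" "\<lambda>y. ?E (of_real y)"] by auto
    have s0: "(\<lambda>n. complex_of_real (1 / real (Suc n))) \<longlonglongrightarrow> of_real 0"
      by (intro tendsto_of_real LIMSEQ_Suc[OF lim_1_over_n])
    have "(\<lambda>n. ?E (of_real (1 / real (Suc n)))) \<longlonglongrightarrow> (C + s * 0) * exp (- s * of_real 0)"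
      by (intro tendsto_intros lim0 lim1 s0)
    moreover have "?E (of_real (1 / real (Suc n))) = c" for n by (rule c) simp
    ultimately have "c = C" by (simp add: LIMSEQ_const_iff)
    thus ?thesis using c[of x] x by simp
  qed
  have "D0 (of_real b) + D1 (of_real b) = C * exp (of_real b)"
    using const[of 1, OF _ b] by (simp add: exp_minus field_simps)
  moreover have "D0 (of_real b) - D1 (of_real b) = C * exp (- of_real b)"
    using const[of "-1", OF _ b] by (simp add: exp_minus field_simps)
  ultimately have "2 * D0 (of_real b) = C * (exp (of_real b) + exp (- of_real b))" by (simp add: distrib_left) (metis add_diff_cancel_left' diff_add_eq diff_diff_eq2 mult_2)
  hence "D0 (of_real b) = C * cosh (of_real b)" by (simp add: cosh_field_def mult.commute)
  hence "(osc_int 1 \<tau> z (of_real b) + osc_int (-1) \<tau> z (of_real b)) / 2 = C * (cosh (of_real b) - of_real b powr (1 - z) * bseries z (of_real b))"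
    unfolding D0_def by (simp only: right_diff_distrib eq_diff_eq)
  thus ?thesis unfolding C_def .
qed

section \<open>Rotated integrals representing \<open>B\<close>\<close>

definition bregion :: "real \<Rightarrow> complex set" where "bregion \<tau> = {b. \<tau> * \<bar>Im b\<bar> < Re b}"

lemma open_bregion: "open (bregion \<tau>)"
  unfolding bregion_def by (intro open_Collect_less continuous_intros)

lemma convex_bregion:
  assumes "\<tau> \<ge> 0"
  shows "convex (bregion \<tau>)"
proof -
  have "bregion \<tau> = {b. \<tau> * Im b < Re b} \<inter> {b. - (\<tau> * Im b) < Re b}"
  proof safe
    fix b assume "b \<in> bregion \<tau>"
    hence "\<bar>\<tau> * Im b\<bar> < Re b" using assms by (simp add: bregion_def abs_mult)
    thus "\<tau> * Im b < Re b" "- (\<tau> * Im b) < Re b" by auto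
  next
    fix b assume "\<tau> * Im b < Re b" "- (\<tau> * Im b) < Re b"
    hence "\<bar>\<tau> * Im b\<bar> < Re b" by auto
    thus "b \<in> bregion \<tau>" using assms by (simp add: bregion_def abs_mult)
  qed
  also have "\<dots> = {b. inner (Complex (-1) \<tau>) b < 0} \<inter> {b. inner (Complex (-1) (-\<tau>)) b < 0}"
    by (auto simp: inner_complex_def)
  finally show ?thesis by (simp add: convex_Int convex_halfspace_lt)
qed

text \<open>One exponential half of the defining integral of B(z, b), rotated to the ray on which it
  decays. Here the frequency is 1 and \<open>b\<close> sits in the denominator, the normalisation of
  \<open>B\<close>.\<close>

definition bint :: "real \<Rightarrow> real \<Rightarrow> complex \<Rightarrow> complex \<Rightarrow> complex" where
  "bint e \<tau> z b = (\<integral>x. (of_real x * rayv e \<tau>) powr z * exp (\<i> * of_real e * (of_real x * rayv e \<tau>)) /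
      ((of_real x * rayv e \<tau>) ^ 2 + b ^ 2) * rayv e \<tau> \<partial>halfline)"

text \<open>The denominator vanishes at the points i b and - i b. For \<open>b\<close> in
  \<open>bregion\<close> these lie outside the closed wedge bounded by the rays, and each factor is
  bounded below by a distance to the line of the ray, obtained from the imaginary part after
  multiplication by the conjugate direction.\<close>

lemma norm_quad_ray_ge:
  assumes e: "unit_sign e" and b: "b \<in> bregion \<tau>" and tau: "\<tau> > 0"
  shows "norm ((of_real x * rayv e \<tau>) ^ 2 + b ^ 2) \<ge> (Re b - \<tau> * \<bar>Im b\<bar>)\<^sup>2 / (norm (rayv e \<tau>))\<^sup>2"
proof -
  let ?v = "rayv e \<tau>"
  define g where "g = Re b - \<tau> * \<bar>Im b\<bar>"
  have g: "g > 0" using b by (simp add: g_def bregion_def)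
  have key: "g \<le> norm (of_real x * ?v + of_real s * (\<i> * b)) * norm ?v" if s: "s = 1 \<or> s = -1" for s
  proof -
    have eq: "Im ((of_real x * ?v + of_real s * (\<i> * b)) * cnj ?v) = s * (Re b + e * \<tau> * Im b)"
      by (simp add: algebra_simps)
    have "\<bar>e * \<tau> * Im b\<bar> = \<tau> * \<bar>Im b\<bar>" using e tau by (auto simp: abs_mult)
    hence "g \<le> Re b + e * \<tau> * Im b" unfolding g_def by linarith
    hence "g \<le> \<bar>s * (Re b + e * \<tau> * Im b)\<bar>" using s by auto
    also have "\<dots> \<le> norm ((of_real x * ?v + of_real s * (\<i> * b)) * cnj ?v)" unfolding eq[symmetric] by (rule abs_Im_le_cmod)
    finally show ?thesis by (simp add: norm_mult)
  qed
  have f: "(of_real x * ?v) ^ 2 + b ^ 2 = (of_real x * ?v + of_real 1 * (\<i> * b)) * (of_real x * ?v + of_real (-1) * (\<i> * b))"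
    by (simp add: power2_eq_square algebra_simps)
  have "g * g \<le> (norm (of_real x * ?v + of_real 1 * (\<i> * b)) * norm ?v) * (norm (of_real x * ?v + of_real (-1) * (\<i> * b)) * norm ?v)"
    using g key[of 1] key[of "-1"] by (intro mult_mono) auto
  also have "\<dots> = norm ((of_real x * ?v + of_real 1 * (\<i> * b)) * (of_real x * ?v + of_real (-1) * (\<i> * b))) * (norm ?v)\<^sup>2"
    unfolding norm_mult[of "of_real x * ?v + of_real 1 * (\<i> * b)"] power2_eq_square by (simp only: mult_ac)
  also note f[symmetric]
  finally show ?thesis by (simp add: g_def[symmetric] power2_eq_square field_simps)
qed

lemma quad_ray_nz:
  assumes "unit_sign e" "b \<in> bregion \<tau>" "\<tau> > 0"
  shows "(of_real x * rayv e \<tau>) ^ 2 + b ^ 2 \<noteq> 0"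
proof
  assume "(of_real x * rayv e \<tau>) ^ 2 + b ^ 2 = 0"
  hence "(Re b - \<tau> * \<bar>Im b\<bar>)\<^sup>2 / (norm (rayv e \<tau>))\<^sup>2 \<le> 0" using norm_quad_ray_ge[OF assms, of x] by simp
  moreover have "(Re b - \<tau> * \<bar>Im b\<bar>)\<^sup>2 / (norm (rayv e \<tau>))\<^sup>2 > 0"
    using assms(2) by (simp add: bregion_def)
  ultimately show False by simp
qed

abbreviation bint_integrand :: "real \<Rightarrow> real \<Rightarrow> complex \<Rightarrow> complex \<Rightarrow> real \<Rightarrow> complex" where
  "bint_integrand e \<tau> z b x \<equiv> (of_real x * rayv e \<tau>) powr z * exp (\<i> * of_real e * (of_real x * rayv e \<tau>)) /
      ((of_real x * rayv e \<tau>) ^ 2 + b ^ 2) * rayv e \<tau>"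

lemma bint_continuous:
  assumes "unit_sign e" "b \<in> bregion \<tau>" "\<tau> > 0"
  shows "continuous_on {0<..} (bint_integrand e \<tau> z b)"
proof (intro continuous_intros)
  show "\<forall>x\<in>{0<..}. (of_real x * rayv e \<tau>) ^ 2 + b ^ 2 \<noteq> 0" using quad_ray_nz[OF assms] by simp
qed auto

lemma bint_bound:
  assumes e: "unit_sign e" and tau: "\<tau> > 0" and z: "\<bar>Im z\<bar> \<le> Q" and b: "b \<in> bregion \<tau>" "Re b - \<tau> * \<bar>Im b\<bar> \<ge> g" "g > 0" and x: "x > 0"
  shows "norm (bint_integrand e \<tau> z b x) \<le> exp (pi * Q) * norm (rayv e \<tau>) ^ 3 / g\<^sup>2 * ((x * norm (rayv e \<tau>)) powr Re z * exp (- \<tau> * x))"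
proof -
  let ?v = "rayv e \<tau>"
  have "norm ((of_real x * ?v) powr z) \<le> norm (of_real x * ?v) powr Re z * exp (pi * \<bar>Im z\<bar>)"
    using x by (intro norm_powr_complex_bounds) auto
  also have "\<dots> \<le> (x * norm ?v) powr Re z * exp (pi * Q)"
    using x z by (intro mult_mono) (auto simp: norm_mult)
  finally have 1: "norm ((of_real x * ?v) powr z) \<le> (x * norm ?v) powr Re z * exp (pi * Q)" .
  have "norm (exp (\<i> * of_real e * 1 * (of_real x * ?v))) = exp (- (x * (\<tau> * Re 1 + e * Im 1)))" by (rule norm_exp_ray[OF e])
  hence 2: "norm (exp (\<i> * of_real e * (of_real x * ?v))) = exp (- \<tau> * x)" by (simp add: mult.commute)
  have "g\<^sup>2 / (norm ?v)\<^sup>2 \<le> (Re b - \<tau> * \<bar>Im b\<bar>)\<^sup>2 / (norm ?v)\<^sup>2" using b by (intro divide_right_mono power_mono) auto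
  also have "\<dots> \<le> norm ((of_real x * ?v) ^ 2 + b ^ 2)" by (rule norm_quad_ray_ge[OF e b(1) tau])
  finally have 3: "g\<^sup>2 / (norm ?v)\<^sup>2 \<le> norm ((of_real x * ?v) ^ 2 + b ^ 2)" .
  have "norm (bint_integrand e \<tau> z b x) = norm ((of_real x * ?v) powr z) * exp (- \<tau> * x) / norm ((of_real x * ?v) ^ 2 + b ^ 2) * norm ?v"
    unfolding norm_mult[of _ ?v] norm_divide norm_mult[of "(of_real x * ?v) powr z"] 2 ..
  also have "\<dots> \<le> ((x * norm ?v) powr Re z * exp (pi * Q) * exp (- \<tau> * x)) / (g\<^sup>2 / (norm ?v)\<^sup>2) * norm ?v"
    using b by (intro mult_right_mono frac_le 1 3) (auto intro!: divide_pos_pos)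
  also have "\<dots> = exp (pi * Q) * norm ?v ^ 3 / g\<^sup>2 * ((x * norm ?v) powr Re z * exp (- \<tau> * x))"
    using b by (simp add: field_simps power2_eq_square power3_eq_cube)
  finally show ?thesis .
qed

lemma integrable_bint:
  assumes e: "unit_sign e" and tau: "\<tau> > 0" and z: "Re z > -1" and b: "b \<in> bregion \<tau>"
  shows "integrable halfline (bint_integrand e \<tau> z b)"
proof (rule integrable_halfline_bound[OF bint_continuous[OF e b tau]])
  let ?v = "rayv e \<tau>"
  define g where "g = Re b - \<tau> * \<bar>Im b\<bar>"
  have g: "g > 0" using b by (simp add: g_def bregion_def)
  define K where "K = exp (pi * \<bar>Im z\<bar>) * norm ?v ^ 3 / g\<^sup>2 * norm ?v powr Re z"
  show "integrable halfline (\<lambda>x. K * (x powr Re z * exp (- \<tau> * x)))"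
    by (intro integrable_mult_right integrable_powr_exp_halfline z tau)
  fix x :: real assume x: "x > 0"
  have "norm (bint_integrand e \<tau> z b x) \<le> exp (pi * \<bar>Im z\<bar>) * norm ?v ^ 3 / g\<^sup>2 * ((x * norm ?v) powr Re z * exp (- \<tau> * x))"
    by (rule bint_bound[OF e tau order_refl b _ g x]) (simp add: g_def)
  also have "\<dots> = K * (x powr Re z * exp (- \<tau> * x))" using x by (simp add: K_def powr_mult)
  finally show "norm (bint_integrand e \<tau> z b x) \<le> K * (x powr Re z * exp (- \<tau> * x))" .
qed

lemma holomorphic_bint_b:
  assumes e: "unit_sign e" and tau: "\<tau> > 0" and z: "Re z > -1"
  shows "bint e \<tau> z holomorphic_on bregion \<tau>"
  unfolding bint_def[abs_def]
proof (rule holomorphic_on_integral_halfline[OF open_bregion])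
  let ?v = "rayv e \<tau>"
  show "continuous_on {0<..} (bint_integrand e \<tau> z b)" if "b \<in> bregion \<tau>" for b by (rule bint_continuous[OF e that tau])
  show "(\<lambda>b. bint_integrand e \<tau> z b x) holomorphic_on bregion \<tau>" for x
    using quad_ray_nz[OF e _ tau] by (intro holomorphic_intros) auto
  fix b0 assume b0: "b0 \<in> bregion \<tau>"
  define g where "g = (Re b0 - \<tau> * \<bar>Im b0\<bar>) / 2"
  have g: "g > 0" using b0 by (simp add: g_def bregion_def)
  have "open {b. g < Re b - \<tau> * \<bar>Im b\<bar>}" by (intro open_Collect_less continuous_intros)
  moreover have "b0 \<in> {b. g < Re b - \<tau> * \<bar>Im b\<bar>}" using b0 by (simp add: g_def bregion_def)
  ultimately obtain r where r: "r > 0" "ball b0 r \<subseteq> {b. g < Re b - \<tau> * \<bar>Im b\<bar>}" by (meson openE)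
  define K where "K = exp (pi * \<bar>Im z\<bar>) * norm ?v ^ 3 / g\<^sup>2 * norm ?v powr Re z"
  have "norm (bint_integrand e \<tau> z b x) \<le> K * (x powr Re z * exp (- \<tau> * x))" if b: "b \<in> bregion \<tau>" "b \<in> ball b0 r" and x: "x > 0" for b x
  proof -
    have "norm (bint_integrand e \<tau> z b x) \<le> exp (pi * \<bar>Im z\<bar>) * norm ?v ^ 3 / g\<^sup>2 * ((x * norm ?v) powr Re z * exp (- \<tau> * x))"
      using b r by (intro bint_bound[OF e tau order_refl b(1) _ g x]) auto
    also have "\<dots> = K * (x powr Re z * exp (- \<tau> * x))" using x by (simp add: K_def powr_mult)
    finally show ?thesis .
  qed
  moreover have "integrable halfline (\<lambda>x. K * (x powr Re z * exp (- \<tau> * x)))"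
    by (intro integrable_mult_right integrable_powr_exp_halfline z tau)
  ultimately show "\<exists>r>0. \<exists>g. integrable halfline g \<and> (\<forall>b\<in>bregion \<tau> \<inter> ball b0 r. \<forall>x>0. norm (bint_integrand e \<tau> z b x) \<le> g x)"
    using r(1) by (intro exI[of _ r] conjI exI[of _ "\<lambda>x. K * (x powr Re z * exp (- \<tau> * x))"]) auto
qed

lemma holomorphic_bint_z:
  assumes e: "unit_sign e" and tau: "\<tau> > 0" and b: "b \<in> bregion \<tau>"
  shows "(\<lambda>z. bint e \<tau> z b) holomorphic_on {z. Re z > -1}"
  unfolding bint_def
proof (rule holomorphic_on_integral_halfline)
  let ?v = "rayv e \<tau>"
  show "open {z. Re z > -1}" by (rule open_halfspace_Re_gt)
  show "continuous_on {0<..} (bint_integrand e \<tau> z b)" for z by (rule bint_continuous[OF e b tau])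
  show "(\<lambda>z. bint_integrand e \<tau> z b x) holomorphic_on {z. Re z > -1}" for x
    using quad_ray_nz[OF e b tau] by (intro holomorphic_intros holomorphic_powr_exponent) auto
  fix z0 :: complex assume "z0 \<in> {z. Re z > -1}"
  hence z0: "Re z0 > -1" by simp
  define d where "d = (Re z0 + 1) / 2"
  have d: "d > 0" "Re z0 - d > -1" using z0 by (auto simp: d_def field_simps)
  define g where "g = Re b - \<tau> * \<bar>Im b\<bar>"
  have g: "g > 0" using b by (simp add: g_def bregion_def)
  define L where "L = exp (pi * (\<bar>Im z0\<bar> + d)) * norm ?v ^ 3 / g\<^sup>2"
  have L: "L \<ge> 0" by (simp add: L_def)
  define D where "D x = L * norm ?v powr (Re z0 - d) * (x powr (Re z0 - d) * exp (- \<tau> * x)) + L * norm ?v powr (Re z0 + d) * (x powr (Re z0 + d) * exp (- \<tau> * x))" for x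
  have "integrable halfline D"
    unfolding D_def using d tau by (intro Bochner_Integration.integrable_add integrable_mult_right integrable_powr_exp_halfline) auto
  moreover have "norm (bint_integrand e \<tau> z b x) \<le> D x" if z: "z \<in> ball z0 d" and x: "x > 0" for z x
  proof -
    let ?N = "x * norm ?v"
    have N: "?N > 0" using x by simp
    have "\<bar>Re (z0 - z)\<bar> < d" "\<bar>Im (z0 - z)\<bar> < d"
      using z abs_Re_le_cmod[of "z0 - z"] abs_Im_le_cmod[of "z0 - z"] by (auto simp: dist_norm)
    hence r: "Re z0 - d \<le> Re z" "Re z \<le> Re z0 + d" "\<bar>Im z\<bar> \<le> \<bar>Im z0\<bar> + d" by auto
    have pz: "?N powr Re z \<le> ?N powr (Re z0 - d) + ?N powr (Re z0 + d)"
    proof (cases "?N \<le> 1")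
      case True
      have "?N powr Re z \<le> ?N powr (Re z0 - d)" using r N True by (intro powr_mono') auto
      thus ?thesis by (simp add: add_increasing2)
    next
      case False
      have "?N powr Re z \<le> ?N powr (Re z0 + d)" using r False by (intro powr_mono) auto
      thus ?thesis by (simp add: add_increasing)
    qed
    have "norm (bint_integrand e \<tau> z b x) \<le> L * (?N powr Re z * exp (- \<tau> * x))"
      unfolding L_def by (rule bint_bound[OF e tau r(3) b _ g x]) (simp add: g_def)
    also have "\<dots> \<le> L * ((?N powr (Re z0 - d) + ?N powr (Re z0 + d)) * exp (- \<tau> * x))"
      using L pz by (intro mult_left_mono mult_right_mono) auto
    also have "\<dots> = D x" using x by (simp add: D_def powr_mult algebra_simps)
    finally show ?thesis .
  qed
  ultimately show "\<exists>r>0. \<exists>g. integrable halfline g \<and> (\<forall>z\<in>{z. Re z > -1} \<inter> ball z0 r. \<forall>x>0. norm (bint_integrand e \<tau> z b x) \<le> g x)"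
    using d(1) by (intro exI[of _ d] conjI exI[of _ D]) auto
qed

lemma bint_scale:
  assumes b: "b > 0"
  shows "bint e \<tau> z (of_real b) = of_real b powr (z - 1) * osc_int e \<tau> z (of_real b)"
proof -
  let ?v = "rayv e \<tau>"
  let ?M = "halfline"
  have "bint e \<tau> z (of_real b) / of_real b = (\<integral>x. bint_integrand e \<tau> z (of_real b) (b * x) \<partial>?M)"
    unfolding bint_def by (rule integral_halfline_scale[OF b, symmetric])
  also have "\<dots> = (\<integral>x. of_real b powr z / of_real b ^ 2 * (kern0 z ?v x * exp (\<i> * of_real e * of_real b * (of_real x * ?v))) \<partial>?M)"
  proof (rule integral_halfline_cong)
    fix x :: real assume x: "x > 0"
    have p: "(of_real (b * x) * ?v) powr z = of_real b powr z * (of_real x * ?v) powr z"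
      using powr_of_real_mult[OF b, of "of_real x * ?v" z] x by (simp add: mult.assoc)
    have q: "(of_real (b * x) * ?v) ^ 2 + of_real b ^ 2 = of_real b ^ 2 * (1 + (of_real x * ?v) ^ 2)"
      by (simp add: power2_eq_square algebra_simps)
    have ex: "\<i> * of_real e * (of_real (b * x) * ?v) = \<i> * of_real e * of_real b * (of_real x * ?v)" by simp
    show "bint_integrand e \<tau> z (of_real b) (b * x) = of_real b powr z / of_real b ^ 2 * (kern0 z ?v x * exp (\<i> * of_real e * of_real b * (of_real x * ?v)))"
      unfolding p q ex kern0_def by (simp add: field_simps)
  qed
  also have "\<dots> = of_real b powr z / of_real b ^ 2 * osc_int e \<tau> z (of_real b)" unfolding osc_int_def by (rule integral_mult_right_zero)
  finally show ?thesis using b by (simp add: powr_diff power2_eq_square field_simps)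
qed

text \<open>For real z in (-1, 0) and b > 0 this is \<open>osc_sum_formula\<close> after scaling; it
  is continued first in \<open>b\<close> over \<open>bregion\<close> and then in \<open>z\<close>.
  The factor cos (pi z / 2) is kept on the left so that both sides are holomorphic at the odd
  integers too.\<close>

lemma bint_sum_formula:
  assumes tau: "\<tau> > 0" and z: "Re z > -1" and b: "b \<in> bregion \<tau>"
  shows "2 * cos (of_real pi * z / 2) / of_real pi * ((bint 1 \<tau> z b + bint (-1) \<tau> z b) / 2) = b powr (z - 1) * cosh b - bseries z b"
proof -
  have us: "unit_sign 1" "unit_sign (-1)" by auto
  have Re_pos: "Re b > 0" if "b \<in> bregion \<tau>" for b
  proof -
    have "0 \<le> \<tau> * \<bar>Im b\<bar>" using tau by simp
    thus ?thesis using that unfolding bregion_def by auto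
  qed
  have bnn: "b \<notin> \<real>\<^sub>\<le>\<^sub>0" if "b \<in> bregion \<tau>" for b using Re_pos[OF that] by (auto simp: complex_nonpos_Reals_iff)
  have hb: "(\<lambda>b. b powr (z - 1) * cosh b - bseries z b) holomorphic_on bregion \<tau>" for z
    using bnn by (intro holomorphic_intros holomorphic_on_subset[OF holomorphic_bseries2]) (auto simp: cosh_field_def intro!: holomorphic_intros)
  have base: "2 * cos (of_real pi * z / 2) / of_real pi * ((bint 1 \<tau> z b + bint (-1) \<tau> z b) / 2) = b powr (z - 1) * cosh b - bseries z b"
    if r: "-1 < r" "r < 0" and zr: "z = of_real r" and b: "b \<in> bregion \<tau>" for r z b
  proof (rule analytic_continuation_reals[where S = "bregion \<tau>" and a = 0 and b = 1 and w = b
        and f = "\<lambda>b. 2 * cos (of_real pi * z / 2) / of_real pi * ((bint 1 \<tau> z b + bint (-1) \<tau> z b) / 2)"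
        and g = "\<lambda>b. b powr (z - 1) * cosh b - bseries z b"])
    have rz: "Re z > -1" using r zr by simp
    show "(\<lambda>b. 2 * cos (of_real pi * z / 2) / of_real pi * ((bint 1 \<tau> z b + bint (-1) \<tau> z b) / 2)) holomorphic_on bregion \<tau>"
      by (intro holomorphic_intros holomorphic_bint_b us tau rz) auto
    show "connected (bregion \<tau>)" using tau by (intro convex_connected convex_bregion) auto
    fix x :: real assume x: "0 < x" "x < 1"
    have cosnz: "cos (of_real pi * z / 2) \<noteq> 0"
    proof -
      have "pi * (-1) < pi * r" using r by (intro mult_strict_left_mono) auto
      moreover have "pi * r < pi * 1" using r by (intro mult_strict_left_mono) auto
      ultimately have "cos (pi * r / 2) > 0" by (intro cos_gt_zero_pi) simp_all
      hence "complex_of_real (cos (pi * r / 2)) \<noteq> 0" by simp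
      thus ?thesis by (simp add: zr flip: cos_of_real)
    qed
    have "(bint 1 \<tau> z (of_real x) + bint (-1) \<tau> z (of_real x)) / 2 = of_real x powr (z - 1) * ((osc_int 1 \<tau> z (of_real x) + osc_int (-1) \<tau> z (of_real x)) / 2)"
      unfolding bint_scale[OF x(1)] by (simp add: algebra_simps)
    also have "\<dots> = of_real x powr (z - 1) * (of_real pi / (2 * cos (of_real pi * z / 2)) * (cosh (of_real x) - of_real x powr (1 - z) * bseries z (of_real x)))"
      unfolding zr osc_sum_formula[OF r x(1) tau] ..
    finally have "2 * cos (of_real pi * z / 2) / of_real pi * ((bint 1 \<tau> z (of_real x) + bint (-1) \<tau> z (of_real x)) / 2) =
       of_real x powr (z - 1) * (cosh (of_real x) - of_real x powr (1 - z) * bseries z (of_real x))"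
      using cosnz by simp
    also have "\<dots> = of_real x powr (z - 1) * cosh (of_real x) - bseries z (of_real x)"
    proof -
      have "complex_of_real x powr (z - 1) * of_real x powr (1 - z) = of_real x powr ((z - 1) + (1 - z))" by (simp only: powr_add)
      also have "\<dots> = 1" using x by simp
      finally show ?thesis by (simp add: right_diff_distrib flip: mult.assoc)
    qed
    finally show "of_real x \<in> bregion \<tau> \<and> 2 * cos (of_real pi * z / 2) / of_real pi * ((bint 1 \<tau> z (of_real x) + bint (-1) \<tau> z (of_real x)) / 2) =
       of_real x powr (z - 1) * cosh (of_real x) - bseries z (of_real x)"
      using x by (simp add: bregion_def)
  qed (use hb b open_bregion in auto)
  show ?thesis
  proof (rule analytic_continuation_reals[where S = "{z. Re z > -1}" and a = "-1" and b = 0 and w = z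
        and f = "\<lambda>z. 2 * cos (of_real pi * z / 2) / of_real pi * ((bint 1 \<tau> z b + bint (-1) \<tau> z b) / 2)"
        and g = "\<lambda>z. b powr (z - 1) * cosh b - bseries z b"])
    show "(\<lambda>z. 2 * cos (of_real pi * z / 2) / of_real pi * ((bint 1 \<tau> z b + bint (-1) \<tau> z b) / 2)) holomorphic_on {z. Re z > -1}"
      by (intro holomorphic_intros holomorphic_bint_z us tau b) auto
    show "(\<lambda>z. b powr (z - 1) * cosh b - bseries z b) holomorphic_on {z. Re z > -1}"
      by (intro holomorphic_intros holomorphic_powr_exponent holomorphic_on_subset[OF holomorphic_bseries1]) auto
    show "open {z. Re z > -1}" by (rule open_halfspace_Re_gt)
    show "connected {z. Re z > -1}" by (intro convex_connected convex_halfspace_Re_gt)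
    show "of_real x \<in> {z. Re z > -1} \<and> 2 * cos (of_real pi * of_real x / 2) / of_real pi * ((bint 1 \<tau> (of_real x) b + bint (-1) \<tau> (of_real x) b) / 2) =
       b powr (of_real x - 1) * cosh b - bseries (of_real x) b" if "-1 < x" "x < 0" for x
      using base[OF that refl b] that by simp
  qed (use z in auto)
qed

lemma cos_half_eq_0:
  assumes "cos (of_real pi * z / 2) = 0" "Re z > -1"
  shows "\<exists>m::nat. z = of_nat (2 * m + 1)"
proof -
  obtain n :: int where n: "of_real pi * z / 2 = of_real (of_int n * pi) + of_real pi / 2"
    using assms(1) by (auto simp: cos_eq_0)
  have "of_real pi * z = of_real pi * of_int (2 * n + 1)" using n by (simp add: field_simps)
  hence z: "z = of_int (2 * n + 1)" by simp
  hence "real_of_int (2 * n + 1) > -1" using assms(2) by simp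
  hence "2 * n + 1 > -1" by linarith
  hence "n \<ge> 0" by simp
  hence "z = of_nat (2 * nat n + 1)" using z by simp
  thus ?thesis by blast
qed

text \<open>Where the cosine is nonzero it can be divided out. At a positive odd integer the
  integrals are continuous in \<open>z\<close>, so they equal the limit by which
  \<open>B_fun\<close> is defined there; the negative odd integers are excluded by Re z >
  -1.\<close>

theorem B_fun_eq_bint:
  assumes tau: "\<tau> > 0" and z: "Re z > -1" and b: "b \<in> bregion \<tau>"
  shows "B_fun z b = (bint 1 \<tau> z b + bint (-1) \<tau> z b) / 2"
proof -
  define I where "I z = (bint 1 \<tau> z b + bint (-1) \<tau> z b) / 2" for z
  have eq: "B_formula z b = I z" if "Re z > -1" "cos (of_real pi * z / 2) \<noteq> 0" for z
  proof -
    have "I z = of_real pi / (2 * cos (of_real pi * z / 2)) * (2 * cos (of_real pi * z / 2) / of_real pi * I z)"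
      using that(2) by simp
    also have "\<dots> = of_real pi / (2 * cos (of_real pi * z / 2)) * (b powr (z - 1) * cosh b - bseries z b)"
      unfolding I_def bint_sum_formula[OF tau that(1) b] ..
    finally show ?thesis by (simp add: B_formula_def bseries_def algebra_simps)
  qed
  have "B_fun z b = I z"
  proof (cases "\<exists>m::nat. z = of_nat (2 * m + 1)")
    case False
    hence "cos (of_real pi * z / 2) \<noteq> 0" using cos_half_eq_0 z by blast
    from eq[OF z this] show ?thesis using False by (simp add: B_fun_def)
  next
    case True
    have "I holomorphic_on {z. Re z > -1}" unfolding I_def[abs_def]
      using holomorphic_bint_z[OF _ tau b] by (intro holomorphic_intros) auto
    hence "continuous_on {z. Re z > -1} I" by (rule holomorphic_on_imp_continuous_on)
    hence cont: "(I \<longlongrightarrow> I z) (at z)"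
      using z open_halfspace_Re_gt[of "-1"] by (simp add: continuous_on_eq_continuous_at isCont_def)
    have ev1: "eventually (\<lambda>s. Re s > -1) (at z)"
      using z open_halfspace_Re_gt[of "-1"] by (intro eventually_at_in_open'[of "{z. Re z > -1}", simplified]) auto
    \<comment> \<open>Odd integers are at least 2 apart, so the punctured unit ball contains no
      further zero of the cosine.\<close>
    have ev2: "eventually (\<lambda>s. s \<in> ball z 1 - {z}) (at z)" by (rule eventually_at_in_open) auto
    have "eventually (\<lambda>s. B_formula s b = I s) (at z)"
      using ev1 ev2
    proof eventually_elim
      case (elim s)
      have "cos (of_real pi * s / 2) \<noteq> 0"
      proof
        assume "cos (of_real pi * s / 2) = 0"
        from cos_half_eq_0[OF this elim(1)] obtain m :: nat where m: "s = of_nat (2 * m + 1)" by blast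
        obtain m' :: nat where m': "z = of_nat (2 * m' + 1)" using True by blast
        have "dist (of_nat (2 * m' + 1) :: complex) (of_nat (2 * m + 1)) < 1" using elim(2) m m' by simp
        hence "\<bar>int (2 * m' + 1) - int (2 * m + 1)\<bar> < 1"
          by (metis dist_of_nat of_int_less_1_iff of_int_abs of_int_diff of_int_of_nat_eq)
        hence "m = m'" by linarith
        thus False using elim(2) m m' by simp
      qed
      thus ?case using eq[OF elim(1)] by simp
    qed
    hence "((\<lambda>s. B_formula s b) \<longlongrightarrow> I z) (at z)" using cont by (subst tendsto_cong)
    hence "Lim (at z) (\<lambda>s. B_formula s b) = I z" by (intro tendsto_Lim) auto
    thus ?thesis using True by (simp add: B_fun_def)
  qed
  thus ?thesis by (simp add: I_def)
qed

section \<open>Regrouping over power factorizations\<close>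

lemma finite_power_factorizations:
  assumes "k \<ge> 1" "n > (0::nat)"
  shows "finite {(d1, d2). d1 ^ k * d2 = n}"
proof (rule finite_subset)
  show "{(d1, d2). d1 ^ k * d2 = n} \<subseteq> {..n} \<times> {..n}"
  proof safe
    fix d1 d2 :: nat assume eq: "n = d1 ^ k * d2"
    have "d1 > 0" "d2 > 0" using eq assms by (auto intro!: Nat.gr0I simp: power_0_left)
    have "d1 ^ 1 \<le> d1 ^ k" using \<open>d1 > 0\<close> assms by (intro power_increasing) auto
    also have "d1 ^ k \<le> d1 ^ k * d2" using \<open>d2 > 0\<close> by simp
    finally show "d1 \<le> d1 ^ k * d2" by simp
    show "d2 \<le> d1 ^ k * d2" using \<open>d1 > 0\<close> by simp
  qed
qed auto

text \<open>The product majorant makes the family over all pairs absolutely summable, so it may be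
  rearranged freely. Grouping by n = d1^k * d2 is then a bijection onto a disjoint union of finite
  fibres.\<close>

lemma sums_regroup_power:
  fixes F :: "nat \<Rightarrow> nat \<Rightarrow> complex"
  assumes k: "k \<ge> 1" and A: "summable A" and B: "summable B"
    and bd: "\<And>l m. norm (F (Suc l) (Suc m)) \<le> A l * B m"
  shows "(\<lambda>n. \<Sum>(d1, d2)\<in>{(d1, d2). d1 ^ k * d2 = Suc n}. F d1 d2) sums (\<Sum>l. \<Sum>m. F (Suc l) (Suc m))"
proof -
  let ?f = "\<lambda>(l, m). F (Suc l) (Suc m)"
  have sm: "summable (\<lambda>m. norm (F (Suc l) (Suc m)))" for l
    by (rule summable_comparison_test'[OF summable_mult[OF B, of "A l"], of 0]) (use bd in auto)
  have nb': "norm (\<Sum>m. norm (F (Suc l) (Suc m))) \<le> A l * suminf B" for l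
  proof -
    have "(\<Sum>m. norm (F (Suc l) (Suc m))) \<le> (\<Sum>m. A l * B m)"
      by (rule suminf_le[OF bd sm summable_mult[OF B]])
    moreover have "(\<Sum>m. norm (F (Suc l) (Suc m))) \<ge> 0" by (intro suminf_nonneg sm) auto
    ultimately show ?thesis by (simp add: suminf_mult[OF B])
  qed
  have AB: "summable (\<lambda>l. A l * suminf B)" by (rule summable_mult2[OF A])
  have "summable (\<lambda>l. \<Sum>m. norm (F (Suc l) (Suc m)))"
    by (rule summable_comparison_test'[OF AB, of 0]) (use nb' in auto)
  hence inner: "((\<lambda>l. \<Sum>m. norm (F (Suc l) (Suc m))) has_sum (\<Sum>l. \<Sum>m. norm (F (Suc l) (Suc m)))) UNIV"
    by (intro norm_summable_imp_has_sum) (use suminf_nonneg[OF sm] in \<open>auto simp: summable_sums\<close>)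
  have innern: "((\<lambda>m. norm (F (Suc l) (Suc m))) has_sum (\<Sum>m. norm (F (Suc l) (Suc m)))) UNIV" for l
    by (intro norm_summable_imp_has_sum) (use sm in \<open>auto simp: summable_sums\<close>)
  have "(\<lambda>p. norm (?f p)) summable_on (UNIV \<times> UNIV)"
    by (rule summable_on_SigmaI[where g = "\<lambda>l. \<Sum>m. norm (F (Suc l) (Suc m))"])
       (use innern inner in \<open>auto simp: summable_on_def\<close>)
  hence fs: "?f summable_on UNIV \<times> UNIV" by (rule abs_summable_summable)
  define S where "S = infsum ?f (UNIV \<times> UNIV)"
  have hs: "(?f has_sum S) (UNIV \<times> UNIV)" unfolding S_def using fs by (rule has_sum_infsum)
  have "((\<lambda>l. \<Sum>m. F (Suc l) (Suc m)) has_sum S) UNIV"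
  proof (rule has_sum_SigmaD[OF hs])
    show "((\<lambda>m. ?f (l, m)) has_sum (\<Sum>m. F (Suc l) (Suc m))) UNIV" for l
      using norm_summable_imp_has_sum[OF sm summable_sums[OF summable_norm_cancel[OF sm]], of l] by simp
  qed
  hence "(\<lambda>l. \<Sum>m. F (Suc l) (Suc m)) sums S" by (rule has_sum_imp_sums)
  hence S: "S = (\<Sum>l. \<Sum>m. F (Suc l) (Suc m))" by (rule sums_unique)
  let ?P = "\<lambda>n. {(d1, d2). d1 ^ k * d2 = Suc n}"
  have pos: "d1 > 0 \<and> d2 > 0" if "d1 ^ k * d2 = Suc n" for d1 d2 n
    using that k by (auto intro!: Nat.gr0I simp: power_0_left)
  have "((\<lambda>(n, d1, d2). F d1 d2) has_sum S) (Sigma UNIV ?P) \<longleftrightarrow> (?f has_sum S) (UNIV \<times> UNIV)"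
  \<comment> \<open>\<open>l\<close>, \<open>m\<close> and \<open>n\<close> all count from 0 and
    stand for their successors; hence the predecessor of the product as the index of the
    fibre.\<close>
  proof (rule has_sum_reindex_bij_witness[where j = "\<lambda>(n, d1, d2). (d1 - 1, d2 - 1)" and i = "\<lambda>(l, m). (Suc l ^ k * Suc m - 1, Suc l, Suc m)"])
    fix a assume "a \<in> Sigma UNIV ?P"
    then obtain n d1 d2 where a: "a = (n, d1, d2)" "d1 ^ k * d2 = Suc n" by auto
    obtain l m where lm: "d1 = Suc l" "d2 = Suc m" using pos[OF a(2)] by (auto simp: gr0_conv_Suc)
    show "(case (case a of (n, d1, d2) \<Rightarrow> (d1 - 1, d2 - 1)) of (l, m) \<Rightarrow> (Suc l ^ k * Suc m - 1, Suc l, Suc m)) = a"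
      using a(2) unfolding a(1) lm prod.case by (simp only: diff_Suc_1)
    show "?f (case a of (n, d1, d2) \<Rightarrow> (d1 - 1, d2 - 1)) = (case a of (n, d1, d2) \<Rightarrow> F d1 d2)"
      by (simp add: a lm)
  qed (auto simp del: mult_Suc_right)
  hence "((\<lambda>(n, d1, d2). F d1 d2) has_sum S) (Sigma UNIV ?P)" using hs by simp
  hence "((\<lambda>n. \<Sum>(d1, d2)\<in>?P n. F d1 d2) has_sum S) UNIV"
  proof (rule has_sum_SigmaD)
    fix n
    show "((\<lambda>y. case (n, y) of (n, d1, d2) \<Rightarrow> F d1 d2) has_sum (\<Sum>(d1, d2)\<in>?P n. F d1 d2)) (?P n)"
      using has_sum_finite[OF finite_power_factorizations[OF k, of "Suc n"], of "\<lambda>(d1, d2). F d1 d2"] by simp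
  qed
  from has_sum_imp_sums[OF this] show ?thesis unfolding S .
qed

lemma summable_exp_linear: "u > 0 \<Longrightarrow> summable (\<lambda>n. exp (- (u * real (Suc n))))"
proof -
  assume u: "u > 0"
  have "exp (- (u * real (Suc n))) = exp (-u) * exp (-u) ^ n" for n
    by (simp add: exp_of_nat_mult[symmetric] exp_add[symmetric] algebra_simps)
  thus ?thesis using u by (simp add: summable_mult summable_geometric)
qed

text \<open>The divisor sum is undone: \<open>sigma_fun\<close> collects the pairs (d, m) with d^k *
  m = n, and summing the geometric series over m leaves the Planck kernel at d.\<close>

lemma sigma_series_sums:
  assumes k: "k \<ge> 1" and w: "Re w > 0"
  shows "(\<lambda>n. sigma_fun k z (Suc n) * exp (- of_nat (Suc n) * w)) sums (\<Sum>d. of_nat (Suc d) powr z * planck k w (of_nat (Suc d)))"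
proof -
  define F where "F d m = of_nat d powr z * exp (- (of_nat m * w) * of_nat d ^ k)" for d m :: nat
  define u where "u = Re w"
  have u: "u > 0" using w by (simp add: u_def)
  obtain L where L: "L > 0" "\<And>t. t \<ge> 0 \<Longrightarrow> (1 + t) powr (Re z) \<le> L * exp (u / 2 * t)"
    using powr_le_exp_bound[of "u / 2" "Re z"] u by auto
  define A where "A l = L * exp u * exp (- (u / 2 * real (Suc l)))" for l
  define B where "B m = exp (- (u * real (Suc m)))" for m
  have "(\<lambda>n. \<Sum>(d1, d2)\<in>{(d1, d2). d1 ^ k * d2 = Suc n}. F d1 d2) sums (\<Sum>l. \<Sum>m. F (Suc l) (Suc m))"
  proof (rule sums_regroup_power[OF k])
    show "summable A" unfolding A_def using u by (intro summable_mult summable_exp_linear) auto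
    show "summable B" unfolding B_def using u by (intro summable_exp_linear) auto
    fix l m
    let ?l = "real (Suc l)" and ?m = "real (Suc m)"
    have "norm (of_nat (Suc l) powr z) = (1 + real l) powr Re z"
      using norm_powr_real_powr[of "of_nat (Suc l)" z] by simp
    also have "\<dots> \<le> L * exp (u / 2 * real l)" by (rule L) simp
    also have "\<dots> \<le> L * exp (u / 2 * ?l)" using L u by (intro mult_left_mono) auto
    finally have 1: "norm (of_nat (Suc l) powr z) \<le> L * exp (u / 2 * ?l)" .
    have "norm (exp (- (of_nat (Suc m) * w) * of_nat (Suc l) ^ k)) = exp (- (u * (?m * ?l ^ k)))"
      by (simp add: u_def flip: of_nat_power of_nat_mult)
    also have "\<dots> \<le> exp (u - u * ?l - u * ?m)"
    proof -
      \<comment> \<open>This gives l + m - 1 \<le> l * m \<le> m * l^k, so the exponential splits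
        into a product of decays in l and in m. Half of the decay in l then pays for the power of
        l.\<close>
      have "0 \<le> (?m - 1) * (?l - 1)" by simp
      hence "?l + ?m - 1 \<le> ?m * ?l" by (simp add: algebra_simps)
      also have "?m * ?l \<le> ?m * ?l ^ k" using k power_increasing[of 1 k ?l] by (intro mult_left_mono) auto
      finally have "?l + ?m - 1 \<le> ?m * ?l ^ k" by simp
      hence "u * (?l + ?m - 1) \<le> u * (?m * ?l ^ k)" using u by (intro mult_left_mono) auto
      thus ?thesis by (simp add: algebra_simps)
    qed
    finally have 2: "norm (exp (- (of_nat (Suc m) * w) * of_nat (Suc l) ^ k)) \<le> exp (u - u * ?l - u * ?m)" .
    have "norm (F (Suc l) (Suc m)) \<le> (L * exp (u / 2 * ?l)) * exp (u - u * ?l - u * ?m)"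
      unfolding F_def norm_mult using 1 2 L by (intro mult_mono) auto
    also have "\<dots> = L * exp (u / 2 * ?l + (u - u * ?l - u * ?m))" by (simp only: exp_add mult.assoc)
    also have "u / 2 * ?l + (u - u * ?l - u * ?m) = u + - (u / 2 * ?l) + - (u * ?m)" by (simp add: field_simps)
    also have "L * exp \<dots> = A l * B m" by (simp only: A_def B_def exp_add mult.assoc)
    finally show "norm (F (Suc l) (Suc m)) \<le> A l * B m" .
  qed
  also have "(\<lambda>n. \<Sum>(d1, d2)\<in>{(d1, d2). d1 ^ k * d2 = Suc n}. F d1 d2) = (\<lambda>n. sigma_fun k z (Suc n) * exp (- of_nat (Suc n) * w))"
  proof
    fix n
    have "(\<Sum>(d1, d2)\<in>{(d1, d2). d1 ^ k * d2 = Suc n}. F d1 d2) = (\<Sum>d | d ^ k dvd Suc n. of_nat d powr z * exp (- of_nat (Suc n) * w))"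
    proof (rule sum.reindex_bij_witness[where j = fst and i = "\<lambda>d. (d, Suc n div d ^ k)"])
      fix p assume p: "p \<in> {(d1, d2). d1 ^ k * d2 = Suc n}"
      obtain d1 d2 where d: "p = (d1, d2)" "d1 ^ k * d2 = Suc n" using p by auto
      have "d1 ^ k > 0" using d(2) by (cases "d1 ^ k") auto
      thus "(fst p, Suc n div fst p ^ k) = p" using d by (simp flip: d(2))
      show "fst p \<in> {d. d ^ k dvd Suc n}" using d by (auto simp flip: d(2))
      have "(of_nat d1 ^ k * of_nat d2 :: complex) = of_nat (Suc n)" unfolding d(2)[symmetric] by simp
      thus "of_nat (fst p) powr z * exp (- of_nat (Suc n) * w) = (case p of (d1, d2) \<Rightarrow> F d1 d2)"
        by (simp add: d(1) F_def mult_ac flip: \<open>(of_nat d1 ^ k * of_nat d2 :: complex) = of_nat (Suc n)\<close>) (simp add: algebra_simps)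
    qed auto
    thus "(\<Sum>(d1, d2)\<in>{(d1, d2). d1 ^ k * d2 = Suc n}. F d1 d2) = sigma_fun k z (Suc n) * exp (- of_nat (Suc n) * w)"
      by (simp add: sigma_fun_def sum_distrib_right)
  qed
  also have "(\<Sum>l. \<Sum>m. F (Suc l) (Suc m)) = (\<Sum>d. of_nat (Suc d) powr z * planck k w (of_nat (Suc d)))"
  proof -
    have "(\<Sum>m. F (Suc l) (Suc m)) = of_nat (Suc l) powr z * planck k w (of_nat (Suc l))" for l
      using sums_unique[OF sums_mult[OF planck_sums[OF k w, of "real (Suc l)"], of "of_nat (Suc l) powr z"]] by (simp add: F_def)
    thus ?thesis by simp
  qed
  finally show ?thesis .
qed

section \<open>Partial fractions over the roots of -1\<close>

lemma sum_roots_power_int: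
  fixes j :: int
  assumes k: "k \<ge> 1" and j: "\<bar>j\<bar> < int k"
  shows "(\<Sum>s<k. exp (\<i> * of_real pi * of_int (2 * int s + 1 - int k) * of_int j / of_nat k)) = (if j = 0 then of_nat k else 0)"
proof (cases "j = 0")
  case False
  \<comment> \<open>The exponents \<open>2 s + 1 - k\<close> form an arithmetic progression, so the
    sum is geometric with ratio \<open>q\<close>. It is a k-th root of unity, and since 0 <
    \<bar>j\<bar> < k it is not 1.\<close>
  define q where "q = exp (\<i> * of_real pi * 2 * of_int j / of_nat k)"
  have trm: "exp (\<i> * of_real pi * of_int (2 * int s + 1 - int k) * of_int j / of_nat k) =
      exp (\<i> * of_real pi * of_int (1 - int k) * of_int j / of_nat k) * q ^ s" for s
    by (simp add: q_def exp_of_nat_mult[symmetric] exp_add[symmetric] add_divide_distrib[symmetric] algebra_simps)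
  have "q ^ k = exp (2 * of_int j * of_real pi * \<i>)" using k by (simp add: q_def exp_of_nat_mult[symmetric] mult_ac)
  also have "\<dots> = 1" by (subst exp_eq_1) (auto intro!: exI[of _ j])
  finally have qk: "q ^ k = 1" .
  have q1: "q \<noteq> 1"
  proof
    assume "q = 1"
    then obtain n :: int where "Im (\<i> * of_real pi * 2 * of_int j / of_nat k) = real_of_int (2 * n) * pi"
      unfolding q_def exp_eq_1 by blast
    hence "real_of_int j = real_of_int n * real k" using k by (simp add: field_simps)
    hence "real_of_int j = real_of_int (n * int k)" by simp
    hence jn: "j = n * int k" by (subst (asm) of_int_eq_iff)
    hence "n \<noteq> 0" using False by auto
    hence "int k \<le> \<bar>n\<bar> * int k" using mult_right_mono[of 1 "\<bar>n\<bar>" "int k"] by simp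
    thus False using j jn by (simp add: abs_mult)
  qed
  have "(\<Sum>s<k. q ^ s) = 0" using geometric_sum[OF q1, of k] qk by simp
  thus ?thesis using False by (simp only: trm sum_distrib_left[symmetric]) simp
qed simp

text \<open>The numbers \<open>- \<beta> s\<close> are the k roots of X^k + A^k = 0, and the
  coefficient at a root \<rho> is \<rho>^h / (k \<rho>^(k-1)). After clearing denominators, the sum
  over the roots kills every power of X except X^h by orthogonality.\<close>

lemma partial_fractions_unity:
  fixes X A :: complex and h :: nat
  assumes k: "k \<ge> 1" and h: "h < k" and A: "A \<noteq> 0"
  defines "\<beta> \<equiv> (\<lambda>s. A * exp (\<i> * of_real pi * of_int (2 * int s + 1 - int k) / of_nat k))"
  assumes nz: "\<And>s. s < k \<Longrightarrow> X + \<beta> s \<noteq> 0" and XA: "X ^ k + A ^ k \<noteq> 0"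
  shows "X ^ h / (X ^ k + A ^ k) = (\<Sum>s<k. (- \<beta> s) powi (int h + 1 - int k) / (X + \<beta> s)) / of_nat k"
proof -
  have b0: "- \<beta> s \<noteq> 0" for s using A by (simp add: \<beta>_def)
  have bk: "(- \<beta> s) ^ k = - (A ^ k)" for s
  proof -
    have "exp (\<i> * of_real pi * of_int (2 * int s + 1 - int k) / of_nat k) ^ k = exp (\<i> * of_real pi * of_int (2 * int s + 1 - int k))"
      using k by (simp add: exp_of_nat_mult[symmetric])
    also have "\<dots> = (-1) ^ (k + 1)"
    proof -
      have "\<i> * of_real pi * of_int (2 * int s + 1 - int k) = of_nat (k + 1) * (\<i> * of_real pi) + 2 * of_int (int s - int k) * of_real pi * \<i>"
        by (simp add: algebra_simps)
      moreover have "exp (2 * of_int (int s - int k) * of_real pi * \<i>) = (1::complex)" by (subst exp_eq_1) (auto intro!: exI[of _ "int s - int k"])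
      moreover have "exp (of_nat (k + 1) * (\<i> * of_real pi)) = (-1::complex) ^ (k + 1)"
        unfolding exp_of_nat_mult by (simp add: mult.commute)
      ultimately show ?thesis by (simp only: exp_add mult_1_right)
    qed
    finally show ?thesis unfolding \<beta>_def by (simp add: power_minus[of "A * _"] power_mult_distrib)
  qed
  have fac: "X ^ k + A ^ k = (X + \<beta> s) * (\<Sum>i<k. (- \<beta> s) ^ (k - Suc i) * X ^ i)" for s
    using power_diff_sumr2[of X k "- \<beta> s"] bk[of s] by simp
  have trm: "(- \<beta> s) powi (int h + 1 - int k) / (X + \<beta> s) * (X ^ k + A ^ k) = (\<Sum>i<k. (- \<beta> s) powi (int h - int i) * X ^ i)" if s: "s < k" for s
  proof -
    have "(- \<beta> s) powi (int h + 1 - int k) / (X + \<beta> s) * (X ^ k + A ^ k) = (- \<beta> s) powi (int h + 1 - int k) * (\<Sum>i<k. (- \<beta> s) ^ (k - Suc i) * X ^ i)"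
      unfolding fac[of s] using nz[OF s] by simp
    also have "\<dots> = (\<Sum>i<k. (- \<beta> s) powi (int h - int i) * X ^ i)"
      unfolding sum_distrib_left
    proof (rule sum.cong[OF refl])
      fix i assume "i \<in> {..<k}"
      hence e: "int h - int i = (int h + 1 - int k) + int (k - Suc i)" by auto
      have "(- \<beta> s) powi (int h - int i) = (- \<beta> s) powi (int h + 1 - int k) * (- \<beta> s) ^ (k - Suc i)"
        unfolding e using b0[of s] by (subst power_int_add) auto
      thus "(- \<beta> s) powi (int h + 1 - int k) * ((- \<beta> s) ^ (k - Suc i) * X ^ i) = (- \<beta> s) powi (int h - int i) * X ^ i" by simp
    qed
    finally show ?thesis .
  qed
  have bj: "(- \<beta> s) powi j = (- A) powi j * exp (\<i> * of_real pi * of_int (2 * int s + 1 - int k) * of_int j / of_nat k)" for s j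
  proof -
    have "- \<beta> s = (- A) * exp (\<i> * of_real pi * of_int (2 * int s + 1 - int k) / of_nat k)" by (simp add: \<beta>_def)
    hence "(- \<beta> s) powi j = (- A) powi j * exp (\<i> * of_real pi * of_int (2 * int s + 1 - int k) / of_nat k) powi j"
      by (simp only: power_int_mult_distrib)
    also have "exp (\<i> * of_real pi * of_int (2 * int s + 1 - int k) / of_nat k) powi j = exp (\<i> * of_real pi * of_int (2 * int s + 1 - int k) * of_int j / of_nat k)"
      by (simp add: exp_power_int mult_ac)
    finally show ?thesis .
  qed
  have "(\<Sum>s<k. (- \<beta> s) powi (int h + 1 - int k) / (X + \<beta> s)) * (X ^ k + A ^ k) = (\<Sum>s<k. \<Sum>i<k. (- \<beta> s) powi (int h - int i) * X ^ i)"
    unfolding sum_distrib_right by (rule sum.cong[OF refl]) (use trm in auto)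
  also have "\<dots> = (\<Sum>i<k. \<Sum>s<k. (- \<beta> s) powi (int h - int i) * X ^ i)" by (rule sum.swap)
  also have "\<dots> = (\<Sum>i<k. if i = h then of_nat k * X ^ h else 0)"
  proof (rule sum.cong[OF refl])
    fix i assume i: "i \<in> {..<k}"
    have "(\<Sum>s<k. (- \<beta> s) powi (int h - int i) * X ^ i) = (- A) powi (int h - int i) * X ^ i *
        (\<Sum>s<k. exp (\<i> * of_real pi * of_int (2 * int s + 1 - int k) * of_int (int h - int i) / of_nat k))"
      unfolding bj sum_distrib_left by (intro sum.cong refl) (simp only: mult_ac)
    also have "(\<Sum>s<k. exp (\<i> * of_real pi * of_int (2 * int s + 1 - int k) * of_int (int h - int i) / of_nat k)) = (if int h - int i = 0 then of_nat k else 0)"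
      by (rule sum_roots_power_int[OF k]) (use i h in auto)
    finally show "(\<Sum>s<k. (- \<beta> s) powi (int h - int i) * X ^ i) = (if i = h then of_nat k * X ^ h else 0)" by simp
  qed
  also have "\<dots> = of_nat k * X ^ h" using h by simp
  finally have main: "(\<Sum>s<k. (- \<beta> s) powi (int h + 1 - int k) / (X + \<beta> s)) * (X ^ k + A ^ k) = of_nat k * X ^ h" .
  show ?thesis using main XA k by (simp add: field_simps)
qed

section \<open>The ray integrals as an absolutely convergent double series\<close>

lemma integral_powr_exp_real:
  fixes a b :: real
  assumes "a > -1" "b > 0"
  shows "(\<integral>x. x powr a * exp (- b * x) \<partial>halfline) = Gamma (a + 1) * b powr (- (a + 1))"
proof -
  have "of_real (\<integral>x. x powr a * exp (- b * x) \<partial>halfline) =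
      (\<integral>x. complex_of_real (x powr a * exp (- b * x)) \<partial>halfline)"
    by (rule integral_complex_of_real[symmetric])
  also have "\<dots> = (\<integral>x. of_real x powr of_real a * exp (- of_real b * of_real x) \<partial>halfline)"
    by (rule integral_halfline_cong) (simp add: powr_of_real exp_of_real[symmetric])
  also have "\<dots> = Gamma (of_real a + 1) * of_real b powr (- (of_real a + 1))"
    by (rule integral_Gamma_cmult) (use assms in auto)
  also have "of_real b powr (- (of_real a + 1)) = complex_of_real (b powr (- (a + 1)))"
    using assms by (simp add: powr_of_real[symmetric])
  also have "Gamma (of_real a + 1) = complex_of_real (Gamma (a + 1))"
    using Gamma_complex_of_real[of "a + 1"] by simp
  finally show ?thesis by (simp only: of_real_mult[symmetric] of_real_eq_iff)
qed

lemma pkern_ray_sums: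
  assumes e: "unit_sign e" and tau: "\<tau> > 0" and x: "x > 0"
  shows "(\<lambda>l. exp (\<i> * of_real e * of_real (2 * pi * real (Suc l)) * (of_real x * rayv e \<tau>))) sums
    pkern e (of_real x * rayv e \<tau>)"
proof -
  let ?t = "of_real x * rayv e \<tau>"
  define q where "q = exp (\<i> * of_real e * of_real (2 * pi) * ?t)"
  have "norm q = exp (- (x * (\<tau> * Re (of_real (2 * pi)) + e * Im (of_real (2 * pi)))))"
    unfolding q_def by (rule norm_exp_ray[OF e])
  also have "\<dots> < 1" using x tau by simp
  finally have q1: "norm q < 1" .
  have q0: "q \<noteq> 0" by (simp add: q_def)
  have "exp (\<i> * of_real e * of_real (2 * pi * real (Suc l)) * ?t) = q * q ^ l" for l
  proof -
    have "exp (\<i> * of_real e * of_real (2 * pi * real (Suc l)) * ?t) = exp (of_nat (Suc l) * (\<i> * of_real e * of_real (2 * pi) * ?t))"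
      by (rule arg_cong[of _ _ exp]) (simp add: algebra_simps)
    thus ?thesis unfolding exp_of_nat_mult by (simp add: q_def)
  qed
  moreover have "(\<lambda>l. q * q ^ l) sums (q * (1 / (1 - q)))" by (intro sums_mult geometric_sums q1)
  moreover have "q * (1 / (1 - q)) = pkern e ?t"
  proof -
    have E: "exp (- (2 * of_real pi * \<i> * of_real e * ?t)) = inverse q" by (simp add: q_def exp_minus mult_ac)
    show ?thesis unfolding pkern_def E using q0 q1 by (auto simp: field_simps)
  qed
  ultimately show ?thesis by simp
qed

text \<open>The indices \<open>l\<close> and \<open>m\<close> start at 1, whereas \<open>bterm\<close> counts from 0.\<close>

definition ray_term :: "nat \<Rightarrow> complex \<Rightarrow> real \<Rightarrow> real \<Rightarrow> complex \<Rightarrow> nat \<Rightarrow> nat \<Rightarrow> real \<Rightarrow> complex" where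
  "ray_term k w e \<tau> z l m x = (of_real x * rayv e \<tau>) powr z * bterm (w * (of_real x * rayv e \<tau>) ^ k) (m - 1) *
     exp (\<i> * of_real e * of_real (2 * pi * real l) * (of_real x * rayv e \<tau>)) * rayv e \<tau>"

context
  fixes k :: nat and w :: complex and \<tau> \<tau>' \<kappa> e :: real and z :: complex
  assumes k: "k \<ge> 1" and w: "Re w > 0" and tau: "0 < \<tau>" "\<tau> < \<tau>'" and kap: "\<kappa> > 0"
    and wedge: "\<And>t. t \<in> wedge \<tau>' \<Longrightarrow> Re (w * t ^ k) \<ge> \<kappa> * norm (w * t ^ k)"
    and e: "unit_sign e" and z: "Re z > -1"
begin

lemma bterm_denominator_nz:
  assumes x: "x > 0"
  shows "(w * (of_real x * rayv e \<tau>) ^ k)\<^sup>2 + (2 * of_real pi * of_nat (Suc m))\<^sup>2 \<noteq> 0"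
proof
  let ?x = "w * (of_real x * rayv e \<tau>) ^ k"
  assume *: "?x\<^sup>2 + (2 * of_real pi * of_nat (Suc m))\<^sup>2 = 0"
  have wd: "of_real x * rayv e \<tau> \<in> wedge \<tau>'" using ray_in_wedge[of 0 \<tau> \<tau>' e x] tau e x by simp
  have "?x \<noteq> 0" using x w by auto
  hence "\<kappa>\<^sup>2 * (2 * pi * real (Suc m))\<^sup>2 \<le> norm (?x\<^sup>2 + of_real (2 * pi * real (Suc m)) ^ 2)"
    by (intro norm_square_add_square_ge[OF wedge[OF wd]]) (use kap in auto)
  moreover have "\<kappa>\<^sup>2 * (2 * pi * real (Suc m))\<^sup>2 > 0" using kap by simp
  ultimately show False using * by simp
qed

lemma ray_term_continuous: "continuous_on {0<..} (ray_term k w e \<tau> z l m)"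
  unfolding ray_term_def[abs_def] bterm_def using bterm_denominator_nz[of _ "m - 1"] by (intro continuous_intros) auto

text \<open>The factor x^k comes from the zero of the partial fractions at 0, the inverse square
  from their decay in m, and the exponential decay in l from the slope of the ray.\<close>

lemma ray_term_bound:
  obtains C where "C > 0" "\<And>l m x. x > 0 \<Longrightarrow> norm (ray_term k w e \<tau> z (Suc l) (Suc m) x) \<le>
    C * (x powr (Re z + real k) * exp (- (2 * pi * real (Suc l) * \<tau>) * x)) * (1 / real (Suc m) ^ 2)"
proof
  let ?v = "rayv e \<tau>"
  let ?V = "norm ?v"
  define C where "C = (?V powr Re z * exp (pi * \<bar>Im z\<bar>)) * (norm w * ?V ^ k / \<kappa>\<^sup>2) * ?V"
  have w0: "w \<noteq> 0" using w by auto
  show "C > 0" using w0 kap by (auto simp: C_def intro!: mult_pos_pos divide_pos_pos)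
  fix l m :: nat and x :: real assume x: "x > 0"
  let ?t = "of_real x * ?v"
  have wd: "?t \<in> wedge \<tau>'" using ray_in_wedge[of 0 \<tau> \<tau>' e x] tau e x by simp
  have "norm (?t powr z) \<le> norm ?t powr Re z * exp (pi * \<bar>Im z\<bar>)"
    using x by (intro norm_powr_complex_bounds) auto
  also have "\<dots> = x powr Re z * (?V powr Re z * exp (pi * \<bar>Im z\<bar>))" using x by (simp add: norm_mult powr_mult)
  finally have 1: "norm (?t powr z) \<le> x powr Re z * (?V powr Re z * exp (pi * \<bar>Im z\<bar>))" .
  have "norm (bterm (w * ?t ^ k) m) \<le> norm (w * ?t ^ k) / \<kappa>\<^sup>2 * (1 / real (Suc m) ^ 2)"
    by (rule norm_bterm_le[OF wedge[OF wd] kap])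
  also have "\<dots> = x powr real k * (norm w * ?V ^ k / \<kappa>\<^sup>2) * (1 / real (Suc m) ^ 2)"
    using x by (simp add: norm_mult norm_power power_mult_distrib powr_realpow)
  finally have 2: "norm (bterm (w * ?t ^ k) m) \<le> x powr real k * (norm w * ?V ^ k / \<kappa>\<^sup>2) * (1 / real (Suc m) ^ 2)" .
  have 3: "norm (exp (\<i> * of_real e * of_real (2 * pi * real (Suc l)) * ?t)) = exp (- (2 * pi * real (Suc l) * \<tau>) * x)"
    unfolding norm_exp_ray[OF e] by (simp add: mult_ac)
  have "norm (ray_term k w e \<tau> z (Suc l) (Suc m) x) \<le>
     (x powr Re z * (?V powr Re z * exp (pi * \<bar>Im z\<bar>))) * (x powr real k * (norm w * ?V ^ k / \<kappa>\<^sup>2) * (1 / real (Suc m) ^ 2)) *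
     exp (- (2 * pi * real (Suc l) * \<tau>) * x) * ?V"
    unfolding ray_term_def norm_mult diff_Suc_1 3[unfolded norm_mult] using 1 2
    by (intro mult_right_mono mult_mono) (auto simp: norm_mult)
  also have "\<dots> = C * (x powr (Re z + real k) * exp (- (2 * pi * real (Suc l) * \<tau>) * x)) * (1 / real (Suc m) ^ 2)"
    unfolding C_def powr_add by (simp only: mult_ac times_divide_eq_right times_divide_eq_left)
  finally show "norm (ray_term k w e \<tau> z (Suc l) (Suc m) x) \<le>
    C * (x powr (Re z + real k) * exp (- (2 * pi * real (Suc l) * \<tau>) * x)) * (1 / real (Suc m) ^ 2)" .
qed

text \<open>Two interchanges of sum and integral, over m for fixed l and then over l, both
  controlled by \<open>ray_term_bound\<close>. The sequence \<open>A\<close> is part of the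
  conclusion because regrouping needs a product majorant.\<close>

lemma ray_expansion:
  obtains A where "summable A"
    "\<And>l m. norm (\<integral>x. ray_term k w e \<tau> z (Suc l) (Suc m) x \<partial>halfline) \<le> A l * (1 / real (Suc m) ^ 2)"
    "(\<integral>x. hfun k w z (of_real x * rayv e \<tau>) * pkern e (of_real x * rayv e \<tau>) * rayv e \<tau> \<partial>halfline) =
     (\<Sum>l. \<Sum>m. \<integral>x. ray_term k w e \<tau> z (Suc l) (Suc m) x \<partial>halfline)"
proof -
  let ?H = "halfline"
  let ?T = "\<lambda>l m. ray_term k w e \<tau> z (Suc l) (Suc m)"
  let ?t = "\<lambda>x. of_real x * rayv e \<tau>"
  let ?U = "\<lambda>l x. hfun k w z (?t x) * exp (\<i> * of_real e * of_real (2 * pi * real (Suc l)) * ?t x) * rayv e \<tau>"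
  obtain C where C: "C > 0" "\<And>l m x. x > 0 \<Longrightarrow> norm (?T l m x) \<le>
    C * (x powr (Re z + real k) * exp (- (2 * pi * real (Suc l) * \<tau>) * x)) * (1 / real (Suc m) ^ 2)"
    using ray_term_bound by blast
  define a where "a = Re z + real k"
  have a: "a > 0" using z k by (simp add: a_def)
  define D where "D l x = C * (x powr a * exp (- (2 * pi * real (Suc l) * \<tau>) * x))" for l x
  \<comment> \<open>The integral of \<open>D l\<close>. It decays like l^(-(a+1)) with a = Re z + k
    > 0, which makes the outer series converge.\<close>
  define J where "J l = C * (Gamma (a + 1) * (2 * pi * real (Suc l) * \<tau>) powr (- (a + 1)))" for l
  define Z where "Z = (\<Sum>m. 1 / real (Suc m) ^ 2)"
  have Z: "Z \<ge> 0" unfolding Z_def by (intro suminf_nonneg summable_inverse_squares) auto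
  have T_le: "norm (?T l m x) \<le> D l x * (1 / real (Suc m) ^ 2)" if "x > 0" for l m x
    using C(2)[OF that] by (simp add: D_def a_def)
  have Dint: "integrable ?H (D l)" for l
    unfolding D_def[abs_def] using a tau by (intro integrable_mult_right integrable_powr_exp_halfline) auto
  have DJ: "(\<integral>x. D l x \<partial>?H) = J l" for l
    unfolding D_def J_def using a tau
    by (subst Bochner_Integration.integral_mult_right_zero, subst integral_powr_exp_real) auto
  have J_sum: "summable J"
  proof -
    have "summable (\<lambda>l. real (Suc l) powr (- (a + 1)))"
      using summable_Suc_iff[of "\<lambda>n. real n powr (- (a + 1))"] a by (simp add: summable_real_powr_iff)
    hence "summable (\<lambda>l. (C * Gamma (a + 1) * (2 * pi * \<tau>) powr (- (a + 1))) * real (Suc l) powr (- (a + 1)))"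
      by (rule summable_mult)
    moreover have "J l = (C * Gamma (a + 1) * (2 * pi * \<tau>) powr (- (a + 1))) * real (Suc l) powr (- (a + 1))" for l
    proof -
      have "(2 * pi * real (Suc l) * \<tau>) = (2 * pi * \<tau>) * real (Suc l)" by simp
      thus ?thesis unfolding J_def using tau by (simp only: powr_mult mult_ac)
    qed
    ultimately show ?thesis by presburger
  qed
  have Tint: "integrable ?H (?T l m)" for l m
    by (rule integrable_halfline_bound[OF ray_term_continuous integrable_mult_left[OF Dint] T_le])
  have Tnorm: "(\<integral>x. norm (?T l m x) \<partial>?H) \<le> J l * (1 / real (Suc m) ^ 2)" for l m
  proof -
    have "(\<integral>x. norm (?T l m x) \<partial>?H) \<le> (\<integral>x. D l x * (1 / real (Suc m) ^ 2) \<partial>?H)"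
      by (intro integral_mono_AE integrable_norm Tint integrable_mult_left Dint AE_I2) (use T_le in auto)
    thus ?thesis by (simp only: Bochner_Integration.integral_mult_left_zero DJ)
  qed
  have pos: "Re (w * ?t x ^ k) > 0" if x: "x > 0" for x
  proof -
    have wd: "?t x \<in> wedge \<tau>'" using ray_in_wedge[of 0 \<tau> \<tau>' e x] tau e x by simp
    have "w * ?t x ^ k \<noteq> 0" using x w by auto
    hence "\<kappa> * norm (w * ?t x ^ k) > 0" using kap by simp
    thus ?thesis using wedge[OF wd] by linarith
  qed
  have hfun_eq: "hfun k w z t = t powr z * bexp (w * t ^ k)" for t
    by (rule hfun_def[OF k w tau kap]) (rule wedge)
  have Tsums: "(\<lambda>m. ?T l m x) sums ?U l x" if x: "x > 0" for l x
  proof -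
    have "(\<lambda>m. bterm (w * ?t x ^ k) m) sums bexp (w * ?t x ^ k)"
      using sums_bexp[OF pos[OF x]] by (simp add: bterm_def[abs_def])
    from sums_mult2[OF sums_mult[OF this]]
    show ?thesis unfolding ray_term_def hfun_eq diff_Suc_1 by (simp only: mult.assoc)
  qed
  have sq: "summable (\<lambda>m. c * (1 / real (Suc m) ^ 2))" for c by (intro summable_mult summable_inverse_squares)
  have snorm: "summable (\<lambda>m. norm (?T l m x))" if "x > 0" for l x
    by (rule summable_comparison_test'[OF sq, of 0]) (use T_le[OF that] in simp)
  have snint: "summable (\<lambda>m. \<integral>x. norm (?T l m x) \<partial>?H)" for l
    by (rule summable_comparison_test'[OF sq, of 0]) (use Tnorm in simp)
  have AE: "AE x in ?H. summable (\<lambda>m. norm (?T l m x))" for l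
    by (rule AE_I2) (use snorm in auto)
  have inner: "(\<Sum>m. \<integral>x. ?T l m x \<partial>?H) = (\<integral>x. ?U l x \<partial>?H)" and Uint: "integrable ?H (?U l)" for l
  proof -
    have eq: "(\<Sum>m. ?T l m x) = ?U l x" if "x > 0" for x using sums_unique[OF Tsums[OF that]] by simp
    have "(\<integral>x. (\<Sum>m. ?T l m x) \<partial>?H) = (\<integral>x. ?U l x \<partial>?H)" by (rule integral_halfline_cong) (rule eq)
    thus "(\<Sum>m. \<integral>x. ?T l m x \<partial>?H) = (\<integral>x. ?U l x \<partial>?H)"
      using integral_suminf[OF Tint AE snint] by simp
    show "integrable ?H (?U l)"
      using integrable_suminf[OF Tint AE snint, of l] integrable_halfline_cong[of "\<lambda>x. \<Sum>m. ?T l m x" "?U l", OF eq] by simp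
  qed
  have U_le: "norm (?U l x) \<le> D l x * Z" if x: "x > 0" for l x
  proof -
    have "norm (\<Sum>m. ?T l m x) \<le> (\<Sum>m. D l x * (1 / real (Suc m) ^ 2))"
      by (rule norm_suminf_le[OF T_le[OF x] sq])
    thus ?thesis using sums_unique[OF Tsums[OF x], of l] by (simp only: Z_def suminf_mult[OF summable_inverse_squares])
  qed
  have Unorm: "(\<integral>x. norm (?U l x) \<partial>?H) \<le> J l * Z" for l
  proof -
    have "(\<integral>x. norm (?U l x) \<partial>?H) \<le> (\<integral>x. D l x * Z \<partial>?H)"
      by (intro integral_mono_AE integrable_norm Uint integrable_mult_left Dint AE_I2) (use U_le in auto)
    thus ?thesis by (simp only: Bochner_Integration.integral_mult_left_zero DJ)
  qed
  have Usums: "(\<lambda>l. ?U l x) sums (hfun k w z (?t x) * pkern e (?t x) * rayv e \<tau>)" if x: "x > 0" for x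
    by (intro sums_mult2 sums_mult pkern_ray_sums e tau x)
  have Usn: "summable (\<lambda>l. norm (?U l x))" if x: "x > 0" for x
  proof -
    define u where "u = 2 * pi * \<tau> * x"
    have "summable (\<lambda>l. C * x powr a * Z * exp (- (u * real (Suc l))))"
      using x tau by (intro summable_mult summable_exp_linear) (auto simp: u_def)
    hence "summable (\<lambda>l. D l x * Z)" by (simp add: D_def u_def mult_ac)
    thus ?thesis by (rule summable_comparison_test'[where N = 0]) (use U_le[OF x] in simp)
  qed
  have "(\<Sum>l. \<integral>x. ?U l x \<partial>?H) = (\<integral>x. (\<Sum>l. ?U l x) \<partial>?H)"
  proof (rule integral_suminf[symmetric, OF Uint])
    show "AE x in ?H. summable (\<lambda>l. norm (?U l x))" by (rule AE_I2) (use Usn in auto)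
    show "summable (\<lambda>l. \<integral>x. norm (?U l x) \<partial>?H)"
      by (rule summable_comparison_test'[OF summable_mult2[OF J_sum, of Z], of 0]) (use Unorm in simp)
  qed
  also have "\<dots> = (\<integral>x. hfun k w z (?t x) * pkern e (?t x) * rayv e \<tau> \<partial>?H)"
    by (rule integral_halfline_cong) (use sums_unique[OF Usums] in simp)
  finally have final: "(\<integral>x. hfun k w z (?t x) * pkern e (?t x) * rayv e \<tau> \<partial>?H) = (\<Sum>l. \<Sum>m. \<integral>x. ?T l m x \<partial>?H)"
    by (simp only: inner)
  have "norm (\<integral>x. ?T l m x \<partial>?H) \<le> J l * (1 / real (Suc m) ^ 2)" for l m
    by (rule order.trans[OF integral_norm_bound Tnorm])
  from that[OF J_sum this final] show thesis .
qed

end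

section \<open>The transformation formula\<close>

lemma zeta4_powi: "zeta4 k powi r = exp (\<i> * of_real (pi * of_int r / (2 * of_nat k)))"
  unfolding zeta4_def exp_power_int by (simp add: mult_ac)

lemma zeta4_nz [simp]: "zeta4 k \<noteq> 0" by (simp add: zeta4_def)

lemma cnj_zeta4_powi: "cnj (zeta4 k powi r) = zeta4 k powi (- r)"
  unfolding zeta4_powi exp_cnj by simp

lemma Complex_div_powr_nat:
  fixes X :: complex
  assumes "X \<noteq> 0" "k \<ge> 1"
  shows "(X powr (1 / of_nat k)) ^ n = X powr (of_nat n / of_nat k)"
  using assms by (simp add: powr_def exp_of_nat_mult[symmetric])

lemma sum_lessThan_Suc_both:
  fixes G :: "nat \<Rightarrow> 'a :: comm_monoid_add"
  shows "(\<Sum>s<Suc (Suc n). G s) = G 0 + (\<Sum>s<n. G (Suc s)) + G (Suc n)"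
  by (simp only: sum.lessThan_Suc[of G "Suc n"] sum.lessThan_Suc_shift[of G n])

text \<open>The exponents 1 - k, 3 - k, ..., k - 1 are symmetric about 0, and 0 is among them only
  for odd k. Folding r with - r produces the conjugate pairs of the formula; the induction removes
  both ends at once.\<close>

lemma sum_symmetric_even:
  fixes g :: "int \<Rightarrow> 'a :: comm_monoid_add"
  shows "(\<Sum>s<2 * h. g (2 * int s + 1 - int (2 * h))) = (\<Sum>j = 1..h. g (2 * int j - 1) + g (- (2 * int j - 1)))"
proof (induction h)
  case (Suc h)
  have "(\<Sum>s<2 * Suc h. g (2 * int s + 1 - int (2 * Suc h))) =
      g (- (2 * int (Suc h) - 1)) + (\<Sum>s<2 * h. g (2 * int s + 1 - int (2 * h))) + g (2 * int (Suc h) - 1)"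
    using sum_lessThan_Suc_both[of "\<lambda>s. g (2 * int s + 1 - int (2 * Suc h))" "2 * h"] by (simp add: algebra_simps)
  thus ?case unfolding Suc by (simp add: add_ac)
qed simp

lemma sum_symmetric_odd:
  fixes g :: "int \<Rightarrow> 'a :: comm_monoid_add"
  shows "(\<Sum>s<2 * h + 1. g (2 * int s + 1 - int (2 * h + 1))) = g 0 + (\<Sum>j = 1..h. g (2 * int j) + g (- (2 * int j)))"
proof (induction h)
  case (Suc h)
  have "(\<Sum>s<2 * Suc h + 1. g (2 * int s + 1 - int (2 * Suc h + 1))) =
      g (- (2 * int (Suc h))) + (\<Sum>s<2 * h + 1. g (2 * int s + 1 - int (2 * h + 1))) + g (2 * int (Suc h))"
    using sum_lessThan_Suc_both[of "\<lambda>s. g (2 * int s + 1 - int (2 * Suc h + 1))" "2 * h + 1"] by (simp add: algebra_simps)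
  thus ?case unfolding Suc by (simp add: add_ac)
qed simp

text \<open>
  A bound for the arguments of all the \<open>a_arg k w n * zeta4 k powi r\<close> with \<open>\<bar>r\<bar> < k\<close>; it is below
  \<open>pi / 2\<close>, which leaves room for rays of small positive slope.
\<close>

definition ray_angle :: "nat \<Rightarrow> complex \<Rightarrow> real" where
  "ray_angle k w = \<bar>Im (Ln (inverse w))\<bar> / real k + pi * (real k - 1) / (2 * real k)"

text \<open>The argument of \<open>w\<close> is below pi / 2 in absolute value, so its k-th part is
  less than pi / (2 k), exactly what the other summand lacks to reach pi / 2.\<close>

lemma ray_angle_bounds:
  assumes "k \<ge> 1" "Re w > 0"
  shows "0 \<le> ray_angle k w" "ray_angle k w < pi / 2"
proof -
  have "Re (inverse w) > 0" using assms by (auto intro!: divide_pos_pos simp: sum_power2_gt_zero_iff)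
  hence "\<bar>Im (Ln (inverse w))\<bar> < pi / 2" using Re_Ln_pos_lt by (metis inverse_zero less_irrefl zero_complex.sel(1))
  hence "ray_angle k w < (pi / 2) / real k + pi * (real k - 1) / (2 * real k)"
    unfolding ray_angle_def using assms by (intro add_strict_right_mono divide_strict_right_mono) auto
  also have "\<dots> = pi / 2" using assms by (simp add: field_simps)
  finally show "ray_angle k w < pi / 2" .
  show "ray_angle k w \<ge> 0" using assms by (auto simp: ray_angle_def)
qed

text \<open>In polar form the number is N cis \<theta> with \<bar>\<theta>\<bar> at most
  \<open>ray_angle k w\<close>, whence \<tau> \<bar>sin \<theta>\<bar> \<le> \<tau> < cos
  \<theta>.\<close>

lemma bregion_root:
  assumes k: "k \<ge> 1" and w: "Re w > 0" and tau: "\<tau> > 0" "\<tau> < cos (ray_angle k w)"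
    and c: "c > 0" and y: "y > 0" and r: "\<bar>r\<bar> < int k"
  shows "of_real c * ((of_real y / w) powr (1 / of_nat k) * zeta4 k powi r) \<in> bregion \<tau>"
proof -
  have w0: "w \<noteq> 0" using w by auto
  define \<theta> where "\<theta> = Im (Ln (inverse w)) / real k + pi * of_int r / (2 * real k)"
  define N where "N = c * exp ((ln y + Re (Ln (inverse w))) / real k)"
  have N: "N > 0" using c by (simp add: N_def)
  have Lny: "Ln (of_real y / w) = of_real (ln y) + Ln (inverse w)"
    using y w0 by (simp add: divide_inverse Ln_times_of_real Ln_of_real)
  have "(of_real y / w) powr (1 / of_nat k) * zeta4 k powi r = exp ((of_real (ln y) + Ln (inverse w)) / of_nat k + \<i> * of_real (pi * of_int r / (2 * of_nat k)))"
    using y w0 unfolding zeta4_powi exp_add powr_def Lny by simp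
  also have "(of_real (ln y) + Ln (inverse w)) / of_nat k + \<i> * of_real (pi * of_int r / (2 * of_nat k)) =
      of_real ((ln y + Re (Ln (inverse w))) / real k) + \<i> * of_real \<theta>"
    by (simp add: complex_eq_iff \<theta>_def Re_divide_of_nat Im_divide_of_nat)
  finally have eq: "of_real c * ((of_real y / w) powr (1 / of_nat k) * zeta4 k powi r) = of_real N * cis \<theta>"
    by (simp add: exp_add N_def cis_conv_exp flip: exp_of_real)
  have "\<bar>pi * of_int r / (2 * real k)\<bar> \<le> pi * (real k - 1) / (2 * real k)"
    using r k by (simp add: abs_mult divide_right_mono)
  hence "\<bar>\<theta>\<bar> \<le> ray_angle k w" unfolding \<theta>_def ray_angle_def by (intro order.trans[OF abs_triangle_ineq] add_mono) auto
  moreover have "ray_angle k w \<le> pi" using ray_angle_bounds[OF k w] by linarith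
  ultimately have "cos (ray_angle k w) \<le> cos \<bar>\<theta>\<bar>" by (intro cos_monotone_0_pi_le) auto
  hence cos: "\<tau> < cos \<theta>" using tau by simp
  have "\<tau> * \<bar>N * sin \<theta>\<bar> = \<tau> * N * \<bar>sin \<theta>\<bar>" using N by (simp add: abs_mult)
  also have "\<dots> \<le> \<tau> * N * 1" using N tau by (intro mult_left_mono) auto
  also have "\<dots> < N * cos \<theta>" using cos N by simp
  finally show ?thesis unfolding eq bregion_def by simp
qed

section \<open>Scalings and powers in a single term\<close>

lemma ray_integral_scale:
  assumes c: "c > 0"
  shows "(\<integral>x. (of_real x * rayv e \<tau>) powr s * exp (\<i> * of_real e * of_real c * (of_real x * rayv e \<tau>)) /
      ((of_real x * rayv e \<tau>)\<^sup>2 + b\<^sup>2) * rayv e \<tau> \<partial>halfline) = of_real c powr (1 - s) * bint e \<tau> s (of_real c * b)"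
proof -
  let ?t = "\<lambda>x. of_real x * rayv e \<tau>"
  have c0: "of_real c \<noteq> (0::complex)" using c by simp
  have "bint_integrand e \<tau> s (of_real c * b) (c * x) = of_real c powr (s - 2) *
    ((?t x) powr s * exp (\<i> * of_real e * of_real c * ?t x) / ((?t x)\<^sup>2 + b\<^sup>2) * rayv e \<tau>)" if x: "x > 0" for x
  proof -
    have tc: "of_real (c * x) * rayv e \<tau> = of_real c * ?t x" by simp
    have "(of_real c * ?t x) powr s = of_real c powr s * ?t x powr s" using c x by (intro powr_of_real_mult) auto
    moreover have "(of_real c * ?t x)\<^sup>2 + (of_real c * b)\<^sup>2 = of_real c ^ 2 * ((?t x)\<^sup>2 + b\<^sup>2)" by (simp add: power_mult_distrib algebra_simps)
    moreover have "of_real c powr (s - 2) = of_real c powr s / of_real c ^ 2"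
      using c0 by (simp add: powr_diff powr_numeral)
    ultimately show ?thesis unfolding tc by (simp add: mult_ac)
  qed
  hence "(\<integral>x. bint_integrand e \<tau> s (of_real c * b) (c * x) \<partial>halfline) =
    (\<integral>x. of_real c powr (s - 2) * ((?t x) powr s * exp (\<i> * of_real e * of_real c * ?t x) / ((?t x)\<^sup>2 + b\<^sup>2) * rayv e \<tau>) \<partial>halfline)"
    by (rule integral_halfline_cong)
  also have "\<dots> = of_real c powr (s - 2) * (\<integral>x. (?t x) powr s * exp (\<i> * of_real e * of_real c * ?t x) / ((?t x)\<^sup>2 + b\<^sup>2) * rayv e \<tau> \<partial>halfline)"
    by (rule Bochner_Integration.integral_mult_right_zero)
  finally have "of_real c powr (s - 2) * (\<integral>x. (?t x) powr s * exp (\<i> * of_real e * of_real c * ?t x) / ((?t x)\<^sup>2 + b\<^sup>2) * rayv e \<tau> \<partial>halfline) = bint e \<tau> s (of_real c * b) / of_real c"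
    unfolding bint_def using integral_halfline_scale[OF c, of "bint_integrand e \<tau> s (of_real c * b)"] by simp
  hence "(of_real c powr (1 - s) * of_real c powr (s - 2)) * (\<integral>x. (?t x) powr s * exp (\<i> * of_real e * of_real c * ?t x) / ((?t x)\<^sup>2 + b\<^sup>2) * rayv e \<tau> \<partial>halfline) =
    of_real c powr (1 - s) * (bint e \<tau> s (of_real c * b) / of_real c)" by (simp only: mult.assoc)
  moreover have "of_real c powr (1 - s) * of_real c powr (s - 2) = 1 / (of_real c :: complex)"
    using c0 by (simp add: powr_add[symmetric] powr_minus_divide)
  ultimately show ?thesis using c0 by simp
qed

lemma inverse_powr_complex:
  fixes w s :: complex
  assumes "Re w > 0"
  shows "inverse w powr s = inverse (w powr s)"
proof -
  have "w \<notin> \<real>\<^sub>\<le>\<^sub>0" using assms by (auto simp: complex_nonpos_Reals_iff)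
  thus ?thesis using assms by (auto simp: powr_def Ln_inverse exp_minus)
qed

lemma of_nat_mult_powr:
  "a > 0 \<Longrightarrow> b > 0 \<Longrightarrow> of_nat (a * b) powr s = of_nat a powr s * (of_nat b powr s :: complex)"
  using powr_of_real_mult[of "real a" "of_nat b" s] by simp

lemma of_nat_power_powr:
  assumes "a > 0"
  shows "of_nat (a ^ k) powr s = (of_nat a :: complex) powr (of_nat k * s)"
proof -
  have "Ln (of_nat (a ^ k)) = of_nat k * Ln (of_nat a :: complex)"
    using assms Ln_of_real[of "real a ^ k"] Ln_of_real[of "real a"] by (simp add: ln_realpow)
  thus ?thesis using assms by (simp add: powr_def mult_ac)
qed

text \<open>This is why the double series can be grouped by n. The frequency 2 pi L and the pole
  parameter (2 pi M / w)^(1/k) of the term (L, M) enter \<open>B\<close> only through their product,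
  and that depends on L^k * M alone.\<close>

lemma a_arg_power_mult:
  assumes "k \<ge> 1" "Re w > 0" "L > 0" "M > 0"
  shows "a_arg k w (L ^ k * M) = of_real (2 * pi * real L) * (of_real (2 * pi * real M) / w) powr (1 / of_nat k)"
proof -
  have w: "w \<noteq> 0" using assms by auto
  have E: "2 * of_real pi * of_nat (L ^ k * M) / w = of_real (real L ^ k) * (of_real (2 * pi * real M) / w)" by simp
  have "(of_real (real L ^ k) * (of_real (2 * pi * real M) / w)) powr (1 / of_nat k) =
      of_real (real L ^ k) powr (1 / of_nat k) * (of_real (2 * pi * real M) / w) powr (1 / of_nat k)"
    using assms w by (intro powr_of_real_mult) auto
  moreover have "of_real (real L ^ k) powr (1 / of_nat k) = (of_nat L :: complex)"
    using of_nat_power_powr[of L k "1 / of_nat k"] assms by simp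
  ultimately show ?thesis unfolding a_arg_def E by simp
qed

text \<open>\<open>p\<close> is the parity of \<open>k\<close> and \<open>P\<close> is 2 - p, so (p,
  P) is (0, 2) for even and (1, 1) for odd \<open>k\<close>. Writing t^k = t^p (t^2)^h shifts the
  first argument of \<open>B\<close> from \<open>z\<close> to \<open>z + p\<close>, while
  \<open>P\<close> collects the exponents in which the two formulas differ.\<close>

context
  fixes k h p P :: nat and w z :: complex and \<tau> \<tau>' \<kappa> :: real and L M :: nat
  assumes k: "k \<ge> 1" and w: "Re w > 0" and tau: "0 < \<tau>" "\<tau> < \<tau>'" and kap: "\<kappa> > 0"
    and wedge: "\<And>t. t \<in> wedge \<tau>' \<Longrightarrow> Re (w * t ^ k) \<ge> \<kappa> * norm (w * t ^ k)"
    and z: "Re z > -1" and angle: "\<tau> < cos (ray_angle k w)" and LM: "L > 0" "M > 0"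
    and kp: "k = 2 * h + p" "p + P = 2"  "P > 0"
begin

private abbreviation "r s \<equiv> 2 * int s + 1 - int k"
private abbreviation "A \<equiv> (of_real (2 * pi * real M) / w) powr (1 / of_nat k)"
private abbreviation "b s \<equiv> A * zeta4 k powi r s"
private abbreviation "c \<equiv> 2 * pi * real L"

lemma r_lt: "s < k \<Longrightarrow> \<bar>r s\<bar> < int k" by auto

lemma A_power: "A ^ k = of_real (2 * pi * real M) / w" and A_nz: "A \<noteq> 0"
proof -
  have "of_real (2 * pi * real M) / w \<noteq> 0" using w LM by auto
  thus "A ^ k = of_real (2 * pi * real M) / w" "A \<noteq> 0"
    using Complex_div_powr_nat[of "of_real (2 * pi * real M) / w" k k] k by auto
qed

lemma b_square: "(b s)\<^sup>2 = A\<^sup>2 * exp (\<i> * of_real pi * of_int (r s) / of_nat k)"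
proof -
  have "(zeta4 k powi r s)\<^sup>2 = exp (\<i> * of_real pi * of_int (r s) / of_nat k)"
    unfolding zeta4_powi exp_double[symmetric] using k by (intro arg_cong[of _ _ exp]) (simp add: field_simps)
  thus ?thesis by (simp add: power_mult_distrib)
qed

lemma b_region: "s < k \<Longrightarrow> y > 0 \<Longrightarrow> of_real y * b s \<in> bregion \<tau>"
  using bregion_root[OF k w tau(1) angle, of y "2 * pi * real M" "r s"] r_lt[of s] LM by simp

lemma b_region1: "s < k \<Longrightarrow> b s \<in> bregion \<tau>"
  using b_region[of s 1] by simp

text \<open>With t^k = t^p (t^2)^h and (A^2)^k = (2 pi M / w)^2, the m-th Euler term is a rational
  function of t^2 times t^p. Its partial fractions have denominators t^2 + b_s^2, the shape of the
  integrand of \<open>bint\<close>, and scaling by the frequency \<open>c\<close> moves it into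
  \<open>b\<close>.\<close>

lemma integral_ray_term:
  assumes e: "unit_sign e"
  shows "(\<integral>x. ray_term k w e \<tau> z L M x \<partial>halfline) =
    2 / (w * of_nat k) * (\<Sum>s<k. (- ((b s)\<^sup>2)) powi (int h + 1 - int k) * (of_real c powr (1 - (z + of_nat p)) * bint e \<tau> (z + of_nat p) (of_real c * b s)))"
proof -
  let ?t = "\<lambda>x. of_real x * rayv e \<tau>"
  let ?f = "\<lambda>s x. (?t x) powr (z + of_nat p) * exp (\<i> * of_real e * of_real c * ?t x) / ((?t x)\<^sup>2 + (b s)\<^sup>2) * rayv e \<tau>"
  have w0: "w \<noteq> 0" using w by auto
  have c0: "c > 0" using LM by simp
  have eq: "ray_term k w e \<tau> z L M x = 2 / (w * of_nat k) * (\<Sum>s<k. (- ((b s)\<^sup>2)) powi (int h + 1 - int k) * ?f s x)" if x: "x > 0" for x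
  proof -
    define t where "t = ?t x"
    have t0: "t \<noteq> 0" using x by (simp add: t_def)
    define Y where "Y = complex_of_real (2 * pi * real M)"
    have Suc: "2 * of_real pi * of_nat (Suc (M - 1)) = Y" using LM by (simp add: Y_def)
    have Ak: "(A\<^sup>2) ^ k = (Y / w)\<^sup>2" unfolding power_mult[symmetric] mult.commute[of 2 k] unfolding power_mult A_power Y_def ..
    have fac: "(w * t ^ k)\<^sup>2 + Y\<^sup>2 = w\<^sup>2 * ((t\<^sup>2) ^ k + (A\<^sup>2) ^ k)"
      unfolding Ak using w0 by (simp add: power_mult_distrib power_divide distrib_left power_mult[symmetric] mult.commute)
    have nz: "(w * t ^ k)\<^sup>2 + Y\<^sup>2 \<noteq> 0"
      using bterm_denominator_nz[OF k w tau kap _ e z x, where m = "M - 1"] wedge unfolding Suc t_def by blast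
    have "(t\<^sup>2) ^ h / ((t\<^sup>2) ^ k + (A\<^sup>2) ^ k) = (\<Sum>s<k. (- ((b s)\<^sup>2)) powi (int h + 1 - int k) / (t\<^sup>2 + (b s)\<^sup>2)) / of_nat k"
      unfolding b_square
    proof (rule partial_fractions_unity[OF k])
      show "h < k" using kp k by auto
      show "A\<^sup>2 \<noteq> 0" using A_nz by simp
      show "(t\<^sup>2) ^ k + (A\<^sup>2) ^ k \<noteq> 0" using nz unfolding fac by simp
      show "t\<^sup>2 + A\<^sup>2 * exp (\<i> * of_real pi * of_int (r s) / of_nat k) \<noteq> 0" if "s < k" for s
        using quad_ray_nz[OF e b_region1[OF that] tau(1), of x] unfolding b_square t_def .
    qed
    moreover have "bterm (w * t ^ k) (M - 1) = 2 / w * (t ^ p * ((t\<^sup>2) ^ h / ((t\<^sup>2) ^ k + (A\<^sup>2) ^ k)))"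
    proof -
      have "t ^ k = t ^ p * (t\<^sup>2) ^ h" by (simp add: kp(1) power_add power_mult)
      hence "2 * (w * t ^ k) / ((w * t ^ k)\<^sup>2 + Y\<^sup>2) = 2 * (w * (t ^ p * (t\<^sup>2) ^ h)) / (w\<^sup>2 * ((t\<^sup>2) ^ k + (A\<^sup>2) ^ k))"
        unfolding fac by simp
      thus ?thesis unfolding bterm_def Suc using w0 by (simp add: power2_eq_square)
    qed
    moreover have "t powr (z + of_nat p) = t powr z * t ^ p" using t0 by (simp add: powr_add powr_nat')
    ultimately have "ray_term k w e \<tau> z L M x = 2 / w * (t powr (z + of_nat p) * ((\<Sum>s<k. (- ((b s)\<^sup>2)) powi (int h + 1 - int k) / (t\<^sup>2 + (b s)\<^sup>2)) / of_nat k) *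
        exp (\<i> * of_real e * of_real c * t) * rayv e \<tau>)"
      unfolding ray_term_def t_def[symmetric] by (simp only: mult_ac)
    also have "\<dots> = 2 / (w * of_nat k) * (\<Sum>s<k. (- ((b s)\<^sup>2)) powi (int h + 1 - int k) * (t powr (z + of_nat p) * exp (\<i> * of_real e * of_real c * t) / (t\<^sup>2 + (b s)\<^sup>2) * rayv e \<tau>))"
      by (simp add: sum_distrib_left sum_distrib_right sum_divide_distrib mult_ac)
    finally show ?thesis unfolding t_def .
  qed
  have int: "integrable halfline (?f s)" if s: "s < k" for s
  proof -
    have zp: "Re (z + of_nat p) > -1" using z by simp
    show ?thesis
    proof (rule integrable_halfline_bound)
      have nz: "(?t x)\<^sup>2 + (b s)\<^sup>2 \<noteq> 0" for x using quad_ray_nz[OF e b_region1[OF s] tau(1)] .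
      show "continuous_on {0<..} (?f s)" using nz by (intro continuous_intros) auto
      \<comment> \<open>The integrand of \<open>bint\<close> has frequency 1; the present frequency
        \<open>c\<close> is at least 1, so it can only decay faster along the ray.\<close>
      show "integrable halfline (\<lambda>x. norm (bint_integrand e \<tau> (z + of_nat p) (b s) x))"
        by (intro integrable_norm integrable_bint e tau zp b_region1[OF s])
      fix x :: real assume x: "x > 0"
      have L1: "real L \<ge> 1" using LM by simp
      have "1 * 1 \<le> (2 * pi) * real L" using pi_ge_two L1 by (intro mult_mono) auto
      hence c1: "1 \<le> c" by simp
      have "norm (exp (\<i> * of_real e * of_real c * ?t x)) \<le> norm (exp (\<i> * of_real e * 1 * ?t x))"
        unfolding norm_exp_ray[OF e] using mult_left_mono[OF mult_right_mono[OF c1, of \<tau>], of x] x tau by (simp add: mult_ac)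
      thus "norm (?f s x) \<le> norm (bint_integrand e \<tau> (z + of_nat p) (b s) x)"
        unfolding norm_mult norm_divide by (intro mult_right_mono divide_right_mono mult_left_mono) (auto simp: norm_mult)
    qed
  qed
  have "(\<integral>x. ray_term k w e \<tau> z L M x \<partial>halfline) =
    (\<integral>x. 2 / (w * of_nat k) * (\<Sum>s<k. (- ((b s)\<^sup>2)) powi (int h + 1 - int k) * ?f s x) \<partial>halfline)"
    by (rule integral_halfline_cong) (rule eq)
  also have "\<dots> = 2 / (w * of_nat k) * (\<Sum>s<k. \<integral>x. (- ((b s)\<^sup>2)) powi (int h + 1 - int k) * ?f s x \<partial>halfline)"
    unfolding Bochner_Integration.integral_mult_right_zero[of _ "2 / (w * of_nat k)"]
    by (intro arg_cong[of _ _ "\<lambda>y. 2 / (w * of_nat k) * y"] Bochner_Integration.integral_sum Bochner_Integration.integrable_mult_right int) (simp del: of_real_mult)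
  finally show ?thesis unfolding Bochner_Integration.integral_mult_right_zero ray_integral_scale[OF c0] .
qed

text \<open>Sorts the powers of L and M: L^(P-1-z) is completed by a power of M to n^((P-1-z)/k),
  and the power of M left over has the exponent (1 + z) / k - 1 of \<open>S_fun\<close>.\<close>

lemma scalar_factor:
  "4 / (w * of_nat k) * of_real c powr (1 - (z + of_nat p)) * A powi (int P - int k) =
   (2 * of_real pi) powr (of_nat P + of_nat P / of_nat k - z) / (of_real pi ^ 2 * of_nat k * w powr (of_nat P / of_nat k)) *
   (of_nat M powr ((1 + z) / of_nat k - 1) * of_nat (L ^ k * M) powr ((of_nat P - 1 - z) / of_nat k))"
proof -
  define T where "T = complex_of_real (2 * pi)"
  define m where "m = complex_of_nat M"
  have w0: "w \<noteq> 0" using w by auto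
  have T0: "T \<noteq> 0" by (simp add: T_def)
  have m0: "m \<noteq> 0" using LM by (simp add: m_def)
  have p': "1 - (z + of_nat p) = of_nat P - 1 - z"
  proof -
    have "of_nat p + of_nat P = (2 :: complex)" using kp(2) by (metis of_nat_add of_nat_numeral)
    thus ?thesis by (simp add: algebra_simps)
  qed
  have cT: "of_real c powr q = T powr q * of_nat L powr q" for q
    using powr_of_real_mult[of "2 * pi" "of_nat L" q] LM by (simp add: T_def)
  have X: "(of_real (2 * pi * real M) / w) powr q = T powr q * m powr q / w powr q" for q
  proof -
    have "of_real (2 * pi * real M) / w = of_real (2 * pi) * (of_real (real M) * inverse w)" by (simp add: divide_inverse)
    also have "\<dots> powr q = T powr q * (of_real (real M) * inverse w) powr q"
      unfolding T_def using LM w0 by (intro powr_of_real_mult) auto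
    also have "(of_real (real M) * inverse w) powr q = m powr q * inverse w powr q"
      unfolding m_def using powr_of_real_mult[of "real M" "inverse w" q] LM w0 by simp
    finally show ?thesis by (simp add: inverse_powr_complex[OF w] divide_inverse)
  qed
  have "A powi (int P - int k) = A ^ P / A ^ k" using A_nz by (simp add: power_int_diff)
  also have "A ^ P = T powr (of_nat P / of_nat k) * m powr (of_nat P / of_nat k) / w powr (of_nat P / of_nat k)"
    using Complex_div_powr_nat[of "of_real (2 * pi * real M) / w" k P] k LM w0 by (simp only: X) auto
  also have "A ^ k = T * m / w" unfolding A_power by (simp add: T_def m_def)
  finally have 1: "A powi (int P - int k) = T powr (of_nat P / of_nat k) * m powr (of_nat P / of_nat k) / w powr (of_nat P / of_nat k) / (T * m / w)" .
  have "of_nat (L ^ k * M) powr ((of_nat P - 1 - z) / of_nat k) = of_nat (L ^ k) powr ((of_nat P - 1 - z) / of_nat k) * m powr ((of_nat P - 1 - z) / of_nat k)"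
    unfolding m_def using LM by (intro of_nat_mult_powr) auto
  also have "of_nat (L ^ k) powr ((of_nat P - 1 - z) / of_nat k) = (of_nat L powr (of_nat P - 1 - z) :: complex)"
    using of_nat_power_powr[of L k "(of_nat P - 1 - z) / of_nat k"] LM k by simp
  finally have 2: "of_nat (L ^ k * M) powr ((of_nat P - 1 - z) / of_nat k) = of_nat L powr (of_nat P - 1 - z) * m powr ((of_nat P - 1 - z) / of_nat k)" .
  have "m powr ((1 + z) / of_nat k - 1) * m powr ((of_nat P - 1 - z) / of_nat k) = m powr (of_nat P / of_nat k - 1)"
    unfolding powr_add[symmetric] by (rule arg_cong[of _ _ "\<lambda>q. m powr q"]) (use k in \<open>simp add: field_simps\<close>)
  also have "\<dots> = m powr (of_nat P / of_nat k) / m" using m0 by (simp add: powr_diff)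
  finally have 3: "m powr ((1 + z) / of_nat k - 1) * m powr ((of_nat P - 1 - z) / of_nat k) = m powr (of_nat P / of_nat k) / m" .
  have "(2 * of_real pi) powr (of_nat P + of_nat P / of_nat k - z) = T powr (of_nat P / of_nat k + (of_nat P - 1 - z) + 1)"
    by (simp add: T_def algebra_simps)
  also have "\<dots> = T powr (of_nat P / of_nat k) * T powr (of_nat P - 1 - z) * T" using T0 unfolding powr_add by simp
  finally have 4: "(2 * of_real pi) powr (of_nat P + of_nat P / of_nat k - z) = T powr (of_nat P / of_nat k) * T powr (of_nat P - 1 - z) * T" .
  \<comment> \<open>The factor 2 from the Euler term and the 2 from recombining the exponentials
    into \<open>B\<close> meet the 1 / (2 pi) of M here; this is the origin of pi^2 in the
    formula.\<close>
  have T2: "4 / T = T / of_real pi ^ 2" by (simp add: T_def power2_eq_square)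
  have "4 / (w * of_nat k) * (T powr (of_nat P - 1 - z) * l) * (T powr (of_nat P / of_nat k) * m powr (of_nat P / of_nat k) / W / (T * m / w)) =
    T powr (of_nat P / of_nat k) * T powr (of_nat P - 1 - z) * l * (m powr (of_nat P / of_nat k) / m) * (4 / T) / (of_nat k * W)" for W l
    using w0 by (simp add: mult_ac)
  also have "\<dots> W l = T powr (of_nat P / of_nat k) * T powr (of_nat P - 1 - z) * T / (of_real pi ^ 2 * of_nat k * W) * (l * (m powr (of_nat P / of_nat k) / m))" for W l
    unfolding T2 by (simp add: mult_ac)
  finally have 5: "4 / (w * of_nat k) * (T powr (of_nat P - 1 - z) * l) * (T powr (of_nat P / of_nat k) * m powr (of_nat P / of_nat k) / W / (T * m / w)) =
    T powr (of_nat P / of_nat k) * T powr (of_nat P - 1 - z) * T / (of_real pi ^ 2 * of_nat k * W) * (l * (m powr (of_nat P / of_nat k) / m))" for W l .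
  show ?thesis unfolding p' cT 1 4 2 5 m_def[symmetric] 3[symmetric] by (simp only: mult_ac)
qed

lemma power_b: "(- ((b s)\<^sup>2)) powi (int h + 1 - int k) =
   (-1) powi (int h + 1 - int k) * (A powi (int P - int k) * zeta4 k powi (r s * (int P - int k)))"
proof -
  have j: "int P - int k = 2 * (int h + 1 - int k)" using kp by simp
  have "(- ((b s)\<^sup>2)) powi (int h + 1 - int k) = ((-1) * (b s) powi 2) powi (int h + 1 - int k)" by (simp add: power_int_numeral)
  also have "\<dots> = (-1) powi (int h + 1 - int k) * (b s) powi (int P - int k)"
    unfolding j power_int_mult_distrib[of "-1"] power_int_mult[of "b s" 2] ..
  also have "(b s) powi (int P - int k) = A powi (int P - int k) * zeta4 k powi (r s * (int P - int k))"
    unfolding power_int_mult_distrib power_int_mult ..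
  finally show ?thesis .
qed

text \<open>Adding the two rays rebuilds the cosine: each pair of \<open>bint\<close> values is
  twice a value of \<open>B\<close>. Apart from the power of M, the result depends on L and M only
  through L^k * M.\<close>

lemma ray_term_pair:
  "(\<integral>x. ray_term k w 1 \<tau> z L M x \<partial>halfline) + (\<integral>x. ray_term k w (-1) \<tau> z L M x \<partial>halfline) =
   (-1) powi (int h + 1 - int k) * (2 * of_real pi) powr (of_nat P + of_nat P / of_nat k - z) /
     (of_real pi ^ 2 * of_nat k * w powr (of_nat P / of_nat k)) *
   (of_nat M powr ((1 + z) / of_nat k - 1) * of_nat (L ^ k * M) powr ((of_nat P - 1 - z) / of_nat k) *
    (\<Sum>s<k. zeta4 k powi (r s * (int P - int k)) * B_fun (z + of_nat p) (a_arg k w (L ^ k * M) * zeta4 k powi r s)))"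
proof -
  let ?C = "of_real c powr (1 - (z + of_nat p))"
  let ?I = "\<lambda>e s. bint e \<tau> (z + of_nat p) (of_real c * b s)"
  let ?S = "\<Sum>s<k. zeta4 k powi (r s * (int P - int k)) * B_fun (z + of_nat p) (a_arg k w (L ^ k * M) * zeta4 k powi r s)"
  have a: "a_arg k w (L ^ k * M) * zeta4 k powi r s = of_real c * b s" for s
    unfolding a_arg_power_mult[OF k w LM] by (simp only: mult.assoc)
  have B: "?I 1 s + ?I (-1) s = 2 * B_fun (z + of_nat p) (a_arg k w (L ^ k * M) * zeta4 k powi r s)" if s: "s < k" for s
    unfolding a by (subst B_fun_eq_bint[OF tau(1) _ b_region[OF s]]) (use z LM in auto)
  have "(\<integral>x. ray_term k w 1 \<tau> z L M x \<partial>halfline) + (\<integral>x. ray_term k w (-1) \<tau> z L M x \<partial>halfline) =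
      2 / (w * of_nat k) * (\<Sum>s<k. (- ((b s)\<^sup>2)) powi (int h + 1 - int k) * (?C * (?I 1 s + ?I (-1) s)))"
    unfolding integral_ray_term[OF disjI1[OF refl]] integral_ray_term[OF disjI2[OF refl]]
    by (simp only: distrib_left sum.distrib)
  also have "(\<Sum>s<k. (- ((b s)\<^sup>2)) powi (int h + 1 - int k) * (?C * (?I 1 s + ?I (-1) s))) =
     (\<Sum>s<k. (2 * ((-1) powi (int h + 1 - int k) * ?C * A powi (int P - int k))) *
       (zeta4 k powi (r s * (int P - int k)) * B_fun (z + of_nat p) (a_arg k w (L ^ k * M) * zeta4 k powi r s)))"
  proof (rule sum.cong[OF refl])
    fix s assume "s \<in> {..<k}"
    hence s: "s < k" by simp
    show "(- ((b s)\<^sup>2)) powi (int h + 1 - int k) * (?C * (?I 1 s + ?I (-1) s)) =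
      (2 * ((-1) powi (int h + 1 - int k) * ?C * A powi (int P - int k))) *
       (zeta4 k powi (r s * (int P - int k)) * B_fun (z + of_nat p) (a_arg k w (L ^ k * M) * zeta4 k powi r s))"
      unfolding B[OF s] power_b by (simp only: mult_ac)
  qed
  also have "\<dots> = (2 * ((-1) powi (int h + 1 - int k) * ?C * A powi (int P - int k))) * ?S"
    by (rule sum_distrib_left[symmetric])
  also have "2 / (w * of_nat k) * \<dots> = (-1) powi (int h + 1 - int k) * (4 / (w * of_nat k) * ?C * A powi (int P - int k)) * ?S"
    by simp
  finally show ?thesis unfolding scalar_factor by (simp only: mult.assoc times_divide_eq_right times_divide_eq_left)
qed

end

text \<open>The inner sum in the form common to both parities, indexed by all k roots. For P = 2 and
  P = 1 the weights are the coefficients \<open>A_coeff\<close> and \<open>B_coeff\<close> and their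
  conjugates, and for odd k the middle root has weight 1.\<close>

definition root_sum :: "nat \<Rightarrow> complex \<Rightarrow> int \<Rightarrow> complex \<Rightarrow> complex" where
  "root_sum k s P a = (\<Sum>j<k. zeta4 k powi ((2 * int j + 1 - int k) * (P - int k)) * B_fun s (a * zeta4 k powi (2 * int j + 1 - int k)))"

text \<open>Each ray is regrouped separately by n = L^k * M and the two are then added. For fixed n
  the values of \<open>B\<close> are the same for all factorizations, so only the powers of M are
  summed, which gives \<open>S_fun\<close>.\<close>

lemma sigma_series_transform:
  assumes k: "k \<ge> 1" and z: "-1 < Re z" "Re z < real k" "z \<noteq> of_nat k - 1" and w: "Re w > 0"
    and kp: "k = 2 * h + p" "p + P = 2" "P > 0"
  defines "K \<equiv> (-1) powi (int h + 1 - int k) * (2 * of_real pi) powr (of_nat P + of_nat P / of_nat k - z) /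
     (of_real pi ^ 2 * of_nat k * w powr (of_nat P / of_nat k))"
    and "f \<equiv> \<lambda>n. S_fun k z n * of_nat n powr ((of_nat P - 1 - z) / of_nat k) * root_sum k (z + of_nat p) (int P) (a_arg k w n)"
  shows "summable (\<lambda>n. sigma_fun k z (Suc n) * exp (- of_nat (Suc n) * w))" "summable (\<lambda>n. f (Suc n))"
    "(\<Sum>n. sigma_fun k z (Suc n) * exp (- of_nat (Suc n) * w)) = main_terms k z w + K * (\<Sum>n. f (Suc n))"
proof -
  obtain \<tau>' \<kappa> where "\<tau>' > 0" and kap: "\<kappa> > 0" and wdg: "\<And>t. t \<in> wedge \<tau>' \<Longrightarrow> Re (w * t ^ k) \<ge> \<kappa> * norm (w * t ^ k)"
    using ex_wedge[OF w, of k] by blast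
  \<comment> \<open>Two demands on the slope: below \<open>\<tau>'\<close> the values
    \<open>w * t^k\<close> stay in the sector that avoids the poles of the Planck kernel, and below
    the cosine all arguments of \<open>B\<close> lie in \<open>bregion \<tau>\<close>.\<close>
  define \<tau> where "\<tau> = min (\<tau>' / 2) (cos (ray_angle k w) / 2)"
  have "cos (ray_angle k w) > 0" using ray_angle_bounds[OF k w] by (intro cos_gt_zero_pi) auto
  hence tau: "0 < \<tau>" "\<tau> < \<tau>'" "\<tau> < cos (ray_angle k w)" using \<open>\<tau>' > 0\<close> by (auto simp: \<tau>_def min_def)
  let ?F = "\<lambda>e L M. \<integral>x. ray_term k w e \<tau> z L M x \<partial>halfline"
  let ?P = "\<lambda>n. {(d1, d2). d1 ^ k * d2 = n}"
  let ?I = "\<lambda>e. \<integral>x. hfun k w z (of_real x * rayv e \<tau>) * pkern e (of_real x * rayv e \<tau>) * rayv e \<tau> \<partial>halfline"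
  have S: "(\<lambda>n. \<Sum>(d1, d2)\<in>?P (Suc n). ?F e d1 d2) sums ?I e" if e: "unit_sign e" for e
  proof -
    obtain A where A: "summable A" "\<And>l m. norm (?F e (Suc l) (Suc m)) \<le> A l * (1 / real (Suc m) ^ 2)"
       "?I e = (\<Sum>l. \<Sum>m. ?F e (Suc l) (Suc m))"
      using ray_expansion[OF k w tau(1,2) kap wdg e z(1)] by blast
    show ?thesis unfolding A(3) by (rule sums_regroup_power[OF k A(1) summable_inverse_squares A(2)])
  qed
  have "(\<Sum>(d1, d2)\<in>?P n. ?F 1 d1 d2) + (\<Sum>(d1, d2)\<in>?P n. ?F (-1) d1 d2) = K * f n" if n: "n > 0" for n
  proof -
    let ?R = "root_sum k (z + of_nat p) (int P) (a_arg k w n)"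
    let ?u = "of_nat n powr ((of_nat P - 1 - z) / of_nat k)"
    have "(\<Sum>(d1, d2)\<in>?P n. ?F 1 d1 d2) + (\<Sum>(d1, d2)\<in>?P n. ?F (-1) d1 d2) = (\<Sum>(d1, d2)\<in>?P n. ?F 1 d1 d2 + ?F (-1) d1 d2)"
      by (simp add: sum.distrib case_prod_unfold)
    also have "\<dots> = (\<Sum>(d1, d2)\<in>?P n. K * (of_nat d2 powr ((1 + z) / of_nat k - 1) * ?u * ?R))"
    proof (rule sum.cong[OF refl], safe)
      fix L M assume n': "n = L ^ k * M"
      hence LM: "L > 0" "M > 0" using n k by (auto intro!: Nat.gr0I simp: power_0_left)
      show "?F 1 L M + ?F (-1) L M = K * (of_nat M powr ((1 + z) / of_nat k - 1) * of_nat (L ^ k * M) powr ((of_nat P - 1 - z) / of_nat k) *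
          root_sum k (z + of_nat p) (int P) (a_arg k w (L ^ k * M)))"
        unfolding K_def root_sum_def by (rule ray_term_pair[OF k w tau(1,2) kap wdg z(1) tau(3) LM kp])
    qed
    also have "\<dots> = K * f n"
      by (simp add: f_def S_fun_def sum_distrib_left sum_distrib_right case_prod_unfold mult_ac)
    finally show ?thesis .
  qed
  hence "(\<lambda>n. K * f (Suc n)) sums (?I 1 + ?I (-1))"
    using sums_add[OF S[of 1] S[of "-1"]] by simp
  hence sK: "(\<lambda>n. K * f (Suc n)) sums ray_int \<tau> 0 (hfun k w z)" by (simp add: ray_int_def)
  have "w \<noteq> 0" using w by auto
  \<comment> \<open>Convergence is known for the series with the factor \<open>K\<close>; dividing
    by it gives the summability claimed for \<open>f\<close> alone.\<close>
  hence K0: "K \<noteq> 0" using k by (simp add: K_def)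
  have sf: "(\<lambda>n. f (Suc n)) sums (inverse K * ray_int \<tau> 0 (hfun k w z))"
    using sums_mult[OF sK, of "inverse K"] K0 by (simp add: mult.assoc[symmetric])
  thus "summable (\<lambda>n. f (Suc n))" by (rule sums_summable)
  note sg = sigma_series_sums[OF k w, of z]
  thus "summable (\<lambda>n. sigma_fun k z (Suc n) * exp (- of_nat (Suc n) * w))" by (rule sums_summable)
  have "K * (\<Sum>n. f (Suc n)) = ray_int \<tau> 0 (hfun k w z)"
    using sums_unique[OF sf] K0 by (simp flip: sums_unique[OF sf])
  thus "(\<Sum>n. sigma_fun k z (Suc n) * exp (- of_nat (Suc n) * w)) = main_terms k z w + K * (\<Sum>n. f (Suc n))"
    using sums_unique[OF sg] lambert_formula[OF k w tau(1,2) kap wdg z] by simp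
qed

lemma root_sum_even:
  assumes "k = 2 * h"
  shows "root_sum k s 2 a = (\<Sum>j = 1..h. A_coeff k j * B_fun s (a * zeta4 k powi (2 * int j - 1)) +
    cnj (A_coeff k j) * B_fun s (a * zeta4 k powi (- (2 * int j - 1))))"
  unfolding root_sum_def assms sum_symmetric_even[of "\<lambda>r. zeta4 (2 * h) powi (r * (2 - int (2 * h))) * B_fun s (a * zeta4 (2 * h) powi r)"] A_coeff_def
  by (simp only: cnj_zeta4_powi mult.commute[of "2 - int (2 * h)"] mult_minus_left)

lemma root_sum_odd:
  assumes "k = 2 * h + 1"
  shows "root_sum k s 1 a = B_fun s a + (\<Sum>j = 1..h. B_coeff k j * B_fun s (a * zeta4 k powi (2 * int j)) +
    cnj (B_coeff k j) * B_fun s (a * zeta4 k powi (- (2 * int j))))"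
  unfolding root_sum_def assms sum_symmetric_odd[of "\<lambda>r. zeta4 (2 * h + 1) powi (r * (1 - int (2 * h + 1))) * B_fun s (a * zeta4 (2 * h + 1) powi r)"] B_coeff_def
  by (simp only: cnj_zeta4_powi mult.commute[of "1 - int (2 * h + 1)"] mult_minus_left) simp

theorem theorem2p5:
  fixes k :: nat and z w :: complex
  assumes "k \<ge> 1"
    and "- 1 < Re z" and "Re z < real k" and "z \<noteq> of_nat k - 1"
    and "Re w > 0"
  shows
    "summable (\<lambda>n. sigma_fun k z (Suc n) * exp (- of_nat (Suc n) * w)) \<and>
     (even k \<longrightarrow>
        summable (\<lambda>n. even_term k z w (Suc n)) \<and>
        (\<Sum>n. sigma_fun k z (Suc n) * exp (- of_nat (Suc n) * w)) =
          main_terms k z w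
          + (- 1) ^ (k div 2 - 1) * (2 * of_real pi) powr (2 + 2 / of_nat k - z)
              / (of_real pi ^ 2 * of_nat k * w powr (2 / of_nat k))
            * (\<Sum>n. even_term k z w (Suc n))) \<and>
     (odd k \<longrightarrow>
        summable (\<lambda>n. odd_term k z w (Suc n)) \<and>
        (\<Sum>n. sigma_fun k z (Suc n) * exp (- of_nat (Suc n) * w)) =
          main_terms k z w
          + (- 1) ^ ((k - 1) div 2) * (2 * of_real pi) powr (1 + 1 / of_nat k - z)
              / (of_real pi ^ 2 * of_nat k * w powr (1 / of_nat k))
            * (\<Sum>n. odd_term k z w (Suc n)))"
proof (cases "even k")
  case True
  define h where "h = k div 2"
  have kh: "k = 2 * h" "k = 2 * h + 0" using True by (simp_all add: h_def)
  have h: "h \<ge> 1" using assms(1) kh by simp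
  have "even_term k z w = (\<lambda>n. S_fun k z n * of_nat n powr ((1 - z) / of_nat k) * root_sum k z 2 (a_arg k w n))"
    unfolding even_term_def root_sum_even[OF kh(1)] h_def ..
  \<comment> \<open>For \<open>k = 2 * h\<close> the exponent is \<open>- (h - 1)\<close>, and a
    power of -1 equals its inverse.\<close>
  moreover have "(-1) powi (int h + 1 - int k) = ((-1) ^ (k div 2 - 1) :: complex)"
  proof -
    have "int h + 1 - int k = - int (h - 1)" using kh h by simp
    thus ?thesis by (simp only: h_def power_int_minus power_int_of_nat) (simp flip: power_inverse)
  qed
  ultimately show ?thesis
    using sigma_series_transform[OF assms(1-5) kh(2), of 2] True by simp
next
  case False
  define h where "h = (k - 1) div 2"
  have kh: "k = 2 * h + 1" using False by (simp add: h_def odd_two_times_div_two_nat[symmetric])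
  have "odd_term k z w = (\<lambda>n. S_fun k z n * of_nat n powr (- z / of_nat k) * root_sum k (z + 1) 1 (a_arg k w n))"
    unfolding odd_term_def root_sum_odd[OF kh(1)] h_def ..
  moreover have "(-1) powi (int h + 1 - int k) = ((-1) ^ ((k - 1) div 2) :: complex)"
  proof -
    have "int h + 1 - int k = - int h" using kh by simp
    thus ?thesis by (simp only: h_def power_int_minus power_int_of_nat) (simp flip: power_inverse)
  qed
  ultimately show ?thesis
    using sigma_series_transform[OF assms(1-5) kh, of 1] False by simp
qed

end
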